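(* Let $A$ be a simple tracially $\mathcal{Z}$-absorbing C*-algebra and let $n \in \mathbb{N}$. Then $M_n(A)$ is also tracially $\mathcal{Z}$-absorbing.
   Context: C*-algebras are not assumed unital; $\mathbb{N}=\{1,2,\dots\}$. For positive elements $a,b$ of a C*-algebra $A$, $a \precsim b$ (Cuntz subequivalence) means there is a sequence $(v_n)$ in $A$ with $\|a - v_n b v_n^*\| \to 0$. For self-adjoint $c$ and $\varepsilon>0$, $(c-\varepsilon)_+$ is obtained by applying $t \mapsto \max(t-\varepsilon,0)$. $M_n=M_n(\mathbb{C})$, $[y,z]=yz-zy$. A completely positive contractive (c.p.c.) map $\varphi$ has order zero if $\varphi(y)\varphi(z)=0$ whenever $y,z$ are positive with $yz=0$. A simple C*-algebra $A$ is tracially $\mathcal{Z}$-absorbing if $A \not\cong \mathbb{C}$ and for every $x,a \in A_+$ with $a \neq 0$, every finite set $F \subseteq A$, every $\varepsilon>0$, and every $n \in \mathbb{N}$, there is a c.p.c. order zero map $\varphi\colon M_n \to A$ such that (i) $(x^2 - x\varphi(1)x - \varepsilon)_+ \precsim a$, and (ii) $\|[\varphi(z),b]\| < \varepsilon$ for all $z \in M_n$ with $\|z\| \le 1$ and all $b \in F$. *)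

theory Defs
  imports
    "HOL-Analysis.Analysis"
    "HOL-Computational_Algebra.Polynomial"
    "HOL-Algebra.Module"
begin

text \<open>
  C*-algebras are carrier-based structures extending the records of HOL-Algebra.  As for modules in
  HOL-Algebra, the record has a field for a unit; it is unconstrained here, because C*-algebras
  need not be unital.
\<close>

record 'a cstar = "(complex, 'a) module" +
  adj :: "'a \<Rightarrow> 'a"
  cnorm :: "'a \<Rightarrow> real"

definition complex_cstar :: "complex cstar" where
  "complex_cstar =
     \<lparr>carrier = UNIV, mult = (*), one = 1, zero = 0, add = (+), smult = (*), adj = cnj, cnorm = cmod\<rparr>"

definition converges_to :: "'a cstar \<Rightarrow> (nat \<Rightarrow> 'a) \<Rightarrow> 'a \<Rightarrow> bool" where
  "converges_to A s x \<longleftrightarrow> (\<lambda>k. cnorm A (s k \<ominus>\<^bsub>A\<^esub> x)) \<longlonglongrightarrow> 0"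

locale cstar_algebra = Module.module complex_cstar A for A :: "'a cstar" (structure) +
  assumes mult_closed: "\<lbrakk>x \<in> carrier A; y \<in> carrier A\<rbrakk> \<Longrightarrow> x \<otimes> y \<in> carrier A"
    and mult_assoc: "\<lbrakk>x \<in> carrier A; y \<in> carrier A; z \<in> carrier A\<rbrakk>
      \<Longrightarrow> (x \<otimes> y) \<otimes> z = x \<otimes> (y \<otimes> z)"
    and mult_l_distr: "\<lbrakk>x \<in> carrier A; y \<in> carrier A; z \<in> carrier A\<rbrakk>
      \<Longrightarrow> (x \<oplus> y) \<otimes> z = x \<otimes> z \<oplus> y \<otimes> z"
    and mult_r_distr: "\<lbrakk>x \<in> carrier A; y \<in> carrier A; z \<in> carrier A\<rbrakk>
      \<Longrightarrow> z \<otimes> (x \<oplus> y) = z \<otimes> x \<oplus> z \<otimes> y"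
    and smult_mult_left: "\<lbrakk>x \<in> carrier A; y \<in> carrier A\<rbrakk> \<Longrightarrow> (c \<odot> x) \<otimes> y = c \<odot> (x \<otimes> y)"
    and smult_mult_right: "\<lbrakk>x \<in> carrier A; y \<in> carrier A\<rbrakk> \<Longrightarrow> x \<otimes> (c \<odot> y) = c \<odot> (x \<otimes> y)"
    and adj_closed: "x \<in> carrier A \<Longrightarrow> adj A x \<in> carrier A"
    and adj_adj: "x \<in> carrier A \<Longrightarrow> adj A (adj A x) = x"
    and adj_add: "\<lbrakk>x \<in> carrier A; y \<in> carrier A\<rbrakk> \<Longrightarrow> adj A (x \<oplus> y) = adj A x \<oplus> adj A y"
    and adj_smult: "x \<in> carrier A \<Longrightarrow> adj A (c \<odot> x) = cnj c \<odot> adj A x"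
    and adj_mult: "\<lbrakk>x \<in> carrier A; y \<in> carrier A\<rbrakk> \<Longrightarrow> adj A (x \<otimes> y) = adj A y \<otimes> adj A x"
    and cnorm_nonneg: "x \<in> carrier A \<Longrightarrow> 0 \<le> cnorm A x"
    and cnorm_eq_zero_iff: "x \<in> carrier A \<Longrightarrow> cnorm A x = 0 \<longleftrightarrow> x = \<zero>"
    and cnorm_triangle: "\<lbrakk>x \<in> carrier A; y \<in> carrier A\<rbrakk> \<Longrightarrow> cnorm A (x \<oplus> y) \<le> cnorm A x + cnorm A y"
    and cnorm_smult: "x \<in> carrier A \<Longrightarrow> cnorm A (c \<odot> x) = cmod c * cnorm A x"
    and cnorm_mult: "\<lbrakk>x \<in> carrier A; y \<in> carrier A\<rbrakk> \<Longrightarrow> cnorm A (x \<otimes> y) \<le> cnorm A x * cnorm A y"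
    and cnorm_adj_mult: "x \<in> carrier A \<Longrightarrow> cnorm A (adj A x \<otimes> x) = (cnorm A x)\<^sup>2"
    and complete: "\<lbrakk>\<And>k. s k \<in> carrier A;
        \<And>e. e > 0 \<Longrightarrow> \<exists>N. \<forall>i\<ge>N. \<forall>j\<ge>N. cnorm A (s i \<ominus> s j) < e\<rbrakk>
      \<Longrightarrow> \<exists>x\<in>carrier A. converges_to A s x"

definition positive :: "'a cstar \<Rightarrow> 'a \<Rightarrow> bool" where
  "positive A a \<longleftrightarrow> a \<in> carrier A \<and> (\<exists>b\<in>carrier A. a = adj A b \<otimes>\<^bsub>A\<^esub> b)"

definition closed_ideal :: "'a cstar \<Rightarrow> 'a set \<Rightarrow> bool" where
  "closed_ideal A I \<longleftrightarrow>
     submodule I complex_cstar A \<and>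
     (\<forall>a\<in>carrier A. \<forall>x\<in>I. a \<otimes>\<^bsub>A\<^esub> x \<in> I \<and> x \<otimes>\<^bsub>A\<^esub> a \<in> I) \<and>
     (\<forall>s. \<forall>x\<in>carrier A. (\<forall>k. s k \<in> I) \<and> converges_to A s x \<longrightarrow> x \<in> I)"

definition simple_cstar_algebra :: "'a cstar \<Rightarrow> bool" where
  "simple_cstar_algebra A \<longleftrightarrow>
     cstar_algebra A \<and> carrier A \<noteq> {\<zero>\<^bsub>A\<^esub>} \<and>
     (\<forall>I. closed_ideal A I \<longrightarrow> I = {\<zero>\<^bsub>A\<^esub>} \<or> I = carrier A)"

text \<open>
  The value at \<open>c\<close> of the polynomial \<open>t * q t\<close>.  Every polynomial without constant term has this
  form; only these can be evaluated in an algebra without unit.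
\<close>

definition eval_times_X :: "'a cstar \<Rightarrow> real poly \<Rightarrow> 'a \<Rightarrow> 'a" where
  "eval_times_X A q c =
     (\<Oplus>\<^bsub>A\<^esub>i\<in>{..degree q}. complex_of_real (coeff q i) \<odot>\<^bsub>A\<^esub> (((\<lambda>y. c \<otimes>\<^bsub>A\<^esub> y) ^^ i) c))"

text \<open>
  Continuous functional calculus for self-adjoint \<open>c\<close> and continuous \<open>f\<close> with \<open>f 0 = 0\<close>: the
  common limit of \<open>p\<^sub>k(c)\<close> over all sequences of real polynomials \<open>p\<^sub>k\<close> without constant
  term that converge to \<open>f\<close> uniformly on the interval from \<open>- cnorm A c\<close> to \<open>cnorm A c\<close>, which
  contains the spectrum of \<open>c\<close>.  Such sequences exist by the Weierstrass theorem, so the limit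
  is unique.
\<close>

definition cfc :: "'a cstar \<Rightarrow> (real \<Rightarrow> real) \<Rightarrow> 'a \<Rightarrow> 'a" where
  "cfc A f c = (THE d. d \<in> carrier A \<and>
     (\<forall>q. uniform_limit {- cnorm A c..cnorm A c} (\<lambda>k t. t * poly (q k) t) f sequentially \<longrightarrow>
          converges_to A (\<lambda>k. eval_times_X A (q k) c) d))"

definition cut_down :: "'a cstar \<Rightarrow> 'a \<Rightarrow> real \<Rightarrow> 'a" where
  "cut_down A c \<epsilon> = cfc A (\<lambda>t. max (t - \<epsilon>) 0) c"

definition cuntz_subeq :: "'a cstar \<Rightarrow> 'a \<Rightarrow> 'a \<Rightarrow> bool" where
  "cuntz_subeq A a b \<longleftrightarrow>
     (\<exists>v. (\<forall>k. v k \<in> carrier A) \<and>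
          (\<lambda>k. cnorm A (a \<ominus>\<^bsub>A\<^esub> v k \<otimes>\<^bsub>A\<^esub> b \<otimes>\<^bsub>A\<^esub> adj A (v k))) \<longlonglongrightarrow> 0)"

text \<open>
  An \<open>n \<times> n\<close> matrix is a function of two indices that is zero outside \<open>{..<n} \<times> {..<n}\<close>.
  The norm is the operator norm of the action on the Hilbert \<open>A\<close>-module \<open>A\<^sup>n\<close> of columns, whose norm is
  \<open>\<parallel>\<Sum>\<^sub>i x\<^sub>i\<^sup>* x\<^sub>i\<parallel>\<close> to the power \<open>1/2\<close>.  This action is faithful, so this is the unique
  C*-norm on the *-algebra of matrices; for \<open>A\<close> the complex numbers it is the usual operator norm.
  If \<open>A\<close> has a unit \<open>one A\<close>, the field \<open>one\<close> is the identity matrix.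
\<close>

definition column_norm :: "'a cstar \<Rightarrow> nat \<Rightarrow> (nat \<Rightarrow> 'a) \<Rightarrow> real" where
  "column_norm A n x = sqrt (cnorm A (\<Oplus>\<^bsub>A\<^esub>i\<in>{..<n}. adj A (x i) \<otimes>\<^bsub>A\<^esub> x i))"

definition matrix_algebra :: "nat \<Rightarrow> 'a cstar \<Rightarrow> (nat \<Rightarrow> nat \<Rightarrow> 'a) cstar" where
  "matrix_algebra n A =
     \<lparr>carrier = {a. (\<forall>i<n. \<forall>j<n. a i j \<in> carrier A) \<and> (\<forall>i j. \<not> (i < n \<and> j < n) \<longrightarrow> a i j = \<zero>\<^bsub>A\<^esub>)},
      mult = (\<lambda>a b i j. \<Oplus>\<^bsub>A\<^esub>k\<in>{..<n}. a i k \<otimes>\<^bsub>A\<^esub> b k j),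
      one = (\<lambda>i j. if i = j \<and> i < n then \<one>\<^bsub>A\<^esub> else \<zero>\<^bsub>A\<^esub>),
      zero = (\<lambda>i j. \<zero>\<^bsub>A\<^esub>),
      add = (\<lambda>a b i j. a i j \<oplus>\<^bsub>A\<^esub> b i j),
      smult = (\<lambda>c a i j. c \<odot>\<^bsub>A\<^esub> a i j),
      adj = (\<lambda>a i j. adj A (a j i)),
      cnorm = (\<lambda>a. SUP x\<in>{x. (\<forall>i<n. x i \<in> carrier A) \<and> column_norm A n x \<le> 1}.
                 column_norm A n (\<lambda>i. \<Oplus>\<^bsub>A\<^esub>j\<in>{..<n}. a i j \<otimes>\<^bsub>A\<^esub> x j))\<rparr>"

definition linear_map :: "'a cstar \<Rightarrow> 'b cstar \<Rightarrow> ('a \<Rightarrow> 'b) \<Rightarrow> bool" where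
  "linear_map A B \<phi> \<longleftrightarrow>
     \<phi> \<in> carrier A \<rightarrow> carrier B \<and>
     (\<forall>x\<in>carrier A. \<forall>y\<in>carrier A. \<phi> (x \<oplus>\<^bsub>A\<^esub> y) = \<phi> x \<oplus>\<^bsub>B\<^esub> \<phi> y) \<and>
     (\<forall>c. \<forall>x\<in>carrier A. \<phi> (c \<odot>\<^bsub>A\<^esub> x) = c \<odot>\<^bsub>B\<^esub> \<phi> x)"

definition star_isomorphic :: "'a cstar \<Rightarrow> 'b cstar \<Rightarrow> bool" where
  "star_isomorphic A B \<longleftrightarrow>
     (\<exists>\<phi>. linear_map A B \<phi> \<and> bij_betw \<phi> (carrier A) (carrier B) \<and>
       (\<forall>x\<in>carrier A. \<forall>y\<in>carrier A. \<phi> (x \<otimes>\<^bsub>A\<^esub> y) = \<phi> x \<otimes>\<^bsub>B\<^esub> \<phi> y) \<and>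
       (\<forall>x\<in>carrier A. \<phi> (adj A x) = adj B (\<phi> x)))"

definition completely_positive :: "'a cstar \<Rightarrow> 'b cstar \<Rightarrow> ('a \<Rightarrow> 'b) \<Rightarrow> bool" where
  "completely_positive A B \<phi> \<longleftrightarrow>
     linear_map A B \<phi> \<and>
     (\<forall>k\<ge>1. \<forall>a. positive (matrix_algebra k A) a \<longrightarrow>
        positive (matrix_algebra k B) (\<lambda>i j. \<phi> (a i j)))"

definition cpc_order_zero :: "'a cstar \<Rightarrow> 'b cstar \<Rightarrow> ('a \<Rightarrow> 'b) \<Rightarrow> bool" where
  "cpc_order_zero A B \<phi> \<longleftrightarrow>
     completely_positive A B \<phi> \<and>
     (\<forall>z\<in>carrier A. cnorm B (\<phi> z) \<le> cnorm A z) \<and>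
     (\<forall>y z. positive A y \<and> positive A z \<and> y \<otimes>\<^bsub>A\<^esub> z = \<zero>\<^bsub>A\<^esub> \<longrightarrow> \<phi> y \<otimes>\<^bsub>B\<^esub> \<phi> z = \<zero>\<^bsub>B\<^esub>)"

definition tracially_Z_absorbing :: "'a cstar \<Rightarrow> bool" where
  "tracially_Z_absorbing A \<longleftrightarrow>
     simple_cstar_algebra A \<and>
     \<not> star_isomorphic A complex_cstar \<and>
     (\<forall>x a F \<epsilon> n.
        positive A x \<and> positive A a \<and> a \<noteq> \<zero>\<^bsub>A\<^esub> \<and> finite F \<and> F \<subseteq> carrier A \<and> (\<epsilon>::real) > 0 \<and> n \<ge> 1 \<longrightarrow>
        (\<exists>\<phi>. let M = matrix_algebra n complex_cstar in
           cpc_order_zero M A \<phi> \<and>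
           cuntz_subeq A (cut_down A (x \<otimes>\<^bsub>A\<^esub> x \<ominus>\<^bsub>A\<^esub> x \<otimes>\<^bsub>A\<^esub> \<phi> \<one>\<^bsub>M\<^esub> \<otimes>\<^bsub>A\<^esub> x) \<epsilon>) a \<and>
           (\<forall>z\<in>carrier M. cnorm M z \<le> 1 \<longrightarrow>
              (\<forall>b\<in>F. cnorm A (\<phi> z \<otimes>\<^bsub>A\<^esub> b \<ominus>\<^bsub>A\<^esub> b \<otimes>\<^bsub>A\<^esub> \<phi> z) < \<epsilon>))))"

end

theory Submission
  imports Defs "HOL-Complex_Analysis.Cauchy_Integral_Formula"
begin

text \<open>
  For an order zero map \<open>\<phi>\<close> into \<open>A\<close> the map \<open>diag \<circ> \<phi>\<close> into \<open>M\<^sub>n(A)\<close> is again order zero and almost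
  commutes with a finite set of matrices as soon as \<open>\<phi>\<close> almost commutes with their entries. For a
  positive \<open>x\<close> and an element \<open>y\<close> of an approximate unit of \<open>A\<close>, the element
  \<open>x\<^sup>2 - x (1 \<otimes> \<phi>(1)) x\<close> is close to \<open>x (1 \<otimes> (y\<^sup>2 - y \<phi>(1) y)) x\<close>, hence Cuntz subequivalent, after
  cutting down, to \<open>1 \<otimes> a0\<close> if \<open>y\<^sup>2 - y \<phi>(1) y\<close> is so to \<open>a0\<close>. It remains to find \<open>a0\<close> with \<open>1 \<otimes> a0\<close> of the form
  \<open>z a z\<^sup>*\<close>: this amounts to \<open>n\<close> orthogonal, mutually equivalent positive elements below a given one,
  which exist in a simple algebra without minimal projections. A minimal projection is excluded by
  an order zero map from \<open>M\<^sub>2\<close> almost commuting with a copy of \<open>M\<^sub>2\<close> in \<open>A\<close>, unless \<open>A\<close> is \<open>\<complex>\<close>.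

  All norm and positivity arguments take place in the type class of unital C*-algebras. Every
  C*-algebra on a type embeds isometrically into the unitization of the product of all C*-algebras
  on that type.
\<close>

section \<open>Polynomials in an element of a real algebra\<close>

text \<open>No spectra occur. The calculus rests on one inequality: for self-adjoint c and a real
  polynomial p, the norm of p(c) is at most the supremum of |p| on the interval from -||c|| to
  ||c||. It comes from a unitary with real part c, Cauchy's estimate and the C*-identity. For a
  positive element h^2 only values of f at nonnegative arguments enter f(h^2), and this replaces
  knowledge of the spectrum. The product over all algebras is needed because a type class instance
  is attached to a type and cannot depend on the record \<open>A\<close>; each algebra occurs as one
  coordinate of the product. In M_n(A) condition (i) compares with an element a of M_n(A), whereas
  the hypothesis only compares with elements of A. Hence 1 \<otimes> a0 has to be reached from a.
  Over the complex numbers this is impossible for n \<ge> 2 and a of rank one, since 1 \<otimes> a0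
  has rank n. The element y is there because x is not of the form 1 \<otimes> x0 and A has no unit
  to put in its place.\<close>

definition peval :: "real poly \<Rightarrow> 'a::real_algebra_1 \<Rightarrow> 'a" where
  "peval p c = (\<Sum>i\<le>degree p. coeff p i *\<^sub>R c ^ i)"

lemma peval_eq_sum:
  assumes "degree p \<le> n"
  shows "peval p c = (\<Sum>i\<le>n. coeff p i *\<^sub>R c ^ i)"
  unfolding peval_def
  by (rule sum.mono_neutral_left) (use assms in \<open>auto simp: coeff_eq_0\<close>)

lemma peval_0 [simp]: "peval 0 c = 0"
  by (simp add: peval_def)

lemma peval_pCons: "peval (pCons a p) c = of_real a + c * peval p c"
proof -
  have "peval (pCons a p) c = (\<Sum>i\<le>Suc (degree p). coeff (pCons a p) i *\<^sub>R c ^ i)"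
    by (rule peval_eq_sum) (simp add: degree_pCons_le)
  also have "\<dots> = of_real a + c * peval p c"
    by (simp only: sum.atMost_Suc_shift coeff_pCons_0 coeff_pCons_Suc)
      (simp add: peval_def sum_distrib_left of_real_def)
  finally show ?thesis .
qed

lemma peval_add: "peval (p + q) c = peval p c + peval q c"
proof -
  let ?n = "max (degree p) (degree q)"
  have "peval (p + q) c = (\<Sum>i\<le>?n. coeff (p + q) i *\<^sub>R c ^ i)"
    by (rule peval_eq_sum) (simp add: degree_add_le_max)
  moreover have "peval p c = (\<Sum>i\<le>?n. coeff p i *\<^sub>R c ^ i)" "peval q c = (\<Sum>i\<le>?n. coeff q i *\<^sub>R c ^ i)"
    by (rule peval_eq_sum; simp)+
  ultimately show ?thesis
    by (simp add: scaleR_left_distrib sum.distrib)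
qed

lemma peval_smult: "peval (Polynomial.smult a p) c = a *\<^sub>R peval p c"
proof -
  have "peval (Polynomial.smult a p) c = (\<Sum>i\<le>degree p. coeff (Polynomial.smult a p) i *\<^sub>R c ^ i)"
    by (rule peval_eq_sum) (simp add: degree_smult_le)
  then show ?thesis
    by (simp add: peval_def scaleR_sum_right)
qed

lemma peval_minus: "peval (- p) c = - peval p c"
  using peval_smult[of "-1" p c] by simp

lemma peval_diff: "peval (p - q) c = peval p c - peval q c"
  using peval_add[of p "- q" c] by (simp add: peval_minus)

lemma peval_mult: "peval (p * q) c = peval p c * peval q c"
  by (induction p) (simp_all add: peval_pCons peval_add peval_smult algebra_simps of_real_def)

lemma peval_1 [simp]: "peval 1 c = 1"
  by (simp add: peval_def)

lemma peval_power: "peval (p ^ n) c = peval p c ^ n"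
  by (induction n) (simp_all add: peval_mult)

lemma peval_sum: "peval (sum f A) c = (\<Sum>i\<in>A. peval (f i) c)"
  by (induction A rule: infinite_finite_induct) (simp_all add: peval_add)

lemma peval_pcompose: "peval (pcompose p q) c = peval p (peval q c)"
  by (induction p) (simp_all add: pcompose_pCons peval_pCons peval_add peval_mult)

lemma peval_of_real: "peval p (of_real t) = of_real (poly p t)"
  by (induction p) (simp_all add: peval_pCons)

lemma peval_intertwine:
  assumes "y * c = d * y"
  shows "y * peval p c = peval p d * y"
proof (induction p)
  case (pCons a p)
  have "y * (c * peval p c) = d * peval p d * y"
    by (metis pCons.IH assms mult.assoc)
  then show ?case
    by (simp add: peval_pCons algebra_simps) (simp add: of_real_def)
qed simp

lemma continuous_peval_scale:
  fixes c :: "'a::real_normed_algebra_1"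
  shows "isCont (\<lambda>t. peval p (t *\<^sub>R c)) x"
  unfolding peval_def by (intro continuous_intros)

text \<open>The Joukowski substitution: with \<open>v\<close> the inverse of \<open>u\<close>, each
  \<open>c ^ i\<close> is the quotient of \<open>(u\<^sup>2 + 1) ^ i\<close> by
  \<open>(2 * u) ^ i\<close>. The factor \<open>u ^ degree p\<close> clears the negative powers. The
  algebra is arbitrary because the identity is used both for complex numbers on the unit circle and
  for unitaries.\<close>

lemma peval_laurent:
  fixes u v :: "'a::real_normed_algebra_1"
  assumes uv: "u * v = 1" "v * u = 1" and c: "2 *\<^sub>R c = u + v"
  defines "X \<equiv> [:0, 1:] :: real poly"
  shows "peval (\<Sum>i\<le>degree p. Polynomial.smult (coeff p i / 2 ^ i) ((X\<^sup>2 + 1) ^ i * X ^ (degree p - i))) u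
    = u ^ degree p * peval p c"
proof -
  have X: "peval X u = u"
    by (simp add: X_def peval_pCons)
  have cu: "c = (1/2) *\<^sub>R (u + v)"
    by (simp flip: c)
  have comm: "u * c = c * u"
    using uv by (simp add: cu algebra_simps)
  have u2: "u\<^sup>2 + 1 = 2 *\<^sub>R (u * c)"
    using uv by (simp add: cu algebra_simps power2_eq_square)
  have comm': "c ^ i * u ^ j = u ^ j * c ^ i" for i j
    by (rule power_commuting_commutes[OF power_commuting_commutes[OF comm, symmetric]])
  have "(u * c) ^ i = u ^ i * c ^ i" for i
  proof (induction i)
    case (Suc i)
    have "(u * c) ^ Suc i = u * (c * u ^ i) * c ^ i"
      by (simp add: Suc mult.assoc)
    also have "c * u ^ i = u ^ i * c"
      using comm'[of 1 i] by simp
    finally show ?case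
      by (simp add: mult.assoc)
  qed simp
  then have ui: "(u\<^sup>2 + 1) ^ i = 2 ^ i *\<^sub>R (u ^ i * c ^ i)" for i
    by (simp add: u2)
  have eq: "(u\<^sup>2 + 1) ^ i * u ^ (degree p - i) = 2 ^ i *\<^sub>R (u ^ degree p * c ^ i)" if "i \<le> degree p" for i
  proof -
    have "u ^ i * c ^ i * u ^ (degree p - i) = u ^ i * u ^ (degree p - i) * c ^ i"
      by (simp add: comm' mult.assoc)
    also have "u ^ i * u ^ (degree p - i) = u ^ degree p"
      using that by (simp flip: power_add)
    finally show ?thesis
      by (simp add: ui)
  qed
  have "peval (\<Sum>i\<le>degree p. Polynomial.smult (coeff p i / 2 ^ i) ((X\<^sup>2 + 1) ^ i * X ^ (degree p - i))) u
     = (\<Sum>i\<le>degree p. (coeff p i / 2 ^ i) *\<^sub>R ((u\<^sup>2 + 1) ^ i * u ^ (degree p - i)))"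
    by (simp add: peval_sum peval_smult peval_mult peval_power peval_add X)
  also have "\<dots> = (\<Sum>i\<le>degree p. coeff p i *\<^sub>R (u ^ degree p * c ^ i))"
    by (rule sum.cong) (simp_all add: eq)
  also have "\<dots> = u ^ degree p * peval p c"
    by (simp add: peval_def sum_distrib_left)
  finally show ?thesis .
qed

section \<open>Coefficient bounds from Cauchy's inequality\<close>

lemma coeff_higher_pderiv_0: "coeff ((pderiv ^^ n) p) 0 = fact n * coeff p n"
proof -
  have "coeff ((pderiv ^^ n) p) k = (\<Prod>i=1..n. of_nat (k + i)) * coeff p (k + n)" for k
  proof (induction n arbitrary: k)
    case (Suc n)
    have "(\<Prod>i=1..Suc n. of_nat (k + i)) = of_nat (Suc k) * (\<Prod>i=1..n. of_nat (Suc k + i) :: 'a)"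
      by (subst prod.atLeast_Suc_atMost)
        (simp_all add: prod.shift_bounds_cl_Suc_ivl add_ac del: prod.cl_ivl_Suc)
    then show ?case
      by (simp add: coeff_pderiv Suc algebra_simps)
  qed simp
  then show ?thesis
    by (simp add: fact_prod)
qed

text \<open>Cauchy's inequality for the unit disc, where the radius contributes only the factor 1;
  the \<open>n\<close>-th derivative at 0 is \<open>fact n\<close> times the coefficient.\<close>

lemma coeff_bound_circle:
  fixes q :: "complex poly"
  assumes "\<And>z. cmod z = 1 \<Longrightarrow> cmod (poly q z) \<le> B"
  shows "cmod (coeff q n) \<le> B"
proof -
  have deriv: "(deriv ^^ n) (poly q) = poly ((pderiv ^^ n) q)" for n
  proof (induction n)
    case (Suc n)
    have "deriv (poly r) = poly (pderiv r)" for r :: "complex poly"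
      by (rule ext) (simp add: DERIV_imp_deriv poly_DERIV)
    then show ?case by (simp add: Suc)
  qed simp
  have "norm ((deriv ^^ n) (poly q) 0) \<le> fact n * B / 1 ^ n"
    by (rule Cauchy_inequality) (use assms in \<open>auto intro!: holomorphic_intros continuous_intros\<close>)
  then have "norm (fact n * coeff q n) \<le> fact n * B"
    by (simp add: deriv poly_0_coeff_0 coeff_higher_pderiv_0)
  then show ?thesis
    by (simp add: norm_mult)
qed

text \<open>On the unit circle the inverse of \<open>z\<close> is \<open>cnj z\<close>, so the
  argument of \<open>p\<close> becomes \<open>Re z\<close>, which lies between -1 and 1, and
  \<open>z ^ degree p\<close> has modulus 1. The transformed polynomial is therefore bounded by
  \<open>B\<close> on the circle. The degree bound later counts its coefficients.\<close>

lemma coeff_bound_interval: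
  fixes p :: "real poly"
  defines "X \<equiv> [:0, 1:] :: real poly"
  defines "q \<equiv> \<Sum>i\<le>degree p. Polynomial.smult (coeff p i / 2 ^ i) ((X\<^sup>2 + 1) ^ i * X ^ (degree p - i))"
  assumes "\<And>t. \<bar>t\<bar> \<le> 1 \<Longrightarrow> \<bar>poly p t\<bar> \<le> B"
  shows "\<bar>coeff q n\<bar> \<le> B" and "degree q \<le> 2 * degree p"
proof -
  define Q where "Q = map_poly complex_of_real q"
  have Q: "poly Q z = peval q z" for z
  proof -
    have "poly Q z = (\<Sum>i\<le>degree q. coeff Q i * z ^ i)"
      by (simp add: Q_def poly_altdef degree_map_poly)
    then show ?thesis
      by (simp add: Q_def coeff_map_poly peval_def scaleR_conv_of_real)
  qed
  have "cmod (poly Q z) \<le> B" if z: "cmod z = 1" for z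
  proof -
    have zz: "z * cnj z = 1"
      using z by (simp add: complex_norm_square[symmetric])
    have "poly Q z = z ^ degree p * peval p (complex_of_real (Re z))"
      unfolding Q q_def X_def
      by (rule peval_laurent[where v = "cnj z"]) (use zz in \<open>auto simp: complex_eq_iff algebra_simps\<close>)
    moreover have "\<bar>Re z\<bar> \<le> 1"
      using abs_Re_le_cmod[of z] z by simp
    ultimately show ?thesis
      by (simp add: peval_of_real norm_mult norm_power z assms)
  qed
  then have "cmod (coeff Q n) \<le> B"
    by (rule coeff_bound_circle)
  then show "\<bar>coeff q n\<bar> \<le> B"
    by (simp add: Q_def coeff_map_poly)
  show "degree q \<le> 2 * degree p"
    unfolding q_def
  proof (rule degree_sum_le)
    fix i assume "i \<in> {..degree p}"
    have X: "degree X \<le> 1" by (simp add: X_def)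
    have "degree (X\<^sup>2 + 1) \<le> 2"
      by (simp add: X_def power2_eq_square one_pCons)
    then have "degree ((X\<^sup>2 + 1) ^ i * X ^ (degree p - i)) \<le> 2 * i + (degree p - i)"
      using X degree_mult_le[of "(X\<^sup>2 + 1) ^ i" "X ^ (degree p - i)"]
        degree_power_le[of "X\<^sup>2 + 1" i] degree_power_le[of X "degree p - i"]
        mult_le_mono1[of "degree (X\<^sup>2 + 1)" 2 i] mult_le_mono1[of "degree X" 1 "degree p - i"]
      by linarith
    then show "degree (Polynomial.smult (coeff p i / 2 ^ i) ((X\<^sup>2 + 1) ^ i * X ^ (degree p - i))) \<le> 2 * degree p"
      using degree_smult_le[of "coeff p i / 2 ^ i" "(X\<^sup>2 + 1) ^ i * X ^ (degree p - i)"] \<open>i \<in> {..degree p}\<close>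
      by simp
  qed simp
qed

section \<open>Unital C*-algebras as a type class\<close>

text \<open>Complex scalars are encoded by a central element with square -1 on top of a real Banach
  algebra, so that the theory of real normed algebras applies unchanged. Complex homogeneity of the
  norm follows from the C*-identity instead of being an axiom.\<close>

class cstar_unital = real_normed_algebra_1 + banach +
  fixes star :: "'a \<Rightarrow> 'a" and imag_unit :: 'a
  assumes star_star [simp]: "star (star x) = x"
    and star_add: "star (x + y) = star x + star y"
    and star_scaleR: "star (r *\<^sub>R x) = r *\<^sub>R star x"
    and star_mult: "star (x * y) = star y * star x"
    and imag_unit_sq: "imag_unit * imag_unit = - 1"
    and imag_unit_commute: "imag_unit * x = x * imag_unit"
    and star_imag_unit: "star imag_unit = - imag_unit"
    and norm_star_mult: "norm (star x * x) = (norm x)\<^sup>2"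

lemma star_0 [simp]: "star (0 :: 'a::cstar_unital) = 0"
  using star_scaleR[of 0 0] by simp

lemma star_1 [simp]: "star (1 :: 'a::cstar_unital) = 1"
  by (metis mult.left_neutral star_mult star_star mult.right_neutral)

lemma star_uminus: "star (- x) = - star (x :: 'a::cstar_unital)"
  using star_scaleR[of "-1" x] by simp

lemma star_diff: "star (x - y) = star x - star (y :: 'a::cstar_unital)"
  using star_add[of x "- y"] by (simp add: star_uminus)

lemma star_of_real [simp]: "star (of_real r :: 'a::cstar_unital) = of_real r"
  by (simp add: of_real_def star_scaleR)

lemma star_power: "star (x ^ n) = star (x :: 'a::cstar_unital) ^ n"
  by (induction n) (simp_all add: star_mult power_commutes)

lemma star_sum: "star (sum f A) = (\<Sum>i\<in>A. star (f i :: 'a::cstar_unital))"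
  by (induction A rule: infinite_finite_induct) (simp_all add: star_add)

lemma star_eq_0_iff [simp]: "star x = 0 \<longleftrightarrow> x = (0 :: 'a::cstar_unital)"
  by (metis star_0 star_star)

lemma norm_star [simp]: "norm (star x) = norm (x :: 'a::cstar_unital)"
proof -
  have "norm x \<le> norm (star x)" for x :: 'a
  proof (cases "norm x = 0")
    case False
    have "norm x * norm x \<le> norm (star x) * norm x"
      using norm_star_mult[of x] norm_mult_ineq[of "star x" x] by (simp add: power2_eq_square)
    then show ?thesis
      using False by (simp add: mult_le_cancel_right)
  qed (metis norm_ge_zero)
  from this[of x] this[of "star x"] show ?thesis by simp
qed

lemma bounded_linear_star: "bounded_linear (star :: 'a::cstar_unital \<Rightarrow> 'a)"
  by (rule bounded_linear_intro[where K = 1]) (simp_all add: star_add star_scaleR)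

lemma norm_mult_star: "norm (x * star x) = (norm (x :: 'a::cstar_unital))\<^sup>2"
  using norm_star_mult[of "star x"] by simp

lemma star_mult_eq_0_iff: "star x * x = 0 \<longleftrightarrow> x = (0 :: 'a::cstar_unital)"
  by (metis norm_star_mult norm_eq_zero mult_zero_right power_eq_0_iff zero_neq_numeral)

section \<open>The norm of a polynomial in a self-adjoint element\<close>

lemma norm_selfadjoint_square:
  "star c = c \<Longrightarrow> norm (c * c) = (norm (c :: 'a::cstar_unital))\<^sup>2"
  using norm_star_mult[of c] by simp

lemma norm_selfadjoint_power2:
  "star c = c \<Longrightarrow> norm (c ^ (2 ^ k)) = norm (c :: 'a::cstar_unital) ^ (2 ^ k)"
proof (induction k arbitrary: c)
  case (Suc k)
  have "c ^ (2 ^ Suc k) = (c * c) ^ (2 ^ k)"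
    by (simp add: power_mult flip: power2_eq_square)
  then show ?case
    using Suc.IH[of "c * c"] Suc.prems
    by (simp add: star_mult norm_selfadjoint_square flip: power_mult)
qed simp

text \<open>Consecutive coefficients have the ratio \<open>(1/2 - n) / (n + 1)\<close>, of modulus
  at most 1. The bound makes the series of the square root converge absolutely, by comparison with
  the geometric series.\<close>

lemma abs_gbinomial_half_le_1: "\<bar>(1/2 :: real) gchoose n\<bar> \<le> 1"
proof (induction n)
  case (Suc n)
  have "(1/2 :: real) gchoose Suc n = ((1/2) gchoose n) * ((1/2 - real n) / real (Suc n))"
    using gbinomial_mult_1[of "1/2 :: real" n] by (simp add: field_simps)
  moreover have "\<bar>(1/2 - real n) / real (Suc n)\<bar> \<le> 1"
    by (simp add: abs_le_iff field_simps)
  ultimately show ?case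
    using Suc mult_mono[OF Suc, of "\<bar>(1/2 - real n) / real (Suc n)\<bar>" 1] by (simp add: abs_mult)
qed simp

text \<open>The binomial series of \<open>sqrt (1 - t)\<close>, squared by Vandermonde's identity.\<close>

lemma sqrt_one_minus_exists:
  fixes a :: "'a::cstar_unital"
  assumes a: "norm a < 1" and sa: "star a = a"
  obtains s where "s * s = 1 - a" "star s = s" "\<And>y. y * a = a * y \<Longrightarrow> y * s = s * y"
proof -
  define b where "b n = ((- 1) ^ n * ((1/2 :: real) gchoose n)) *\<^sub>R a ^ n" for n
  have "norm (b n) \<le> norm a ^ n" for n
  proof -
    have "norm (b n) \<le> 1 * norm (a ^ n)"
      unfolding b_def norm_scaleR using abs_gbinomial_half_le_1[of n]
      by (intro mult_right_mono) (simp_all add: abs_mult)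
    then show ?thesis using norm_power_ineq[of a n] by simp
  qed
  then have nsum: "summable (\<lambda>n. norm (b n))"
    by (intro summable_comparison_test[OF _ summable_geometric[of "norm a"]]) (use a in auto)
  then have bsum: "summable b" by (rule summable_norm_cancel)
  define s where "s = suminf b"
  have "(\<lambda>k. \<Sum>i\<le>k. b i * b (k - i)) sums (s * s)"
    unfolding s_def by (rule Cauchy_product_sums[OF nsum nsum])
  moreover have "(\<Sum>i\<le>k. b i * b (k - i)) = ((- 1) ^ k * ((1 :: real) gchoose k)) *\<^sub>R a ^ k" for k
  proof -
    have "(\<Sum>i\<le>k. b i * b (k - i))
        = (\<Sum>i\<le>k. ((- 1) ^ k * (((1/2) gchoose i) * ((1/2) gchoose (k - i)))) *\<^sub>R a ^ k)"
    proof (rule sum.cong, simp)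
      fix i assume "i \<in> {..k}"
      then have "(- 1 :: real) ^ k = (- 1) ^ i * (- 1) ^ (k - i)" "a ^ k = a ^ i * a ^ (k - i)"
        by (simp_all flip: power_add)
      then show "b i * b (k - i)
          = ((- 1) ^ k * (((1/2) gchoose i) * ((1/2) gchoose (k - i)))) *\<^sub>R a ^ k"
        by (simp add: b_def mult_ac)
    qed
    also have "\<dots> = ((- 1) ^ k * (\<Sum>i\<le>k. ((1/2) gchoose i) * ((1/2) gchoose (k - i)))) *\<^sub>R a ^ k"
      by (simp add: sum_distrib_left scaleR_sum_left)
    also have "(\<Sum>i\<le>k. ((1/2 :: real) gchoose i) * ((1/2) gchoose (k - i))) = 1 gchoose k"
      using gbinomial_Vandermonde[of "1/2 :: real" "1/2" k] by (simp add: atMost_atLeast0)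
    finally show ?thesis .
  qed
  moreover have "(\<lambda>k. ((- 1) ^ k * ((1 :: real) gchoose k)) *\<^sub>R a ^ k) sums (\<Sum>k\<in>{0, 1}. ((- 1) ^ k * ((1 :: real) gchoose k)) *\<^sub>R a ^ k)"
  proof (rule sums_finite)
    fix k :: nat assume "k \<notin> {0, 1}"
    then have "(1 :: nat) < k" by auto
    then have "(1 :: real) gchoose k = 0"
      using binomial_gbinomial[of 1 k, where 'a = real] binomial_eq_0[OF \<open>1 < k\<close>]
      by (simp only: of_nat_0 of_nat_1)
    then show "((- 1) ^ k * ((1 :: real) gchoose k)) *\<^sub>R a ^ k = 0" by simp
  qed simp
  ultimately have ss: "s * s = 1 - a"
    by (simp add: sums_unique2)
  have "star (b n) = b n" for n
    by (simp add: b_def star_scaleR star_power sa)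
  then have st: "star s = s"
    by (simp add: s_def bounded_linear.suminf[OF bounded_linear_star bsum])
  have comm: "y * s = s * y" if "y * a = a * y" for y
  proof -
    have "y * a ^ n = a ^ n * y" for n
      by (rule power_commuting_commutes[OF that[symmetric], symmetric])
    then have "y * b n = b n * y" for n
      by (simp add: b_def)
    then show ?thesis
      using suminf_mult[OF bsum, of y] suminf_mult2[OF bsum, of y] by (simp add: s_def)
  qed
  show ?thesis by (rule that[OF ss st comm])
qed

text \<open>As with cosine and sine, \<open>u = c + imag_unit * s\<close> with
  \<open>s * s = 1 - c * c\<close> is a unitary with real part \<open>c\<close>. Up to a unitary
  factor p(c) is then a polynomial in \<open>u\<close> with at most \<open>2 * degree p + 1\<close>
  coefficients, each bounded by \<open>B\<close>, and powers of \<open>u\<close> have norm at most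
  1. The strict bound on the norm lets \<open>s\<close> be given by a power series.\<close>

lemma norm_peval_le_degree:
  fixes c :: "'a::cstar_unital"
  assumes sa: "star c = c" and c: "norm c < 1"
    and B: "\<And>t. \<bar>t\<bar> \<le> 1 \<Longrightarrow> \<bar>poly p t\<bar> \<le> B"
  shows "norm (peval p c) \<le> (2 * real (degree p) + 1) * B"
proof -
  have "norm (c * c) < 1"
    unfolding norm_selfadjoint_square[OF sa] using abs_square_less_1[of "norm c"] c by simp
  moreover have "star (c * c) = c * c"
    by (simp add: star_mult sa)
  ultimately obtain s where s: "s * s = 1 - c * c" "star s = s"
    and s_comm: "\<And>y. y * (c * c) = (c * c) * y \<Longrightarrow> y * s = s * y"
    using sqrt_one_minus_exists[of "c * c"] by blast
  have cs: "c * s = s * c"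
    by (rule s_comm) (simp add: mult.assoc)
  define u where "u = c + imag_unit * s"
  define v where "v = c - imag_unit * s"
  have i: "imag_unit * (imag_unit * x) = - x" for x :: 'a
    by (simp add: imag_unit_sq flip: mult.assoc)
  have i': "c * (imag_unit * x) = imag_unit * (c * x)" "s * (imag_unit * x) = imag_unit * (s * x)" for x
    by (simp_all add: imag_unit_commute mult.assoc)
  have "u * v = 1" "v * u = 1"
    by (simp_all add: u_def v_def algebra_simps i i' cs s imag_unit_sq)
  have "star u = v" "star v = u"
    by (simp_all add: u_def v_def star_add star_diff star_mult star_imag_unit s sa imag_unit_commute)
  then have nu: "norm u = 1" "norm v = 1"
  proof -
    have "(norm u)\<^sup>2 = 1\<^sup>2"
      using norm_star_mult[of u] by (simp add: \<open>star u = v\<close> \<open>v * u = 1\<close>)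
    then show "norm u = 1"
      by (rule power2_eq_imp_eq) simp_all
    then show "norm v = 1"
      using norm_star[of u] by (simp add: \<open>star u = v\<close>)
  qed
  define X where "X = ([:0, 1:] :: real poly)"
  define q where "q = (\<Sum>i\<le>degree p. Polynomial.smult (coeff p i / 2 ^ i) ((X\<^sup>2 + 1) ^ i * X ^ (degree p - i)))"
  have "peval q u = u ^ degree p * peval p c"
    unfolding q_def X_def
    by (rule peval_laurent[OF \<open>u * v = 1\<close> \<open>v * u = 1\<close>]) (simp add: u_def v_def scaleR_2)
  moreover have "v ^ n * u ^ n = 1" for n
    by (rule left_right_inverse_power) fact
  ultimately have "peval p c = v ^ degree p * peval q u"
    by (simp flip: mult.assoc)
  also have "norm \<dots> \<le> norm v ^ degree p * norm (peval q u)"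
    by (meson mult_right_mono norm_ge_zero norm_mult_ineq norm_power_ineq order_trans)
  also have "\<dots> = norm (peval q u)"
    by (simp add: nu)
  also have "\<dots> \<le> (\<Sum>i\<le>degree q. B)"
    unfolding peval_def
  proof (rule sum_norm_le)
    fix i assume "i \<in> {..degree q}"
    have "norm (coeff q i *\<^sub>R u ^ i) \<le> \<bar>coeff q i\<bar> * 1"
      unfolding norm_scaleR using norm_power_ineq[of u i] by (intro mult_left_mono) (simp_all add: nu)
    also have "\<dots> \<le> B"
      using coeff_bound_interval(1)[where p = p and n = i, OF B] by (simp add: q_def X_def)
    finally show "norm (coeff q i *\<^sub>R u ^ i) \<le> B" .
  qed
  also have "\<dots> = (real (degree q) + 1) * B"
    by simp
  also have "\<dots> \<le> (2 * real (degree p) + 1) * B"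
  proof (rule mult_right_mono)
    have "degree q \<le> 2 * degree p"
      using coeff_bound_interval(2)[where p = p, OF B] by (simp add: q_def X_def)
    then show "real (degree q) + 1 \<le> 2 * real (degree p) + 1"
      by linarith
    show "0 \<le> B" using B[of 0] abs_ge_zero[of "poly p 0"] by linarith
  qed
  finally show ?thesis .
qed

text \<open>The C*-identity removes the factor depending on the degree: apply the previous bound to
  the powers \<open>p ^ (2 ^ k)\<close>.\<close>

lemma norm_peval_le_unit_ball:
  fixes c :: "'a::cstar_unital"
  assumes sa: "star c = c" and c: "norm c < 1"
    and B: "\<And>t. \<bar>t\<bar> \<le> 1 \<Longrightarrow> \<bar>poly p t\<bar> \<le> B"
  shows "norm (peval p c) \<le> B"
proof (rule ccontr)
  assume "\<not> norm (peval p c) \<le> B"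
  moreover have "0 \<le> B" using B[of 0] abs_ge_zero[of "poly p 0"] by linarith
  ultimately have r: "0 \<le> B" "B < norm (peval p c)" by auto
  let ?r = "B / norm (peval p c)"
  define d where "d = 2 * real (degree p)"
  have saP: "star (peval p c) = peval p c"
    by (simp add: peval_def star_sum star_scaleR star_power sa)
  have *: "1 \<le> (d * real (2 ^ k) + 1) * ?r ^ (2 ^ k)" for k :: nat
  proof -
    have "norm (peval (p ^ (2 ^ k)) c) \<le> (2 * real (degree (p ^ (2 ^ k))) + 1) * B ^ (2 ^ k)"
      by (rule norm_peval_le_degree[OF sa c]) (simp add: power_mono B power_abs)
    also have "\<dots> \<le> (d * real (2 ^ k) + 1) * B ^ (2 ^ k)"
    proof (rule mult_right_mono)
      have "real (degree (p ^ (2 ^ k))) \<le> real (degree p * 2 ^ k)"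
        using degree_power_le of_nat_le_iff by blast
      then show "2 * real (degree (p ^ (2 ^ k))) + 1 \<le> d * real (2 ^ k) + 1"
        by (simp add: d_def)
    qed (use r in auto)
    finally have "norm (peval p c) ^ (2 ^ k) \<le> (d * real (2 ^ k) + 1) * B ^ (2 ^ k)"
      by (simp add: peval_power norm_selfadjoint_power2[OF saP])
    moreover have "0 < norm (peval p c)" using r by linarith
    ultimately show ?thesis
      by (simp add: power_divide pos_le_divide_eq del: zero_less_norm_iff)
  qed
  have q: "\<bar>?r\<bar> < 1" using r by (simp add: divide_less_eq_1 del: zero_less_norm_iff)
  have "(\<lambda>n. d * (real n * ?r ^ n) + ?r ^ n) \<longlonglongrightarrow> d * 0 + 0"
    by (intro tendsto_intros powser_times_n_limit_0 LIMSEQ_power_zero) (use q in auto)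
  then have "(\<lambda>n. (d * real n + 1) * ?r ^ n) \<longlonglongrightarrow> 0"
    by (simp add: algebra_simps)
  then have "\<forall>\<^sub>F n in sequentially. (d * real n + 1) * ?r ^ n < 1"
    by (rule order_tendstoD) simp
  then obtain N where N: "\<And>n. n \<ge> N \<Longrightarrow> (d * real n + 1) * ?r ^ n < 1"
    unfolding eventually_sequentially by blast
  have "\<not> 1 \<le> (d * real (2 ^ N) + 1) * ?r ^ (2 ^ N)"
    using N[OF less_imp_le[OF less_exp]] by (simp only: not_le)
  then show False
    using *[of N] by (rule notE)
qed

text \<open>Rescaling by \<open>N\<close> reduces to the open unit ball, which only reaches
  \<open>r *\<^sub>R c\<close> with \<open>r < 1\<close>; continuity in \<open>r\<close> gives the
  boundary. The case \<open>N = 0\<close> is separate because it cannot be rescaled; there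
  \<open>c = 0\<close>.\<close>

lemma norm_peval_le:
  fixes c :: "'a::cstar_unital"
  assumes sa: "star c = c" and c: "norm c \<le> N"
    and B: "\<And>t. \<bar>t\<bar> \<le> N \<Longrightarrow> \<bar>poly p t\<bar> \<le> B"
  shows "norm (peval p c) \<le> B"
proof (cases "N = 0")
  case True
  then have "peval p c = of_real (poly p 0)"
    using c peval_of_real[of p 0, where 'a = 'a] by simp
  then show ?thesis
    using B[of 0] True by simp
next
  case False
  with c have N: "N > 0" using norm_ge_zero[of c] by linarith
  have *: "norm (peval p (r *\<^sub>R c)) \<le> B" if r: "0 < r" "r < 1" for r
  proof -
    let ?c = "(r / N) *\<^sub>R c" and ?p = "pcompose p [:0, N:]"
    have "norm ?c < 1"
    proof -
      have "r * norm c \<le> r * N" using c r by simp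
      also have "\<dots> < N" using r N by simp
      finally show ?thesis using r N by simp
    qed
    moreover have "\<bar>poly ?p t\<bar> \<le> B" if "\<bar>t\<bar> \<le> 1" for t
    proof -
      have "N * \<bar>t\<bar> \<le> N" using that N by simp
      then show ?thesis using N by (simp add: poly_pcompose B abs_mult mult.commute)
    qed
    ultimately have "norm (peval ?p ?c) \<le> B"
      by (intro norm_peval_le_unit_ball) (simp_all add: star_scaleR sa)
    moreover have "peval [:0, N:] ?c = r *\<^sub>R c"
      using N by (simp add: peval_pCons of_real_def)
    ultimately show ?thesis
      by (simp add: peval_pcompose)
  qed
  have "((\<lambda>r. norm (peval p (r *\<^sub>R c))) \<longlongrightarrow> norm (peval p (1 *\<^sub>R c))) (at_left 1)"
    using continuous_peval_scale[where p = p and c = c and x = 1] unfolding isCont_def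
    by (intro tendsto_norm) (rule tendsto_mono[OF at_le], auto)
  moreover have "\<forall>\<^sub>F r in at_left (1::real). norm (peval p (r *\<^sub>R c)) \<le> B"
    using eventually_at_left_real[of 0 1] by (rule eventually_mono) (use * in auto)
  ultimately have "norm (peval p (1 *\<^sub>R c)) \<le> B"
    by (rule tendsto_upperbound) simp
  then show ?thesis by simp
qed

section \<open>Continuous functional calculus\<close>

text \<open>One sequence serves all compact intervals, so that the same polynomials can be evaluated
  in different elements. The value at 0 is exact, because inside a subalgebra without unit only
  polynomials vanishing at 0 can be evaluated.\<close>

lemma polynomial_approximation:
  fixes f :: "real \<Rightarrow> real"
  assumes "continuous_on UNIV f"
  obtains q where "\<And>K. uniform_limit {-K..K} (\<lambda>k. poly (q k)) f sequentially"
    and "\<And>k. poly (q k) 0 = f 0"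
proof -
  have "\<exists>p. \<forall>t\<in>{-real k..real k}. \<bar>f t - poly p t\<bar> < inverse (real (Suc k))" for k
  proof -
    obtain g where g: "real_polynomial_function g"
      and lt: "\<And>x. x \<in> {-real k..real k} \<Longrightarrow> \<bar>f x - g x\<bar> < inverse (real (Suc k))"
    proof (rule Stone_Weierstrass_real_polynomial_function)
      show "continuous_on {-real k..real k} f"
        by (rule continuous_on_subset[OF assms]) simp
    qed auto
    obtain a n where "g = (\<lambda>x. \<Sum>i\<le>n. a i * x ^ i)"
      using g real_polynomial_function_iff_sum by blast
    then have "g x = poly (\<Sum>i\<le>n. monom (a i) i) x" for x
      by (simp add: poly_sum poly_monom)
    with lt show ?thesis by metis
  qed
  then obtain p where p: "\<And>k t. t \<in> {-real k..real k} \<Longrightarrow> \<bar>f t - poly (p k) t\<bar> < inverse (real (Suc k))"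
    by metis
  \<comment> \<open>Subtracting the error at 0 makes the value there exact and at most doubles the
    error elsewhere, provided that 0 lies in the interval, which it does for every
    \<open>k\<close>.\<close>
  define q where "q k = p k + [:f 0 - poly (p k) 0:]" for k
  have q: "\<bar>poly (q k) t - f t\<bar> < 2 * inverse (real (Suc k))" if "t \<in> {-real k..real k}" for t k
    using p[OF that] p[of 0 k] by (simp add: q_def abs_if split: if_splits)
  have lim: "uniform_limit {-K..K} (\<lambda>k. poly (q k)) f sequentially" for K
  proof (rule uniform_limitI)
    fix e :: real assume "e > 0"
    then have "\<forall>\<^sub>F k in sequentially. inverse (real (Suc k)) < e / 2"
      by (intro order_tendstoD(2)[OF LIMSEQ_inverse_real_of_nat] half_gt_zero)
    moreover have "\<forall>\<^sub>F k in sequentially. K \<le> real k"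
      using filterlim_real_sequentially unfolding filterlim_at_top by blast
    ultimately show "\<forall>\<^sub>F k in sequentially. \<forall>t\<in>{-K..K}. dist (poly (q k) t) (f t) < e"
    proof eventually_elim
      case (elim k)
      show ?case
      proof
        fix t assume "t \<in> {-K..K}"
        then have "t \<in> {-real k..real k}" using elim by simp
        from q[OF this] show "dist (poly (q k) t) (f t) < e"
          using elim by (simp add: dist_real_def)
      qed
    qed
  qed
  show ?thesis
    by (rule that[OF lim]) (simp add: q_def)
qed

lemma star_peval: "star c = c \<Longrightarrow> star (peval p c) = peval p (c :: 'a::cstar_unital)"
  by (simp add: peval_def star_sum star_scaleR star_power)

lemma tendsto_peval_null:
  fixes c :: "'a::cstar_unital"
  assumes sa: "star c = c" and lim: "uniform_limit {-norm c..norm c} (\<lambda>k. poly (p k)) (\<lambda>_. 0) F"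
  shows "((\<lambda>k. peval (p k) c) \<longlongrightarrow> 0) F"
proof (rule tendstoI)
  fix e :: real assume e: "e > 0"
  have "\<forall>\<^sub>F k in F. \<forall>t\<in>{-norm c..norm c}. dist (poly (p k) t) 0 < e / 2"
    using lim e by (intro uniform_limitD) auto
  then show "\<forall>\<^sub>F k in F. dist (peval (p k) c) 0 < e"
  proof eventually_elim
    case (elim k)
    have "norm (peval (p k) c) \<le> e / 2"
    proof (rule norm_peval_le[OF sa order_refl])
      fix t assume "\<bar>t\<bar> \<le> norm c"
      then have "t \<in> {-norm c..norm c}" by auto
      with elim have "dist (poly (p k) t) 0 < e / 2" by blast
      then show "\<bar>poly (p k) t\<bar> \<le> e / 2" by simp
    qed
    then show ?case using e by simp
  qed
qed

text \<open>The limit along some approximating sequence; \<open>fcalc_limit\<close> shows that any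
  other sequence gives the same element. The choice is meaningful for self-adjoint elements only,
  since only there the polynomial bound is available.\<close>

definition fcalc :: "(real \<Rightarrow> real) \<Rightarrow> 'a::cstar_unital \<Rightarrow> 'a" where
  "fcalc f c = (SOME d. \<exists>q. uniform_limit {-norm c..norm c} (\<lambda>k. poly (q k)) f sequentially \<and>
     (\<lambda>k. peval (q k) c) \<longlonglongrightarrow> d)"

text \<open>The polynomial bound applied to differences of approximants gives both convergence and
  independence of the sequence. The interval may be larger than the norm requires, so that one
  approximating sequence can be shared by elements of different norm.\<close>

lemma fcalc_limit:
  fixes c :: "'a::cstar_unital"
  assumes sa: "star c = c" and lim: "uniform_limit {-K..K} (\<lambda>k. poly (q k)) f sequentially"
    and K: "norm c \<le> K"
  shows "(\<lambda>k. peval (q k) c) \<longlonglongrightarrow> fcalc f c"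
proof -
  let ?I = "{-norm c..norm c}"
  have lim': "uniform_limit ?I (\<lambda>k. poly (q k)) f sequentially"
    by (rule uniform_limit_on_subset[OF lim]) (use K in auto)
  have "Cauchy (\<lambda>k. peval (q k) c)"
  proof (rule CauchyI)
    fix e :: real assume e: "e > 0"
    have "\<forall>\<^sub>F k in sequentially. \<forall>t\<in>?I. dist (poly (q k) t) (f t) < e / 4"
      using lim' e by (intro uniform_limitD) auto
    then obtain M where M: "\<And>k t. k \<ge> M \<Longrightarrow> t \<in> ?I \<Longrightarrow> dist (poly (q k) t) (f t) < e / 4"
      unfolding eventually_sequentially by blast
    show "\<exists>M. \<forall>m\<ge>M. \<forall>n\<ge>M. norm (peval (q m) c - peval (q n) c) < e"
    proof (intro exI[of _ M] allI impI)
      fix m n assume mn: "M \<le> m" "M \<le> n"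
      have "norm (peval (q m - q n) c) \<le> e / 2"
      proof (rule norm_peval_le[OF sa order_refl])
        fix t assume "\<bar>t\<bar> \<le> norm c"
        then have "t \<in> ?I" by auto
        from M[OF mn(1) this] M[OF mn(2) this] show "\<bar>poly (q m - q n) t\<bar> \<le> e / 2"
          unfolding dist_real_def poly_diff by linarith
      qed
      then show "norm (peval (q m) c - peval (q n) c) < e"
        using e by (simp add: peval_diff)
    qed
  qed
  then have "convergent (\<lambda>k. peval (q k) c)"
    by (rule Cauchy_convergent)
  then have "\<exists>d r. uniform_limit ?I (\<lambda>k. poly (r k)) f sequentially \<and> (\<lambda>k. peval (r k) c) \<longlonglongrightarrow> d"
    using lim' unfolding convergent_def by blast
  from someI_ex[OF this] obtain r where r: "uniform_limit ?I (\<lambda>k. poly (r k)) f sequentially"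
    "(\<lambda>k. peval (r k) c) \<longlonglongrightarrow> fcalc f c"
    unfolding fcalc_def by blast
  have "uniform_limit ?I (\<lambda>k t. poly (q k) t - poly (r k) t) (\<lambda>t. f t - f t) sequentially"
    by (intro uniform_limit_intros lim' r)
  then have "uniform_limit ?I (\<lambda>k. poly (q k - r k)) (\<lambda>_. 0) sequentially"
    by (simp add: poly_diff[abs_def])
  then have "(\<lambda>k. peval (q k - r k) c) \<longlonglongrightarrow> 0"
    by (rule tendsto_peval_null[OF sa])
  from tendsto_add[OF this r(2)] show ?thesis
    by (simp add: peval_diff)
qed

definition poly_approx :: "(real \<Rightarrow> real) \<Rightarrow> nat \<Rightarrow> real poly" where
  "poly_approx f = (SOME q. (\<forall>K. uniform_limit {-K..K} (\<lambda>k. poly (q k)) f sequentially) \<and>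
     (\<forall>k. poly (q k) 0 = f 0))"

lemma
  assumes "continuous_on UNIV f"
  shows poly_approx_limit: "uniform_limit {-K..K} (\<lambda>k. poly (poly_approx f k)) f sequentially"
    and poly_approx_0: "poly (poly_approx f k) 0 = f 0"
proof -
  have "\<exists>q. (\<forall>K. uniform_limit {-K..K} (\<lambda>k. poly (q k)) f sequentially) \<and> (\<forall>k. poly (q k) 0 = f 0)"
    by (rule polynomial_approximation[OF assms]) blast
  from someI_ex[OF this] show "uniform_limit {-K..K} (\<lambda>k. poly (poly_approx f k)) f sequentially"
    "poly (poly_approx f k) 0 = f 0"
    unfolding poly_approx_def by blast+
qed

lemma tendsto_poly_approx:
  fixes c :: "'a::cstar_unital"
  shows "star c = c \<Longrightarrow> continuous_on UNIV f \<Longrightarrow> (\<lambda>k. peval (poly_approx f k) c) \<longlonglongrightarrow> fcalc f c"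
  by (rule fcalc_limit[OF _ poly_approx_limit order_refl])

lemma fcalc_poly:
  "star c = c \<Longrightarrow> fcalc (poly p) c = peval p (c :: 'a::cstar_unital)"
  using fcalc_limit[where c = c and K = "norm c" and q = "\<lambda>_. p" and f = "poly p"]
  by (simp add: LIMSEQ_const_iff uniform_limit_const)

lemma fcalc_const: "star c = c \<Longrightarrow> fcalc (\<lambda>_. r) c = of_real r"
  for c :: "'a::cstar_unital"
proof -
  have "poly [:r:] = (\<lambda>_. r)" by auto
  then show "fcalc (\<lambda>_. r) c = of_real r" if "star c = c"
    using fcalc_poly[OF that, of "[:r:]"] by (simp add: peval_pCons)
qed

lemma fcalc_id: "star c = c \<Longrightarrow> fcalc (\<lambda>t. t) c = c"
  for c :: "'a::cstar_unital"
proof -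
  have "poly [:0, 1:] = (\<lambda>t::real. t)" by (rule ext) simp
  then show "fcalc (\<lambda>t. t) c = c" if "star c = c"
    using fcalc_poly[OF that, of "[:0, 1:]"] by (simp add: peval_pCons)
qed

lemma fcalc_norm_le:
  fixes c :: "'a::cstar_unital"
  assumes sa: "star c = c" and f: "continuous_on UNIV f"
    and B: "\<And>t. \<bar>t\<bar> \<le> norm c \<Longrightarrow> \<bar>f t\<bar> \<le> B"
  shows "norm (fcalc f c) \<le> B"
proof (rule field_le_epsilon)
  fix e :: real assume e: "e > 0"
  let ?q = "poly_approx f"
  note q = tendsto_poly_approx[OF sa f] and lim = poly_approx_limit[OF f, of "norm c"]
  have "\<forall>\<^sub>F k in sequentially. \<forall>t\<in>{-norm c..norm c}. dist (poly (?q k) t) (f t) < e"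
    using lim e by (rule uniform_limitD)
  then have "\<forall>\<^sub>F k in sequentially. norm (peval (?q k) c) \<le> B + e"
  proof eventually_elim
    case (elim k)
    show ?case
    proof (rule norm_peval_le[OF sa order_refl])
      fix t assume t: "\<bar>t\<bar> \<le> norm c"
      then have "t \<in> {-norm c..norm c}" by auto
      with elim have "dist (poly (?q k) t) (f t) < e" by blast
      with B[OF t] show "\<bar>poly (?q k) t\<bar> \<le> B + e"
        by (simp add: dist_real_def)
    qed
  qed
  then show "norm (fcalc f c) \<le> B + e"
    using tendsto_upperbound[OF tendsto_norm[OF q]] by simp
qed

section \<open>Algebraic rules of the functional calculus\<close>

lemma fcalc_add:
  fixes c :: "'a::cstar_unital"
  assumes sa: "star c = c" and f: "continuous_on UNIV f" "continuous_on UNIV g"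
  shows "fcalc (\<lambda>t. f t + g t) c = fcalc f c + fcalc g c"
proof -
  define p where "p = poly_approx f"
  have p: "(\<lambda>k. peval (p k) c) \<longlonglongrightarrow> fcalc f c" "uniform_limit {-norm c..norm c} (\<lambda>k. poly (p k)) f sequentially"
    unfolding p_def using tendsto_poly_approx[OF sa f(1)] poly_approx_limit[OF f(1)] by blast+
  define q where "q = poly_approx g"
  have q: "(\<lambda>k. peval (q k) c) \<longlonglongrightarrow> fcalc g c" "uniform_limit {-norm c..norm c} (\<lambda>k. poly (q k)) g sequentially"
    unfolding q_def using tendsto_poly_approx[OF sa f(2)] poly_approx_limit[OF f(2)] by blast+
  have "uniform_limit {-norm c..norm c} (\<lambda>k. poly (p k + q k)) (\<lambda>t. f t + g t) sequentially"
    unfolding poly_add[abs_def] by (intro uniform_limit_intros p q)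
  then have "(\<lambda>k. peval (p k + q k) c) \<longlonglongrightarrow> fcalc (\<lambda>t. f t + g t) c"
    by (rule fcalc_limit[OF sa]) simp
  moreover have "(\<lambda>k. peval (p k + q k) c) \<longlonglongrightarrow> fcalc f c + fcalc g c"
    unfolding peval_add by (intro tendsto_intros p q)
  ultimately show ?thesis by (rule LIMSEQ_unique)
qed

lemma fcalc_mult:
  fixes c :: "'a::cstar_unital"
  assumes sa: "star c = c" and f: "continuous_on UNIV f" "continuous_on UNIV g"
  shows "fcalc (\<lambda>t. f t * g t) c = fcalc f c * fcalc g c"
proof -
  define p where "p = poly_approx f"
  have p: "(\<lambda>k. peval (p k) c) \<longlonglongrightarrow> fcalc f c" "uniform_limit {-norm c..norm c} (\<lambda>k. poly (p k)) f sequentially"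
    unfolding p_def using tendsto_poly_approx[OF sa f(1)] poly_approx_limit[OF f(1)] by blast+
  define q where "q = poly_approx g"
  have q: "(\<lambda>k. peval (q k) c) \<longlonglongrightarrow> fcalc g c" "uniform_limit {-norm c..norm c} (\<lambda>k. poly (q k)) g sequentially"
    unfolding q_def using tendsto_poly_approx[OF sa f(2)] poly_approx_limit[OF f(2)] by blast+
  have "compact (h ` {-norm c..norm c})" if "continuous_on UNIV h" for h :: "real \<Rightarrow> real"
    by (intro compact_continuous_image continuous_on_subset[OF that]) auto
  then have "bounded (f ` {-norm c..norm c})" "bounded (g ` {-norm c..norm c})"
    using f compact_imp_bounded by blast+
  then have "uniform_limit {-norm c..norm c} (\<lambda>k. poly (p k * q k)) (\<lambda>t. f t * g t) sequentially"
    unfolding poly_mult[abs_def] by (intro uniform_lim_mult p q)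
  then have "(\<lambda>k. peval (p k * q k) c) \<longlonglongrightarrow> fcalc (\<lambda>t. f t * g t) c"
    by (rule fcalc_limit[OF sa]) simp
  moreover have "(\<lambda>k. peval (p k * q k) c) \<longlonglongrightarrow> fcalc f c * fcalc g c"
    unfolding peval_mult by (intro tendsto_intros p q)
  ultimately show ?thesis by (rule LIMSEQ_unique)
qed

lemma fcalc_diff:
  fixes c :: "'a::cstar_unital"
  assumes sa: "star c = c" and f: "continuous_on UNIV f" "continuous_on UNIV g"
  shows "fcalc (\<lambda>t. f t - g t) c = fcalc f c - fcalc g c"
  using fcalc_add[OF sa, of "\<lambda>t. f t - g t" g] f by (simp add: continuous_intros)

lemma fcalc_cong:
  fixes c :: "'a::cstar_unital"
  assumes sa: "star c = c" and f: "continuous_on UNIV f" "continuous_on UNIV g"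
    and eq: "\<And>t. \<bar>t\<bar> \<le> norm c \<Longrightarrow> f t = g t"
  shows "fcalc f c = fcalc g c"
  using fcalc_norm_le[OF sa, of "\<lambda>t. f t - g t" 0] eq f
  by (simp add: fcalc_diff[OF sa] continuous_intros)

lemma star_fcalc:
  fixes c :: "'a::cstar_unital"
  assumes sa: "star c = c" and f: "continuous_on UNIV f"
  shows "star (fcalc f c) = fcalc f c"
proof -
  note p = tendsto_poly_approx[OF sa f]
  from bounded_linear.tendsto[OF bounded_linear_star p] have "(\<lambda>k. peval (poly_approx f k) c) \<longlonglongrightarrow> star (fcalc f c)"
    by (simp add: star_peval[OF sa])
  then show ?thesis using p by (rule LIMSEQ_unique)
qed

lemma fcalc_intertwine:
  fixes c d y :: "'a::cstar_unital"
  assumes sa: "star c = c" "star d = d" and f: "continuous_on UNIV f" and y: "y * c = d * y"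
  shows "y * fcalc f c = fcalc f d * y"
proof -
  have "(\<lambda>k. y * peval (poly_approx f k) c) \<longlonglongrightarrow> y * fcalc f c"
    "(\<lambda>k. peval (poly_approx f k) d * y) \<longlonglongrightarrow> fcalc f d * y"
    by (intro tendsto_intros tendsto_poly_approx sa f)+
  then show ?thesis
    unfolding peval_intertwine[OF y] by (rule LIMSEQ_unique)
qed

text \<open>Composition with a polynomial as inner function. Approximants of \<open>f\<close>,
  composed with \<open>p\<close>, approximate the composition if they are good on an interval that
  contains the values of \<open>p\<close> on the norm interval. With \<open>p t = t * t\<close> this
  carries information from a root of an element to the element itself.\<close>

lemma fcalc_peval:
  fixes c :: "'a::cstar_unital"
  assumes sa: "star c = c" and f: "continuous_on UNIV f"
  shows "fcalc f (peval p c) = fcalc (\<lambda>t. f (poly p t)) c"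
proof -
  let ?q = "poly_approx f"
  note q = tendsto_poly_approx[OF star_peval[OF sa] f, of p] and lim = poly_approx_limit[OF f]
  have "compact (poly p ` {-norm c..norm c})"
    by (intro compact_continuous_image continuous_intros) auto
  then obtain K where K: "\<And>t. t \<in> {-norm c..norm c} \<Longrightarrow> \<bar>poly p t\<bar> \<le> K"
    using compact_imp_bounded[THEN bounded_pos[THEN iffD1]] by fastforce
  have "uniform_limit {-norm c..norm c} (\<lambda>k t. poly (?q k) (poly p t)) (\<lambda>t. f (poly p t)) sequentially"
    by (rule uniform_limit_compose'[OF lim[of K]]) (use K in \<open>auto simp: abs_le_iff minus_le_iff\<close>)
  then have "uniform_limit {-norm c..norm c} (\<lambda>k. poly (pcompose (?q k) p)) (\<lambda>t. f (poly p t)) sequentially"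
    by (simp add: poly_pcompose[abs_def])
  from fcalc_limit[OF sa this order_refl] have "(\<lambda>k. peval (?q k) (peval p c)) \<longlonglongrightarrow> fcalc (\<lambda>t. f (poly p t)) c"
    by (simp only: peval_pcompose)
  with q show ?thesis
    by (rule LIMSEQ_unique)
qed

lemma fcalc_square:
  fixes c :: "'a::cstar_unital"
  assumes sa: "star c = c" and f: "continuous_on UNIV f"
  shows "fcalc f (c * c) = fcalc (\<lambda>t. f (t * t)) c"
  using fcalc_peval[OF sa f, of "[:0, 0, 1:]"] by (simp add: peval_pCons)

section \<open>Positive elements\<close>

text \<open>Squares of self-adjoint elements are taken because the functional calculus applies to
  the root. That all products \<open>star x * x\<close> are included is the content of
  \<open>positive_elem_star_mult\<close>.\<close>

definition positive_elem :: "'a::cstar_unital \<Rightarrow> bool" where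
  "positive_elem a \<longleftrightarrow> (\<exists>h. star h = h \<and> a = h * h)"

lemma positive_elem_star: "positive_elem a \<Longrightarrow> star a = a"
  by (auto simp: positive_elem_def star_mult)

lemma positive_elem_square: "star h = h \<Longrightarrow> positive_elem (h * h)"
  by (auto simp: positive_elem_def)

lemma positive_elem_0 [simp]: "positive_elem 0"
  using positive_elem_square[of 0] by simp

lemma positive_elem_fcalc:
  fixes c :: "'a::cstar_unital"
  assumes sa: "star c = c" and f: "continuous_on UNIV f" and nonneg: "\<And>t. 0 \<le> f t"
  shows "positive_elem (fcalc f c)"
proof -
  have s: "continuous_on UNIV (\<lambda>t. sqrt (f t))"
    by (intro continuous_intros f)
  have "fcalc f c = fcalc (\<lambda>t. sqrt (f t) * sqrt (f t)) c"
    by (simp add: nonneg)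
  also have "\<dots> = fcalc (\<lambda>t. sqrt (f t)) c * fcalc (\<lambda>t. sqrt (f t)) c"
    by (rule fcalc_mult[OF sa s s])
  finally show ?thesis
    using star_fcalc[OF sa s] by (auto simp: positive_elem_def)
qed

text \<open>For \<open>a = h * h\<close> the element f(a) is g(h) with
  \<open>g t = f (t * t)\<close>, and \<open>t * t\<close> stays between 0 and
  \<open>norm a\<close>. This stands in for the location of the spectrum of a positive
  element.\<close>

lemma norm_fcalc_positive_le:
  fixes a :: "'a::cstar_unital"
  assumes a: "positive_elem a" and f: "continuous_on UNIV f"
    and B: "\<And>t. 0 \<le> t \<Longrightarrow> t \<le> norm a \<Longrightarrow> \<bar>f t\<bar> \<le> B"
  shows "norm (fcalc f a) \<le> B"
proof -
  obtain h where h: "star h = h" "a = h * h"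
    using a by (auto simp: positive_elem_def)
  have cont: "continuous_on UNIV (\<lambda>t. f (t * t))"
    by (rule continuous_on_compose2[OF f]) (auto intro!: continuous_intros)
  have "norm (fcalc (\<lambda>t. f (t * t)) h) \<le> B"
  proof (rule fcalc_norm_le[OF h(1) cont])
    fix t assume "\<bar>t\<bar> \<le> norm h"
    then have "\<bar>t\<bar> * \<bar>t\<bar> \<le> norm h * norm h"
      by (intro mult_mono) auto
    then show "\<bar>f (t * t)\<bar> \<le> B"
      using norm_selfadjoint_square[OF h(1)] by (intro B) (simp_all add: h(2) power2_eq_square)
  qed
  then show ?thesis
    by (simp add: h(2) fcalc_square[OF h(1) f])
qed

lemma fcalc_positive_cong:
  fixes a :: "'a::cstar_unital"
  assumes a: "positive_elem a" and f: "continuous_on UNIV f" "continuous_on UNIV g"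
    and eq: "\<And>t. 0 \<le> t \<Longrightarrow> t \<le> norm a \<Longrightarrow> f t = g t"
  shows "fcalc f a = fcalc g a"
  using norm_fcalc_positive_le[OF a, of "\<lambda>t. f t - g t" 0] eq f
  by (simp add: fcalc_diff[OF positive_elem_star[OF a]] continuous_intros)

text \<open>With \<open>- a = h * h\<close> the calculus at \<open>a\<close> becomes a calculus at
  \<open>h\<close> for the function that sends \<open>t\<close> to \<open>f (- t * t)\<close>, so
  only nonpositive arguments of \<open>f\<close> are seen.\<close>

lemma fcalc_negative_cong:
  fixes a :: "'a::cstar_unital"
  assumes a: "positive_elem (- a)" and f: "continuous_on UNIV f" "continuous_on UNIV g"
    and eq: "\<And>t. t \<le> 0 \<Longrightarrow> f t = g t"
  shows "fcalc f a = fcalc g a"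
proof -
  obtain h where h: "star h = h" "- a = h * h"
    using a by (auto simp: positive_elem_def)
  then have "a = peval [:0, 0, -1:] h"
    by (simp add: peval_pCons) (metis minus_minus)
  then show ?thesis
    using eq by (simp add: fcalc_peval[OF h(1)] f)
qed

text \<open>A norm criterion is needed since a sum of squares is not visibly a square, while norms
  satisfy the triangle inequality. Conversely, if \<open>d = of_real t - a\<close> has norm at most
  \<open>t\<close>, then \<open>t - s\<close> is nonnegative on the norm interval of
  \<open>d\<close>, and \<open>a\<close> is the square of its root evaluated at
  \<open>d\<close>.\<close>

lemma positive_elem_iff_norm:
  fixes a :: "'a::cstar_unital"
  assumes sa: "star a = a" and t: "norm a \<le> t"
  shows "positive_elem a \<longleftrightarrow> norm (of_real t - a) \<le> t"
proof
  assume a: "positive_elem a"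
  have "of_real t - a = fcalc (\<lambda>s. t - s) a"
    by (simp add: fcalc_diff[OF sa] continuous_intros fcalc_const[OF sa] fcalc_id[OF sa])
  moreover have "norm (fcalc (\<lambda>s. t - s) a) \<le> t"
    by (rule norm_fcalc_positive_le[OF a]) (use t in \<open>auto intro!: continuous_intros\<close>)
  ultimately show "norm (of_real t - a) \<le> t" by simp
next
  assume le: "norm (of_real t - a) \<le> t"
  define d where "d = of_real t - a"
  have sd: "star d = d"
    by (simp add: d_def star_diff sa)
  let ?f = "\<lambda>s. sqrt (max (t - s) 0)"
  have f: "continuous_on UNIV ?f" by (intro continuous_intros)
  have "fcalc ?f d * fcalc ?f d = fcalc (\<lambda>s. ?f s * ?f s) d"
    by (rule fcalc_mult[OF sd f f, symmetric])
  also have "\<dots> = fcalc (\<lambda>s. t - s) d"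
    by (rule fcalc_cong[OF sd]) (use le in \<open>auto simp: d_def intro!: continuous_intros\<close>)
  also have "\<dots> = a"
    by (simp add: fcalc_diff[OF sd] continuous_intros fcalc_const[OF sd] fcalc_id[OF sd]) (simp add: d_def)
  finally show "positive_elem a"
    using positive_elem_square[OF star_fcalc[OF sd f]] by simp
qed

lemma positive_elem_add:
  fixes a b :: "'a::cstar_unital"
  assumes a: "positive_elem a" and b: "positive_elem b"
  shows "positive_elem (a + b)"
proof -
  note sa = positive_elem_star[OF a] positive_elem_star[OF b]
  have "norm (of_real (norm a) - a) \<le> norm a" "norm (of_real (norm b) - b) \<le> norm b"
    using positive_elem_iff_norm[OF sa(1)] positive_elem_iff_norm[OF sa(2)] a b by auto
  moreover have "of_real (norm a + norm b) - (a + b) = (of_real (norm a) - a) + (of_real (norm b) - b)"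
    by simp
  ultimately have "norm (of_real (norm a + norm b) - (a + b)) \<le> norm a + norm b"
    by (metis norm_triangle_mono)
  then show ?thesis
    using positive_elem_iff_norm[of "a + b" "norm a + norm b"] sa
    by (simp add: star_add norm_triangle_ineq)
qed

lemma positive_elem_sum:
  fixes f :: "'i \<Rightarrow> 'a::cstar_unital"
  shows "(\<And>i. i \<in> A \<Longrightarrow> positive_elem (f i)) \<Longrightarrow> positive_elem (sum f A)"
  by (induction A rule: infinite_finite_induct) (auto intro: positive_elem_add)

lemma positive_elem_scaleR:
  fixes a :: "'a::cstar_unital"
  assumes "positive_elem a" "0 \<le> r"
  shows "positive_elem (r *\<^sub>R a)"
proof -
  obtain h where "star h = h" "a = h * h"
    using assms by (auto simp: positive_elem_def)
  then show ?thesis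
    using positive_elem_square[of "sqrt r *\<^sub>R h"] assms(2) by (simp add: star_scaleR)
qed

text \<open>The spectra of \<open>star y * y\<close> and \<open>y * star y\<close> agree up to \<open>0\<close>; here this enters as
  \<open>y * f (star y * y) = f (y * star y) * y\<close>, which vanishes for \<open>f t = min t 0\<close>.\<close>

lemma negative_star_mult_eq_0:
  fixes y :: "'a::cstar_unital"
  assumes neg: "positive_elem (- (star y * y))"
  shows "y = 0"
proof -
  have re: "star (y + star y) = y + star y" and im: "star (imag_unit * (y - star y)) = imag_unit * (y - star y)"
    by (simp_all add: star_add star_mult star_diff star_imag_unit imag_unit_commute algebra_simps)
  have "imag_unit * (x * (imag_unit * z)) = - (x * z)" for x z :: 'a
    by (metis imag_unit_commute imag_unit_sq mult.assoc mult_minus1)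
  \<comment> \<open>The squares of twice the real part and, up to sign, twice the imaginary part of
    \<open>y\<close>. The identity writes \<open>y * star y\<close> as a sum of squares minus
    \<open>star y * y\<close>, so it is positive under the hypothesis.\<close>
  then have "(y + star y) * (y + star y) + imag_unit * (y - star y) * (imag_unit * (y - star y))
      = 2 *\<^sub>R (y * star y + star y * y)"
    by (simp add: algebra_simps scaleR_2)
  then have "y * star y = (1/2) *\<^sub>R ((y + star y) * (y + star y) +
      imag_unit * (y - star y) * (imag_unit * (y - star y))) + (- (star y * y))"
    by simp
  also have "positive_elem \<dots>"
    by (intro positive_elem_add positive_elem_scaleR positive_elem_square re im neg) simp
  finally have pos: "positive_elem (y * star y)" .
  let ?f = "\<lambda>t::real. min t 0"
  have f: "continuous_on UNIV ?f" by (intro continuous_intros)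
  have sa: "star (star y * y) = star y * y" "star (y * star y) = y * star y"
    by (simp_all add: star_mult)
  have "y * fcalc ?f (star y * y) = fcalc ?f (y * star y) * y"
    by (rule fcalc_intertwine[OF sa f]) (simp add: mult.assoc)
  also have "fcalc ?f (y * star y) = fcalc (\<lambda>_. 0) (y * star y)"
    by (rule fcalc_positive_cong[OF pos f]) auto
  also have "\<dots> = 0"
    by (simp add: fcalc_const[OF sa(2)])
  also have "fcalc ?f (star y * y) = fcalc (\<lambda>t. t) (star y * y)"
    by (rule fcalc_negative_cong[OF neg f]) auto
  also have "\<dots> = star y * y"
    by (rule fcalc_id[OF sa(1)])
  finally have "y * (star y * y) = 0" by simp
  then have "star (star y * y) * (star y * y) = 0"
    by (simp add: sa mult.assoc)
  then show ?thesis
    by (simp add: star_mult_eq_0_iff)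
qed

text \<open>With \<open>m\<close> the negative part of \<open>a = star x * x\<close>, the element
  \<open>star (x * m) * (x * m) = m * a * m\<close> equals \<open>- (m * m * m)\<close> and is
  negative. Hence \<open>x * m = 0\<close> by the previous lemma, which forces \<open>m = 0\<close>,
  and \<open>a\<close> equals its positive part.\<close>

theorem positive_elem_star_mult:
  fixes x :: "'a::cstar_unital"
  shows "positive_elem (star x * x)"
proof -
  define a where "a = star x * x"
  have sa: "star a = a" by (simp add: a_def star_mult)
  let ?n = "\<lambda>t::real. max (- t) 0"
  define m where "m = fcalc ?n a"
  have n: "continuous_on UNIV ?n" by (intro continuous_intros)
  have sm: "star m = m" unfolding m_def by (rule star_fcalc[OF sa n])
  have "m * a * m = fcalc (\<lambda>t. ?n t * t * ?n t) a"
    unfolding m_def by (simp add: fcalc_mult[OF sa] continuous_intros fcalc_id[OF sa])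
  also have "(\<lambda>t. ?n t * t * ?n t) = (\<lambda>t. - (?n t * ?n t * ?n t))"
    by (auto simp: max_def)
  finally have mam: "m * a * m = fcalc (\<lambda>t. - (?n t * ?n t * ?n t)) a" .
  have neg: "fcalc (\<lambda>t. - f t) a = - fcalc f a" if "continuous_on UNIV f" for f
    using fcalc_diff[OF sa continuous_on_const that, of 0] by (simp add: fcalc_const[OF sa])
  have mmm: "m * a * m = - (m * m * m)"
    unfolding mam by (subst neg) (simp_all add: fcalc_mult[OF sa] continuous_intros m_def)
  have "- (star (x * m) * (x * m)) = - (m * a * m)"
    by (simp add: star_mult sm a_def mult.assoc)
  also have "\<dots> = fcalc (\<lambda>t. ?n t * ?n t * ?n t) a"
    unfolding mam by (subst neg) (simp_all add: continuous_intros)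
  also have "positive_elem \<dots>"
    by (rule positive_elem_fcalc[OF sa]) (auto intro!: continuous_intros)
  finally have "x * m = 0"
    by (rule negative_star_mult_eq_0)
  then have "m * a * m = 0"
    by (simp add: a_def mult.assoc)
  then have "m * m * m = 0"
    using mmm by simp
  then have "star (m * m) * (m * m) = 0"
    by (simp add: star_mult sm flip: mult.assoc)
  then have "star m * m = 0"
    by (simp add: star_mult_eq_0_iff sm)
  then have "m = 0"
    by (simp add: star_mult_eq_0_iff)
  have "(\<lambda>t. max t 0 - ?n t) = (\<lambda>t. t)"
    by (auto simp: max_def)
  then have "a = fcalc (\<lambda>t. max t 0 - ?n t) a"
    by (simp only: fcalc_id[OF sa])
  also have "\<dots> = fcalc (\<lambda>t. max t 0) a - m"
    unfolding m_def by (rule fcalc_diff[OF sa]) (intro continuous_intros)+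
  also have "\<dots> = fcalc (\<lambda>t. max t 0) a"
    by (simp only: \<open>m = 0\<close> diff_zero)
  also have "positive_elem \<dots>"
    by (rule positive_elem_fcalc[OF sa]) (auto intro!: continuous_intros)
  finally show ?thesis by (simp add: a_def)
qed

lemma positive_elem_conj:
  fixes a :: "'a::cstar_unital"
  assumes "positive_elem a"
  shows "positive_elem (star x * a * x)"
proof -
  obtain h where "star h = h" "a = h * h"
    using assms by (auto simp: positive_elem_def)
  then show ?thesis
    using positive_elem_star_mult[of "h * x"] by (simp add: star_mult mult.assoc)
qed

section \<open>Order and norm\<close>

lemma positive_elem_norm_diff:
  fixes b :: "'a::cstar_unital"
  assumes sb: "star b = b" and N: "norm b \<le> N"
  shows "positive_elem (of_real N - b)"
proof -
  have "of_real N - b = fcalc (\<lambda>t. N - t) b"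
    by (simp add: fcalc_diff[OF sb] continuous_intros fcalc_const[OF sb] fcalc_id[OF sb])
  also have "\<dots> = fcalc (\<lambda>t. max (N - t) 0) b"
    by (rule fcalc_cong[OF sb]) (use N in \<open>auto intro!: continuous_intros\<close>)
  also have "positive_elem \<dots>"
    by (rule positive_elem_fcalc[OF sb]) (auto intro!: continuous_intros)
  finally show ?thesis .
qed

text \<open>Written in terms of a root \<open>k\<close> of \<open>of_real N - a\<close>, the part of
  \<open>a\<close> above \<open>N\<close> is the function \<open>max (- (t * t)) 0\<close>, which is
  zero. So \<open>a\<close> coincides with its truncation at \<open>N\<close>.\<close>

lemma norm_le_of_positive_diff:
  fixes a :: "'a::cstar_unital"
  assumes a: "positive_elem a" and d: "positive_elem (of_real N - a)" and N: "0 \<le> N"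
  shows "norm a \<le> N"
proof -
  note sa = positive_elem_star[OF a]
  obtain k where k: "star k = k" "of_real N - a = k * k"
    using d by (auto simp: positive_elem_def)
  then have ak: "a = peval [:N, 0, -1:] k"
    by (simp add: peval_pCons algebra_simps)
  have "fcalc (\<lambda>t. max (t - N) 0) a = fcalc (\<lambda>t. 0) k"
    unfolding ak by (subst fcalc_peval[OF k(1)]) (auto intro!: continuous_intros arg_cong[where f = "\<lambda>f. fcalc f k"])
  then have 0: "fcalc (\<lambda>t. max (t - N) 0) a = 0"
    by (simp add: fcalc_const[OF k(1)])
  have "(\<lambda>t. min t N + max (t - N) 0) = (\<lambda>t. t)"
    by (auto simp: min_def max_def)
  then have "a = fcalc (\<lambda>t. min t N + max (t - N) 0) a"
    by (simp only: fcalc_id[OF sa])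
  also have "\<dots> = fcalc (\<lambda>t. min t N) a"
    using 0 by (simp add: fcalc_add[OF sa] continuous_intros)
  also have "norm \<dots> \<le> N"
    by (rule norm_fcalc_positive_le[OF a]) (use N in \<open>auto intro!: continuous_intros\<close>)
  finally show ?thesis .
qed

lemma norm_mono_positive:
  fixes a :: "'a::cstar_unital"
  assumes a: "positive_elem a" and d: "positive_elem (b - a)"
  shows "norm a \<le> norm b"
proof -
  have "positive_elem b"
    using positive_elem_add[OF a d] by simp
  then have "positive_elem (of_real (norm b) - b)"
    by (intro positive_elem_norm_diff positive_elem_star) auto
  from positive_elem_add[OF this d] show ?thesis
    by (intro norm_le_of_positive_diff[OF a]) auto
qed

section \<open>Cut-downs and approximate units\<close>

lemma norm_sub_fcalc_cut:
  fixes a :: "'a::cstar_unital"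
  assumes a: "positive_elem a" and e: "0 \<le> e"
  shows "norm (a - fcalc (\<lambda>t. max (t - e) 0) a) \<le> e"
proof -
  note sa = positive_elem_star[OF a]
  have "a - fcalc (\<lambda>t. max (t - e) 0) a = fcalc (\<lambda>t. t - max (t - e) 0) a"
    by (simp add: fcalc_diff[OF sa] continuous_intros fcalc_id[OF sa])
  also have "norm \<dots> \<le> e"
    by (rule norm_fcalc_positive_le[OF a]) (use e in \<open>auto intro!: continuous_intros\<close>)
  finally show ?thesis .
qed

text \<open>For small \<eta> a continuous substitute for the support projection: the function is 0
  for negative \<open>t\<close>, grows like \<open>t / \<eta>\<close> up to \<eta> and is 1
  afterwards. It vanishes at 0, so that it can be applied in subalgebras without unit.\<close>

definition absorber :: "real \<Rightarrow> 'a::cstar_unital \<Rightarrow> 'a" where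
  "absorber \<eta> = fcalc (\<lambda>t. max t 0 / max t \<eta>)"

lemma continuous_absorber: "0 < \<eta> \<Longrightarrow> continuous_on UNIV (\<lambda>t. max t 0 / max t \<eta> :: real)"
  by (intro continuous_intros) (auto simp: max_def)

lemma norm_absorber_le: "0 < \<eta> \<Longrightarrow> star e = e \<Longrightarrow> norm (absorber \<eta> e) \<le> 1"
  for e :: "'a::cstar_unital"
  unfolding absorber_def by (rule fcalc_norm_le[OF _ continuous_absorber]) (auto simp: max_def)

lemma positive_elem_absorber: "0 < \<eta> \<Longrightarrow> star e = e \<Longrightarrow> positive_elem (absorber \<eta> e)"
  for e :: "'a::cstar_unital"
  unfolding absorber_def by (rule positive_elem_fcalc) (auto simp: continuous_absorber)

text \<open>By the C*-identity the square of the norm is that of \<open>w * g * star g * w\<close>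
  with \<open>w = 1 - absorber \<eta> e\<close>. Monotonicity replaces \<open>g * star g\<close> by
  \<open>e\<close>, and \<open>t * (1 - t / \<eta>)\<^sup>2\<close> is at most \<eta> below \<eta>,
  while the function vanishes above.\<close>

lemma norm_absorber_diff:
  fixes e g :: "'a::cstar_unital"
  assumes e: "positive_elem e" and g: "positive_elem (e - g * star g)" and \<eta>: "0 < \<eta>"
  shows "(norm (g - absorber \<eta> e * g))\<^sup>2 \<le> \<eta>"
proof -
  note se = positive_elem_star[OF e]
  let ?f = "\<lambda>t. 1 - max t 0 / max t \<eta>"
  have f: "continuous_on UNIV ?f"
    by (intro continuous_on_diff continuous_on_const continuous_absorber \<eta>)
  define w where "w = fcalc ?f e"
  have w: "w = 1 - absorber \<eta> e"
    using fcalc_diff[OF se continuous_on_const continuous_absorber[OF \<eta>], of 1]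
    by (simp add: w_def absorber_def fcalc_const[OF se])
  have sw: "star w = w" unfolding w_def by (rule star_fcalc[OF se f])
  have "(norm (g - absorber \<eta> e * g))\<^sup>2 = norm ((w * g) * star (w * g))"
    unfolding norm_mult_star by (simp add: w algebra_simps)
  also have "\<dots> \<le> norm (w * e * w)"
  proof (rule norm_mono_positive)
    show "positive_elem ((w * g) * star (w * g))"
      using positive_elem_star_mult[of "star (w * g)"] by simp
    show "positive_elem (w * e * w - (w * g) * star (w * g))"
      using positive_elem_conj[OF g, of w] by (simp add: star_mult sw algebra_simps)
  qed
  also have "w * e * w = fcalc (\<lambda>t. ?f t * t * ?f t) e"
    by (simp add: w_def fcalc_mult[OF se] f continuous_intros fcalc_id[OF se])
  also have "norm \<dots> \<le> \<eta>"
  proof (rule norm_fcalc_positive_le[OF e])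
    show "continuous_on UNIV (\<lambda>t. ?f t * t * ?f t)"
      by (intro continuous_intros f)
    fix t :: real assume t: "0 \<le> t"
    show "\<bar>?f t * t * ?f t\<bar> \<le> \<eta>"
    proof (cases "t \<ge> \<eta>")
      case False
      then have "0 \<le> ?f t" "?f t \<le> 1"
        using t \<eta> by (auto simp: max_def divide_le_eq_1)
      then have "?f t * (t * ?f t) \<le> 1 * (t * 1)"
        using t by (intro mult_mono) auto
      moreover have "0 \<le> ?f t * (t * ?f t)"
        using \<open>0 \<le> ?f t\<close> t by (intro mult_nonneg_nonneg)
      ultimately show ?thesis
        using False by (simp only: mult.assoc abs_of_nonneg)
    qed (use \<eta> in \<open>simp add: max_def\<close>)
  qed
  finally show ?thesis .
qed

section \<open>Closed star-subalgebras\<close>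

text \<open>The unit of the ambient type need not belong to \<open>S\<close>. In this form the given
  algebra is treated later, as the image of an embedding: the ambient unit is available in
  computations, and membership in \<open>S\<close> is tracked separately.\<close>

locale cstar_subalgebra =
  fixes S :: "'a::cstar_unital set"
  assumes zero_mem [simp]: "0 \<in> S"
    and add_mem: "x \<in> S \<Longrightarrow> y \<in> S \<Longrightarrow> x + y \<in> S"
    and mult_mem: "x \<in> S \<Longrightarrow> y \<in> S \<Longrightarrow> x * y \<in> S"
    and scaleR_mem: "x \<in> S \<Longrightarrow> r *\<^sub>R x \<in> S"
    and imag_mem: "x \<in> S \<Longrightarrow> imag_unit * x \<in> S"
    and star_mem: "x \<in> S \<Longrightarrow> star x \<in> S"
    and closed_S: "closed S"
begin

lemma uminus_mem: "x \<in> S \<Longrightarrow> - x \<in> S"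
  using scaleR_mem[of x "-1"] by simp

lemma diff_mem: "x \<in> S \<Longrightarrow> y \<in> S \<Longrightarrow> x - y \<in> S"
  using add_mem[of x "- y"] uminus_mem by simp

lemma sum_mem: "(\<And>i. i \<in> I \<Longrightarrow> f i \<in> S) \<Longrightarrow> sum f I \<in> S"
  by (induction I rule: infinite_finite_induct) (auto intro: add_mem)

lemma peval_mem:
  assumes c: "c \<in> S" and p: "poly p 0 = 0"
  shows "peval p c \<in> S"
  unfolding peval_def
proof (intro sum_mem)
  fix i
  have pow: "c ^ Suc n \<in> S" for n
    by (induction n) (auto intro: mult_mem c)
  show "coeff p i *\<^sub>R c ^ i \<in> S"
    using p pow by (cases i) (auto simp: poly_0_coeff_0 intro: scaleR_mem)
qed

lemma fcalc_mem:
  assumes c: "c \<in> S" "star c = c" and f: "continuous_on UNIV f" "f 0 = 0"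
  shows "fcalc f c \<in> S"
proof (rule closed_sequentially[OF closed_S _ tendsto_poly_approx[OF c(2) f(1)]])
  show "peval (poly_approx f k) c \<in> S" for k
    using peval_mem[OF c(1)] poly_approx_0[OF f(1)] f(2) by simp
qed

lemma absorber_mem: "e \<in> S \<Longrightarrow> star e = e \<Longrightarrow> 0 < \<eta> \<Longrightarrow> absorber \<eta> e \<in> S"
  unfolding absorber_def by (rule fcalc_mem) (auto simp: continuous_absorber)

lemma positive_sqrt_mem:
  assumes a: "positive_elem a" "a \<in> S"
  obtains d where "d \<in> S" "star d = d" "d * d = a"
proof -
  note sa = positive_elem_star[OF a(1)]
  let ?f = "\<lambda>t. sqrt (max t 0)"
  have f: "continuous_on UNIV ?f" by (intro continuous_intros)
  have "fcalc ?f a * fcalc ?f a = fcalc (\<lambda>t. ?f t * ?f t) a"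
    by (rule fcalc_mult[OF sa f f, symmetric])
  also have "\<dots> = fcalc (\<lambda>t. t) a"
    by (rule fcalc_positive_cong[OF a(1)]) (auto intro!: continuous_intros)
  finally have "fcalc ?f a * fcalc ?f a = a"
    by (simp add: fcalc_id[OF sa])
  then show ?thesis
    using that[of "fcalc ?f a"] fcalc_mem[OF a(2) sa f] star_fcalc[OF sa f] by simp
qed

text \<open>The sum of all \<open>g * star g\<close> dominates each summand, so one absorber of it
  almost fixes every \<open>g\<close> from the left. The parameter \<open>\<delta>\<^sup>2\<close>
  compensates the square in \<open>norm_absorber_diff\<close>.\<close>

lemma approximate_unit:
  assumes "finite G" "G \<subseteq> S" "0 < \<delta>"
  obtains y where "y \<in> S" "positive_elem y" "norm y \<le> 1" "\<And>g. g \<in> G \<Longrightarrow> norm (g - y * g) \<le> \<delta>"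
proof -
  define e where "e = (\<Sum>g\<in>G. g * star g)"
  have pos: "positive_elem (g * star g)" for g :: 'a
    using positive_elem_star_mult[of "star g"] by simp
  have e: "positive_elem e" "e \<in> S"
    using assms by (auto simp: e_def intro!: positive_elem_sum pos sum_mem mult_mem star_mem)
  note se = positive_elem_star[OF e(1)]
  have \<eta>: "0 < \<delta>\<^sup>2" using assms by simp
  show ?thesis
  proof (rule that[of "absorber (\<delta>\<^sup>2) e"])
    show "absorber (\<delta>\<^sup>2) e \<in> S" "positive_elem (absorber (\<delta>\<^sup>2) e)" "norm (absorber (\<delta>\<^sup>2) e) \<le> 1"
      using absorber_mem[OF e(2) se \<eta>] positive_elem_absorber[OF \<eta> se] norm_absorber_le[OF \<eta> se] by auto
    fix g assume g: "g \<in> G"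
    have "e - g * star g = (\<Sum>g\<in>G - {g}. g * star g)"
      unfolding e_def using assms(1) g by (simp add: sum.remove)
    also have "positive_elem \<dots>"
      by (intro positive_elem_sum pos)
    finally have "(norm (g - absorber (\<delta>\<^sup>2) e * g))\<^sup>2 \<le> \<delta>\<^sup>2"
      by (intro norm_absorber_diff e \<eta>)
    then show "norm (g - absorber (\<delta>\<^sup>2) e * g) \<le> \<delta>"
      by (rule power2_le_imp_le) (use assms in simp)
  qed
qed

text \<open>With \<open>F (t)\<^sup>2 (t - \<eta>) = max (t - \<epsilon>) 0\<close> one gets \<open>max (c - \<epsilon>) 0 \<le> F c * b * F c\<close>.\<close>

lemma cut_down_cuntz_below:
  assumes c: "c \<in> S" "star c = c" and b: "b \<in> S" "positive_elem b"
    and less: "norm (c - b) < \<epsilon>"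
  obtains v where "\<And>k. v k \<in> S" "(\<lambda>k. v k * b * star (v k)) \<longlonglongrightarrow> fcalc (\<lambda>t. max (t - \<epsilon>) 0) c"
proof -
  define \<eta> where "\<eta> = norm (c - b)"
  have \<epsilon>: "0 \<le> \<eta>" "\<eta> < \<epsilon>" "0 < \<epsilon>"
    using less norm_ge_zero[of "c - b"] by (auto simp: \<eta>_def simp del: norm_ge_zero)
  note sb = positive_elem_star[OF b(2)]
  \<comment> \<open>\<open>?z\<close> is the root of the cut-down. In \<open>?F\<close> the lower
    bound \<open>\<epsilon> - \<eta>\<close> in the denominator ensures continuity and changes
    nothing where the numerator is nonzero.\<close>
  let ?z = "\<lambda>t. sqrt (max (t - \<epsilon>) 0)"
  let ?F = "\<lambda>t. sqrt (max (t - \<epsilon>) 0 / max (t - \<eta>) (\<epsilon> - \<eta>))"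
  have contz: "continuous_on UNIV ?z" by (intro continuous_intros)
  have contF: "continuous_on UNIV ?F"
    using \<epsilon> by (intro continuous_intros) (auto simp: max_def)
  define z where "z = fcalc ?z c"
  define F where "F = fcalc ?F c"
  have sz: "star z = z" and sF: "star F = F"
    unfolding z_def F_def by (rule star_fcalc[OF c(2)], fact)+
  have zS: "z \<in> S" and FS: "F \<in> S"
    unfolding z_def F_def using \<epsilon> by (auto intro!: fcalc_mem c contz contF)
  have zz: "z * z = fcalc (\<lambda>t. max (t - \<epsilon>) 0) c"
    unfolding z_def by (simp add: contz flip: fcalc_mult[OF c(2)])
  have "F * (c - of_real \<eta>) * F = fcalc (\<lambda>t. ?F t * (t - \<eta>) * ?F t) c"
    by (simp add: F_def fcalc_mult[OF c(2)] fcalc_diff[OF c(2)] contF continuous_intros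
        fcalc_id[OF c(2)] fcalc_const[OF c(2)])
  also have "(\<lambda>t. ?F t * (t - \<eta>) * ?F t) = (\<lambda>t. max (t - \<epsilon>) 0)"
  proof
    fix t
    have "?F t * (t - \<eta>) * ?F t = (?F t * ?F t) * (t - \<eta>)" by (simp only: ac_simps)
    also have "?F t * ?F t = max (t - \<epsilon>) 0 / max (t - \<eta>) (\<epsilon> - \<eta>)"
      using \<epsilon> by (simp add: max_def)
    also have "\<dots> * (t - \<eta>) = max (t - \<epsilon>) 0"
      using \<epsilon> by (auto simp: max_def)
    finally show "?F t * (t - \<eta>) * ?F t = max (t - \<epsilon>) 0" .
  qed
  finally have FcF: "F * (c - of_real \<eta>) * F = z * z" using zz by simp
  define e where "e = F * b * F"
  have e: "positive_elem e" "e \<in> S"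
    using positive_elem_conj[OF b(2), of F] by (auto simp: e_def sF intro!: mult_mem FS b)
  note se = positive_elem_star[OF e(1)]
  \<comment> \<open>That is, \<open>b\<close> dominates \<open>c - of_real \<eta>\<close>;
    conjugation by \<open>F\<close> turns this into the domination of \<open>z * z\<close> by
    \<open>e = F * b * F\<close>.\<close>
  have "positive_elem (of_real \<eta> - (c - b))"
    by (rule positive_elem_norm_diff) (simp_all add: \<eta>_def star_diff c sb)
  from positive_elem_conj[OF this, of F] have "positive_elem (e - z * star z)"
    by (simp add: sF sz e_def algebra_simps flip: FcF)
  note absorb = norm_absorber_diff[OF e(1) this]
  define g where "g k = 1 / real (Suc k)" for k
  have g: "0 < g k" for k by (simp add: g_def)
  define y where "y k = absorber (g k) e" for k
  have yz: "(\<lambda>k. y k * z) \<longlonglongrightarrow> z"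
  proof (rule LIM_zero_cancel, rule Lim_null_comparison)
    show "\<forall>\<^sub>F k in sequentially. norm (y k * z - z) \<le> sqrt (g k)"
      using absorb[OF g] by (auto simp: y_def norm_minus_commute intro!: always_eventually real_le_rsqrt)
    have "g \<longlonglongrightarrow> 0"
      unfolding g_def using LIMSEQ_inverse_real_of_nat by (simp add: inverse_eq_divide)
    from tendsto_real_sqrt[OF this] show "(\<lambda>k. sqrt (g k)) \<longlonglongrightarrow> 0" by simp
  qed
  \<comment> \<open>A regularised inverse square root of \<open>e\<close>:
    \<open>r k * e * r k\<close> is the square of the absorber, which almost fixes \<open>z\<close>.
    Hence \<open>z * r k\<close> carries \<open>e\<close> approximately to
    \<open>z * z\<close>.\<close>
  let ?r = "\<lambda>\<eta> t. sqrt (max t 0) / max t \<eta>"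
  have contr: "continuous_on UNIV (?r (g k))" for k
    using g[of k] by (intro continuous_intros) (auto simp: max_def)
  define r where "r k = fcalc (?r (g k)) e" for k
  have r: "star (r k) = r k" "r k \<in> S" for k
    unfolding r_def by (auto intro!: star_fcalc fcalc_mem se e contr)
  have rer: "r k * e * r k = y k * y k" for k
  proof -
    have "fcalc (\<lambda>t. ?r (g k) t * t * ?r (g k) t) e = fcalc (\<lambda>t. ?r (g k) t * t) e * r k"
      unfolding r_def by (rule fcalc_mult[OF se]) (intro continuous_on_mult continuous_on_id contr)+
    also have "fcalc (\<lambda>t. ?r (g k) t * t) e = r k * fcalc (\<lambda>t. t) e"
      unfolding r_def by (rule fcalc_mult[OF se]) (intro continuous_on_id contr)+
    finally have "r k * e * r k = fcalc (\<lambda>t. ?r (g k) t * t * ?r (g k) t) e"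
      by (simp only: fcalc_id[OF se])
    also have "\<dots> = fcalc (\<lambda>t. (max t 0 / max t (g k)) * (max t 0 / max t (g k))) e"
    proof (rule fcalc_positive_cong[OF e(1)])
      fix t :: real assume "0 \<le> t"
      then show "?r (g k) t * t * ?r (g k) t = (max t 0 / max t (g k)) * (max t 0 / max t (g k))"
        by (simp add: mult.commute mult.left_commute)
    qed (intro continuous_intros contr continuous_absorber g)+
    also have "\<dots> = y k * y k"
      unfolding y_def absorber_def by (rule fcalc_mult[OF se continuous_absorber[OF g] continuous_absorber[OF g]])
    finally show ?thesis .
  qed
  have sy: "star (y k) = y k" for k
    unfolding y_def by (rule positive_elem_star[OF positive_elem_absorber[OF g se]])
  show ?thesis
  proof (rule that[of "\<lambda>k. z * r k * F"])
    show "z * r k * F \<in> S" for k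
      by (intro mult_mem zS FS r)
    have "(z * r k * F) * b * star (z * r k * F) = star (y k * z) * (y k * z)" for k
    proof -
      have "(z * r k * F) * b * star (z * r k * F) = z * (r k * e * r k) * z"
        by (simp add: star_mult sz sF r e_def mult.assoc)
      also have "\<dots> = z * (y k * y k) * z"
        by (simp only: rer)
      also have "\<dots> = star (y k * z) * (y k * z)"
        by (simp add: star_mult sz sy mult.assoc)
      finally show ?thesis .
    qed
    moreover have "(\<lambda>k. star (y k * z) * (y k * z)) \<longlonglongrightarrow> star z * z"
      by (intro tendsto_mult yz bounded_linear.tendsto[OF bounded_linear_star])
    ultimately show "(\<lambda>k. (z * r k * F) * b * star (z * r k * F)) \<longlonglongrightarrow> fcalc (\<lambda>t. max (t - \<epsilon>) 0) c"
      by (simp add: sz zz)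
  qed
qed

end

section \<open>Unitization\<close>

text \<open>Without a unit no element can represent the imaginary unit, so multiplication by it is
  an operation of its own.\<close>

class cstar_nonunital = real_normed_algebra + banach +
  fixes nstar :: "'a \<Rightarrow> 'a" and times_i :: "'a \<Rightarrow> 'a"
  assumes nstar_nstar: "nstar (nstar x) = x"
    and nstar_add: "nstar (x + y) = nstar x + nstar y"
    and nstar_scaleR: "nstar (r *\<^sub>R x) = r *\<^sub>R nstar x"
    and nstar_mult: "nstar (x * y) = nstar y * nstar x"
    and times_i_times_i: "times_i (times_i x) = - x"
    and times_i_add: "times_i (x + y) = times_i x + times_i y"
    and times_i_scaleR: "times_i (r *\<^sub>R x) = r *\<^sub>R times_i x"
    and times_i_mult_left: "times_i x * y = times_i (x * y)"
    and times_i_mult_right: "x * times_i y = times_i (x * y)"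
    and nstar_times_i: "nstar (times_i x) = - times_i (nstar x)"
    and norm_nstar_mult: "norm (nstar x * x) = (norm x)\<^sup>2"

lemma norm_nstar: "norm (nstar x) = norm (x :: 'a::cstar_nonunital)"
proof -
  have "norm x \<le> norm (nstar x)" for x :: 'a
  proof (cases "norm x = 0")
    case False
    have "norm x * norm x \<le> norm (nstar x) * norm x"
      using norm_nstar_mult[of x] norm_mult_ineq[of "nstar x" x] by (simp add: power2_eq_square)
    then show ?thesis
      using False by (simp add: mult_le_cancel_right)
  qed (metis norm_ge_zero)
  from this[of x] this[of "nstar x"] show ?thesis by (simp add: nstar_nstar)
qed

lemma times_i_0: "times_i 0 = (0 :: 'a::cstar_nonunital)"
  using times_i_scaleR[of 0 0] by simp

lemma times_i_uminus: "times_i (- x) = - times_i (x :: 'a::cstar_nonunital)"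
  using times_i_scaleR[of "-1" x] by simp

lemma times_i_diff: "times_i (x - y) = times_i x - times_i (y :: 'a::cstar_nonunital)"
  using times_i_add[of x "- y"] by (simp add: times_i_uminus)

lemma norm_times_i: "norm (times_i x) = norm (x :: 'a::cstar_nonunital)"
proof -
  have "(norm (times_i x))\<^sup>2 = (norm x)\<^sup>2"
    by (simp flip: norm_nstar_mult)
      (simp add: nstar_times_i times_i_mult_left times_i_mult_right times_i_times_i times_i_uminus)
  then show ?thesis by simp
qed

lemma bounded_linear_times_i: "bounded_linear (times_i :: 'a::cstar_nonunital \<Rightarrow> 'a)"
  by (rule bounded_linear_intro[where K = 1]) (simp_all add: times_i_add times_i_scaleR norm_times_i)

datatype 'a unitization = Unitization (uscalar: complex) (uelem: 'a)

text \<open>The left action of a formal sum of a scalar and an element on the algebra. The scalar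
  enters through its real and imaginary parts, as the class offers only real scalars and
  \<open>times_i\<close>.\<close>

definition lact :: "'a::cstar_nonunital unitization \<Rightarrow> 'a \<Rightarrow> 'a" where
  "lact T y = Re (uscalar T) *\<^sub>R y + Im (uscalar T) *\<^sub>R times_i y + uelem T * y"

lemma bounded_linear_lact: "bounded_linear (lact T)"
  unfolding lact_def
  by (intro bounded_linear_add bounded_linear_scaleR_right bounded_linear_mult_right
      bounded_linear_compose[OF bounded_linear_scaleR_right bounded_linear_times_i])

instantiation unitization :: (cstar_nonunital) real_normed_algebra_1
begin

definition "0 = Unitization 0 0"
definition "1 = Unitization 1 0"
definition "S + T = Unitization (uscalar S + uscalar T) (uelem S + uelem T)"
definition "- T = Unitization (- uscalar T) (- uelem T)"
definition "S - T = Unitization (uscalar S - uscalar T) (uelem S - uelem T)"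
definition "S * T = Unitization (uscalar S * uscalar T) (lact S (uelem T) +
  (Re (uscalar T) *\<^sub>R uelem S + Im (uscalar T) *\<^sub>R times_i (uelem S)))"
definition "r *\<^sub>R T = Unitization (r *\<^sub>R uscalar T) (r *\<^sub>R uelem T)"
text \<open>The operator norm of the left action alone is degenerate if the algebra already has a
  unit, because the new unit minus the old one acts as zero. The maximum with the modulus of the
  scalar part is definite in every case, and it satisfies the C*-identity because both of its parts
  do.\<close>

definition "norm T = max (cmod (uscalar T)) (onorm (lact T))"
definition "dist S T = norm (S - T :: 'a unitization)"
definition "sgn T = inverse (norm T) *\<^sub>R (T :: 'a unitization)"
definition "uniformity = (INF e\<in>{0<..}. principal {(S, T :: 'a unitization). dist S T < e})"
definition "open U \<longleftrightarrow> (\<forall>S\<in>U. \<forall>\<^sub>F (S', T) in uniformity. S' = S \<longrightarrow> (T :: 'a unitization) \<in> U)"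

lemma lact_add: "lact (S + T) y = lact S y + lact T y"
  by (simp add: lact_def plus_unitization_def algebra_simps)

lemma lact_scaleR: "lact (r *\<^sub>R T) y = r *\<^sub>R lact T y"
  by (simp add: lact_def scaleR_unitization_def algebra_simps)

lemma lact_mult: "lact (S * T) y = lact S (lact T y)"
  by (simp add: lact_def times_unitization_def algebra_simps times_i_add times_i_scaleR
      times_i_times_i times_i_mult_left times_i_mult_right)

lemma norm_lact_le: "norm (lact T y) \<le> norm T * norm y"
  using onorm[OF bounded_linear_lact, of T y]
  by (rule order_trans) (simp add: norm_unitization_def mult_right_mono)

lemma norm_unitization_le:
  assumes "cmod (uscalar T) \<le> B" "\<And>y. norm (lact T y) \<le> B * norm y"
  shows "norm T \<le> B"
  using assms by (auto simp: norm_unitization_def intro!: onorm_bound order_trans[OF norm_ge_zero])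

lemma cmod_uscalar_le: "cmod (uscalar T) \<le> norm T"
  by (simp add: norm_unitization_def)

text \<open>Acting on \<open>nstar (uelem T)\<close>, the element recovers the square of its norm;
  its action differs from that of \<open>T\<close> by a scalar, and both are bounded by
  \<open>norm T\<close>. Definiteness and completeness of the norm on the unitization depend on this
  bound.\<close>

lemma norm_uelem_le: "norm (uelem T) \<le> 2 * norm T"
proof -
  let ?x = "uelem T"
  have "norm (?x * y) \<le> 2 * norm T * norm y" for y
  proof -
    have "norm (Re (uscalar T) *\<^sub>R y + Im (uscalar T) *\<^sub>R times_i y) \<le> cmod (uscalar T) * norm y"
    proof -
      let ?z = "Re (uscalar T) *\<^sub>R y + Im (uscalar T) *\<^sub>R times_i y"
      have "nstar ?z * ?z = ((Re (uscalar T))\<^sup>2 + (Im (uscalar T))\<^sup>2) *\<^sub>R (nstar y * y)"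
        by (simp add: nstar_add nstar_scaleR nstar_times_i algebra_simps times_i_mult_left
            times_i_mult_right times_i_times_i times_i_add times_i_diff times_i_scaleR power2_eq_square)
      then have "(norm ?z)\<^sup>2 = (cmod (uscalar T) * norm y)\<^sup>2"
        using norm_nstar_mult[of ?z] norm_nstar_mult[of y]
        by (simp add: cmod_power2 power_mult_distrib)
      then show ?thesis
        by (simp add: power2_eq_iff_nonneg)
    qed
    also have "\<dots> \<le> norm T * norm y"
      by (intro mult_right_mono cmod_uscalar_le norm_ge_zero)
    finally have 1: "norm (Re (uscalar T) *\<^sub>R y + Im (uscalar T) *\<^sub>R times_i y) \<le> norm T * norm y" .
    have "?x * y = lact T y - (Re (uscalar T) *\<^sub>R y + Im (uscalar T) *\<^sub>R times_i y)"
      by (simp add: lact_def)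
    then have "norm (?x * y) \<le> norm (lact T y) + norm (Re (uscalar T) *\<^sub>R y + Im (uscalar T) *\<^sub>R times_i y)"
      by (metis norm_triangle_ineq4)
    then show ?thesis
      using 1 norm_lact_le[of T y] by simp
  qed
  from this[of "nstar ?x"] have "norm ?x * norm ?x \<le> 2 * norm T * norm ?x"
    using norm_nstar_mult[of "nstar ?x"] by (simp add: nstar_nstar norm_nstar power2_eq_square)
  moreover have "0 \<le> norm T"
    using cmod_uscalar_le[of T] norm_ge_zero order_trans by blast
  ultimately show ?thesis
    by (cases "?x = 0") (auto simp: mult_le_cancel_right)
qed

instance
proof
  fix S T U :: "'a unitization" and r s :: real
  show "S + T + U = S + (T + U)" "S + T = T + S" "0 + S = S" "- S + S = 0" "S - T = S + - T"
    by (simp_all add: plus_unitization_def zero_unitization_def uminus_unitization_def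
        minus_unitization_def ac_simps)
  show "S * T * U = S * (T * U)"
    by (simp add: times_unitization_def lact_def algebra_simps times_i_add times_i_scaleR
      times_i_times_i times_i_mult_left times_i_mult_right)
  show "(S + T) * U = S * U + T * U" "S * (T + U) = S * T + S * U"
    by (simp_all add: times_unitization_def plus_unitization_def lact_def algebra_simps times_i_add)
  show "1 * S = S" "S * 1 = S"
    by (simp_all add: times_unitization_def one_unitization_def lact_def times_i_0)
  show "(0 :: 'a unitization) \<noteq> 1"
    by (simp add: zero_unitization_def one_unitization_def)
  show "r *\<^sub>R (S + T) = r *\<^sub>R S + r *\<^sub>R T" "(r + s) *\<^sub>R S = r *\<^sub>R S + s *\<^sub>R S"
    "r *\<^sub>R s *\<^sub>R S = (r * s) *\<^sub>R S" "1 *\<^sub>R S = S"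
    by (simp_all add: scaleR_unitization_def plus_unitization_def algebra_simps)
  show "r *\<^sub>R S * T = r *\<^sub>R (S * T)" "S * r *\<^sub>R T = r *\<^sub>R (S * T)"
    by (simp_all add: scaleR_unitization_def times_unitization_def lact_def algebra_simps times_i_scaleR)
  show "dist S T = norm (S - T)" "sgn S = inverse (norm S) *\<^sub>R S"
    by (simp_all add: dist_unitization_def sgn_unitization_def)
  show "uniformity = (INF e\<in>{0<..}. principal {(S, T :: 'a unitization). dist S T < e})"
    by (rule uniformity_unitization_def)
  show "open U \<longleftrightarrow> (\<forall>S\<in>U. \<forall>\<^sub>F (S', T) in uniformity. S' = S \<longrightarrow> (T :: 'a unitization) \<in> U)" for U
    by (rule open_unitization_def)
  have ge0: "0 \<le> norm T" for T :: "'a unitization"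
    using cmod_uscalar_le[of T] norm_ge_zero order_trans by blast
  have n0: "norm (0 :: 'a unitization) = 0"
    by (simp add: norm_unitization_def zero_unitization_def lact_def[abs_def] onorm_zero)
  show "norm S = 0 \<longleftrightarrow> S = 0"
    using cmod_uscalar_le[of S] norm_uelem_le[of S] n0
    by (auto simp: zero_unitization_def intro: unitization.expand)
  show "norm (S + T) \<le> norm S + norm T"
  proof (rule norm_unitization_le)
    show "cmod (uscalar (S + T)) \<le> norm S + norm T"
      using norm_triangle_mono[OF cmod_uscalar_le cmod_uscalar_le] by (simp add: plus_unitization_def)
    show "norm (lact (S + T) y) \<le> (norm S + norm T) * norm y" for y
      using norm_triangle_mono[OF norm_lact_le norm_lact_le] by (simp add: lact_add distrib_right)
  qed
  show "norm (r *\<^sub>R S) = \<bar>r\<bar> * norm S"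
    using onorm_scaleR[OF bounded_linear_lact, of r S]
    by (simp add: norm_unitization_def lact_scaleR[abs_def] max_mult_distrib_left)
      (simp add: scaleR_unitization_def)
  show "norm (S * T) \<le> norm S * norm T"
  proof (rule norm_unitization_le)
    show "cmod (uscalar (S * T)) \<le> norm S * norm T"
      by (simp add: times_unitization_def norm_mult mult_mono cmod_uscalar_le ge0)
    show "norm (lact (S * T) y) \<le> norm S * norm T * norm y" for y
      unfolding lact_mult using norm_lact_le[of S "lact T y"] mult_left_mono[OF norm_lact_le[of T y] ge0[of S]]
      by (simp add: mult.assoc)
  qed
  show "norm (1 :: 'a unitization) = 1"
    by (simp add: norm_unitization_def one_unitization_def lact_def[abs_def] max_absorb1 onorm_id_le)
qed

end

instance unitization :: (cstar_nonunital) banach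
proof
  fix X :: "nat \<Rightarrow> 'a unitization"
  assume X: "Cauchy X"
  have "Cauchy (\<lambda>n. uscalar (X n))"
  proof (rule CauchyI)
    fix e :: real assume "0 < e"
    with X obtain M where M: "\<forall>m\<ge>M. \<forall>n\<ge>M. norm (X m - X n) < e"
      using CauchyD by blast
    then show "\<exists>M. \<forall>m\<ge>M. \<forall>n\<ge>M. norm (uscalar (X m) - uscalar (X n)) < e"
      using cmod_uscalar_le[of "X m - X n" for m n]
      by (metis le_less_trans minus_unitization_def unitization.sel(1))
  qed
  then obtain l where l: "(\<lambda>n. uscalar (X n)) \<longlonglongrightarrow> l"
    using Cauchy_convergent convergent_def by blast
  have "Cauchy (\<lambda>n. uelem (X n))"
  proof (rule CauchyI)
    fix e :: real assume "0 < e"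
    then have "0 < e / 2" by simp
    with X obtain M where M: "\<forall>m\<ge>M. \<forall>n\<ge>M. norm (X m - X n) < e / 2"
      using CauchyD by blast
    show "\<exists>M. \<forall>m\<ge>M. \<forall>n\<ge>M. norm (uelem (X m) - uelem (X n)) < e"
    proof (intro exI[of _ M] allI impI)
      fix m n assume "M \<le> m" "M \<le> n"
      then have "norm (X m - X n) < e / 2" using M by blast
      then show "norm (uelem (X m) - uelem (X n)) < e"
        using norm_uelem_le[of "X m - X n"] by (simp add: minus_unitization_def)
    qed
  qed
  then obtain x where x: "(\<lambda>n. uelem (X n)) \<longlonglongrightarrow> x"
    using Cauchy_convergent convergent_def by blast
  let ?L = "Unitization l x"
  have "norm (X n - ?L) \<le> 2 * cmod (uscalar (X n) - l) + norm (uelem (X n) - x)" for n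
  proof (rule norm_unitization_le)
    let ?D = "X n - ?L"
    have D: "uscalar ?D = uscalar (X n) - l" "uelem ?D = uelem (X n) - x"
      by (simp_all add: minus_unitization_def)
    show "cmod (uscalar ?D) \<le> 2 * cmod (uscalar (X n) - l) + norm (uelem (X n) - x)"
      by (simp add: D)
    fix y
    have "norm (lact ?D y) \<le> \<bar>Re (uscalar ?D)\<bar> * norm y + \<bar>Im (uscalar ?D)\<bar> * norm y + norm (uelem ?D) * norm y"
      unfolding lact_def
      by (intro norm_triangle_mono norm_mult_ineq) (simp_all add: norm_times_i)
    also have "\<dots> \<le> (2 * cmod (uscalar (X n) - l) + norm (uelem (X n) - x)) * norm y"
      using abs_Re_le_cmod[of "uscalar ?D"] abs_Im_le_cmod[of "uscalar ?D"]
      unfolding D[symmetric] distrib_right[symmetric] by (intro mult_right_mono) auto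
    finally show "norm (lact ?D y) \<le> (2 * cmod (uscalar (X n) - l) + norm (uelem (X n) - x)) * norm y" .
  qed
  moreover have "(\<lambda>n. 2 * cmod (uscalar (X n) - l) + norm (uelem (X n) - x)) \<longlonglongrightarrow> 2 * 0 + 0"
    by (intro tendsto_intros tendsto_norm_zero LIM_zero l x)
  ultimately have "(\<lambda>n. X n - ?L) \<longlonglongrightarrow> 0"
    by (intro Lim_null_comparison[of "\<lambda>n. X n - ?L"]) (auto intro: always_eventually)
  then show "convergent X"
    unfolding convergent_def using LIM_zero_cancel by blast
qed

instantiation unitization :: (cstar_nonunital) cstar_unital
begin

definition "star T = Unitization (cnj (uscalar T)) (nstar (uelem T))"
definition "imag_unit = Unitization \<i> 0"

instance
proof
  fix S T :: "'a unitization" and r :: real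
  show ss: "star (star S) = S" for S :: "'a unitization"
    by (simp add: star_unitization_def nstar_nstar)
  show "star (S + T) = star S + star T"
    by (simp add: star_unitization_def plus_unitization_def nstar_add)
  show "star (r *\<^sub>R S) = r *\<^sub>R star S"
    by (simp add: star_unitization_def scaleR_unitization_def nstar_scaleR)
  show star_mult: "star (S * T) = star T * star S" for S T :: "'a unitization"
    by (simp add: star_unitization_def times_unitization_def lact_def nstar_add nstar_mult
        nstar_scaleR nstar_times_i algebra_simps)
  show "imag_unit * imag_unit = (- 1 :: 'a unitization)"
    by (simp add: imag_unit_unitization_def times_unitization_def lact_def uminus_unitization_def
        one_unitization_def times_i_0)
  show "imag_unit * S = S * imag_unit"
    by (simp add: imag_unit_unitization_def times_unitization_def lact_def)
  show "star imag_unit = (- imag_unit :: 'a unitization)"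
    using nstar_scaleR[of 0 "0 :: 'a"]
    by (simp add: imag_unit_unitization_def star_unitization_def uminus_unitization_def)
  \<comment> \<open>The action is adjointable for the algebra-valued inner product
    \<open>nstar y * z\<close>. This bounds \<open>norm (lact S y)\<close> in terms of the norm of
    \<open>star S * S\<close>, as for operators on a Hilbert space.\<close>
  have inner: "nstar (lact S y) * lact S y = nstar y * lact (star S * S) y" for S :: "'a unitization" and y
    unfolding lact_mult
    by (simp add: star_unitization_def lact_def nstar_add nstar_mult nstar_scaleR nstar_times_i
        algebra_simps times_i_mult_left times_i_mult_right times_i_add times_i_diff times_i_scaleR)
  have le: "(norm S)\<^sup>2 \<le> norm (star S * S)" for S :: "'a unitization"
  proof -
    have "(norm (lact S y))\<^sup>2 \<le> norm (star S * S) * (norm y)\<^sup>2" for y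
    proof -
      have "(norm (lact S y))\<^sup>2 = norm (nstar y * lact (star S * S) y)"
        by (simp flip: norm_nstar_mult inner)
      also have "\<dots> \<le> norm y * norm (lact (star S * S) y)"
        by (metis norm_mult_ineq norm_nstar)
      also have "\<dots> \<le> norm y * (norm (star S * S) * norm y)"
        by (intro mult_left_mono norm_lact_le norm_ge_zero)
      finally show ?thesis by (simp add: power2_eq_square ac_simps)
    qed
    then have "norm (lact S y) \<le> sqrt (norm (star S * S)) * norm y" for y
      using real_le_rsqrt[of "norm (lact S y)" "norm (star S * S) * (norm y)\<^sup>2"]
      by (simp add: real_sqrt_mult)
    moreover have "cmod (uscalar S) \<le> sqrt (norm (star S * S))"
    proof (rule real_le_rsqrt)
      have "(cmod (uscalar S))\<^sup>2 = cmod (uscalar (star S * S))"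
        by (simp add: star_unitization_def times_unitization_def norm_mult power2_eq_square)
      then show "(cmod (uscalar S))\<^sup>2 \<le> norm (star S * S)"
        using cmod_uscalar_le by simp
    qed
    ultimately have "norm S \<le> sqrt (norm (star S * S))"
      by (intro norm_unitization_le)
    then have "(norm S)\<^sup>2 \<le> (sqrt (norm (star S * S)))\<^sup>2"
      by (intro power_mono) auto
    then show ?thesis by simp
  qed
  have "norm S \<le> norm (star S)" for S :: "'a unitization"
  proof (cases "norm S = 0")
    case False
    have "norm S * norm S \<le> norm (star S) * norm S"
      using le[of S] norm_mult_ineq[of "star S" S] by (simp add: power2_eq_square)
    then show ?thesis
      using False by (simp add: mult_le_cancel_right)
  qed (metis norm_ge_zero)
  from this[of "star S"] have "norm (star S) \<le> norm S" by (simp add: ss)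
  then have "norm (star S) * norm S \<le> (norm S)\<^sup>2"
    by (simp add: power2_eq_square mult_right_mono)
  then show "norm (star S * S) = (norm S)\<^sup>2"
    using le[of S] norm_mult_ineq[of "star S" S] by simp
qed

end

lemma norm_Unitization_0: "norm (Unitization 0 x) = norm (x :: 'a::cstar_nonunital)"
proof (rule antisym)
  show "norm (Unitization 0 x) \<le> norm x"
    by (rule norm_unitization_le) (simp_all add: lact_def norm_mult_ineq)
  have "norm x * norm x \<le> norm (Unitization 0 x) * norm x"
    using norm_lact_le[of "Unitization 0 x" "nstar x"] norm_nstar_mult[of "nstar x"]
    by (simp add: lact_def nstar_nstar norm_nstar power2_eq_square)
  then show "norm x \<le> norm (Unitization 0 x)"
    by (cases "x = 0") (auto simp: mult_le_cancel_right)
qed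

section \<open>The product of all C*-algebras on a type\<close>

context cstar_algebra
begin

lemma smult_closed' [simp]: "x \<in> carrier A \<Longrightarrow> c \<odot> x \<in> carrier A"
  using smult_closed[of c x] by (simp add: complex_cstar_def)

lemma smult_add_left: "x \<in> carrier A \<Longrightarrow> (b + c) \<odot> x = b \<odot> x \<oplus> c \<odot> x"
  using smult_l_distr[of b c x] by (simp add: complex_cstar_def)

lemma smult_add_right: "x \<in> carrier A \<Longrightarrow> y \<in> carrier A \<Longrightarrow> c \<odot> (x \<oplus> y) = c \<odot> x \<oplus> c \<odot> y"
  using smult_r_distr[of c x y] by (simp add: complex_cstar_def)

lemma smult_smult: "x \<in> carrier A \<Longrightarrow> b \<odot> (c \<odot> x) = (b * c) \<odot> x"
  using smult_assoc1[of b c x] by (simp add: complex_cstar_def)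

lemma smult_1: "x \<in> carrier A \<Longrightarrow> 1 \<odot> x = x"
  using smult_one[of x] by (simp add: complex_cstar_def)

lemma smult_0: "x \<in> carrier A \<Longrightarrow> 0 \<odot> x = \<zero>"
  using smult_l_null[of x] by (simp add: complex_cstar_def)

lemma smult_minus_1: "x \<in> carrier A \<Longrightarrow> (- 1) \<odot> x = \<ominus> x"
  using smult_add_left[of x "-1" 1] minus_equality[of "(-1) \<odot> x" x]
  by (simp add: smult_1 smult_0)

lemma minus_eq_smult: "x \<in> carrier A \<Longrightarrow> y \<in> carrier A \<Longrightarrow> x \<ominus> y = x \<oplus> (- 1) \<odot> y"
  by (simp add: a_minus_def smult_minus_1)

lemma cnorm_adj: "x \<in> carrier A \<Longrightarrow> cnorm A (adj A x) = cnorm A x"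
proof -
  have "cnorm A x \<le> cnorm A (adj A x)" if x: "x \<in> carrier A" for x
  proof (cases "cnorm A x = 0")
    case False
    have "cnorm A x * cnorm A x \<le> cnorm A (adj A x) * cnorm A x"
      using cnorm_adj_mult[OF x] cnorm_mult[OF adj_closed[OF x] x] by (simp add: power2_eq_square)
    then show ?thesis
      using False cnorm_nonneg[OF x] by (simp add: mult_le_cancel_right)
  qed (simp add: cnorm_nonneg adj_closed x)
  then show "cnorm A (adj A x) = cnorm A x" if "x \<in> carrier A"
    using that adj_closed[OF that] adj_adj[OF that] by (metis order_antisym)
qed

lemma cnorm_zero: "cnorm A \<zero> = 0"
  by (simp add: cnorm_eq_zero_iff)

end

text \<open>An element of the bounded product over all C*-algebra structures on the type
  \<open>'a\<close>. The fixed value \<open>undefined\<close> at records that are not C*-algebras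
  makes equality of sections a componentwise matter.\<close>

definition bounded_section :: "('a cstar \<Rightarrow> 'a) \<Rightarrow> bool" where
  "bounded_section f \<longleftrightarrow> (\<forall>A. cstar_algebra A \<longrightarrow> f A \<in> carrier A) \<and>
     (\<forall>A. \<not> cstar_algebra A \<longrightarrow> f A = undefined) \<and>
     (\<exists>K. \<forall>A. cstar_algebra A \<longrightarrow> cnorm A (f A) \<le> K)"

typedef 'a cproduct = "{f :: 'a cstar \<Rightarrow> 'a. bounded_section f}"
  morphisms component Abs_cproduct
proof
  show "(\<lambda>A. if cstar_algebra A then \<zero>\<^bsub>A\<^esub> else undefined) \<in> {f. bounded_section f}"
    by (auto simp: bounded_section_def cstar_algebra.cnorm_zero intro!: exI[of _ 0]
        abelian_monoid.zero_closed abelian_group.axioms Module.module.axioms cstar_algebra.axioms)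
qed

definition mk_cproduct :: "('a cstar \<Rightarrow> 'a) \<Rightarrow> 'a cproduct" where
  "mk_cproduct f = Abs_cproduct (\<lambda>A. if cstar_algebra A then f A else undefined)"

lemma component_mk:
  assumes "\<And>A. cstar_algebra A \<Longrightarrow> f A \<in> carrier A"
    and "\<And>A. cstar_algebra A \<Longrightarrow> cnorm A (f A) \<le> K"
    and "cstar_algebra A"
  shows "component (mk_cproduct f) A = f A"
proof -
  have "bounded_section (\<lambda>A. if cstar_algebra A then f A else undefined)"
    using assms(1,2) by (auto simp: bounded_section_def)
  then show ?thesis
    using assms(3) by (simp add: mk_cproduct_def Abs_cproduct_inverse)
qed

lemma component_closed [simp]: "cstar_algebra A \<Longrightarrow> component x A \<in> carrier A"
  using component[of x] by (auto simp: bounded_section_def)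

lemma component_bounded: "\<exists>K. \<forall>A. cstar_algebra A \<longrightarrow> cnorm A (component x A) \<le> K"
  using component[of x] by (auto simp: bounded_section_def)

lemma cproduct_eqI:
  assumes "\<And>A. cstar_algebra A \<Longrightarrow> component x A = component y A"
  shows "x = y"
proof -
  have "component x A = component y A" for A
    using component[of x] component[of y] assms
    by (cases "cstar_algebra A") (auto simp: bounded_section_def)
  then show ?thesis
    using component_inject by blast
qed

instantiation cproduct :: (type) real_normed_algebra
begin

definition "0 = mk_cproduct (\<lambda>A. \<zero>\<^bsub>A\<^esub>)"
definition "x + y = mk_cproduct (\<lambda>A. component x A \<oplus>\<^bsub>A\<^esub> component y A)"
definition "x * y = mk_cproduct (\<lambda>A. component x A \<otimes>\<^bsub>A\<^esub> component y A)"
definition "r *\<^sub>R x = mk_cproduct (\<lambda>A. complex_of_real r \<odot>\<^bsub>A\<^esub> component x A)"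
definition "- x = (- 1) *\<^sub>R (x :: 'a cproduct)"
definition "x - y = x + (- 1) *\<^sub>R (y :: 'a cproduct)"
text \<open>Inserting 0 makes the set nonempty and the supremum nonnegative without looking at the
  algebras that exist on the type.\<close>

definition "norm x = Sup (insert 0 {cnorm A (component x A) |A. cstar_algebra A})"
definition "dist x y = norm (x - y :: 'a cproduct)"
definition "sgn x = inverse (norm x) *\<^sub>R (x :: 'a cproduct)"
definition "uniformity = (INF e\<in>{0<..}. principal {(x, y :: 'a cproduct). dist x y < e})"
definition "open U \<longleftrightarrow> (\<forall>x\<in>U. \<forall>\<^sub>F (x', y) in uniformity. x' = x \<longrightarrow> (y :: 'a cproduct) \<in> U)"

lemma component_norm_le: "cstar_algebra A \<Longrightarrow> cnorm A (component x A) \<le> norm x"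
proof -
  obtain K where K: "\<And>A. cstar_algebra A \<Longrightarrow> cnorm A (component x A) \<le> K"
    using component_bounded by blast
  then have "bdd_above (insert 0 {cnorm A (component x A) |A. cstar_algebra A})"
    by (intro bdd_aboveI[of _ "max K 0"]) (auto intro: order_trans[OF K])
  then show "cstar_algebra A \<Longrightarrow> cnorm A (component x A) \<le> norm x"
    unfolding norm_cproduct_def by (intro cSup_upper) auto
qed

lemma norm_cproduct_nonneg: "0 \<le> norm (x :: 'a cproduct)"
proof -
  obtain K where K: "\<And>A. cstar_algebra A \<Longrightarrow> cnorm A (component x A) \<le> K"
    using component_bounded by blast
  then have "bdd_above (insert 0 {cnorm A (component x A) |A. cstar_algebra A})"
    by (intro bdd_aboveI[of _ "max K 0"]) (auto intro: order_trans[OF K])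
  then show ?thesis
    unfolding norm_cproduct_def by (intro cSup_upper) auto
qed

lemma norm_cproduct_le:
  assumes "0 \<le> K" "\<And>A. cstar_algebra A \<Longrightarrow> cnorm A (component x A) \<le> K"
  shows "norm x \<le> K"
  unfolding norm_cproduct_def by (rule cSup_least) (use assms in auto)

lemma component_0: "cstar_algebra A \<Longrightarrow> component 0 A = \<zero>\<^bsub>A\<^esub>"
  unfolding zero_cproduct_def
proof (rule component_mk[where K = 0])
  fix A :: "'a cstar" assume "cstar_algebra A"
  then interpret cstar_algebra A .
  show "\<zero>\<^bsub>A\<^esub> \<in> carrier A" "cnorm A \<zero>\<^bsub>A\<^esub> \<le> 0" by (simp_all add: cnorm_zero)
qed

lemma component_add: "cstar_algebra A \<Longrightarrow> component (x + y) A = component x A \<oplus>\<^bsub>A\<^esub> component y A"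
  unfolding plus_cproduct_def
proof (rule component_mk[where K = "norm x + norm y"])
  fix A :: "'a cstar" assume A: "cstar_algebra A"
  then interpret cstar_algebra A .
  show "component x A \<oplus>\<^bsub>A\<^esub> component y A \<in> carrier A" by (simp add: A)
  show "cnorm A (component x A \<oplus>\<^bsub>A\<^esub> component y A) \<le> norm x + norm y"
    using cnorm_triangle[of "component x A" "component y A"] component_norm_le[OF A, of x]
      component_norm_le[OF A, of y] by (simp add: A)
qed

lemma component_mult: "cstar_algebra A \<Longrightarrow> component (x * y) A = component x A \<otimes>\<^bsub>A\<^esub> component y A"
  unfolding times_cproduct_def
proof (rule component_mk[where K = "norm x * norm y"])
  fix A :: "'a cstar" assume A: "cstar_algebra A"
  then interpret cstar_algebra A .
  show "component x A \<otimes>\<^bsub>A\<^esub> component y A \<in> carrier A" by (simp add: A mult_closed)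
  have "cnorm A (component x A \<otimes>\<^bsub>A\<^esub> component y A) \<le> cnorm A (component x A) * cnorm A (component y A)"
    by (simp add: A cnorm_mult)
  also have "\<dots> \<le> norm x * norm y"
    by (intro mult_mono component_norm_le A norm_cproduct_nonneg cnorm_nonneg component_closed)
  finally show "cnorm A (component x A \<otimes>\<^bsub>A\<^esub> component y A) \<le> norm x * norm y" .
qed

lemma component_scaleR: "cstar_algebra A \<Longrightarrow> component (r *\<^sub>R x) A = complex_of_real r \<odot>\<^bsub>A\<^esub> component x A"
  unfolding scaleR_cproduct_def
proof (rule component_mk[where K = "\<bar>r\<bar> * norm x"])
  fix A :: "'a cstar" assume A: "cstar_algebra A"
  then interpret cstar_algebra A .
  show "complex_of_real r \<odot>\<^bsub>A\<^esub> component x A \<in> carrier A" by (simp add: A)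
  show "cnorm A (complex_of_real r \<odot>\<^bsub>A\<^esub> component x A) \<le> \<bar>r\<bar> * norm x"
    by (simp add: A cnorm_smult mult_left_mono component_norm_le)
qed

instance
proof
  fix x y z :: "'a cproduct" and r s :: real
  have eqI: "u = v" if "\<And>A. cstar_algebra A \<Longrightarrow> component u A = component v A" for u v :: "'a cproduct"
    using that by (rule cproduct_eqI)
  note comps = component_0 component_add component_mult component_scaleR
  show "x + y + z = x + (y + z)"
  proof (rule eqI)
    fix A :: "'a cstar" assume A: "cstar_algebra A"
    then interpret cstar_algebra A .
    show "component (x + y + z) A = component (x + (y + z)) A"
      by (simp add: comps A a_assoc)
  qed
  show "x + y = y + x"
  proof (rule eqI)
    fix A :: "'a cstar" assume A: "cstar_algebra A"
    then interpret cstar_algebra A .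
    show "component (x + y) A = component (y + x) A"
      by (simp add: comps A a_comm)
  qed
  show zero: "0 + x = x"
  proof (rule eqI)
    fix A :: "'a cstar" assume A: "cstar_algebra A"
    then interpret cstar_algebra A .
    show "component (0 + x) A = component x A"
      by (simp add: comps A)
  qed
  show "- x + x = 0"
  proof (rule eqI)
    fix A :: "'a cstar" assume A: "cstar_algebra A"
    then interpret cstar_algebra A .
    show "component (- x + x) A = component 0 A"
      by (simp add: comps A uminus_cproduct_def smult_minus_1 l_neg)
  qed
  show "x - y = x + - y"
    by (simp add: minus_cproduct_def uminus_cproduct_def)
  show "r *\<^sub>R (x + y) = r *\<^sub>R x + r *\<^sub>R y"
  proof (rule eqI)
    fix A :: "'a cstar" assume A: "cstar_algebra A"
    then interpret cstar_algebra A .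
    show "component (r *\<^sub>R (x + y)) A = component (r *\<^sub>R x + r *\<^sub>R y) A"
      by (simp add: comps A smult_add_right)
  qed
  show "(r + s) *\<^sub>R x = r *\<^sub>R x + s *\<^sub>R x"
  proof (rule eqI)
    fix A :: "'a cstar" assume A: "cstar_algebra A"
    then interpret cstar_algebra A .
    show "component ((r + s) *\<^sub>R x) A = component (r *\<^sub>R x + s *\<^sub>R x) A"
      by (simp add: comps A smult_add_left)
  qed
  show "r *\<^sub>R s *\<^sub>R x = (r * s) *\<^sub>R x"
  proof (rule eqI)
    fix A :: "'a cstar" assume A: "cstar_algebra A"
    then interpret cstar_algebra A .
    show "component (r *\<^sub>R s *\<^sub>R x) A = component ((r * s) *\<^sub>R x) A"
      by (simp add: comps A smult_smult)
  qed
  show "1 *\<^sub>R x = x"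
  proof (rule eqI)
    fix A :: "'a cstar" assume A: "cstar_algebra A"
    then interpret cstar_algebra A .
    show "component (1 *\<^sub>R x) A = component x A"
      by (simp add: comps A smult_1)
  qed
  show "x * y * z = x * (y * z)"
  proof (rule eqI)
    fix A :: "'a cstar" assume A: "cstar_algebra A"
    then interpret cstar_algebra A .
    show "component (x * y * z) A = component (x * (y * z)) A"
      by (simp add: comps A mult_assoc)
  qed
  show "(x + y) * z = x * z + y * z"
  proof (rule eqI)
    fix A :: "'a cstar" assume A: "cstar_algebra A"
    then interpret cstar_algebra A .
    show "component ((x + y) * z) A = component (x * z + y * z) A"
      by (simp add: comps A mult_l_distr)
  qed
  show "x * (y + z) = x * y + x * z"
  proof (rule eqI)
    fix A :: "'a cstar" assume A: "cstar_algebra A"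
    then interpret cstar_algebra A .
    show "component (x * (y + z)) A = component (x * y + x * z) A"
      by (simp add: comps A mult_r_distr)
  qed
  show "r *\<^sub>R x * y = r *\<^sub>R (x * y)"
  proof (rule eqI)
    fix A :: "'a cstar" assume A: "cstar_algebra A"
    then interpret cstar_algebra A .
    show "component (r *\<^sub>R x * y) A = component (r *\<^sub>R (x * y)) A"
      by (simp add: comps A smult_mult_left)
  qed
  show "x * r *\<^sub>R y = r *\<^sub>R (x * y)"
  proof (rule eqI)
    fix A :: "'a cstar" assume A: "cstar_algebra A"
    then interpret cstar_algebra A .
    show "component (x * r *\<^sub>R y) A = component (r *\<^sub>R (x * y)) A"
      by (simp add: comps A smult_mult_right)
  qed
  show "dist x y = norm (x - y)" "sgn x = inverse (norm x) *\<^sub>R x"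
    by (simp_all add: dist_cproduct_def sgn_cproduct_def)
  show "uniformity = (INF e\<in>{0<..}. principal {(x, y :: 'a cproduct). dist x y < e})"
    by (rule uniformity_cproduct_def)
  show "open U \<longleftrightarrow> (\<forall>x\<in>U. \<forall>\<^sub>F (x', y) in uniformity. x' = x \<longrightarrow> (y :: 'a cproduct) \<in> U)" for U
    by (rule open_cproduct_def)
  show norm0: "norm x = 0 \<longleftrightarrow> x = 0"
  proof
    assume n: "norm x = 0"
    show "x = 0"
    proof (rule eqI)
      fix A :: "'a cstar" assume A: "cstar_algebra A"
      then interpret cstar_algebra A .
      have "cnorm A (component x A) = 0"
        using component_norm_le[OF A, of x] cnorm_nonneg[of "component x A"] n A by simp
      then show "component x A = component 0 A"
        using cnorm_eq_zero_iff[of "component x A"] A by (simp add: component_0)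
    qed
  next
    have "norm (0 :: 'a cproduct) \<le> 0"
      by (rule norm_cproduct_le) (simp_all add: component_0 cstar_algebra.cnorm_zero)
    then show "x = 0 \<Longrightarrow> norm x = 0"
      using norm_cproduct_nonneg[of x] by simp
  qed
  show "norm (x + y) \<le> norm x + norm y"
  proof (rule norm_cproduct_le)
    fix A :: "'a cstar" assume A: "cstar_algebra A"
    then interpret cstar_algebra A .
    show "cnorm A (component (x + y) A) \<le> norm x + norm y"
      using cnorm_triangle[of "component x A" "component y A"] component_norm_le[OF A, of x]
        component_norm_le[OF A, of y] by (simp add: A comps)
  qed (simp add: norm_cproduct_nonneg)
  show "norm (x * y) \<le> norm x * norm y"
  proof (rule norm_cproduct_le)
    fix A :: "'a cstar" assume A: "cstar_algebra A"
    then interpret cstar_algebra A .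
    have "cnorm A (component (x * y) A) \<le> cnorm A (component x A) * cnorm A (component y A)"
      by (simp add: A comps cnorm_mult)
    also have "\<dots> \<le> norm x * norm y"
      by (intro mult_mono component_norm_le A norm_cproduct_nonneg cnorm_nonneg component_closed)
    finally show "cnorm A (component (x * y) A) \<le> norm x * norm y" .
  qed (simp add: norm_cproduct_nonneg)
  have le: "norm (r *\<^sub>R x) \<le> \<bar>r\<bar> * norm x" for r and x :: "'a cproduct"
  proof (rule norm_cproduct_le)
    fix A :: "'a cstar" assume A: "cstar_algebra A"
    then interpret cstar_algebra A .
    show "cnorm A (component (r *\<^sub>R x) A) \<le> \<bar>r\<bar> * norm x"
      by (simp add: A comps cnorm_smult mult_left_mono component_norm_le)
  qed (simp add: norm_cproduct_nonneg)
  show "norm (r *\<^sub>R x) = \<bar>r\<bar> * norm x"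
  proof (cases "r = 0")
    case True
    then show ?thesis
      using le[of 0 x] norm_cproduct_nonneg[of "0 *\<^sub>R x"] by simp
  next
    case False
    have "inverse r *\<^sub>R r *\<^sub>R x = x"
    proof (rule eqI)
      fix A :: "'a cstar" assume A: "cstar_algebra A"
      then interpret cstar_algebra A .
      show "component (inverse r *\<^sub>R r *\<^sub>R x) A = component x A"
        using False by (simp add: comps A smult_smult smult_1 flip: of_real_mult)
    qed
    then have "norm x \<le> inverse \<bar>r\<bar> * norm (r *\<^sub>R x)"
      using le[of "inverse r" "r *\<^sub>R x"] by simp
    then have "\<bar>r\<bar> * norm x \<le> norm (r *\<^sub>R x)"
      using False by (simp add: field_simps)
    then show ?thesis using le[of r x] by simp
  qed
qed

end

lemma component_uminus: "cstar_algebra A \<Longrightarrow> component (- x) A = \<ominus>\<^bsub>A\<^esub> component x A"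
  unfolding uminus_cproduct_def by (subst component_scaleR) (simp_all add: cstar_algebra.smult_minus_1)

lemma component_diff: "cstar_algebra A \<Longrightarrow> component (x - y) A = component x A \<ominus>\<^bsub>A\<^esub> component y A"
  unfolding minus_cproduct_def component_add
  by (subst component_scaleR) (simp_all add: cstar_algebra.minus_eq_smult)

instance cproduct :: (type) banach
proof
  fix X :: "nat \<Rightarrow> 'a cproduct"
  assume X: "Cauchy X"
  have "\<exists>l\<in>carrier A. converges_to A (\<lambda>n. component (X n) A) l" if A: "cstar_algebra A" for A :: "'a cstar"
  proof -
    interpret cstar_algebra A by fact
    show ?thesis
    proof (rule complete)
      fix e :: real assume "e > 0"
      with X obtain M where "\<forall>m\<ge>M. \<forall>n\<ge>M. norm (X m - X n) < e"
        using CauchyD by blast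
      then show "\<exists>N. \<forall>i\<ge>N. \<forall>j\<ge>N. cnorm A (component (X i) A \<ominus>\<^bsub>A\<^esub> component (X j) A) < e"
        using component_norm_le[OF A, of "X i - X j" for i j]
        unfolding component_diff[OF A] by (meson le_less_trans)
    qed (simp add: A)
  qed
  then obtain l where l: "\<And>A. cstar_algebra A \<Longrightarrow> l A \<in> carrier A"
    and conv: "\<And>A. cstar_algebra A \<Longrightarrow> converges_to A (\<lambda>n. component (X n) A) (l A)"
    by metis
  \<comment> \<open>Completeness of each algebra gives limits of the components only. The Cauchy
    bound \<open>e\<close> does not depend on the algebra and survives the limit in
    \<open>m\<close>, so convergence is uniform over all algebras.\<close>
  have near: "\<exists>M. \<forall>n\<ge>M. \<forall>A. cstar_algebra A \<longrightarrow> cnorm A (component (X n) A \<ominus>\<^bsub>A\<^esub> l A) \<le> e" if e: "e > 0" for e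
  proof -
    from X e obtain M where M: "\<And>m n. m \<ge> M \<Longrightarrow> n \<ge> M \<Longrightarrow> norm (X m - X n) < e"
      using CauchyD by blast
    show ?thesis
    proof (intro exI[of _ M] allI impI)
      fix n and A :: "'a cstar" assume n: "n \<ge> M" and A: "cstar_algebra A"
      interpret cstar_algebra A by fact
      have le: "cnorm A (component (X n) A \<ominus>\<^bsub>A\<^esub> l A) \<le> e + cnorm A (component (X m) A \<ominus>\<^bsub>A\<^esub> l A)" if "m \<ge> M" for m
      proof -
        have "component (X n) A \<ominus>\<^bsub>A\<^esub> l A = (component (X n) A \<ominus>\<^bsub>A\<^esub> component (X m) A) \<oplus>\<^bsub>A\<^esub> (component (X m) A \<ominus>\<^bsub>A\<^esub> l A)"
          using l[OF A] A by (simp add: a_minus_def a_assoc r_neg2 r_neg1)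
        also have "cnorm A \<dots> \<le> cnorm A (component (X n - X m) A) + cnorm A (component (X m) A \<ominus>\<^bsub>A\<^esub> l A)"
          using l[OF A] A by (simp add: component_diff cnorm_triangle)
        finally show ?thesis
          using component_norm_le[OF A, of "X n - X m"] M[OF n that] by linarith
      qed
      have "(\<lambda>m. e + cnorm A (component (X m) A \<ominus>\<^bsub>A\<^esub> l A)) \<longlonglongrightarrow> e + 0"
        using conv[OF A] unfolding converges_to_def by (intro tendsto_intros)
      from LIMSEQ_le_const[OF this, of "cnorm A (component (X n) A \<ominus>\<^bsub>A\<^esub> l A)"] le
      show "cnorm A (component (X n) A \<ominus>\<^bsub>A\<^esub> l A) \<le> e"
        by auto
    qed
  qed
  obtain N where N: "\<And>A. cstar_algebra A \<Longrightarrow> cnorm A (component (X N) A \<ominus>\<^bsub>A\<^esub> l A) \<le> 1"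
    using near[of 1] by auto
  define L where "L = mk_cproduct l"
  have L: "component L A = l A" if "cstar_algebra A" for A
    unfolding L_def
  proof (rule component_mk[where K = "1 + norm (X N)"])
    fix A :: "'a cstar" assume A: "cstar_algebra A"
    then interpret cstar_algebra A .
    have "l A = component (X N) A \<oplus>\<^bsub>A\<^esub> (- 1) \<odot>\<^bsub>A\<^esub> (component (X N) A \<ominus>\<^bsub>A\<^esub> l A)"
      using l[OF A] A by (simp add: smult_minus_1 a_minus_def minus_add r_neg2 r_neg1)
    also have "cnorm A \<dots> \<le> cnorm A (component (X N) A) + cnorm A ((- 1) \<odot>\<^bsub>A\<^esub> (component (X N) A \<ominus>\<^bsub>A\<^esub> l A))"
      using l[OF A] A by (intro cnorm_triangle) auto
    also have "\<dots> \<le> norm (X N) + 1"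
      using l[OF A] A N[OF A] component_norm_le[OF A, of "X N"] by (simp add: cnorm_smult)
    finally show "cnorm A (l A) \<le> 1 + norm (X N)" by simp
  qed (use l that in auto)
  have "X \<longlonglongrightarrow> L"
  proof (rule LIMSEQ_I)
    fix r :: real assume "0 < r"
    then obtain M where M: "\<And>n A. n \<ge> M \<Longrightarrow> cstar_algebra A \<Longrightarrow> cnorm A (component (X n) A \<ominus>\<^bsub>A\<^esub> l A) \<le> r / 2"
      using near[of "r / 2"] by auto
    show "\<exists>no. \<forall>n\<ge>no. norm (X n - L) < r"
    proof (intro exI[of _ M] allI impI)
      fix n assume "n \<ge> M"
      then have "norm (X n - L) \<le> r / 2"
      proof (intro norm_cproduct_le)
        fix A :: "'a cstar" assume A: "cstar_algebra A"
        show "cnorm A (component (X n - L) A) \<le> r / 2"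
          unfolding component_diff[OF A] L[OF A] by (rule M) fact+
      qed (use \<open>0 < r\<close> in simp)
      then show "norm (X n - L) < r" using \<open>0 < r\<close> by simp
    qed
  qed
  then show "convergent X" by (auto simp: convergent_def)
qed

instantiation cproduct :: (type) cstar_nonunital
begin

definition "nstar x = mk_cproduct (\<lambda>A. adj A (component x A))"
definition "times_i x = mk_cproduct (\<lambda>A. \<i> \<odot>\<^bsub>A\<^esub> component x A)"

lemma component_nstar: "cstar_algebra A \<Longrightarrow> component (nstar x) A = adj A (component x A)"
  unfolding nstar_cproduct_def
  by (rule component_mk[where K = "norm x"])
    (simp_all add: cstar_algebra.adj_closed cstar_algebra.cnorm_adj component_norm_le)

lemma component_times_i: "cstar_algebra A \<Longrightarrow> component (times_i x) A = \<i> \<odot>\<^bsub>A\<^esub> component x A"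
  unfolding times_i_cproduct_def
  by (rule component_mk[where K = "norm x"])
    (simp_all add: cstar_algebra.smult_closed' cstar_algebra.cnorm_smult component_norm_le)

instance
proof
  fix x y :: "'a cproduct" and r :: real
  note comps = component_0 component_add component_mult component_scaleR component_nstar
    component_times_i component_uminus
  show "nstar (nstar x) = x"
    by (rule cproduct_eqI) (simp add: comps cstar_algebra.adj_adj)
  show "nstar (x + y) = nstar x + nstar y"
    by (rule cproduct_eqI) (simp add: comps cstar_algebra.adj_add)
  show "nstar (r *\<^sub>R x) = r *\<^sub>R nstar x"
    by (rule cproduct_eqI) (simp add: comps cstar_algebra.adj_smult)
  show "nstar (x * y) = nstar y * nstar x"
    by (rule cproduct_eqI) (simp add: comps cstar_algebra.adj_mult)
  show "times_i (times_i x) = - x"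
    by (rule cproduct_eqI) (simp add: comps cstar_algebra.smult_smult cstar_algebra.smult_minus_1)
  show "times_i (x + y) = times_i x + times_i y"
    by (rule cproduct_eqI) (simp add: comps cstar_algebra.smult_add_right)
  show "times_i (r *\<^sub>R x) = r *\<^sub>R times_i x"
    by (rule cproduct_eqI) (simp add: comps cstar_algebra.smult_smult mult.commute)
  show "times_i x * y = times_i (x * y)"
    by (rule cproduct_eqI) (simp add: comps cstar_algebra.smult_mult_left)
  show "x * times_i y = times_i (x * y)"
    by (rule cproduct_eqI) (simp add: comps cstar_algebra.smult_mult_right)
  show "nstar (times_i x) = - times_i (nstar x)"
    by (rule cproduct_eqI)
      (simp add: comps cstar_algebra.adj_smult cstar_algebra.smult_smult cstar_algebra.adj_closed
        cstar_algebra.smult_closed' flip: cstar_algebra.smult_minus_1)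
  show "norm (nstar x * x) = (norm x)\<^sup>2"
  proof (rule antisym)
    show "norm (nstar x * x) \<le> (norm x)\<^sup>2"
      by (rule norm_cproduct_le)
        (simp_all add: comps cstar_algebra.cnorm_adj_mult power_mono component_norm_le cstar_algebra.cnorm_nonneg)
    have "cnorm A (component x A) \<le> sqrt (norm (nstar x * x))" if A: "cstar_algebra A" for A :: "'a cstar"
      using component_norm_le[OF A, of "nstar x * x"]
      by (intro real_le_rsqrt) (simp add: comps A cstar_algebra.cnorm_adj_mult)
    then have "norm x \<le> sqrt (norm (nstar x * x))"
      by (intro norm_cproduct_le) auto
    then have "(norm x)\<^sup>2 \<le> (sqrt (norm (nstar x * x)))\<^sup>2"
      by (intro power_mono) auto
    then show "(norm x)\<^sup>2 \<le> norm (nstar x * x)" by simp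
  qed
qed

end

section \<open>The embedding into a unital C*-algebra\<close>

definition of_complex :: "complex \<Rightarrow> 'a::cstar_unital" where
  "of_complex z = of_real (Re z) + Im z *\<^sub>R imag_unit"

lemma of_complex_commute: "of_complex z * x = x * of_complex z"
  by (simp add: of_complex_def of_real_def imag_unit_commute algebra_simps)

lemma of_complex_add: "of_complex (y + z) = of_complex y + of_complex z"
  by (simp add: of_complex_def algebra_simps)

lemma of_complex_mult: "of_complex (y * z) = of_complex y * of_complex z"
  by (simp add: of_complex_def of_real_def imag_unit_sq algebra_simps)

lemma of_complex_of_real [simp]: "of_complex (complex_of_real r) = of_real r"
  by (simp add: of_complex_def)

lemma of_complex_i: "of_complex \<i> = imag_unit"
  by (simp add: of_complex_def)

lemma star_of_complex: "star (of_complex z) = of_complex (cnj z)"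
  by (simp add: of_complex_def star_add star_scaleR star_imag_unit)

definition coordinate :: "'a cstar \<Rightarrow> 'a \<Rightarrow> 'a cproduct" where
  "coordinate A x = mk_cproduct (\<lambda>B. if B = A then x else \<zero>\<^bsub>B\<^esub>)"

text \<open>Only the coordinate of \<open>A\<close> itself is nonzero and the scalar part is 0, so
  the image is a subalgebra that does not contain the unit.\<close>

definition embed :: "'a cstar \<Rightarrow> 'a \<Rightarrow> 'a cproduct unitization" where
  "embed A x = Unitization 0 (coordinate A x)"

lemma of_complex_unitization: "of_complex z = Unitization z 0"
  by (simp add: of_complex_def of_real_def one_unitization_def scaleR_unitization_def
      imag_unit_unitization_def plus_unitization_def complex_eq_iff)

context cstar_algebra
begin

lemma adj_zero: "adj A \<zero> = \<zero>"
  using adj_smult[of \<zero> 0] by (simp add: smult_0 adj_closed)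

lemma mult_zero_left: "x \<in> carrier A \<Longrightarrow> \<zero> \<otimes> x = \<zero>"
  using smult_mult_left[of \<zero> x 0] by (simp add: smult_0 mult_closed)

lemma mult_zero_right: "x \<in> carrier A \<Longrightarrow> x \<otimes> \<zero> = \<zero>"
  using smult_mult_right[of x \<zero> 0] by (simp add: smult_0 mult_closed)

lemma smult_zero: "c \<odot> \<zero> = \<zero>"
  using smult_smult[of \<zero> c 0] by (simp add: smult_0)

end

context cstar_algebra
begin

lemma component_coordinate:
  assumes "x \<in> carrier A" "cstar_algebra B"
  shows "component (coordinate A x) B = (if B = A then x else \<zero>\<^bsub>B\<^esub>)"
  unfolding coordinate_def
proof (rule component_mk[where K = "cnorm A x"])
  fix B :: "'a cstar" assume B: "cstar_algebra B"
  then interpret B: cstar_algebra B .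
  show "(if B = A then x else \<zero>\<^bsub>B\<^esub>) \<in> carrier B" "cnorm B (if B = A then x else \<zero>\<^bsub>B\<^esub>) \<le> cnorm A x"
    using assms(1) by (auto simp: B.cnorm_zero cnorm_nonneg)
qed fact

lemma embed_inject: "x \<in> carrier A \<Longrightarrow> y \<in> carrier A \<Longrightarrow> embed A x = embed A y \<longleftrightarrow> x = y"
  by (metis component_coordinate cstar_algebra_axioms embed_def unitization.inject)

lemma embed_zero: "embed A \<zero> = 0"
  by (auto simp: embed_def zero_unitization_def component_coordinate component_0 intro!: cproduct_eqI)

lemma embed_eq_0_iff: "x \<in> carrier A \<Longrightarrow> embed A x = 0 \<longleftrightarrow> x = \<zero>"
  using embed_inject[of x \<zero>] by (simp add: embed_zero)

lemma coordinate_add: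
  assumes "x \<in> carrier A" "y \<in> carrier A"
  shows "coordinate A (x \<oplus> y) = coordinate A x + coordinate A y"
proof (rule cproduct_eqI)
  fix B :: "'a cstar" assume B: "cstar_algebra B"
  then interpret B: cstar_algebra B .
  show "component (coordinate A (x \<oplus> y)) B = component (coordinate A x + coordinate A y) B"
    using assms by (auto simp: component_coordinate B component_add)
qed

lemma embed_add: "x \<in> carrier A \<Longrightarrow> y \<in> carrier A \<Longrightarrow> embed A (x \<oplus> y) = embed A x + embed A y"
  by (simp add: embed_def plus_unitization_def coordinate_add)

lemma coordinate_mult:
  assumes "x \<in> carrier A" "y \<in> carrier A"
  shows "coordinate A (x \<otimes> y) = coordinate A x * coordinate A y"
proof (rule cproduct_eqI)
  fix B :: "'a cstar" assume B: "cstar_algebra B"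
  then interpret B: cstar_algebra B .
  show "component (coordinate A (x \<otimes> y)) B = component (coordinate A x * coordinate A y) B"
    using assms by (auto simp: component_coordinate B component_mult mult_closed B.mult_zero_left)
qed

lemma embed_mult: "x \<in> carrier A \<Longrightarrow> y \<in> carrier A \<Longrightarrow> embed A (x \<otimes> y) = embed A x * embed A y"
  by (simp add: embed_def times_unitization_def coordinate_mult lact_def)

lemma coordinate_smult:
  assumes "x \<in> carrier A"
  shows "coordinate A (c \<odot> x) = Re c *\<^sub>R coordinate A x + Im c *\<^sub>R times_i (coordinate A x)"
proof (rule cproduct_eqI)
  fix B :: "'a cstar" assume B: "cstar_algebra B"
  then interpret B: cstar_algebra B .
  have "c = complex_of_real (Re c) + complex_of_real (Im c) * \<i>"
    by (simp add: complex_eq_iff)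
  then have "c \<odot> x = complex_of_real (Re c) \<odot> x \<oplus> (complex_of_real (Im c) * \<i>) \<odot> x"
    using smult_add_left[OF assms] by metis
  then show "component (coordinate A (c \<odot> x)) B
      = component (Re c *\<^sub>R coordinate A x + Im c *\<^sub>R times_i (coordinate A x)) B"
    using assms by (auto simp: component_coordinate B component_add component_scaleR component_times_i
        smult_smult B.smult_zero)
qed

lemma embed_smult: "x \<in> carrier A \<Longrightarrow> embed A (c \<odot> x) = of_complex c * embed A x"
  by (simp add: embed_def of_complex_unitization times_unitization_def coordinate_smult lact_def times_i_0)

lemma embed_smult_real: "x \<in> carrier A \<Longrightarrow> embed A (complex_of_real r \<odot> x) = r *\<^sub>R embed A x"
  by (simp add: embed_smult scaleR_conv_of_real)

lemma embed_minus: "x \<in> carrier A \<Longrightarrow> y \<in> carrier A \<Longrightarrow> embed A (x \<ominus> y) = embed A x - embed A y"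
  using embed_smult_real[of y "-1"] by (simp add: minus_eq_smult embed_add)

lemma coordinate_adj:
  assumes "x \<in> carrier A"
  shows "coordinate A (adj A x) = nstar (coordinate A x)"
proof (rule cproduct_eqI)
  fix B :: "'a cstar" assume B: "cstar_algebra B"
  then interpret B: cstar_algebra B .
  show "component (coordinate A (adj A x)) B = component (nstar (coordinate A x)) B"
    using assms by (auto simp: component_coordinate B component_nstar adj_closed B.adj_zero)
qed

lemma embed_adj: "x \<in> carrier A \<Longrightarrow> embed A (adj A x) = star (embed A x)"
  by (simp add: embed_def star_unitization_def coordinate_adj)

lemma norm_embed: 
  assumes "x \<in> carrier A"
  shows "norm (embed A x) = cnorm A x"
  unfolding embed_def norm_Unitization_0
proof (rule antisym)
  show "norm (coordinate A x) \<le> cnorm A x"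
    by (rule norm_cproduct_le)
      (auto simp: component_coordinate assms cnorm_nonneg cstar_algebra.cnorm_zero)
  show "cnorm A x \<le> norm (coordinate A x)"
    using component_norm_le[OF cstar_algebra_axioms, of "coordinate A x"]
    by (simp add: component_coordinate assms cstar_algebra_axioms)
qed

lemma embed_finsum:
  "finite I \<Longrightarrow> (\<And>i. i \<in> I \<Longrightarrow> f i \<in> carrier A) \<Longrightarrow> embed A (\<Oplus>i\<in>I. f i) = (\<Sum>i\<in>I. embed A (f i))"
proof (induction I rule: finite_induct)
  case (insert i I)
  then have "f i \<in> carrier A" "f \<in> I \<rightarrow> carrier A" by auto
  then have "(\<Oplus>i\<in>I. f i) \<in> carrier A" by (intro finsum_closed)
  then show ?case
    using insert \<open>f i \<in> carrier A\<close> \<open>f \<in> I \<rightarrow> carrier A\<close> by (simp add: finsum_insert embed_add)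
qed (simp add: embed_zero)

lemma converges_to_iff:
  assumes "\<And>k. s k \<in> carrier A" "x \<in> carrier A"
  shows "converges_to A s x \<longleftrightarrow> (\<lambda>k. embed A (s k)) \<longlonglongrightarrow> embed A x"
proof -
  have "cnorm A (s k \<ominus> x) = norm (embed A (s k) - embed A x)" for k
    using assms by (simp flip: embed_minus norm_embed)
  then show ?thesis
    by (simp add: converges_to_def LIM_zero_iff[of "\<lambda>k. embed A (s k)"] tendsto_norm_zero_iff)
qed

text \<open>Closedness is the completeness of \<open>A\<close>, transported by the isometry.\<close>

lemma cstar_subalgebra_embed: "cstar_subalgebra (embed A ` carrier A)"
proof
  show "0 \<in> embed A ` carrier A"
    using embed_zero by force
  show "x + y \<in> embed A ` carrier A" "x * y \<in> embed A ` carrier A"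
    if "x \<in> embed A ` carrier A" "y \<in> embed A ` carrier A" for x y
    using that by (auto simp: mult_closed simp flip: embed_add embed_mult)
  show "r *\<^sub>R x \<in> embed A ` carrier A" if "x \<in> embed A ` carrier A" for r x
    using that by (auto simp flip: embed_smult_real)
  show "imag_unit * x \<in> embed A ` carrier A" if "x \<in> embed A ` carrier A" for x
    using that by (auto simp flip: embed_smult of_complex_i)
  show "star x \<in> embed A ` carrier A" if "x \<in> embed A ` carrier A" for x
    using that by (auto simp: adj_closed simp flip: embed_adj)
  show "closed (embed A ` carrier A)"
    unfolding closed_sequential_limits
  proof (intro allI impI, elim conjE)
    fix s l assume s: "\<forall>n. s n \<in> embed A ` carrier A" and l: "s \<longlonglongrightarrow> l"
    have "\<forall>n. \<exists>y. y \<in> carrier A \<and> s n = embed A y"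
      using s by blast
    from choice[OF this] obtain x where x: "\<And>n. x n \<in> carrier A" "\<And>n. s n = embed A (x n)"
      by blast
    have "\<exists>y\<in>carrier A. converges_to A x y"
    proof (rule complete[OF x(1)])
      fix e :: real assume "e > 0"
      with LIMSEQ_imp_Cauchy[OF l] obtain N where "\<forall>i\<ge>N. \<forall>j\<ge>N. norm (s i - s j) < e"
        using CauchyD by blast
      then show "\<exists>N. \<forall>i\<ge>N. \<forall>j\<ge>N. cnorm A (x i \<ominus> x j) < e"
        using x by (auto simp flip: embed_minus norm_embed)
    qed
    then obtain y where y: "y \<in> carrier A" "converges_to A x y"
      by blast
    then have "s \<longlonglongrightarrow> embed A y"
      unfolding converges_to_iff[OF x(1) y(1)] x(2)[symmetric] by simp
    from LIMSEQ_unique[OF l this] have "l = embed A y" .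
    with y show "l \<in> embed A ` carrier A" by blast
  qed
qed

text \<open>Positivity does not depend on the surrounding algebra: the square root of an element of
  the image lies in the image again, because the root function vanishes at 0. The other direction is
  \<open>positive_elem_star_mult\<close>.\<close>

lemma positive_iff: "positive A a \<longleftrightarrow> a \<in> carrier A \<and> positive_elem (embed A a)"
proof
  assume "positive A a"
  then obtain b where b: "b \<in> carrier A" "a = adj A b \<otimes> b"
    by (auto simp: positive_def)
  then have "embed A a = star (embed A b) * embed A b"
    by (simp add: embed_mult embed_adj adj_closed)
  with b show "a \<in> carrier A \<and> positive_elem (embed A a)"
    by (simp add: mult_closed adj_closed positive_elem_star_mult)
next
  assume a: "a \<in> carrier A \<and> positive_elem (embed A a)"
  interpret S: cstar_subalgebra "embed A ` carrier A" by (rule cstar_subalgebra_embed)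
  obtain d where d: "d \<in> embed A ` carrier A" "star d = d" "d * d = embed A a"
    using S.positive_sqrt_mem[of "embed A a"] a by blast
  then obtain b where b: "b \<in> carrier A" "d = embed A b" by blast
  then have "embed A (adj A b \<otimes> b) = embed A a"
    using d by (simp add: embed_mult embed_adj adj_closed)
  then have "a = adj A b \<otimes> b"
    using a b by (simp add: embed_inject mult_closed adj_closed)
  with a b show "positive A a"
    by (auto simp: positive_def)
qed

lemma embed_eval_times_X:
  assumes c: "c \<in> carrier A"
  shows "eval_times_X A q c \<in> carrier A" "embed A (eval_times_X A q c) = peval (pCons 0 q) (embed A c)"
proof -
  have pow: "((\<lambda>y. c \<otimes> y) ^^ i) c \<in> carrier A \<and> embed A (((\<lambda>y. c \<otimes> y) ^^ i) c) = embed A c ^ Suc i" for i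
    by (induction i) (simp_all add: c mult_closed embed_mult)
  show "eval_times_X A q c \<in> carrier A"
    unfolding eval_times_X_def using pow by (intro finsum_closed) auto
  have "embed A (eval_times_X A q c) = (\<Sum>i\<le>degree q. coeff q i *\<^sub>R embed A c ^ Suc i)"
    unfolding eval_times_X_def using pow by (subst embed_finsum) (auto simp: embed_smult_real)
  then show "embed A (eval_times_X A q c) = peval (pCons 0 q) (embed A c)"
    by (simp add: peval_pCons) (simp add: peval_def sum_distrib_left)
qed

text \<open>For the definite description, existence means that all admissible sequences have the
  common limit given by \<open>fcalc\<close>. Uniqueness needs one admissible sequence;
  \<open>poly_approx\<close> supplies it, since its polynomials vanish at 0 and thus have the form
  \<open>pCons 0 r\<close>.\<close>

lemma cfc_embed:
  assumes c: "c \<in> carrier A" "adj A c = c" and f: "continuous_on UNIV f" "f 0 = 0"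
  shows "cfc A f c \<in> carrier A" "embed A (cfc A f c) = fcalc f (embed A c)"
proof -
  interpret S: cstar_subalgebra "embed A ` carrier A" by (rule cstar_subalgebra_embed)
  have sa: "star (embed A c) = embed A c"
    using c by (simp flip: embed_adj)
  have "fcalc f (embed A c) \<in> embed A ` carrier A"
    using c by (intro S.fcalc_mem sa f) auto
  then obtain d where d: "d \<in> carrier A" "embed A d = fcalc f (embed A c)" by force
  let ?P = "\<lambda>d. d \<in> carrier A \<and>
     (\<forall>q. uniform_limit {- cnorm A c..cnorm A c} (\<lambda>k t. t * poly (q k) t) f sequentially \<longrightarrow>
          converges_to A (\<lambda>k. eval_times_X A (q k) c) d)"
  have Pd: "?P d"
  proof (intro conjI allI impI d)
    fix q assume "uniform_limit {- cnorm A c..cnorm A c} (\<lambda>k t. t * poly (q k) t) f sequentially"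
    then have "uniform_limit {- cnorm A c..cnorm A c} (\<lambda>k. poly (pCons 0 (q k))) f sequentially"
      by (simp add: poly_pCons[abs_def])
    then have "(\<lambda>k. peval (pCons 0 (q k)) (embed A c)) \<longlonglongrightarrow> fcalc f (embed A c)"
      by (rule fcalc_limit[OF sa]) (simp add: norm_embed c)
    then show "converges_to A (\<lambda>k. eval_times_X A (q k) c) d"
      using c by (simp add: converges_to_iff embed_eval_times_X d)
  qed
  have "\<exists>r. poly_approx f k = pCons 0 r" for k
    using poly_approx_0[OF f(1), of k] f(2) by (cases "poly_approx f k") simp
  then obtain r where r: "\<And>k. poly_approx f k = pCons 0 (r k)" by metis
  have "d' = d" if d': "?P d'" for d'
  proof -
    have "uniform_limit {- cnorm A c..cnorm A c} (\<lambda>k t. t * poly (r k) t) f sequentially"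
      using poly_approx_limit[OF f(1), of "cnorm A c"] by (simp add: r poly_pCons[abs_def])
    then have "converges_to A (\<lambda>k. eval_times_X A (r k) c) d'" "converges_to A (\<lambda>k. eval_times_X A (r k) c) d"
      using d' Pd by blast+
    then have "embed A d' = embed A d"
      using c d d' by (simp add: converges_to_iff embed_eval_times_X LIMSEQ_unique)
    then show ?thesis
      using embed_inject[of d' d] d(1) d' by blast
  qed
  with Pd have "cfc A f c = d"
    unfolding cfc_def by (intro the_equality) blast+
  with d show "cfc A f c \<in> carrier A" "embed A (cfc A f c) = fcalc f (embed A c)" by auto
qed

lemma cut_down_embed:
  assumes "c \<in> carrier A" "adj A c = c" "0 \<le> \<epsilon>"
  shows "cut_down A c \<epsilon> \<in> carrier A" "embed A (cut_down A c \<epsilon>) = fcalc (\<lambda>t. max (t - \<epsilon>) 0) (embed A c)"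
  unfolding cut_down_def using assms by (auto intro!: cfc_embed continuous_intros)

lemma cuntz_subeq_iff:
  assumes "a \<in> carrier A" "b \<in> carrier A"
  shows "cuntz_subeq A a b \<longleftrightarrow> (\<exists>v. (\<forall>k. v k \<in> carrier A) \<and>
    (\<lambda>k. embed A (v k) * embed A b * star (embed A (v k))) \<longlonglongrightarrow> embed A a)"
proof -
  have "(\<lambda>k. cnorm A (a \<ominus> v k \<otimes> b \<otimes> adj A (v k))) \<longlonglongrightarrow> 0 \<longleftrightarrow>
      (\<lambda>k. embed A (v k) * embed A b * star (embed A (v k))) \<longlonglongrightarrow> embed A a"
    if v: "\<forall>k. v k \<in> carrier A" for v
  proof -
    have "cnorm A (a \<ominus> v k \<otimes> b \<otimes> adj A (v k))
        = norm (embed A (v k) * embed A b * star (embed A (v k)) - embed A a)" for k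
      using v assms
      by (subst norm_minus_commute, subst norm_embed[symmetric])
        (auto simp: embed_minus embed_mult embed_adj mult_closed adj_closed)
    then show ?thesis
      by (simp add: tendsto_norm_zero_iff LIM_zero_iff[of _ "embed A a"])
  qed
  then show ?thesis
    unfolding cuntz_subeq_def by blast
qed

end

section \<open>Columns and matrices over a closed star-subalgebra\<close>

definition inner_col :: "nat \<Rightarrow> (nat \<Rightarrow> 'a::cstar_unital) \<Rightarrow> (nat \<Rightarrow> 'a) \<Rightarrow> 'a" where
  "inner_col n x y = (\<Sum>i<n. star (x i) * y i)"

definition norm_col :: "nat \<Rightarrow> (nat \<Rightarrow> 'a::cstar_unital) \<Rightarrow> real" where
  "norm_col n x = sqrt (norm (inner_col n x x))"

definition mat_vec :: "nat \<Rightarrow> (nat \<Rightarrow> nat \<Rightarrow> 'a::cstar_unital) \<Rightarrow> (nat \<Rightarrow> 'a) \<Rightarrow> nat \<Rightarrow> 'a" where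
  "mat_vec n a x i = (\<Sum>j<n. a i j * x j)"

definition mat_mult :: "nat \<Rightarrow> (nat \<Rightarrow> nat \<Rightarrow> 'a::cstar_unital) \<Rightarrow> (nat \<Rightarrow> nat \<Rightarrow> 'a) \<Rightarrow> nat \<Rightarrow> nat \<Rightarrow> 'a" where
  "mat_mult n a b i j = (\<Sum>k<n. a i k * b k j)"

definition mat_adj :: "(nat \<Rightarrow> nat \<Rightarrow> 'a::cstar_unital) \<Rightarrow> nat \<Rightarrow> nat \<Rightarrow> 'a" where
  "mat_adj a i j = star (a j i)"

lemma inner_col_add_right: "inner_col n x (\<lambda>i. y i + z i) = inner_col n x y + inner_col n x z"
  by (simp add: inner_col_def algebra_simps sum.distrib)

lemma inner_col_add_left: "inner_col n (\<lambda>i. y i + z i) x = inner_col n y x + inner_col n z x"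
  by (simp add: inner_col_def algebra_simps star_add sum.distrib)

lemma inner_col_mult_right: "inner_col n x (\<lambda>i. y i * c) = inner_col n x y * c"
  by (simp add: inner_col_def sum_distrib_right mult.assoc)

lemma inner_col_mult_left: "inner_col n (\<lambda>i. y i * c) x = star c * inner_col n y x"
  by (simp add: inner_col_def sum_distrib_left star_mult mult.assoc)

lemma star_inner_col: "star (inner_col n x y) = inner_col n y x"
  by (simp add: inner_col_def star_sum star_mult)

lemma positive_inner_col: "positive_elem (inner_col n x x)"
  by (simp add: inner_col_def positive_elem_sum positive_elem_star_mult)

lemma norm_col_nonneg: "0 \<le> norm_col n x"
  by (simp add: norm_col_def)

lemma norm_col_sq: "(norm_col n x)\<^sup>2 = norm (inner_col n x x)"
  by (simp add: norm_col_def)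

lemma inner_col_cong: "(\<And>i. i < n \<Longrightarrow> x i = x' i) \<Longrightarrow> (\<And>i. i < n \<Longrightarrow> y i = y' i)
    \<Longrightarrow> inner_col n x y = inner_col n x' y'"
  by (simp add: inner_col_def)

lemma norm_col_cong: "(\<And>i. i < n \<Longrightarrow> x i = x' i) \<Longrightarrow> norm_col n x = norm_col n x'"
  by (simp add: norm_col_def cong: inner_col_cong)

lemma norm_entry_le_norm_col:
  assumes "i < n"
  shows "norm (x i) \<le> norm_col n x"
proof -
  have "inner_col n x x - star (x i) * x i = (\<Sum>j\<in>{..<n} - {i}. star (x j) * x j)"
    unfolding inner_col_def using assms by (subst sum.remove[of "{..<n}" i]) auto
  also have "positive_elem \<dots>"
    by (intro positive_elem_sum positive_elem_star_mult)
  finally have "norm (star (x i) * x i) \<le> norm (inner_col n x x)"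
    by (intro norm_mono_positive positive_elem_star_mult)
  then have "(norm (x i))\<^sup>2 \<le> (norm_col n x)\<^sup>2"
    by (simp add: norm_star_mult norm_col_sq)
  then show ?thesis
    by (rule power2_le_imp_le) (rule norm_col_nonneg)
qed

lemma norm_col_le_sum: "norm_col n x \<le> (\<Sum>i<n. norm (x i))"
proof -
  have "norm (inner_col n x x) \<le> (\<Sum>i<n. norm (star (x i) * x i))"
    unfolding inner_col_def by (rule norm_sum)
  also have "\<dots> = (\<Sum>i<n. norm (x i) * norm (x i))"
    by (simp add: norm_star_mult power2_eq_square)
  also have "\<dots> \<le> (\<Sum>i<n. norm (x i) * (\<Sum>j<n. norm (x j)))"
    by (intro sum_mono mult_left_mono member_le_sum) auto
  also have "\<dots> = (\<Sum>i<n. norm (x i))\<^sup>2"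
    by (simp add: sum_distrib_right power2_eq_square)
  finally show ?thesis
    unfolding norm_col_def by (intro real_le_lsqrt sum_nonneg) auto
qed

text \<open>The Cauchy-Schwarz inequality for Hilbert modules. The inner product of
  \<open>y - x * g / N\<close> with itself is positive, where \<open>g\<close> is the inner product
  of \<open>x\<close> and \<open>y\<close>, and \<open>N\<close> the norm of that of
  \<open>x\<close> with itself. Bounding the latter inner product by \<open>N\<close> leaves
  \<open>(1 / N) *\<^sub>R (star g * g)\<close> below the inner product of \<open>y\<close> with
  itself.\<close>

theorem norm_inner_col_le: "norm (inner_col n x y) \<le> norm_col n x * norm_col n y"
proof (cases "norm_col n x = 0")
  case True
  then have "x i = 0" if "i < n" for i
    using norm_entry_le_norm_col[OF that, of x] by simp
  then show ?thesis
    using True by (simp add: inner_col_def)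
next
  case False
  define X where "X = inner_col n x x"
  define N where "N = norm X"
  define g where "g = inner_col n x y"
  have N: "N > 0"
    using False by (simp add: N_def X_def norm_col_def)
  define k where "k = - 1 / N"
  define c where "c = k *\<^sub>R g"
  define s where "s = star g * g"
  let ?z = "\<lambda>i. y i + x i * c"
  have yx: "inner_col n y x = star g"
    by (simp add: g_def star_inner_col)
  have z: "inner_col n ?z ?z = inner_col n y y + (star g * c + star c * g) + star c * X * c"
    by (simp add: inner_col_add_left inner_col_add_right inner_col_mult_left inner_col_mult_right
        yx distrib_left mult.assoc add_ac flip: g_def X_def)
  have "star g * c = k *\<^sub>R s" "star c * g = k *\<^sub>R s"
    by (simp_all add: c_def star_scaleR s_def)
  then have 1: "star g * c + star c * g = (k + k) *\<^sub>R s"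
    by (simp only: scaleR_left_distrib)
  have 2: "star c * (of_real N - X) * c = (k * k * N) *\<^sub>R s - star c * X * c"
    by (simp add: c_def star_scaleR s_def algebra_simps of_real_def)
  have "- (1 / N) = k + k + k * k * N"
    using N by (simp add: k_def field_simps)
  then have 3: "- (1 / N) *\<^sub>R s = (k + k) *\<^sub>R s + (k * k * N) *\<^sub>R s"
    by (simp only: scaleR_left_distrib)
  have "inner_col n y y - (1 / N) *\<^sub>R s = inner_col n y y + - (1 / N) *\<^sub>R s"
    by simp
  also have "\<dots> = inner_col n ?z ?z + star c * (of_real N - X) * c"
    unfolding z 1 2 3 by simp
  also have "positive_elem \<dots>"
    by (intro positive_elem_add positive_inner_col positive_elem_conj positive_elem_norm_diff)
      (simp_all add: N_def X_def star_inner_col)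
  finally have "norm ((1 / N) *\<^sub>R s) \<le> norm (inner_col n y y)"
    using N by (intro norm_mono_positive) (auto simp: s_def intro!: positive_elem_scaleR positive_elem_star_mult)
  then have "(norm g)\<^sup>2 \<le> N * norm (inner_col n y y)"
    using N by (simp add: s_def norm_star_mult pos_divide_le_eq mult.commute)
  then have "(norm g)\<^sup>2 \<le> (norm_col n x * norm_col n y)\<^sup>2"
    by (simp add: power_mult_distrib norm_col_sq N_def X_def)
  then show ?thesis
    unfolding g_def by (rule power2_le_imp_le) (simp add: norm_col_nonneg)
qed

lemma norm_col_triangle: "norm_col n (\<lambda>i. x i + y i) \<le> norm_col n x + norm_col n y"
proof -
  have "norm (inner_col n (\<lambda>i. x i + y i) (\<lambda>i. x i + y i))
      \<le> norm (inner_col n x x + inner_col n x y) + norm (inner_col n y x + inner_col n y y)"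
    by (subst inner_col_add_left) (simp only: inner_col_add_right norm_triangle_ineq)
  also have "\<dots> \<le> (norm_col n x * norm_col n x + norm_col n x * norm_col n y)
      + (norm_col n y * norm_col n x + norm_col n y * norm_col n y)"
    by (intro add_mono norm_triangle_le norm_inner_col_le)
  also have "\<dots> = (norm_col n x + norm_col n y)\<^sup>2"
    by (simp add: power2_eq_square algebra_simps)
  finally show ?thesis
    unfolding norm_col_def[of n "\<lambda>i. x i + y i"]
    by (intro real_le_lsqrt add_nonneg_nonneg norm_col_nonneg norm_ge_zero)
qed

lemma norm_col_scale: "norm_col n (\<lambda>i. of_complex c * x i) = cmod c * norm_col n x"
proof -
  have "inner_col n (\<lambda>i. of_complex c * x i) (\<lambda>i. of_complex c * x i)
      = inner_col n (\<lambda>i. x i * of_complex c) (\<lambda>i. x i * of_complex c)"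
    by (simp only: of_complex_commute)
  also have "\<dots> = of_complex (cnj c) * (inner_col n x x * of_complex c)"
    by (simp only: inner_col_mult_left inner_col_mult_right star_of_complex mult.assoc)
  also have "\<dots> = of_complex (cnj c * c) * inner_col n x x"
    by (simp only: of_complex_mult of_complex_commute[of c "inner_col n x x"] mult.assoc)
  also have "cnj c * c = complex_of_real ((cmod c)\<^sup>2)"
    by (simp add: complex_norm_square mult.commute del: of_real_power)
  finally have "norm (inner_col n (\<lambda>i. of_complex c * x i) (\<lambda>i. of_complex c * x i)) = (cmod c)\<^sup>2 * norm (inner_col n x x)"
    by (simp only: of_complex_of_real scaleR_conv_of_real[symmetric] norm_scaleR abs_power2)
  then show ?thesis
    by (simp add: norm_col_def real_sqrt_mult)
qed

lemma inner_col_mat_vec: "inner_col n (mat_vec n a x) y = inner_col n x (mat_vec n (mat_adj a) y)"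
proof -
  have "inner_col n (mat_vec n a x) y = (\<Sum>i<n. \<Sum>j<n. star (x j) * star (a i j) * y i)"
    by (simp add: inner_col_def mat_vec_def star_sum star_mult sum_distrib_right)
  also have "\<dots> = (\<Sum>j<n. \<Sum>i<n. star (x j) * star (a i j) * y i)"
    by (rule sum.swap)
  also have "\<dots> = inner_col n x (mat_vec n (mat_adj a) y)"
    by (simp add: inner_col_def mat_vec_def mat_adj_def sum_distrib_left mult.assoc)
  finally show ?thesis .
qed

lemma mat_vec_mult: "mat_vec n (mat_mult n a b) x = mat_vec n a (mat_vec n b x)"
proof
  fix i
  have "mat_vec n (mat_mult n a b) x i = (\<Sum>j<n. \<Sum>k<n. a i k * b k j * x j)"
    by (simp add: mat_vec_def mat_mult_def sum_distrib_right)
  also have "\<dots> = (\<Sum>k<n. \<Sum>j<n. a i k * b k j * x j)"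
    by (rule sum.swap)
  also have "\<dots> = mat_vec n a (mat_vec n b x) i"
    by (simp add: mat_vec_def sum_distrib_left mult.assoc)
  finally show "mat_vec n (mat_mult n a b) x i = mat_vec n a (mat_vec n b x) i" .
qed

lemma norm_col_mat_vec_le: "norm_col n (mat_vec n a x) \<le> (\<Sum>i<n. \<Sum>j<n. norm (a i j)) * norm_col n x"
proof -
  have "norm_col n (mat_vec n a x) \<le> (\<Sum>i<n. norm (mat_vec n a x i))"
    by (rule norm_col_le_sum)
  also have "\<dots> \<le> (\<Sum>i<n. \<Sum>j<n. norm (a i j) * norm_col n x)"
    unfolding mat_vec_def
    by (intro sum_mono sum_norm_le order_trans[OF norm_mult_ineq] mult_left_mono norm_entry_le_norm_col) auto
  finally show ?thesis
    by (simp add: sum_distrib_right)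
qed

section \<open>The operator norm of matrices over a subalgebra\<close>

context cstar_subalgebra
begin

text \<open>The test columns have entries in \<open>S\<close> and not in the whole ambient algebra,
  so that under the embedding this is literally the norm of the matrix algebra.\<close>

definition mat_norm :: "nat \<Rightarrow> (nat \<Rightarrow> nat \<Rightarrow> 'a) \<Rightarrow> real" where
  "mat_norm n a = (SUP x\<in>{x. (\<forall>i<n. x i \<in> S) \<and> norm_col n x \<le> 1}. norm_col n (mat_vec n a x))"

lemma mat_norm_least:
  assumes "\<And>x. (\<And>i. i < n \<Longrightarrow> x i \<in> S) \<Longrightarrow> norm_col n (mat_vec n a x) \<le> B * norm_col n x" "0 \<le> B"
  shows "mat_norm n a \<le> B"
  unfolding mat_norm_def
proof (rule cSUP_least)
  have "(\<lambda>_. 0) \<in> {x. (\<forall>i<n. x i \<in> S) \<and> norm_col n x \<le> 1}"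
    by (simp add: norm_col_def inner_col_def)
  then show "{x. (\<forall>i<n. x i \<in> S) \<and> norm_col n x \<le> 1} \<noteq> {}"
    by (intro notI) (simp only: empty_iff)
  fix x assume x: "x \<in> {x. (\<forall>i<n. x i \<in> S) \<and> norm_col n x \<le> 1}"
  then have "norm_col n (mat_vec n a x) \<le> B * norm_col n x"
    using assms(1) by blast
  also have "\<dots> \<le> B * 1"
    using x assms(2) by (intro mult_left_mono) auto
  finally show "norm_col n (mat_vec n a x) \<le> B" by simp
qed

lemma norm_mat_vec_le_mat_norm_unit:
  assumes "\<And>i. i < n \<Longrightarrow> x i \<in> S" "norm_col n x \<le> 1"
  shows "norm_col n (mat_vec n a x) \<le> mat_norm n a"
  unfolding mat_norm_def
proof (rule cSUP_upper)
  show "bdd_above ((\<lambda>x. norm_col n (mat_vec n a x)) ` {x. (\<forall>i<n. x i \<in> S) \<and> norm_col n x \<le> 1})"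
  proof (rule bdd_aboveI2)
    fix x assume "x \<in> {x. (\<forall>i<n. x i \<in> S) \<and> norm_col n x \<le> 1}"
    then have "(\<Sum>i<n. \<Sum>j<n. norm (a i j)) * norm_col n x \<le> (\<Sum>i<n. \<Sum>j<n. norm (a i j)) * 1"
      by (intro mult_left_mono sum_nonneg) auto
    then show "norm_col n (mat_vec n a x) \<le> (\<Sum>i<n. \<Sum>j<n. norm (a i j))"
      using norm_col_mat_vec_le[of n a x] by simp
  qed
qed (use assms in auto)

lemma mat_norm_nonneg: "0 \<le> mat_norm n a"
  using norm_mat_vec_le_mat_norm_unit[of n "\<lambda>_. 0" a] norm_col_nonneg[of n "mat_vec n a (\<lambda>_. 0)"]
  by (simp add: norm_col_def[of n "\<lambda>_. 0"] inner_col_def)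

lemma norm_mat_vec_le:
  assumes x: "\<And>i. i < n \<Longrightarrow> x i \<in> S"
  shows "norm_col n (mat_vec n a x) \<le> mat_norm n a * norm_col n x"
proof (cases "norm_col n x = 0")
  case True
  then show ?thesis
    using norm_col_mat_vec_le[of n a x] by simp
next
  case False
  then have pos: "0 < norm_col n x" using norm_col_nonneg[of n x] by simp
  define c where "c = complex_of_real (1 / norm_col n x)"
  have "norm_col n (mat_vec n a (\<lambda>i. of_complex c * x i)) \<le> mat_norm n a"
  proof (rule norm_mat_vec_le_mat_norm_unit)
    show "of_complex c * x i \<in> S" if "i < n" for i
      unfolding c_def of_complex_of_real scaleR_conv_of_real[symmetric] using x that by (intro scaleR_mem)
    show "norm_col n (\<lambda>i. of_complex c * x i) \<le> 1"
      unfolding norm_col_scale using pos by (simp add: c_def norm_divide)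
  qed
  moreover have "mat_vec n a (\<lambda>i. of_complex c * x i) = (\<lambda>i. of_complex c * mat_vec n a x i)"
  proof
    fix i
    have "a i j * (of_complex c * x j) = of_complex c * (a i j * x j)" for j
      by (metis mult.assoc of_complex_commute)
    then show "mat_vec n a (\<lambda>i. of_complex c * x i) i = of_complex c * mat_vec n a x i"
      by (simp add: mat_vec_def sum_distrib_left)
  qed
  ultimately have "cmod c * norm_col n (mat_vec n a x) \<le> mat_norm n a"
    by (simp add: norm_col_scale)
  then show ?thesis
    using pos by (simp add: c_def norm_divide field_simps)
qed

lemma mat_norm_le_sum: "mat_norm n a \<le> (\<Sum>i<n. \<Sum>j<n. norm (a i j))"
  by (rule mat_norm_least) (auto intro!: norm_col_mat_vec_le sum_nonneg)

lemma mat_vec_mem: "(\<And>i j. i < n \<Longrightarrow> j < n \<Longrightarrow> a i j \<in> S) \<Longrightarrow> (\<And>i. i < n \<Longrightarrow> x i \<in> S) \<Longrightarrow> i < n \<Longrightarrow> mat_vec n a x i \<in> S"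
  unfolding mat_vec_def by (intro sum_mem mult_mem) auto

text \<open>In the absence of a unit the test column is not a basis vector; it carries
  \<open>star (a i j)\<close> at position \<open>j\<close>, and the C*-identity turns the product
  \<open>a i j * star (a i j)\<close> into the square of the norm.\<close>

lemma norm_entry_le_mat_norm:
  assumes a: "\<And>i j. i < n \<Longrightarrow> j < n \<Longrightarrow> a i j \<in> S" and ij: "i < n" "j < n"
  shows "norm (a i j) \<le> mat_norm n a"
proof -
  define x where "x k = (if k = j then star (a i j) else 0)" for k
  have "norm_col n x \<le> (\<Sum>k<n. norm (x k))"
    by (rule norm_col_le_sum)
  also have "\<dots> = (\<Sum>k<n. if k = j then norm (a i j) else 0)"
    by (intro sum.cong) (auto simp: x_def)
  also have "\<dots> = norm (a i j)"
    using ij by simp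
  finally have nx: "norm_col n x \<le> norm (a i j)" .
  have "mat_vec n a x i = (\<Sum>k<n. if k = j then a i j * star (a i j) else 0)"
    unfolding mat_vec_def by (intro sum.cong) (auto simp: x_def)
  then have "mat_vec n a x i = a i j * star (a i j)"
    using ij by simp
  then have "(norm (a i j))\<^sup>2 \<le> norm_col n (mat_vec n a x)"
    using norm_entry_le_norm_col[OF ij(1), of "mat_vec n a x"] by (simp add: norm_mult_star)
  also have "\<dots> \<le> mat_norm n a * norm_col n x"
    by (rule norm_mat_vec_le) (use a ij in \<open>auto simp: x_def intro: star_mem\<close>)
  also have "\<dots> \<le> mat_norm n a * norm (a i j)"
    by (intro mult_left_mono nx mat_norm_nonneg)
  finally show ?thesis
    by (cases "a i j = 0") (auto simp: power2_eq_square mat_norm_nonneg)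
qed

lemma mat_norm_add: "mat_norm n (\<lambda>i j. a i j + b i j) \<le> mat_norm n a + mat_norm n b"
proof (rule mat_norm_least)
  fix x assume x: "\<And>i. i < n \<Longrightarrow> x i \<in> S"
  have "mat_vec n (\<lambda>i j. a i j + b i j) x = (\<lambda>i. mat_vec n a x i + mat_vec n b x i)"
    by (auto simp: mat_vec_def algebra_simps sum.distrib)
  then have "norm_col n (mat_vec n (\<lambda>i j. a i j + b i j) x) \<le> norm_col n (mat_vec n a x) + norm_col n (mat_vec n b x)"
    by (simp add: norm_col_triangle)
  also have "\<dots> \<le> mat_norm n a * norm_col n x + mat_norm n b * norm_col n x"
    by (intro add_mono norm_mat_vec_le x)
  finally show "norm_col n (mat_vec n (\<lambda>i j. a i j + b i j) x) \<le> (mat_norm n a + mat_norm n b) * norm_col n x"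
    by (simp add: distrib_right)
qed (simp add: mat_norm_nonneg)

lemma mat_norm_scale: "mat_norm n (\<lambda>i j. of_complex c * a i j) = cmod c * mat_norm n a"
proof -
  have le: "mat_norm n (\<lambda>i j. of_complex c * a i j) \<le> cmod c * mat_norm n a" for c a
  proof (rule mat_norm_least)
    fix x assume x: "\<And>i. i < n \<Longrightarrow> x i \<in> S"
    have "mat_vec n (\<lambda>i j. of_complex c * a i j) x = (\<lambda>i. of_complex c * mat_vec n a x i)"
      by (auto simp: mat_vec_def sum_distrib_left mult.assoc)
    then have "norm_col n (mat_vec n (\<lambda>i j. of_complex c * a i j) x) = cmod c * norm_col n (mat_vec n a x)"
      by (simp add: norm_col_scale)
    also have "\<dots> \<le> cmod c * (mat_norm n a * norm_col n x)"
      by (intro mult_left_mono norm_mat_vec_le x) auto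
    finally show "norm_col n (mat_vec n (\<lambda>i j. of_complex c * a i j) x) \<le> cmod c * mat_norm n a * norm_col n x"
      by (simp add: mult.assoc)
  qed (simp add: mat_norm_nonneg)
  show ?thesis
  proof (cases "c = 0")
    case True
    then show ?thesis using le[of 0 a] mat_norm_nonneg[of n "\<lambda>i j. of_complex 0 * a i j"] by simp
  next
    case False
    have "of_complex (inverse c) * (of_complex c * x) = x" for x :: 'a
      using False of_complex_of_real[of 1, where 'a = 'a]
      by (simp flip: mult.assoc of_complex_mult)
    then have "mat_norm n a \<le> cmod (inverse c) * mat_norm n (\<lambda>i j. of_complex c * a i j)"
      using le[of "inverse c" "\<lambda>i j. of_complex c * a i j"] by simp
    then have "cmod c * mat_norm n a \<le> mat_norm n (\<lambda>i j. of_complex c * a i j)"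
      using False by (simp add: norm_divide field_simps)
    then show ?thesis using le[of c a] by simp
  qed
qed

lemma mat_norm_mult:
  assumes b: "\<And>i j. i < n \<Longrightarrow> j < n \<Longrightarrow> b i j \<in> S"
  shows "mat_norm n (mat_mult n a b) \<le> mat_norm n a * mat_norm n b"
proof (rule mat_norm_least)
  fix x assume x: "\<And>i. i < n \<Longrightarrow> x i \<in> S"
  have "norm_col n (mat_vec n (mat_mult n a b) x) \<le> mat_norm n a * norm_col n (mat_vec n b x)"
    unfolding mat_vec_mult by (rule norm_mat_vec_le) (rule mat_vec_mem[OF b x])
  also have "\<dots> \<le> mat_norm n a * (mat_norm n b * norm_col n x)"
    by (intro mult_left_mono norm_mat_vec_le x mat_norm_nonneg)
  finally show "norm_col n (mat_vec n (mat_mult n a b) x) \<le> mat_norm n a * mat_norm n b * norm_col n x"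
    by (simp add: mult.assoc)
qed (simp add: mat_norm_nonneg)

text \<open>By adjointness and Cauchy-Schwarz the square of the norm of \<open>a\<close> is at most
  that of the product of the adjoint with \<open>a\<close>. Applied to \<open>a\<close> and to its
  adjoint, this shows that both have the same norm, and submultiplicativity gives the reverse
  inequality.\<close>

lemma mat_norm_adj_mult:
  assumes a: "\<And>i j. i < n \<Longrightarrow> j < n \<Longrightarrow> a i j \<in> S"
  shows "mat_norm n (mat_mult n (mat_adj a) a) = (mat_norm n a)\<^sup>2"
proof -
  have le: "(mat_norm n a)\<^sup>2 \<le> mat_norm n (mat_mult n (mat_adj a) a)"
    if a: "\<And>i j. i < n \<Longrightarrow> j < n \<Longrightarrow> a i j \<in> S" for a
  proof -
    let ?m = "mat_norm n (mat_mult n (mat_adj a) a)"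
    have "mat_norm n a \<le> sqrt ?m"
    proof (rule mat_norm_least)
      fix x assume x: "\<And>i. i < n \<Longrightarrow> x i \<in> S"
      have "(norm_col n (mat_vec n a x))\<^sup>2 = norm (inner_col n x (mat_vec n (mat_mult n (mat_adj a) a) x))"
        by (simp add: norm_col_sq inner_col_mat_vec mat_vec_mult)
      also have "\<dots> \<le> norm_col n x * norm_col n (mat_vec n (mat_mult n (mat_adj a) a) x)"
        by (rule norm_inner_col_le)
      also have "\<dots> \<le> norm_col n x * (?m * norm_col n x)"
        by (intro mult_left_mono norm_mat_vec_le x norm_col_nonneg)
      also have "\<dots> = ?m * (norm_col n x)\<^sup>2"
        by (simp add: power2_eq_square ac_simps)
      finally have "norm_col n (mat_vec n a x) \<le> sqrt (?m * (norm_col n x)\<^sup>2)"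
        by (rule real_le_rsqrt)
      then show "norm_col n (mat_vec n a x) \<le> sqrt ?m * norm_col n x"
        by (simp add: real_sqrt_mult norm_col_nonneg)
    qed (simp add: mat_norm_nonneg)
    then have "(mat_norm n a)\<^sup>2 \<le> (sqrt ?m)\<^sup>2"
      by (intro power_mono mat_norm_nonneg)
    then show ?thesis by (simp add: mat_norm_nonneg)
  qed
  have a': "mat_adj a i j \<in> S" if "i < n" "j < n" for i j
    using a that by (auto simp: mat_adj_def intro: star_mem)
  have le_adj: "mat_norm n a \<le> mat_norm n (mat_adj a)" if a: "\<And>i j. i < n \<Longrightarrow> j < n \<Longrightarrow> a i j \<in> S" for a
  proof (cases "mat_norm n a = 0")
    case False
    have "mat_norm n a * mat_norm n a \<le> mat_norm n (mat_adj a) * mat_norm n a"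
      unfolding power2_eq_square[symmetric]
      by (rule order_trans[OF le[OF a] mat_norm_mult[OF a]])
    then show ?thesis
      using False mat_norm_nonneg[of n a] by (simp add: mult_le_cancel_right)
  qed (simp add: mat_norm_nonneg)
  have "mat_norm n (mat_adj a) \<le> mat_norm n (mat_adj (mat_adj a))"
    by (rule le_adj) (rule a')
  also have "mat_adj (mat_adj a) = a"
    by (intro ext) (simp add: mat_adj_def)
  finally have "mat_norm n (mat_adj a) \<le> mat_norm n a" .
  then have "mat_norm n (mat_adj a) * mat_norm n a \<le> (mat_norm n a)\<^sup>2"
    by (simp add: power2_eq_square mult_right_mono mat_norm_nonneg)
  moreover have "(mat_norm n a)\<^sup>2 \<le> mat_norm n (mat_mult n (mat_adj a) a)"
    by (rule le) (rule a)
  moreover have "mat_norm n (mat_mult n (mat_adj a) a) \<le> mat_norm n (mat_adj a) * mat_norm n a"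
    by (rule mat_norm_mult) (rule a)
  ultimately show ?thesis by linarith
qed

text \<open>As \<open>star y * y\<close> is dominated by \<open>(norm y)\<^sup>2\<close>,
  conjugating by the entries of a column and summing compares two inner products. The sum of the
  norms of the entries would lose a factor \<open>n\<close>, whereas a contraction is
  wanted.\<close>

lemma mat_norm_diag_le: "mat_norm n (\<lambda>i j. if i = j then y else 0) \<le> norm y"
proof (rule mat_norm_least)
  fix x assume x: "\<And>i. i < n \<Longrightarrow> x i \<in> S"
  have "mat_vec n (\<lambda>i j. if i = j then y else 0) x i = y * x i" if "i < n" for i
  proof -
    have "mat_vec n (\<lambda>i j. if i = j then y else 0) x i = (\<Sum>j<n. if j = i then y * x i else 0)"
      unfolding mat_vec_def by (intro sum.cong) auto
    then show ?thesis using that by simp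
  qed
  then have 1: "norm_col n (mat_vec n (\<lambda>i j. if i = j then y else 0) x) = norm_col n (\<lambda>i. y * x i)"
    by (rule norm_col_cong)
  have "(\<Sum>i<n. star (x i) * (of_real ((norm y)\<^sup>2) - star y * y) * x i)
      = (norm y)\<^sup>2 *\<^sub>R inner_col n x x - inner_col n (\<lambda>i. y * x i) (\<lambda>i. y * x i)"
    by (simp add: inner_col_def star_mult scaleR_sum_right sum_subtractf algebra_simps of_real_def)
  moreover have "positive_elem (\<Sum>i<n. star (x i) * (of_real ((norm y)\<^sup>2) - star y * y) * x i)"
    by (intro positive_elem_sum positive_elem_conj positive_elem_norm_diff)
      (simp_all only: star_mult star_star norm_star_mult order_refl)
  ultimately have "positive_elem ((norm y)\<^sup>2 *\<^sub>R inner_col n x x - inner_col n (\<lambda>i. y * x i) (\<lambda>i. y * x i))"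
    by (simp only:)
  then have "norm (inner_col n (\<lambda>i. y * x i) (\<lambda>i. y * x i)) \<le> norm ((norm y)\<^sup>2 *\<^sub>R inner_col n x x)"
    by (rule norm_mono_positive[OF positive_inner_col])
  then have "(norm_col n (\<lambda>i. y * x i))\<^sup>2 \<le> (norm y * norm_col n x)\<^sup>2"
    by (simp add: norm_col_sq power_mult_distrib)
  then show "norm_col n (mat_vec n (\<lambda>i j. if i = j then y else 0) x) \<le> norm y * norm_col n x"
    unfolding 1 by (rule power2_le_imp_le) (simp add: norm_col_nonneg)
qed simp

end

section \<open>Matrix algebras are C*-algebras\<close>

lemma matrix_algebra_simps:
  "a \<in> carrier (matrix_algebra n A) \<longleftrightarrow>
    (\<forall>i<n. \<forall>j<n. a i j \<in> carrier A) \<and> (\<forall>i j. \<not> (i < n \<and> j < n) \<longrightarrow> a i j = \<zero>\<^bsub>A\<^esub>)"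
  "a \<otimes>\<^bsub>matrix_algebra n A\<^esub> b = (\<lambda>i j. \<Oplus>\<^bsub>A\<^esub>k\<in>{..<n}. a i k \<otimes>\<^bsub>A\<^esub> b k j)"
  "\<zero>\<^bsub>matrix_algebra n A\<^esub> = (\<lambda>i j. \<zero>\<^bsub>A\<^esub>)"
  "a \<oplus>\<^bsub>matrix_algebra n A\<^esub> b = (\<lambda>i j. a i j \<oplus>\<^bsub>A\<^esub> b i j)"
  "c \<odot>\<^bsub>matrix_algebra n A\<^esub> a = (\<lambda>i j. c \<odot>\<^bsub>A\<^esub> a i j)"
  "adj (matrix_algebra n A) a = (\<lambda>i j. adj A (a j i))"
  "\<one>\<^bsub>matrix_algebra n A\<^esub> = (\<lambda>i j. if i = j \<and> i < n then \<one>\<^bsub>A\<^esub> else \<zero>\<^bsub>A\<^esub>)"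
  by (simp_all add: matrix_algebra_def)

context cstar_algebra
begin

abbreviation "M n \<equiv> matrix_algebra n A"
abbreviation "emb a \<equiv> (\<lambda>i j. embed A (a i j))"

lemma mat_entry: "a \<in> carrier (M n) \<Longrightarrow> a i j \<in> carrier A"
  by (cases "i < n \<and> j < n") (auto simp: matrix_algebra_simps)

lemma mat_outside: "a \<in> carrier (M n) \<Longrightarrow> \<not> (i < n \<and> j < n) \<Longrightarrow> a i j = \<zero>"
  by (auto simp: matrix_algebra_simps)

lemma mat_carrierI:
  assumes "\<And>i j. a i j \<in> carrier A" "\<And>i j. \<not> (i < n \<and> j < n) \<Longrightarrow> a i j = \<zero>"
  shows "a \<in> carrier (M n)"
  using assms by (auto simp: matrix_algebra_simps)

lemma mat_eqI:
  assumes "a \<in> carrier (M n)" "b \<in> carrier (M n)" "\<And>i j. embed A (a i j) = embed A (b i j)"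
  shows "a = b"
  using assms(3) by (intro ext) (simp add: embed_inject mat_entry[OF assms(1)] mat_entry[OF assms(2)])

lemma emb_mult:
  "a \<in> carrier (M n) \<Longrightarrow> b \<in> carrier (M n) \<Longrightarrow> emb (a \<otimes>\<^bsub>M n\<^esub> b) = mat_mult n (emb a) (emb b)"
  by (intro ext) (simp add: matrix_algebra_simps(2) mat_mult_def embed_finsum mult_closed mat_entry embed_mult)

lemma emb_adj: "a \<in> carrier (M n) \<Longrightarrow> emb (adj (M n) a) = mat_adj (emb a)"
  by (intro ext) (simp add: matrix_algebra_simps(6) mat_adj_def embed_adj mat_entry)

lemma mat_mult_closed: "a \<in> carrier (M n) \<Longrightarrow> b \<in> carrier (M n) \<Longrightarrow> a \<otimes>\<^bsub>M n\<^esub> b \<in> carrier (M n)"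
proof (rule mat_carrierI)
  fix i j assume ab: "a \<in> carrier (M n)" "b \<in> carrier (M n)"
  show "(a \<otimes>\<^bsub>M n\<^esub> b) i j \<in> carrier A"
    unfolding matrix_algebra_simps by (intro finsum_closed) (auto simp: mult_closed mat_entry[OF ab(1)] mat_entry[OF ab(2)])
  assume out: "\<not> (i < n \<and> j < n)"
  have "a i k \<otimes> b k j = \<zero>" for k
    using out mat_outside[OF ab(1)] mat_outside[OF ab(2)] mat_entry[OF ab(1)] mat_entry[OF ab(2)]
    by (metis mult_zero_left mult_zero_right)
  then show "(a \<otimes>\<^bsub>M n\<^esub> b) i j = \<zero>"
    by (simp add: matrix_algebra_simps)
qed

lemma mat_adj_closed: "a \<in> carrier (M n) \<Longrightarrow> adj (M n) a \<in> carrier (M n)"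
  by (rule mat_carrierI) (auto simp: matrix_algebra_simps(6) adj_closed mat_entry mat_outside adj_zero)

lemma mat_add_closed: "a \<in> carrier (M n) \<Longrightarrow> b \<in> carrier (M n) \<Longrightarrow> a \<oplus>\<^bsub>M n\<^esub> b \<in> carrier (M n)"
  by (rule mat_carrierI) (auto simp: matrix_algebra_simps(4) mat_entry mat_outside)

lemma mat_smult_closed: "a \<in> carrier (M n) \<Longrightarrow> c \<odot>\<^bsub>M n\<^esub> a \<in> carrier (M n)"
  by (rule mat_carrierI) (auto simp: matrix_algebra_simps(5) mat_entry mat_outside smult_zero)

lemma mat_zero_closed: "\<zero>\<^bsub>M n\<^esub> \<in> carrier (M n)"
  by (rule mat_carrierI) (auto simp: matrix_algebra_simps(3))

interpretation S: cstar_subalgebra "embed A ` carrier A"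
  by (rule cstar_subalgebra_embed)

abbreviation "mnorm \<equiv> cstar_subalgebra.mat_norm (embed A ` carrier A)"

lemma column_norm_embed:
  assumes "\<And>i. i < n \<Longrightarrow> x i \<in> carrier A"
  shows "column_norm A n x = norm_col n (\<lambda>i. embed A (x i))"
proof -
  have "embed A (\<Oplus>i\<in>{..<n}. adj A (x i) \<otimes> x i) = inner_col n (\<lambda>i. embed A (x i)) (\<lambda>i. embed A (x i))"
    using assms by (subst embed_finsum) (auto simp: mult_closed adj_closed embed_mult embed_adj inner_col_def)
  moreover have "(\<Oplus>i\<in>{..<n}. adj A (x i) \<otimes> x i) \<in> carrier A"
    using assms by (intro finsum_closed) (auto simp: mult_closed adj_closed)
  ultimately show ?thesis
    unfolding column_norm_def norm_col_def by (metis norm_embed)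
qed

text \<open>The two suprema run over columns that correspond under the isometric embedding. From
  here on norms of matrices are handled in the type class.\<close>

lemma cnorm_matrix:
  assumes a: "a \<in> carrier (M n)"
  shows "cnorm (M n) a = mnorm n (emb a)"
proof -
  let ?X = "{x. (\<forall>i<n. x i \<in> carrier A) \<and> column_norm A n x \<le> 1}"
  let ?Y = "{y. (\<forall>i<n. y i \<in> embed A ` carrier A) \<and> norm_col n y \<le> 1}"
  let ?f = "\<lambda>x. column_norm A n (\<lambda>i. \<Oplus>j\<in>{..<n}. a i j \<otimes> x j)"
  let ?g = "\<lambda>y. norm_col n (mat_vec n (emb a) y)"
  have fg: "?f x = ?g (\<lambda>i. embed A (x i))" if x: "\<And>i. i < n \<Longrightarrow> x i \<in> carrier A" for x
  proof -
    have "(\<Oplus>j\<in>{..<n}. a i j \<otimes> x j) \<in> carrier A" for i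
      using x by (intro finsum_closed) (auto simp: mult_closed mat_entry[OF a])
    then have "?f x = norm_col n (\<lambda>i. embed A (\<Oplus>j\<in>{..<n}. a i j \<otimes> x j))"
      by (rule column_norm_embed)
    also have "(\<lambda>i. embed A (\<Oplus>j\<in>{..<n}. a i j \<otimes> x j)) = mat_vec n (emb a) (\<lambda>i. embed A (x i))"
      by (rule ext, subst embed_finsum) (auto simp: mat_vec_def mult_closed mat_entry[OF a] x embed_mult)
    finally show ?thesis .
  qed
  have "?f ` ?X = ?g ` ?Y"
  proof (intro equalityI subsetI)
    fix r assume "r \<in> ?f ` ?X"
    then obtain x where x: "\<forall>i<n. x i \<in> carrier A" "column_norm A n x \<le> 1" "r = ?f x" by auto
    then have "(\<lambda>i. embed A (x i)) \<in> ?Y" "r = ?g (\<lambda>i. embed A (x i))"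
      using column_norm_embed[of n x] fg[of x] by auto
    then show "r \<in> ?g ` ?Y" by blast
  next
    fix r assume "r \<in> ?g ` ?Y"
    then obtain y where y: "\<forall>i<n. y i \<in> embed A ` carrier A" "norm_col n y \<le> 1" "r = ?g y" by auto
    have "\<forall>i. \<exists>x. i < n \<longrightarrow> x \<in> carrier A \<and> y i = embed A x" using y(1) by blast
    from choice[OF this] obtain x where x: "\<And>i. i < n \<Longrightarrow> x i \<in> carrier A" "\<And>i. i < n \<Longrightarrow> y i = embed A (x i)"
      by blast
    have "norm_col n y = norm_col n (\<lambda>i. embed A (x i))"
      using x(2) by (rule norm_col_cong)
    moreover have "mat_vec n (emb a) y = mat_vec n (emb a) (\<lambda>i. embed A (x i))"
      by (rule ext) (simp add: mat_vec_def x(2))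
    ultimately have "x \<in> ?X" "r = ?f x"
      using y x(1) column_norm_embed[OF x(1)] fg[OF x(1)] by auto
    then show "r \<in> ?f ` ?X" by blast
  qed
  then show ?thesis
    by (simp add: matrix_algebra_def S.mat_norm_def)
qed

lemma emb_mem: "a \<in> carrier (M n) \<Longrightarrow> embed A (a i j) \<in> embed A ` carrier A"
  by (simp add: mat_entry)

lemma mat_cnorm_entry: "a \<in> carrier (M n) \<Longrightarrow> cnorm A (a i j) \<le> cnorm (M n) a"
proof -
  assume a: "a \<in> carrier (M n)"
  show "cnorm A (a i j) \<le> cnorm (M n) a"
  proof (cases "i < n \<and> j < n")
    case True
    then show ?thesis
      using S.norm_entry_le_mat_norm[of n "emb a" i j] emb_mem[OF a]
      by (simp add: cnorm_matrix[OF a] norm_embed[OF mat_entry[OF a]])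
  next
    case False
    then show ?thesis
      by (simp add: mat_outside[OF a] cnorm_zero cnorm_matrix[OF a] S.mat_norm_nonneg)
  qed
qed

lemma mat_cnorm_le_sum: "a \<in> carrier (M n) \<Longrightarrow> cnorm (M n) a \<le> (\<Sum>i<n. \<Sum>j<n. cnorm A (a i j))"
  using S.mat_norm_le_sum[of n "emb a"] by (simp add: cnorm_matrix norm_embed mat_entry)

lemma cring_complex_cstar: "cring complex_cstar"
  by (rule R.is_cring)

lemma matrix_module: "Module.module complex_cstar (M n)"
proof (rule moduleI[OF cring_complex_cstar abelian_groupI])
  fix x y z and b c :: complex
  assume x: "x \<in> carrier (M n)"
  show "c \<odot>\<^bsub>M n\<^esub> x \<in> carrier (M n)" by (rule mat_smult_closed[OF x])
  show "(b \<oplus>\<^bsub>complex_cstar\<^esub> c) \<odot>\<^bsub>M n\<^esub> x = b \<odot>\<^bsub>M n\<^esub> x \<oplus>\<^bsub>M n\<^esub> c \<odot>\<^bsub>M n\<^esub> x"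
    by (simp add: matrix_algebra_simps smult_add_left mat_entry[OF x] complex_cstar_def)
  show "(b \<otimes>\<^bsub>complex_cstar\<^esub> c) \<odot>\<^bsub>M n\<^esub> x = b \<odot>\<^bsub>M n\<^esub> (c \<odot>\<^bsub>M n\<^esub> x)"
    by (simp add: matrix_algebra_simps smult_smult mat_entry[OF x] complex_cstar_def)
  show "\<one>\<^bsub>complex_cstar\<^esub> \<odot>\<^bsub>M n\<^esub> x = x" "\<zero>\<^bsub>M n\<^esub> \<oplus>\<^bsub>M n\<^esub> x = x"
    by (simp_all add: matrix_algebra_simps smult_1 mat_entry[OF x] complex_cstar_def)
  show "\<exists>y\<in>carrier (M n). y \<oplus>\<^bsub>M n\<^esub> x = \<zero>\<^bsub>M n\<^esub>"
  proof (rule bexI)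
    show "(- 1) \<odot>\<^bsub>M n\<^esub> x \<oplus>\<^bsub>M n\<^esub> x = \<zero>\<^bsub>M n\<^esub>"
      by (simp add: matrix_algebra_simps smult_minus_1 mat_entry[OF x] l_neg)
  qed (rule mat_smult_closed[OF x])
  assume y: "y \<in> carrier (M n)"
  show "x \<oplus>\<^bsub>M n\<^esub> y \<in> carrier (M n)" by (rule mat_add_closed[OF x y])
  show "c \<odot>\<^bsub>M n\<^esub> (x \<oplus>\<^bsub>M n\<^esub> y) = c \<odot>\<^bsub>M n\<^esub> x \<oplus>\<^bsub>M n\<^esub> c \<odot>\<^bsub>M n\<^esub> y"
    by (simp add: matrix_algebra_simps smult_add_right mat_entry[OF x] mat_entry[OF y])
  show "x \<oplus>\<^bsub>M n\<^esub> y = y \<oplus>\<^bsub>M n\<^esub> x"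
    by (simp add: matrix_algebra_simps a_comm mat_entry[OF x] mat_entry[OF y])
  assume z: "z \<in> carrier (M n)"
  show "x \<oplus>\<^bsub>M n\<^esub> y \<oplus>\<^bsub>M n\<^esub> z = x \<oplus>\<^bsub>M n\<^esub> (y \<oplus>\<^bsub>M n\<^esub> z)"
    by (simp add: matrix_algebra_simps a_assoc mat_entry[OF x] mat_entry[OF y] mat_entry[OF z])
qed (rule mat_zero_closed)

lemma matrix_minus:
  assumes x: "x \<in> carrier (M n)" and y: "y \<in> carrier (M n)"
  shows "x \<ominus>\<^bsub>M n\<^esub> y = (\<lambda>i j. x i j \<ominus> y i j)"
proof -
  interpret M: Module.module complex_cstar "M n" by (rule matrix_module)
  have "\<ominus>\<^bsub>M n\<^esub> y = (- 1) \<odot>\<^bsub>M n\<^esub> y"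
    by (rule M.minus_equality)
      (simp_all add: y mat_smult_closed, simp add: matrix_algebra_simps smult_minus_1 mat_entry[OF y] l_neg)
  then show ?thesis
    by (simp add: a_minus_def matrix_algebra_simps smult_minus_1 mat_entry[OF y])
qed

text \<open>The norm bounds every entry and is bounded by the sum of the norms of the entries, so
  entrywise limits are limits in norm.\<close>

lemma matrix_complete:
  fixes s :: "nat \<Rightarrow> nat \<Rightarrow> nat \<Rightarrow> 'a"
  assumes s: "\<And>k. s k \<in> carrier (M n)"
    and Cauchy: "\<And>e. e > 0 \<Longrightarrow> \<exists>N. \<forall>i\<ge>N. \<forall>j\<ge>N. cnorm (M n) (s i \<ominus>\<^bsub>M n\<^esub> s j) < e"
  shows "\<exists>x\<in>carrier (M n). converges_to (M n) s x"
proof -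
  interpret M: Module.module complex_cstar "M n" by (rule matrix_module)
  have "\<exists>l\<in>carrier A. converges_to A (\<lambda>k. s k i j) l" for i j
  proof (rule complete)
    show "s k i j \<in> carrier A" for k by (rule mat_entry[OF s])
    fix e :: real assume "e > 0"
    then obtain N where N: "\<forall>k\<ge>N. \<forall>l\<ge>N. cnorm (M n) (s k \<ominus>\<^bsub>M n\<^esub> s l) < e"
      using Cauchy by blast
    have "cnorm A (s k i j \<ominus> s l i j) \<le> cnorm (M n) (s k \<ominus>\<^bsub>M n\<^esub> s l)" for k l
      using mat_cnorm_entry[OF M.minus_closed[OF s s], of k l i j] by (simp add: matrix_minus s)
    with N show "\<exists>N. \<forall>k\<ge>N. \<forall>l\<ge>N. cnorm A (s k i j \<ominus> s l i j) < e"
      by (meson le_less_trans)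
  qed
  then obtain l where l: "\<And>i j. l i j \<in> carrier A" "\<And>i j. converges_to A (\<lambda>k. s k i j) (l i j)"
    by metis
  define x where "x i j = (if i < n \<and> j < n then l i j else \<zero>)" for i j
  have x: "x \<in> carrier (M n)"
    by (rule mat_carrierI) (auto simp: x_def l)
  have "(\<lambda>k. cnorm (M n) (s k \<ominus>\<^bsub>M n\<^esub> x)) \<longlonglongrightarrow> 0"
  proof (rule Lim_null_comparison)
    show "\<forall>\<^sub>F k in sequentially. norm (cnorm (M n) (s k \<ominus>\<^bsub>M n\<^esub> x)) \<le> (\<Sum>i<n. \<Sum>j<n. cnorm A (s k i j \<ominus> x i j))"
    proof (rule always_eventually, rule allI)
      fix k
      show "norm (cnorm (M n) (s k \<ominus>\<^bsub>M n\<^esub> x)) \<le> (\<Sum>i<n. \<Sum>j<n. cnorm A (s k i j \<ominus> x i j))"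
        using mat_cnorm_le_sum[OF M.minus_closed[OF s x], of k] S.mat_norm_nonneg
        by (simp add: cnorm_matrix[OF M.minus_closed[OF s x]]) (simp add: matrix_minus s x)
    qed
    have "(\<lambda>k. \<Sum>i<n. \<Sum>j<n. cnorm A (s k i j \<ominus> x i j)) \<longlonglongrightarrow> (\<Sum>i<n. \<Sum>j<n. 0)"
      using l(2) by (intro tendsto_sum) (auto simp: x_def converges_to_def)
    then show "(\<lambda>k. \<Sum>i<n. \<Sum>j<n. cnorm A (s k i j \<ominus> x i j)) \<longlonglongrightarrow> 0" by simp
  qed
  with x show ?thesis
    by (auto simp: converges_to_def)
qed

lemma matrix_cstar_algebra: "cstar_algebra (M n)"
proof (intro cstar_algebra.intro cstar_algebra_axioms.intro)
  show "Module.module complex_cstar (M n)" by (rule matrix_module)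
next
  fix x y assume x: "x \<in> carrier (M n)" and y: "y \<in> carrier (M n)"
  note xy = mat_entry[OF x] mat_entry[OF y]
  show "x \<otimes>\<^bsub>M n\<^esub> y \<in> carrier (M n)" by (rule mat_mult_closed[OF x y])
  show "(c \<odot>\<^bsub>M n\<^esub> x) \<otimes>\<^bsub>M n\<^esub> y = c \<odot>\<^bsub>M n\<^esub> (x \<otimes>\<^bsub>M n\<^esub> y)" for c
  proof (rule mat_eqI[where n = n])
    fix i j
    have "embed A (((c \<odot>\<^bsub>M n\<^esub> x) \<otimes>\<^bsub>M n\<^esub> y) i j) = (\<Sum>k<n. of_complex c * (embed A (x i k) * embed A (y k j)))"
      by (simp add: matrix_algebra_simps embed_finsum mult_closed embed_mult embed_smult xy mult.assoc)
    also have "\<dots> = embed A ((c \<odot>\<^bsub>M n\<^esub> (x \<otimes>\<^bsub>M n\<^esub> y)) i j)"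
      using mat_entry[OF mat_mult_closed[OF x y], of i j]
      by (simp add: matrix_algebra_simps embed_finsum mult_closed embed_mult embed_smult xy sum_distrib_left)
    finally show "embed A (((c \<odot>\<^bsub>M n\<^esub> x) \<otimes>\<^bsub>M n\<^esub> y) i j) = embed A ((c \<odot>\<^bsub>M n\<^esub> (x \<otimes>\<^bsub>M n\<^esub> y)) i j)" .
  qed (intro mat_mult_closed mat_smult_closed x y)+
  show "x \<otimes>\<^bsub>M n\<^esub> (c \<odot>\<^bsub>M n\<^esub> y) = c \<odot>\<^bsub>M n\<^esub> (x \<otimes>\<^bsub>M n\<^esub> y)" for c
  proof (rule mat_eqI[where n = n])
    fix i j
    have comm: "u * (of_complex c * v) = of_complex c * (u * v)" for u v :: "'a cproduct unitization"
      by (metis mult.assoc of_complex_commute)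
    have "embed A ((x \<otimes>\<^bsub>M n\<^esub> (c \<odot>\<^bsub>M n\<^esub> y)) i j) = (\<Sum>k<n. embed A (x i k) * (of_complex c * embed A (y k j)))"
      by (simp add: matrix_algebra_simps embed_finsum mult_closed embed_mult embed_smult xy)
    also have "\<dots> = (\<Sum>k<n. of_complex c * (embed A (x i k) * embed A (y k j)))"
      by (simp only: comm)
    also have "\<dots> = embed A ((c \<odot>\<^bsub>M n\<^esub> (x \<otimes>\<^bsub>M n\<^esub> y)) i j)"
      using mat_entry[OF mat_mult_closed[OF x y], of i j]
      by (simp add: matrix_algebra_simps embed_finsum mult_closed embed_mult embed_smult xy sum_distrib_left)
    finally show "embed A ((x \<otimes>\<^bsub>M n\<^esub> (c \<odot>\<^bsub>M n\<^esub> y)) i j) = embed A ((c \<odot>\<^bsub>M n\<^esub> (x \<otimes>\<^bsub>M n\<^esub> y)) i j)" .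
  qed (intro mat_mult_closed mat_smult_closed x y)+
  show "adj (M n) (x \<oplus>\<^bsub>M n\<^esub> y) = adj (M n) x \<oplus>\<^bsub>M n\<^esub> adj (M n) y"
    by (simp add: matrix_algebra_simps adj_add xy)
  show "adj (M n) (x \<otimes>\<^bsub>M n\<^esub> y) = adj (M n) y \<otimes>\<^bsub>M n\<^esub> adj (M n) x"
  proof (rule mat_eqI[where n = n])
    fix i j
    have e: "embed A ((x \<otimes>\<^bsub>M n\<^esub> y) j i) = (\<Sum>k<n. embed A (x j k) * embed A (y k i))"
      by (simp add: matrix_algebra_simps embed_finsum mult_closed embed_mult xy)
    have "embed A (adj (M n) (x \<otimes>\<^bsub>M n\<^esub> y) i j) = star (embed A ((x \<otimes>\<^bsub>M n\<^esub> y) j i))"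
      using mat_entry[OF mat_mult_closed[OF x y]] by (simp add: matrix_algebra_simps(6) embed_adj)
    also have "\<dots> = (\<Sum>k<n. star (embed A (y k i)) * star (embed A (x j k)))"
      by (simp add: e star_sum star_mult)
    also have "\<dots> = embed A ((adj (M n) y \<otimes>\<^bsub>M n\<^esub> adj (M n) x) i j)"
      by (simp add: matrix_algebra_simps embed_finsum mult_closed embed_mult embed_adj adj_closed xy)
    finally show "embed A (adj (M n) (x \<otimes>\<^bsub>M n\<^esub> y) i j) = embed A ((adj (M n) y \<otimes>\<^bsub>M n\<^esub> adj (M n) x) i j)" .
  qed (intro mat_mult_closed mat_adj_closed x y)+
  show "cnorm (M n) (x \<oplus>\<^bsub>M n\<^esub> y) \<le> cnorm (M n) x + cnorm (M n) y"
    using S.mat_norm_add[of n "emb x" "emb y"]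
    by (simp add: cnorm_matrix x y mat_add_closed) (simp add: matrix_algebra_simps embed_add xy)
  show "cnorm (M n) (x \<otimes>\<^bsub>M n\<^esub> y) \<le> cnorm (M n) x * cnorm (M n) y"
    unfolding cnorm_matrix[OF x] cnorm_matrix[OF y] cnorm_matrix[OF mat_mult_closed[OF x y]] emb_mult[OF x y]
    by (rule S.mat_norm_mult) (rule emb_mem[OF y])
  fix z assume z: "z \<in> carrier (M n)"
  note xyz = xy mat_entry[OF z]
  show "x \<otimes>\<^bsub>M n\<^esub> y \<otimes>\<^bsub>M n\<^esub> z = x \<otimes>\<^bsub>M n\<^esub> (y \<otimes>\<^bsub>M n\<^esub> z)"
  proof (rule mat_eqI[where n = n])
    fix i j
    have e: "embed A ((u \<otimes>\<^bsub>M n\<^esub> v) i j) = (\<Sum>k<n. embed A (u i k) * embed A (v k j))"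
      if "u \<in> carrier (M n)" "v \<in> carrier (M n)" for u v i j
      by (simp add: matrix_algebra_simps(2) embed_finsum mult_closed embed_mult mat_entry[OF that(1)] mat_entry[OF that(2)])
    have "embed A ((x \<otimes>\<^bsub>M n\<^esub> y \<otimes>\<^bsub>M n\<^esub> z) i j)
        = (\<Sum>k<n. \<Sum>l<n. embed A (x i l) * embed A (y l k) * embed A (z k j))"
      by (simp add: e x y z mat_mult_closed sum_distrib_right)
    also have "\<dots> = (\<Sum>l<n. \<Sum>k<n. embed A (x i l) * embed A (y l k) * embed A (z k j))"
      by (rule sum.swap)
    also have "\<dots> = embed A ((x \<otimes>\<^bsub>M n\<^esub> (y \<otimes>\<^bsub>M n\<^esub> z)) i j)"
      by (simp add: e x y z mat_mult_closed sum_distrib_left mult.assoc)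
    finally show "embed A ((x \<otimes>\<^bsub>M n\<^esub> y \<otimes>\<^bsub>M n\<^esub> z) i j) = embed A ((x \<otimes>\<^bsub>M n\<^esub> (y \<otimes>\<^bsub>M n\<^esub> z)) i j)" .
  qed (intro mat_mult_closed x y z)+
  show "(x \<oplus>\<^bsub>M n\<^esub> y) \<otimes>\<^bsub>M n\<^esub> z = x \<otimes>\<^bsub>M n\<^esub> z \<oplus>\<^bsub>M n\<^esub> y \<otimes>\<^bsub>M n\<^esub> z"
    by (intro mat_eqI[where n = n] mat_mult_closed mat_add_closed x y z)
      (simp add: matrix_algebra_simps embed_finsum mult_closed embed_mult embed_add xyz distrib_right sum.distrib)
  show "z \<otimes>\<^bsub>M n\<^esub> (x \<oplus>\<^bsub>M n\<^esub> y) = z \<otimes>\<^bsub>M n\<^esub> x \<oplus>\<^bsub>M n\<^esub> z \<otimes>\<^bsub>M n\<^esub> y"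
    by (intro mat_eqI[where n = n] mat_mult_closed mat_add_closed x y z)
      (simp add: matrix_algebra_simps embed_finsum mult_closed embed_mult embed_add xyz distrib_left sum.distrib)
next
  fix x c assume x: "x \<in> carrier (M n)"
  note xx = mat_entry[OF x]
  show "adj (M n) x \<in> carrier (M n)" by (rule mat_adj_closed[OF x])
  show "adj (M n) (adj (M n) x) = x"
    by (simp add: matrix_algebra_simps adj_adj xx)
  show "adj (M n) (c \<odot>\<^bsub>M n\<^esub> x) = cnj c \<odot>\<^bsub>M n\<^esub> adj (M n) x"
    by (simp add: matrix_algebra_simps adj_smult xx)
  show "0 \<le> cnorm (M n) x"
    by (simp add: cnorm_matrix x S.mat_norm_nonneg)
  show "cnorm (M n) x = 0 \<longleftrightarrow> x = \<zero>\<^bsub>M n\<^esub>"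
  proof
    assume "cnorm (M n) x = 0"
    then have "x i j = \<zero>" for i j
      using mat_cnorm_entry[OF x, of i j] cnorm_nonneg[OF xx, of i j] cnorm_eq_zero_iff[OF xx, of i j] by simp
    then show "x = \<zero>\<^bsub>M n\<^esub>"
      by (intro ext) (simp add: matrix_algebra_simps)
  next
    assume "x = \<zero>\<^bsub>M n\<^esub>"
    then have "cnorm (M n) x \<le> 0"
      using mat_cnorm_le_sum[OF x] by (simp add: matrix_algebra_simps cnorm_zero)
    then show "cnorm (M n) x = 0"
      using S.mat_norm_nonneg[of n "emb x"] by (simp add: cnorm_matrix x)
  qed
  show "cnorm (M n) (c \<odot>\<^bsub>M n\<^esub> x) = cmod c * cnorm (M n) x"
    using S.mat_norm_scale[of n c "emb x"]
    by (simp add: cnorm_matrix x mat_smult_closed) (simp add: matrix_algebra_simps embed_smult xx)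
  show "cnorm (M n) (adj (M n) x \<otimes>\<^bsub>M n\<^esub> x) = (cnorm (M n) x)\<^sup>2"
    unfolding cnorm_matrix[OF x] cnorm_matrix[OF mat_mult_closed[OF mat_adj_closed[OF x] x]]
      emb_mult[OF mat_adj_closed[OF x] x] emb_adj[OF x]
    by (rule S.mat_norm_adj_mult) (rule emb_mem[OF x])
next
  fix s :: "nat \<Rightarrow> nat \<Rightarrow> nat \<Rightarrow> 'a"
  assume s: "\<And>k. s k \<in> carrier (M n)"
    and Cauchy: "\<And>e. e > 0 \<Longrightarrow> \<exists>N. \<forall>i\<ge>N. \<forall>j\<ge>N. cnorm (M n) (s i \<ominus>\<^bsub>M n\<^esub> s j) < e"
  show "\<exists>x\<in>carrier (M n). converges_to (M n) s x" by (rule matrix_complete[OF s Cauchy])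
qed

end

section \<open>Simple subalgebras and minimal projections\<close>

lemma of_complex_eq_0:
  fixes p :: "'a::cstar_unital"
  assumes "of_complex c * p = 0" "p \<noteq> 0"
  shows "c = 0"
proof (rule ccontr)
  assume "c \<noteq> 0"
  then have "p = of_complex (inverse c * c) * p"
    using of_complex_of_real[of 1, where 'a = 'a] by simp
  also have "\<dots> = of_complex (inverse c) * (of_complex c * p)"
    by (simp only: of_complex_mult mult.assoc)
  finally show False
    using assms by simp
qed

lemma of_complex_diff: "of_complex (y - z) = of_complex y - (of_complex z :: 'a::cstar_unital)"
  using of_complex_add[of "y - z" z, where 'a = 'a] by (simp add: eq_diff_eq)

lemma of_complex_inject:
  fixes p :: "'a::cstar_unital"
  assumes "of_complex b * p = of_complex c * p" "p \<noteq> 0"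
  shows "b = c"
proof -
  have "of_complex (b - c) * p = 0"
    using assms(1) by (simp add: of_complex_diff left_diff_distrib)
  with of_complex_eq_0[OF this assms(2)] show ?thesis by simp
qed

section \<open>Minimal projections from elements that do not split\<close>

context cstar_subalgebra
begin

lemma of_complex_mem: "x \<in> S \<Longrightarrow> of_complex c * x \<in> S"
  unfolding of_complex_def distrib_right
  by (simp add: add_mem scaleR_mem imag_mem flip: scaleR_conv_of_real)

definition minimal_projection :: "'a \<Rightarrow> bool" where
  "minimal_projection p \<longleftrightarrow> p \<in> S \<and> p \<noteq> 0 \<and> star p = p \<and> p * p = p \<and>
     (\<forall>x\<in>S. \<exists>c. p * x * p = of_complex c * p)"

text \<open>Being below \<open>b\<close> is expressed by membership in the right ideal generated by
  \<open>b\<close>. This passes through repeated splitting and later yields columns that are right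
  multiples of \<open>b\<close>.\<close>

definition split_pair :: "'a \<Rightarrow> 'a \<Rightarrow> 'a \<Rightarrow> bool" where
  "split_pair b b1 b2 \<longleftrightarrow> positive_elem b1 \<and> positive_elem b2 \<and> b1 \<noteq> 0 \<and> b2 \<noteq> 0 \<and> b1 * b2 = 0 \<and>
     (\<exists>u\<in>S. b1 = b * u) \<and> (\<exists>u\<in>S. b2 = b * u)"

text \<open>If the spectrum met both the open interval from 0 to \<open>1 - \<delta>\<close> and a
  neighbourhood of 1, two functions with these supports would split \<open>b\<close>. As 1 is
  attained by the norm, the lower function vanishes at \<open>b\<close>, and then
  \<open>b - b * b\<close> has norm at most \<delta>.\<close>

lemma projection_if_no_split:
  assumes b: "b \<in> S" "positive_elem b" "norm b = 1" and no: "\<nexists>b1 b2. split_pair b b1 b2"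
  shows "b * b = b"
proof -
  note sb = positive_elem_star[OF b(2)]
  have "norm (b - b * b) \<le> 0 + \<delta>" if \<delta>: "0 < \<delta>" "\<delta> < 1" for \<delta>
  proof -
    let ?f = "\<lambda>t. max (t - (1 - \<delta>)) 0" and ?m = "\<lambda>t. max (1 - \<delta> - t) 0"
    \<comment> \<open>The factor \<open>t\<close> makes the squares of both functions divisible by
      \<open>t\<close> with a quotient that still vanishes at 0, so that the cofactor of
      \<open>b\<close> lies in \<open>S\<close>. The supports are separated by the point
      \<open>1 - \<delta>\<close>.\<close>
    let ?P = "\<lambda>t. t * ?f t" and ?Q = "\<lambda>t. t * ?m t"
    have contf: "continuous_on UNIV ?f" and contm: "continuous_on UNIV ?m"
      by (intro continuous_intros)+
    have contP: "continuous_on UNIV ?P" and contQ: "continuous_on UNIV ?Q"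
      by (intro continuous_on_mult continuous_on_id contf contm)+
    define P where "P = fcalc ?P b"
    define Q where "Q = fcalc ?Q b"
    have sP: "star P = P" and sQ: "star Q = Q"
      unfolding P_def Q_def by (rule star_fcalc[OF sb contP], rule star_fcalc[OF sb contQ])
    have fact: "\<exists>u\<in>S. fcalc (\<lambda>t. t * g t) b * fcalc (\<lambda>t. t * g t) b = b * u"
      if g: "continuous_on UNIV g" for g
    proof
      have c: "continuous_on UNIV (\<lambda>t. g t * (t * g t))" "continuous_on UNIV (\<lambda>t. t * g t)"
        by (intro continuous_on_mult continuous_on_id g)+
      show "fcalc (\<lambda>t. g t * (t * g t)) b \<in> S"
        by (rule fcalc_mem[OF b(1) sb c(1)]) simp
      have "fcalc (\<lambda>t. t * g t) b * fcalc (\<lambda>t. t * g t) b = fcalc (\<lambda>t. t * g t * (t * g t)) b"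
        by (rule fcalc_mult[OF sb c(2) c(2), symmetric])
      also have "(\<lambda>t. t * g t * (t * g t)) = (\<lambda>t. t * (g t * (t * g t)))"
        by (simp only: mult.assoc)
      also have "fcalc (\<lambda>t. t * (g t * (t * g t))) b = fcalc (\<lambda>t. t) b * fcalc (\<lambda>t. g t * (t * g t)) b"
        by (rule fcalc_mult[OF sb continuous_on_id c(1)])
      finally show "fcalc (\<lambda>t. t * g t) b * fcalc (\<lambda>t. t * g t) b = b * fcalc (\<lambda>t. g t * (t * g t)) b"
        by (simp only: fcalc_id[OF sb])
    qed
    have "P * Q = fcalc (\<lambda>t. ?P t * ?Q t) b"
      unfolding P_def Q_def by (rule fcalc_mult[OF sb contP contQ, symmetric])
    also have "(\<lambda>t. ?P t * ?Q t) = (\<lambda>t. 0)"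
      using \<delta> by (auto simp: max_def)
    finally have PQ: "P * Q = 0"
      by (simp only: fcalc_const[OF sb] of_real_0)
    have "P \<noteq> 0"
    proof
      assume "P = 0"
      \<comment> \<open>Division by \<open>t\<close> on the support of \<open>?f\<close> recovers
        \<open>?f\<close> from \<open>?P\<close>. If \<open>?f\<close> vanished at \<open>b\<close>,
        then \<open>b\<close> would be within \<open>1 - \<delta>\<close> of 0, against its norm
        being 1.\<close>
      let ?k = "\<lambda>t. 1 / max t (1 - \<delta>)"
      have contk: "continuous_on UNIV ?k"
        using \<delta> by (intro continuous_intros) (auto simp: max_def)
      have "(\<lambda>t. ?P t * ?k t) = ?f"
        using \<delta> by (auto simp: max_def)
      then have "fcalc ?f b = P * fcalc ?k b"
        unfolding P_def using fcalc_mult[OF sb contP contk] by simp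
      then have "fcalc ?f b = 0" by (simp only: \<open>P = 0\<close> mult_zero_left)
      moreover have "norm (b - fcalc ?f b) \<le> 1 - \<delta>"
        by (rule norm_sub_fcalc_cut[OF b(2)]) (use \<delta> in simp)
      ultimately show False
        using b(3) \<delta> by simp
    qed
    have "Q = 0"
    proof (rule ccontr)
      assume "Q \<noteq> 0"
      have "split_pair b (P * P) (Q * Q)"
        unfolding split_pair_def
      proof (intro conjI)
        show "positive_elem (P * P)" "positive_elem (Q * Q)"
          by (rule positive_elem_square[OF sP], rule positive_elem_square[OF sQ])
        show "P * P \<noteq> 0" "Q * Q \<noteq> 0"
          using star_mult_eq_0_iff[of P] star_mult_eq_0_iff[of Q] \<open>P \<noteq> 0\<close> \<open>Q \<noteq> 0\<close> by (simp_all add: sP sQ)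
        have "P * P * (Q * Q) = P * (P * Q) * Q" by (simp only: mult.assoc)
        then show "P * P * (Q * Q) = 0" by (simp add: PQ)
        show "\<exists>u\<in>S. P * P = b * u" unfolding P_def by (rule fact[OF contf])
        show "\<exists>u\<in>S. Q * Q = b * u" unfolding Q_def by (rule fact[OF contm])
      qed
      then show False using no by blast
    qed
    have c1: "continuous_on UNIV (\<lambda>t::real. t * t)" "continuous_on UNIV (\<lambda>t::real. t - t * t)"
      by (intro continuous_intros)+
    have "b - b * b = fcalc (\<lambda>t. t) b - fcalc (\<lambda>t. t * t) b - Q"
      by (simp only: \<open>Q = 0\<close> fcalc_mult[OF sb continuous_on_id continuous_on_id] fcalc_id[OF sb] diff_zero)
    also have "\<dots> = fcalc (\<lambda>t. t - t * t - ?Q t) b"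
      unfolding Q_def fcalc_diff[OF sb continuous_on_id c1(1), symmetric]
      by (rule fcalc_diff[OF sb c1(2) contQ, symmetric])
    also have "norm \<dots> \<le> \<delta>"
    proof (rule norm_fcalc_positive_le[OF b(2)])
      show "continuous_on UNIV (\<lambda>t. t - t * t - ?Q t)"
        by (intro continuous_on_diff c1(2) contQ)
      fix t :: real assume t: "0 \<le> t" "t \<le> norm b"
      show "\<bar>t - t * t - ?Q t\<bar> \<le> \<delta>"
      proof (cases "t \<le> 1 - \<delta>")
        case True
        then have "?m t = 1 - \<delta> - t" by simp
        then have "t - t * t - ?Q t = t * \<delta>" by (simp only:) (simp add: algebra_simps)
        moreover have "t * \<delta> \<le> 1 * \<delta>" using t b(3) \<delta> by (intro mult_right_mono) auto
        ultimately show ?thesis using t \<delta> by simp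
      next
        case False
        then have "t - t * t - ?Q t = t * (1 - t)" by (simp add: max_def algebra_simps)
        moreover have "t * (1 - t) \<le> 1 * (1 - t)" using t b(3) by (intro mult_right_mono) auto
        moreover have "0 \<le> t * (1 - t)" using t b(3) by (intro mult_nonneg_nonneg) auto
        ultimately show ?thesis using False by simp
      qed
    qed
    finally show ?thesis by simp
  qed
  note le = this
  have "norm (b - b * b) \<le> 0"
  proof (rule field_le_epsilon)
    fix e :: real assume "0 < e"
    then have "norm (b - b * b) \<le> 0 + min e (1/2)"
      by (intro le) auto
    then show "norm (b - b * b) \<le> 0 + e" by simp
  qed
  then show ?thesis by simp
qed

lemma split_pair_mono:
  assumes "split_pair h b1 b2" "h = b * c" "c \<in> S"
  shows "split_pair b b1 b2"
proof -
  have "\<exists>u\<in>S. y = b * u" if "\<exists>u\<in>S. y = h * u" for y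
  proof -
    from that obtain u where "u \<in> S" "y = h * u" by blast
    then show ?thesis
      using assms by (intro bexI[of _ "c * u"]) (simp_all add: mult.assoc mult_mem)
  qed
  with assms(1) show ?thesis
    unfolding split_pair_def by blast
qed

text \<open>After normalization \<open>b\<close> is a projection \<open>p\<close>. For
  \<open>z\<close> in the corner of \<open>p\<close> the product \<open>star z * z\<close> is a
  multiple of \<open>p\<close>: normalized, it is a projection \<open>h\<close> which does not split
  either, and \<open>h\<close> and \<open>p - h\<close> would split \<open>p\<close> if they were
  both nonzero. Polarization with \<open>h + p\<close> and \<open>h - p\<close> extends this to
  self-adjoint elements of the corner, and real and imaginary parts cover the rest.\<close>

lemma minimal_projection_if_no_split:
  assumes b: "b \<in> S" "positive_elem b" "b \<noteq> 0" and no: "\<nexists>b1 b2. split_pair b b1 b2"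
  shows "\<exists>p. minimal_projection p"
proof -
  define p where "p = inverse (norm b) *\<^sub>R b"
  have pS: "p \<in> S" and pp: "positive_elem p" and np: "norm p = 1"
    using b by (auto simp: p_def scaleR_mem intro!: positive_elem_scaleR)
  have sp: "star p = p" by (rule positive_elem_star[OF pp])
  have nosp: "\<nexists>b1 b2. split_pair p b1 b2"
  proof (intro notI, elim exE)
    fix b1 b2 assume sp2: "split_pair p b1 b2"
    have "\<exists>u\<in>S. y = b * u" if "\<exists>u\<in>S. y = p * u" for y
    proof -
      from that obtain u where "u \<in> S" "y = p * u" by blast
      then show ?thesis
        by (intro bexI[of _ "inverse (norm b) *\<^sub>R u"]) (simp_all add: p_def scaleR_mem)
    qed
    with sp2 have "split_pair b b1 b2"
      unfolding split_pair_def by blast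
    with no show False by blast
  qed
  have p: "p * p = p" by (rule projection_if_no_split[OF pS pp np nosp])
  have p_left: "p * (p * x) = p * x" for x by (simp add: p flip: mult.assoc)
  have sq: "\<exists>r. star z * z = r *\<^sub>R p" if z: "z \<in> S" "p * z = z" "z * p = z" for z
  proof (cases "z = 0")
    case True
    then show ?thesis by (intro exI[of _ 0]) simp
  next
    case False
    define h where "h = inverse (norm (star z * z)) *\<^sub>R (star z * z)"
    have nz: "norm (star z * z) \<noteq> 0"
      using False by (simp add: star_mult_eq_0_iff)
    have hS: "h \<in> S" and hp: "positive_elem h" and nh: "norm h = 1"
      using nz by (auto simp: h_def intro!: scaleR_mem mult_mem star_mem z positive_elem_scaleR positive_elem_star_mult)
    have "star z * p = star z" "p * star z = star z"
      using arg_cong[OF z(2), of star] arg_cong[OF z(3), of star] by (simp_all add: star_mult sp)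
    then have ph: "p * h = h" and hp': "h * p = h"
      using z by (simp_all add: h_def mult.assoc flip: mult.assoc[of p])
    have sh: "star h = h" by (rule positive_elem_star[OF hp])
    have "\<nexists>b1 b2. split_pair h b1 b2"
      using nosp split_pair_mono[of h _ _ p h] ph hS by metis
    from projection_if_no_split[OF hS hp nh this] have hh: "h * h = h" .
    have "h = p"
    proof (rule ccontr)
      assume "h \<noteq> p"
      have dd: "(p - h) * (p - h) = p - h"
        by (simp add: algebra_simps p ph hp' hh)
      have "split_pair p h (p - h)"
        unfolding split_pair_def
      proof (intro conjI)
        show "positive_elem h" by (rule hp)
        have "star (p - h) = p - h" by (simp add: star_diff sp sh)
        from positive_elem_square[OF this] show "positive_elem (p - h)" by (simp only: dd)
        show "h \<noteq> 0" using nh by auto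
        show "p - h \<noteq> 0" using \<open>h \<noteq> p\<close> by simp
        show "h * (p - h) = 0" by (simp add: algebra_simps hp' hh)
        show "\<exists>u\<in>S. h = p * u" by (rule bexI[of _ h]) (simp_all add: ph hS)
        show "\<exists>u\<in>S. p - h = p * u"
          by (rule bexI[of _ "p - h"]) (simp_all add: algebra_simps p ph hS pS diff_mem)
      qed
      with nosp show False by blast
    qed
    moreover have "star z * z = norm (star z * z) *\<^sub>R h"
      using nz by (simp add: h_def)
    ultimately show ?thesis by blast
  qed
  have sa: "\<exists>r. p * x * p = r *\<^sub>R p" if x: "x \<in> S" "star x = x" for x
  proof -
    define h where "h = p * x * p"
    have h: "h \<in> S" "p * h = h" "h * p = h" "star h = h"
      using x by (auto simp: h_def star_mult sp p p_left mult.assoc intro!: mult_mem pS)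
    have "\<exists>r. star (h + p) * (h + p) = r *\<^sub>R p"
      by (rule sq) (simp_all add: add_mem h pS p distrib_left distrib_right)
    moreover have "\<exists>r. star (h - p) * (h - p) = r *\<^sub>R p"
      by (rule sq) (simp_all add: diff_mem h pS p left_diff_distrib right_diff_distrib)
    ultimately obtain r s where rs: "star (h + p) * (h + p) = r *\<^sub>R p" "star (h - p) * (h - p) = s *\<^sub>R p"
      by blast
    have "star (h + p) * (h + p) - star (h - p) * (h - p) = 4 *\<^sub>R h"
      using h p scaleR_left_distrib[of 2 2 h]
      by (simp add: star_add star_diff sp algebra_simps scaleR_2)
    then have "4 *\<^sub>R h = (r - s) *\<^sub>R p"
      unfolding rs by (simp add: scaleR_left_diff_distrib)
    then have "h = ((r - s) / 4) *\<^sub>R p"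
      by (metis (no_types) divide_inverse_commute inverse_eq_divide scaleR_scaleR scaleR_one
          nonzero_mult_div_cancel_left zero_neq_numeral times_divide_eq_left mult_1 eq_divide_eq)
    then show ?thesis
      unfolding h_def by blast
  qed
  have "\<exists>c. p * x * p = of_complex c * p" if x: "x \<in> S" for x
  proof -
    let ?y = "imag_unit * (x - star x)"
    have "star (x + star x) = x + star x" "star ?y = ?y"
      by (simp_all add: star_add star_mult star_diff star_imag_unit imag_unit_commute algebra_simps)
    then obtain r s where r: "p * (x + star x) * p = r *\<^sub>R p" and s: "p * ?y * p = s *\<^sub>R p"
      using sa[of "x + star x"] sa[of ?y] x by (meson add_mem diff_mem imag_mem star_mem)
    have "imag_unit * ?y = - (x - star x)"
      by (simp add: imag_unit_sq flip: mult.assoc)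
    then have "p * - (x - star x) * p = p * (imag_unit * ?y) * p" by simp
    also have "\<dots> = imag_unit * (p * ?y * p)"
      by (metis imag_unit_commute mult.assoc)
    finally have "- (p * (x - star x) * p) = s *\<^sub>R (imag_unit * p)"
      by (simp only: s mult_minus_left mult_minus_right mult_scaleR_right)
    then have d: "p * (x - star x) * p = - (s *\<^sub>R (imag_unit * p))"
      by (metis minus_minus)
    have "2 *\<^sub>R (p * x * p) = p * (x + star x) * p + p * (x - star x) * p"
      by (simp add: algebra_simps scaleR_2)
    also have "\<dots> = of_complex (Complex r (- s)) * p"
      unfolding r d by (simp add: of_complex_def algebra_simps of_real_def)
    finally have "(1/2) *\<^sub>R (2 *\<^sub>R (p * x * p)) = (1/2) *\<^sub>R (of_complex (Complex r (- s)) * p)"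
      by simp
    then have "p * x * p = (1/2) *\<^sub>R (of_complex (Complex r (- s)) * p)"
      by simp
    also have "\<dots> = of_complex (complex_of_real (1/2)) * (of_complex (Complex r (- s)) * p)"
      by (simp only: of_complex_of_real scaleR_conv_of_real)
    also have "\<dots> = of_complex (complex_of_real (1/2) * Complex r (- s)) * p"
      by (simp only: of_complex_mult mult.assoc)
    finally have "p * x * p = of_complex (complex_of_real (1/2) * Complex r (- s)) * p" .
    then show ?thesis by blast
  qed
  then have "minimal_projection p"
    using pS sp p np by (auto simp: minimal_projection_def)
  then show ?thesis by blast
qed

end

section \<open>Primeness and orthogonal equivalent elements in a simple subalgebra\<close>

locale simple_cstar_subalgebra = cstar_subalgebra +
  assumes nontrivial: "S \<noteq> {0}"
    and simple: "\<And>T. T \<subseteq> S \<Longrightarrow> closed T \<Longrightarrow> 0 \<in> T \<Longrightarrow> (\<And>x y. x \<in> T \<Longrightarrow> y \<in> T \<Longrightarrow> x + y \<in> T)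
      \<Longrightarrow> (\<And>c x. x \<in> T \<Longrightarrow> of_complex c * x \<in> T)
      \<Longrightarrow> (\<And>a x. a \<in> S \<Longrightarrow> x \<in> T \<Longrightarrow> a * x \<in> T) \<Longrightarrow> (\<And>a x. a \<in> S \<Longrightarrow> x \<in> T \<Longrightarrow> x * a \<in> T)
      \<Longrightarrow> T = {0} \<or> T = S"
begin

text \<open>The elements annihilated from the left by all \<open>w * z\<close> form a closed
  two-sided ideal. It omits \<open>w\<close>, because \<open>w * star w * w\<close> is nonzero, so
  by simplicity it is zero.\<close>

lemma prime:
  assumes w: "w \<in> S" "w \<noteq> 0" and b: "b \<in> S" "b \<noteq> 0"
  obtains z where "z \<in> S" "w * z * b \<noteq> 0"
proof -
  define T where "T = {y \<in> S. \<forall>z\<in>S. w * z * y = 0}"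
  have "T = {0} \<or> T = S"
  proof (rule simple)
    show "T \<subseteq> S" "0 \<in> T" by (auto simp: T_def)
    have "T = S \<inter> (\<Inter>z\<in>S. {y. w * z * y = 0})" by (auto simp: T_def)
    also have "closed \<dots>"
      by (intro closed_Int closed_S closed_INT ballI closed_Collect_eq continuous_intros)
    finally show "closed T" .
    show "x + y \<in> T" if "x \<in> T" "y \<in> T" for x y
      using that by (auto simp: T_def distrib_left add_mem)
    show "of_complex c * x \<in> T" if "x \<in> T" for c x
    proof -
      have "w * z * (of_complex c * x) = of_complex c * (w * z * x)" for z
        by (metis mult.assoc of_complex_commute)
      then show ?thesis using that by (simp add: T_def of_complex_mem)
    qed
    show "a * x \<in> T" if "a \<in> S" "x \<in> T" for a x
    proof -
      have "w * z * (a * x) = w * (z * a) * x" for z by (simp only: mult.assoc)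
      then show ?thesis using that by (simp add: T_def mult_mem)
    qed
    show "x * a \<in> T" if "a \<in> S" "x \<in> T" for a x
      using that by (simp add: T_def mult_mem flip: mult.assoc)
  qed
  moreover have "w \<notin> T"
  proof
    assume "w \<in> T"
    then have "w * star w * w = 0" using w star_mem by (simp add: T_def)
    then have "star (star w * w) * (star w * w) = 0" by (simp add: star_mult mult.assoc)
    with w(2) show False by (simp add: star_mult_eq_0_iff)
  qed
  ultimately have "b \<notin> T" using w b by auto
  then show ?thesis using b that by (auto simp: T_def)
qed

text \<open>The elements \<open>w i * star (w i)\<close> are \<open>k + 1\<close> orthogonal,
  mutually equivalent positive elements below \<open>b\<close>. In the induction step
  \<open>k + 1\<close> columns below one half of a splitting are linked through primeness with one
  element below the other half, and all are multiplied on the right so that their inner squares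
  agree.\<close>

lemma orthogonal_equivalent_columns:
  fixes k :: nat
  assumes nomin: "\<nexists>p. minimal_projection p" and b: "b \<in> S" "positive_elem b" "b \<noteq> 0"
  shows "\<exists>w a0. a0 \<in> S \<and> a0 \<noteq> 0 \<and> (\<forall>i\<le>k. \<exists>u\<in>S. w i = b * u) \<and>
    (\<forall>i\<le>k. \<forall>j\<le>k. star (w i) * w j = (if i = j then a0 else 0))"
  using b
proof (induction k arbitrary: b)
  case 0
  note sb = positive_elem_star[OF 0(2)]
  have "star (b * b) * (b * b) \<noteq> 0"
    using 0(3) star_mult_eq_0_iff[of "b * b"] star_mult_eq_0_iff[of b] by (simp add: sb)
  with 0 show ?case
    by (intro exI[of _ "\<lambda>_. b * b"] exI[of _ "star (b * b) * (b * b)"]) (auto intro: mult_mem star_mem)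
next
  case (Suc k)
  obtain b1 b2 where sp: "split_pair b b1 b2"
    using minimal_projection_if_no_split[OF Suc.prems] nomin by blast
  then obtain u1 u2 where u: "u1 \<in> S" "b1 = b * u1" "u2 \<in> S" "b2 = b * u2"
    unfolding split_pair_def by blast
  have b12: "positive_elem b1" "positive_elem b2" "b1 \<noteq> 0" "b2 \<noteq> 0" "b1 * b2 = 0" "b1 \<in> S" "b2 \<in> S"
    using sp u Suc.prems(1) by (auto simp: split_pair_def mult_mem)
  note sb = positive_elem_star[OF b12(1)] positive_elem_star[OF b12(2)]
  obtain w a0 where a0: "a0 \<in> S" "a0 \<noteq> 0" and wu: "\<forall>i\<le>k. \<exists>u\<in>S. w i = b1 * u"
    and orth: "\<forall>i\<le>k. \<forall>j\<le>k. star (w i) * w j = (if i = j then a0 else 0)"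
    using Suc.IH[OF b12(6) b12(1) b12(3)] by blast
  have wS: "w i \<in> S" if "i \<le> k" for i
    using wu that b12(6) mult_mem by metis
  have a0w: "star (w 0) * w 0 = a0" using orth by simp
  then have "w 0 \<noteq> 0" using a0 by auto
  then obtain z where z: "z \<in> S" "w 0 * z * b2 \<noteq> 0"
    using prime[OF wS[of 0] _ b12(7) b12(4)] by blast
  define t where "t = w 0 * z * b2"
  have tS: "t \<in> S" unfolding t_def by (intro mult_mem wS z b12) simp
  have "positive_elem (t * star t)" "t * star t \<in> S"
    using positive_elem_star_mult[of "star t"] tS by (auto intro: mult_mem star_mem)
  then obtain d where d: "d \<in> S" "star d = d" "d * d = t * star t"
    by (rule positive_sqrt_mem)
  \<comment> \<open>Chosen to give \<open>w 0 * s = t * star t\<close>. As all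
    \<open>star (w i) * w i\<close> are the same element, this one factor brings every old column to
    the inner square \<open>a'\<close>.\<close>
  define s where "s = z * b2 * star t"
  have sS: "s \<in> S" unfolding s_def by (intro mult_mem star_mem z b12 tS)
  \<comment> \<open>The new column \<open>star t * d\<close> lies below \<open>b2\<close>, since
    \<open>star t\<close> starts with \<open>b2\<close>. The root \<open>d\<close> of
    \<open>t * star t\<close> lifts its inner square to \<open>(t * star t) * (t * star t)\<close>,
    matching the old columns.\<close>
  define w' where "w' i = (if i \<le> k then w i * s else star t * d)" for i
  define a' where "a' = (t * star t) * (t * star t)"
  have ws: "w 0 * s = t * star t"
    by (simp add: s_def t_def mult.assoc)
  have "star s * a0 * s = star (w 0 * s) * (w 0 * s)"
    by (simp add: star_mult mult.assoc flip: a0w)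
  then have sas: "star s * a0 * s = a'"
    unfolding ws by (simp add: a'_def star_mult)
  have old: "star (w' i) * w' j = (if i = j then a' else 0)" if "i \<le> k" "j \<le> k" for i j
  proof -
    have "star (w' i) * w' j = star s * (star (w i) * w j) * s"
      using that by (simp add: w'_def star_mult mult.assoc)
    then show ?thesis using orth that sas by simp
  qed
  have "star (star t * d) * (star t * d) = d * (t * star t) * d"
    by (simp add: star_mult d mult.assoc)
  also have "\<dots> = (d * d) * (d * d)"
    by (simp only: d(3)[symmetric] mult.assoc)
  finally have new: "star (star t * d) * (star t * d) = a'"
    by (simp only: d(3) a'_def)
  have cross: "star (w i * s) * (star t * d) = 0" if i: "i \<le> k" for i
  proof -
    obtain v where v: "w i = b1 * v" using wu i by blast
    have "star (w i * s) * (star t * d) = star s * star v * (b1 * b2) * (star z * star (w 0) * d)"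
      by (simp add: v t_def star_mult sb mult.assoc)
    then show ?thesis by (simp add: b12)
  qed
  have cross': "star (star t * d) * (w i * s) = 0" if i: "i \<le> k" for i
    using arg_cong[OF cross[OF i], of star] by (simp only: star_mult star_star star_0)
  have "a' \<in> S" unfolding a'_def by (intro mult_mem star_mem tS)
  moreover have "a' \<noteq> 0"
  proof -
    have "star (star t) * star t \<noteq> 0"
      unfolding star_mult_eq_0_iff using z(2) by (simp add: t_def del: mult_eq_0_iff)
    then have tt: "t * star t \<noteq> 0" by simp
    have "star (t * star t) * (t * star t) \<noteq> 0"
      unfolding star_mult_eq_0_iff by (rule tt)
    then show ?thesis by (simp add: a'_def star_mult)
  qed
  moreover have "\<exists>u\<in>S. w' i = b * u" if "i \<le> Suc k" for i
  proof (cases "i \<le> k")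
    case True
    then obtain v where v: "v \<in> S" "w i = b1 * v" using wu by blast
    then show ?thesis
      using True u by (intro bexI[of _ "u1 * v * s"]) (simp_all add: w'_def mult.assoc mult_mem sS)
  next
    case False
    have "star t * d = b * (u2 * star z * star (w 0) * d)"
      by (simp add: t_def star_mult sb u(4)[symmetric] flip: mult.assoc)
    then show ?thesis
      using False u z d wS[of 0]
      by (intro bexI[of _ "u2 * star z * star (w 0) * d"]) (auto simp: w'_def intro!: mult_mem star_mem)
  qed
  moreover have "star (w' i) * w' j = (if i = j then a' else 0)" if "i \<le> Suc k" "j \<le> Suc k" for i j
    using that old[of i j] new cross[of i] cross'[of j]
    by (cases "i \<le> k"; cases "j \<le> k") (auto simp: w'_def)
  ultimately show ?case by (intro exI[of _ w'] exI[of _ a']) blast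
qed

end

section \<open>Consequences of a minimal projection\<close>

context simple_cstar_subalgebra
begin

lemma minimal_projectionD:
  assumes "minimal_projection p"
  shows "p \<in> S" "p \<noteq> 0" "star p = p" "p * p = p" "x \<in> S \<Longrightarrow> \<exists>c. p * x * p = of_complex c * p"
proof -
  note D = assms[unfolded minimal_projection_def]
  show "p \<in> S" by (rule D[THEN conjunct1])
  show "p \<noteq> 0" by (rule D[THEN conjunct2, THEN conjunct1])
  show "star p = p" by (rule D[THEN conjunct2, THEN conjunct2, THEN conjunct1])
  show "p * p = p" by (rule D[THEN conjunct2, THEN conjunct2, THEN conjunct2, THEN conjunct1])
  show "\<exists>c. p * x * p = of_complex c * p" if "x \<in> S"
    by (rule D[THEN conjunct2, THEN conjunct2, THEN conjunct2, THEN conjunct2, THEN bspec, OF that])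
qed

lemma minimal_projection_left: "minimal_projection p \<Longrightarrow> p * (p * x) = p * x"
  by (simp add: minimal_projectionD flip: mult.assoc)

lemma norm_minimal_projection:
  assumes "minimal_projection p"
  shows "norm p = 1"
proof -
  note D = minimal_projectionD[OF assms]
  have "norm p * norm p = norm p" "norm p \<noteq> 0"
    using norm_selfadjoint_square[OF D(3)] D(2) by (simp_all add: D(4) power2_eq_square)
  then show ?thesis by simp
qed

lemma norm_of_complex_mult:
  assumes "minimal_projection p"
  shows "norm (of_complex c * p) = cmod c"
proof -
  have p: "star p = p" "p * p = p" by (rule minimal_projectionD[OF assms])+
  have "star (of_complex c * p) * (of_complex c * p) = p * (of_complex (cnj c) * of_complex c) * p"
    by (simp add: star_mult p star_of_complex mult.assoc)
  also have "\<dots> = of_complex (cnj c * c) * (p * p)"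
    by (simp only: of_complex_mult[symmetric] of_complex_commute[of "cnj c * c" p, symmetric] mult.assoc)
  also have "cnj c * c = complex_of_real ((cmod c)\<^sup>2)"
    by (simp add: complex_norm_square mult.commute del: of_real_power)
  finally have "star (of_complex c * p) * (of_complex c * p) = ((cmod c)\<^sup>2) *\<^sub>R p"
    by (simp only: of_complex_of_real scaleR_conv_of_real p)
  then have "(norm (of_complex c * p))\<^sup>2 = (cmod c)\<^sup>2"
    by (simp flip: norm_star_mult add: norm_minimal_projection[OF assms])
  then show ?thesis by simp
qed

lemma selfadjoint_scalar:
  assumes p: "minimal_projection p" and f: "f \<in> S" "star f = f"
  obtains r where "p * f * p = r *\<^sub>R p"
proof -
  obtain c where c: "p * f * p = of_complex c * p"
    using minimal_projectionD(5)[OF p f(1)] by blast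
  have sp: "star p = p" "p \<noteq> 0" by (rule minimal_projectionD[OF p])+
  have "star (p * f * p) = p * f * p"
    by (simp add: star_mult f sp mult.assoc)
  then have "of_complex (cnj c) * p = of_complex c * p"
    unfolding c star_mult star_of_complex sp(1) by (simp only: of_complex_commute[of "cnj c" p])
  then have "cnj c = c"
    by (rule of_complex_inject) (rule sp)
  then have "c = complex_of_real (Re c)"
    by (simp add: complex_eq_iff)
  then have "p * f * p = Re c *\<^sub>R p"
    unfolding c scaleR_conv_of_real by (metis of_complex_of_real)
  then show ?thesis by (rule that)
qed

text \<open>A partial isometry from \<open>p\<close> to an orthogonal projection. If
  \<open>x * p = p * x * p\<close> held for all \<open>x\<close>, the corner of \<open>p\<close>
  would be a nonzero closed ideal, hence all of \<open>S\<close>, and minimality would leave only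
  multiples of \<open>p\<close>. So some \<open>x * p - p * x * p\<close> is nonzero; its inner
  square is a positive multiple of \<open>p\<close>, and rescaling finishes.\<close>

lemma orthogonal_partner:
  assumes p: "minimal_projection p" and big: "S \<noteq> range (\<lambda>c. of_complex c * p)"
  obtains v where "v \<in> S" "star v * v = p" "p * v = 0" "v * p = v"
proof -
  have sp: "star p = p" "p \<noteq> 0" "p * p = p" "p \<in> S" by (rule minimal_projectionD[OF p])+
  have "\<exists>x\<in>S. x * p - p * x * p \<noteq> 0"
  proof (rule ccontr)
    assume "\<not> ?thesis"
    then have xp: "x * p = p * x * p" if "x \<in> S" for x using that by auto
    have px: "p * x = p * x * p" if "x \<in> S" for x
      using arg_cong[OF xp[OF star_mem[OF that]], of star] by (simp add: star_mult sp mult.assoc)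
    define T where "T = {y \<in> S. p * y * p = y}"
    have "T = {0} \<or> T = S"
    proof (rule simple)
      show "T \<subseteq> S" "0 \<in> T" by (auto simp: T_def)
      have "T = S \<inter> {y. p * y * p = y}" by (auto simp: T_def)
      also have "closed \<dots>"
        by (intro closed_Int closed_S closed_Collect_eq continuous_intros)
      finally show "closed T" .
      show "x + y \<in> T" if "x \<in> T" "y \<in> T" for x y
        using that by (auto simp: T_def distrib_left distrib_right add_mem)
      show "of_complex c * x \<in> T" if "x \<in> T" for c x
      proof -
        have "p * (of_complex c * x) * p = of_complex c * (p * x * p)"
          by (metis mult.assoc of_complex_commute)
        then show ?thesis using that by (simp add: T_def of_complex_mem)
      qed
      have yp: "p * y = y" "y * p = y" if "y \<in> T" for y
      proof -
        have y: "p * y * p = y" using that by (simp add: T_def)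
        have "p * (p * y * p) = p * y * p" "(p * y * p) * p = p * y * p"
          using sp(3) by (simp_all add: mult.assoc minimal_projection_left[OF p])
        then show "p * y = y" "y * p = y" unfolding y by simp_all
      qed
      show "a * x \<in> T" if "a \<in> S" "x \<in> T" for a x
      proof -
        have "a * x = a * p * x" using yp[OF that(2)] by (simp add: mult.assoc)
        also have "\<dots> = p * (a * x)"
          unfolding xp[OF that(1)] using yp[OF that(2)] by (simp add: mult.assoc)
        finally have "p * (a * x) * p = a * x"
          using yp[OF that(2)] by (simp add: mult.assoc)
        then show ?thesis using that by (simp add: T_def mult_mem)
      qed
      show "x * a \<in> T" if "a \<in> S" "x \<in> T" for a x
      proof -
        have "x * a = x * (p * a)" using yp[OF that(2)] by (simp flip: mult.assoc)
        also have "p * a = p * a * p" by (rule px[OF that(1)])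
        also have "x * (p * a * p) = x * a * p"
          using yp[OF that(2)] by (simp flip: mult.assoc)
        finally have "p * (x * a) * p = x * a"
          using yp[OF that(2)] by (simp flip: mult.assoc)
        then show ?thesis using that by (simp add: T_def mult_mem)
      qed
    qed
    moreover have "p \<in> T" by (simp add: T_def sp)
    ultimately have "T = S" using sp by auto
    have "S \<subseteq> range (\<lambda>c. of_complex c * p)"
    proof
      fix y assume "y \<in> S"
      then have "p * y * p = y" using \<open>T = S\<close> by (auto simp: T_def)
      then show "y \<in> range (\<lambda>c. of_complex c * p)"
        using minimal_projectionD(5)[OF p \<open>y \<in> S\<close>] by auto
    qed
    moreover have "range (\<lambda>c. of_complex c * p) \<subseteq> S"
      using sp(4) by (auto intro: of_complex_mem)
    ultimately show False using big by blast
  qed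
  then obtain x where x: "x \<in> S" "x * p - p * x * p \<noteq> 0" by blast
  define v where "v = x * p - p * x * p"
  have v: "v \<in> S" "v \<noteq> 0" "p * v = 0" "v * p = v"
    using x sp by (auto simp: v_def algebra_simps minimal_projection_left[OF p] intro!: diff_mem mult_mem)
  have sv: "p * star v = star v"
    using arg_cong[OF v(4), of star] by (simp add: star_mult sp)
  have "p * (star v * v) * p = star v * v"
    using v(4) sv by (simp add: mult.assoc) (simp flip: mult.assoc)
  then obtain r where r: "star v * v = r *\<^sub>R p"
    using selfadjoint_scalar[OF p, of "star v * v"] v(1) by (metis mult_mem star_mem star_mult star_star)
  have pos: "positive_elem p"
    using positive_elem_square[of p] sp by simp
  have "r > 0"
  proof (rule ccontr)
    assume "\<not> r > 0"
    then have "positive_elem ((- r) *\<^sub>R p)"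
      by (intro positive_elem_scaleR pos) simp
    then have "positive_elem (- (star v * v))"
      by (simp add: r)
    then show False using negative_star_mult_eq_0 v(2) by blast
  qed
  show ?thesis
  proof (rule that[of "(1 / sqrt r) *\<^sub>R v"])
    show "star ((1 / sqrt r) *\<^sub>R v) * ((1 / sqrt r) *\<^sub>R v) = p"
      using \<open>r > 0\<close> by (simp add: star_scaleR r)
  qed (use v in \<open>simp_all add: scaleR_mem\<close>)
qed

text \<open>What a completely positive order zero map from the complex \<open>2 \<times> 2\<close> matrices provides: \<open>f0\<close>, \<open>f1\<close>, \<open>f2\<close>
  are the images of the unit and of the Pauli matrices \<open>diag (1, -1)\<close> and \<open>antidiag (1, 1)\<close>.\<close>

definition order_zero_data :: "'a \<Rightarrow> 'a \<Rightarrow> 'a set \<Rightarrow> 'a \<Rightarrow> 'a \<Rightarrow> 'a \<Rightarrow> (nat \<Rightarrow> 'a) \<Rightarrow> bool" where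
  "order_zero_data p x F f0 f1 f2 w \<longleftrightarrow> f0 \<in> S \<and> f1 \<in> S \<and> f2 \<in> S \<and> star f0 = f0 \<and> star f1 = f1 \<and> star f2 = f2 \<and> norm f0 \<le> 1 \<and>
    (\<forall>c s. c\<^sup>2 + s\<^sup>2 = 1 \<longrightarrow>
      ((1/2) *\<^sub>R (f0 + c *\<^sub>R f1 + s *\<^sub>R f2)) * ((1/2) *\<^sub>R (f0 - c *\<^sub>R f1 - s *\<^sub>R f2)) = 0 \<and>
      norm ((1/2) *\<^sub>R (f0 - c *\<^sub>R f1 - s *\<^sub>R f2)) \<le> 1 \<and>
      (\<forall>b\<in>F. norm ((1/2) *\<^sub>R (f0 + c *\<^sub>R f1 + s *\<^sub>R f2) * b - b * ((1/2) *\<^sub>R (f0 + c *\<^sub>R f1 + s *\<^sub>R f2))) < 1/400)) \<and>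
    (\<forall>b\<in>F. norm (f0 * b - b * f0) < 1/400) \<and>
    (\<forall>k. w k \<in> S) \<and> (\<lambda>k. w k * p * star (w k)) \<longlonglongrightarrow> fcalc (\<lambda>t. max (t - 1/400) 0) (x * x - x * f0 * x)"

text \<open>A minimal projection \<open>p\<close> and an equivalent orthogonal one span a copy of \<open>M\<^sub>2\<close>. Order zero
  forces the compression of the map to \<open>p\<close> to be small: rotate the rank one projection so that it
  and its complement have the same compression.  A two-dimensional projection would then be
  approximately of the form \<open>w * p * star w\<close>.\<close>

lemma minimal_projection_spans:
  assumes p: "minimal_projection p"
    and TH: "\<And>x F. x \<in> S \<Longrightarrow> positive_elem x \<Longrightarrow> finite F \<Longrightarrow> F \<subseteq> S \<Longrightarrow>
      \<exists>f0 f1 f2 w. order_zero_data p x F f0 f1 f2 w"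
  shows "S = range (\<lambda>c. of_complex c * p)"
proof (rule ccontr)
  assume "S \<noteq> range (\<lambda>c. of_complex c * p)"
  then obtain v where v: "v \<in> S" "star v * v = p" "p * v = 0" "v * p = v"
    using orthogonal_partner[OF p] by blast
  have sp: "star p = p" "p \<noteq> 0" "p * p = p" "p \<in> S" by (rule minimal_projectionD[OF p])+
  note np = norm_minimal_projection[OF p]
  note ppx = minimal_projection_left[OF p]
  have nv: "norm v = 1"
    using norm_star_mult[of v] np v(2) norm_ge_zero[of v] by (simp add: power2_eq_1_iff)
  have vp: "star v * p = 0"
    using arg_cong[OF v(3), of star] by (simp add: star_mult sp)
  have psv: "p * star v = star v"
    using arg_cong[OF v(4), of star] by (simp add: star_mult sp)
  have cancel: "star v * (v * y) = p * y" "p * (v * y) = 0" "v * (p * y) = v * y"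
    "star v * (p * y) = 0" "p * (star v * y) = star v * y" for y
    using v vp psv by (simp_all flip: mult.assoc)
  \<comment> \<open>The unit of the copy of the 2 by 2 matrices spanned by \<open>p\<close>,
    \<open>v\<close>, \<open>star v\<close> and \<open>v * star v\<close>, a projection of rank
    two.\<close>
  define x where "x = p + v * star v"
  have xx: "x * x = x" and sx: "star x = x"
    by (simp_all add: x_def distrib_left distrib_right mult.assoc cancel psv vp sp star_add star_mult)
  have xS: "x \<in> S" unfolding x_def by (intro add_mem mult_mem star_mem v sp)
  have xpos: "positive_elem x" using positive_elem_square[OF sx] by (simp only: xx)
  have pv: "finite {p, v}" "{p, v} \<subseteq> S" using sp(4) v(1) by simp_all
  obtain f0 f1 f2 w where "order_zero_data p x {p, v} f0 f1 f2 w"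
    using TH[OF xS xpos pv] by (elim exE)
  note data = this[unfolded order_zero_data_def]
  have f: "f0 \<in> S" "f1 \<in> S" "f2 \<in> S" "star f0 = f0" "star f1 = f1" "star f2 = f2" "norm f0 \<le> 1"
    and w: "\<forall>k. w k \<in> S" "(\<lambda>k. w k * p * star (w k)) \<longlonglongrightarrow> fcalc (\<lambda>t. max (t - 1/400) 0) (x * x - x * f0 * x)"
    and "\<forall>b\<in>{p, v}. norm (f0 * b - b * f0) < 1/400"
    and gs: "\<forall>c s. c\<^sup>2 + s\<^sup>2 = 1 \<longrightarrow>
      ((1/2) *\<^sub>R (f0 + c *\<^sub>R f1 + s *\<^sub>R f2)) * ((1/2) *\<^sub>R (f0 - c *\<^sub>R f1 - s *\<^sub>R f2)) = 0 \<and>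
      norm ((1/2) *\<^sub>R (f0 - c *\<^sub>R f1 - s *\<^sub>R f2)) \<le> 1 \<and>
      (\<forall>b\<in>{p, v}. norm ((1/2) *\<^sub>R (f0 + c *\<^sub>R f1 + s *\<^sub>R f2) * b - b * ((1/2) *\<^sub>R (f0 + c *\<^sub>R f1 + s *\<^sub>R f2))) < 1/400)"
    using data by - ((elim conjE, assumption)+)
  then have f0v: "norm (f0 * v - v * f0) < 1/400" by (elim ballE[of _ _ v]) simp_all
  obtain r0 r1 r2 where r: "p * f0 * p = r0 *\<^sub>R p" "p * f1 * p = r1 *\<^sub>R p" "p * f2 * p = r2 *\<^sub>R p"
    using selfadjoint_scalar[OF p f(1) f(4)] selfadjoint_scalar[OF p f(2) f(5)]
      selfadjoint_scalar[OF p f(3) f(6)] by metis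
  \<comment> \<open>A unit vector orthogonal to \<open>(r1, r2)\<close>. For it the images of the
    rotated projection and of its complement have the same compression to \<open>p\<close>, namely
    half of \<open>r0\<close>.\<close>
  have "\<exists>c s :: real. c\<^sup>2 + s\<^sup>2 = 1 \<and> c * r1 + s * r2 = 0"
  proof (cases "r1\<^sup>2 + r2\<^sup>2 = 0")
    case True
    then have "r1 = 0" "r2 = 0" by (simp_all add: sum_power2_eq_zero_iff)
    then show ?thesis by (intro exI[of _ 1] exI[of _ 0]) simp
  next
    case False
    let ?n = "sqrt (r1\<^sup>2 + r2\<^sup>2)"
    have n: "?n\<^sup>2 = r1\<^sup>2 + r2\<^sup>2" "?n \<noteq> 0" using False by (auto simp: sum_power2_eq_zero_iff)
    have "(- r2 / ?n)\<^sup>2 + (r1 / ?n)\<^sup>2 = (r1\<^sup>2 + r2\<^sup>2) / ?n\<^sup>2"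
      by (simp only: power_divide power2_minus add_divide_distrib[symmetric] add.commute)
    then have "(- r2 / ?n)\<^sup>2 + (r1 / ?n)\<^sup>2 = 1"
      unfolding n(1) using False by simp
    moreover have "(- r2 / ?n) * r1 + (r1 / ?n) * r2 = 0" by simp
    ultimately show ?thesis by blast
  qed
  then obtain c s where cs: "c\<^sup>2 + s\<^sup>2 = 1" "c * r1 + s * r2 = 0" by blast
  define g1 where "g1 = (1/2) *\<^sub>R (f0 + c *\<^sub>R f1 + s *\<^sub>R f2)"
  define g2 where "g2 = (1/2) *\<^sub>R (f0 - c *\<^sub>R f1 - s *\<^sub>R f2)"
  have g12: "g1 * g2 = 0" "norm g2 \<le> 1" "norm (g1 * p - p * g1) < 1/400"
  proof -
    note G = gs[rule_format, OF cs(1), folded g1_def g2_def]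
    show "g1 * g2 = 0" by (rule G[THEN conjunct1])
    show "norm g2 \<le> 1" by (rule G[THEN conjunct2, THEN conjunct1])
    show "norm (g1 * p - p * g1) < 1/400"
      by (rule G[THEN conjunct2, THEN conjunct2, THEN bspec]) simp
  qed
  have "p * g1 * p = (1/2) *\<^sub>R (p * f0 * p + c *\<^sub>R (p * f1 * p) + s *\<^sub>R (p * f2 * p))"
    by (simp add: g1_def distrib_left distrib_right mult.assoc)
  also have "\<dots> = (1/2 * (r0 + (c * r1 + s * r2))) *\<^sub>R p"
    by (simp only: r) (simp add: algebra_simps)
  finally have pg1: "p * g1 * p = (r0 / 2) *\<^sub>R p" by (simp add: cs)
  have "p * g2 * p = (1/2) *\<^sub>R (p * f0 * p - c *\<^sub>R (p * f1 * p) - s *\<^sub>R (p * f2 * p))"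
    by (simp add: g2_def left_diff_distrib right_diff_distrib mult.assoc)
  also have "\<dots> = (1/2 * (r0 - (c * r1 + s * r2))) *\<^sub>R p"
    by (simp only: r) (simp add: algebra_simps)
  finally have pg2: "p * g2 * p = (r0 / 2) *\<^sub>R p" by (simp add: cs)
  have np_le: "norm (p * y) \<le> norm y" "norm (y * p) \<le> norm y" for y
    using norm_mult_ineq[of p y] norm_mult_ineq[of y p] by (simp_all add: np)
  have nv_le: "norm (v * y) \<le> norm y" "norm (y * star v) \<le> norm y" "norm (star v * y) \<le> norm y" for y
    using norm_mult_ineq[of v y] norm_mult_ineq[of y "star v"] norm_mult_ineq[of "star v" y] by (simp_all add: nv)
  \<comment> \<open>Because \<open>g1 * g2 = 0\<close>, only the commutator of \<open>g1\<close>
    with \<open>p\<close> remains. So the square of \<open>r0 / 2\<close> is below 1/400, the square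
    of 1/20; this is the origin of the tolerance 1/400.\<close>
  have "((r0 / 2) * (r0 / 2)) *\<^sub>R p = (p * g1 * p) * (p * g2 * p)"
    unfolding pg1 pg2 by (simp add: sp)
  also have "\<dots> = p * ((g1 * p - p * g1) * g2) * p + p * (g1 * g2) * p"
    by (simp add: left_diff_distrib right_diff_distrib mult.assoc ppx)
  also have "\<dots> = p * ((g1 * p - p * g1) * g2) * p"
    by (simp add: g12(1))
  finally have "norm (((r0 / 2) * (r0 / 2)) *\<^sub>R p) \<le> norm ((g1 * p - p * g1) * g2)"
    using np_le order_trans by metis
  also have "\<dots> \<le> norm (g1 * p - p * g1) * 1"
    by (rule order_trans[OF norm_mult_ineq mult_left_mono[OF g12(2)]]) simp
  finally have "(r0 / 2)\<^sup>2 \<le> (1/20)\<^sup>2"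
    using g12(3) by (simp add: np power2_eq_square)
  then have "\<bar>r0 / 2\<bar> \<le> \<bar>1/20\<bar>"
    by (simp only: abs_le_square_iff)
  then have r0: "\<bar>r0\<bar> \<le> 1/10" by simp
  have "norm (p * f0 * p) \<le> 1/10" using r0 by (simp add: r np)
  moreover have pq: "norm (p * f0 * (v * star v)) \<le> 1/400"
  proof -
    have "p * f0 * (v * star v) = p * ((f0 * v - v * f0) * star v)"
      by (simp add: left_diff_distrib right_diff_distrib mult.assoc cancel)
    then have "norm (p * f0 * (v * star v)) \<le> norm (f0 * v - v * f0)"
      using np_le(1) nv_le(2) order_trans by metis
    with f0v show ?thesis by linarith
  qed
  moreover have "norm (v * star v * f0 * p) \<le> 1/400"
  proof -
    have "star (p * f0 * (v * star v)) = v * star v * f0 * p"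
      by (simp add: star_mult sp f mult.assoc)
    then show ?thesis using pq norm_star by metis
  qed
  moreover have "norm (v * star v * f0 * (v * star v)) \<le> 1/10 + 1/400"
  proof -
    have "star v * f0 * v = star v * ((f0 * v - v * f0) * p) + p * f0 * p"
      by (simp add: left_diff_distrib right_diff_distrib mult.assoc cancel v)
    also have "norm \<dots> \<le> norm (f0 * v - v * f0) + 1/10"
      using np_le(2)[of "f0 * v - v * f0"] nv_le(3)[of "(f0 * v - v * f0) * p"] r0
      by (intro norm_triangle_le) (simp add: r np)
    finally have "norm (star v * f0 * v) \<le> 1/10 + 1/400"
      using f0v by linarith
    moreover have "norm (v * (star v * f0 * v * star v)) \<le> norm (star v * f0 * v)"
      using nv_le(1,2) order_trans by metis
    ultimately show ?thesis by (simp add: mult.assoc)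
  qed
  \<comment> \<open>The four corners with respect to \<open>p\<close> and \<open>v * star v\<close>:
    the diagonal ones are close to multiples by \<open>r0\<close>, the others are bounded by the
    commutator of \<open>f0\<close> with \<open>v\<close>.\<close>
  moreover have "x * f0 * x = (p * f0 * p + p * f0 * (v * star v)) + (v * star v * f0 * p + v * star v * f0 * (v * star v))"
    by (simp add: x_def distrib_left distrib_right)
  ultimately have xfx: "norm (x * f0 * x) \<le> (1/10 + 1/400) + (1/400 + (1/10 + 1/400))"
    by (simp only:) (intro norm_triangle_le add_mono)
  let ?c0 = "x * x - x * f0 * x" and ?f = "\<lambda>t::real. max (t - 1/400) 0"
  have "positive_elem (star x * (of_real 1 - f0) * x)"
    by (intro positive_elem_conj positive_elem_norm_diff f)
  then have "positive_elem ?c0"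
    by (simp add: sx left_diff_distrib right_diff_distrib)
  then have cut: "norm (?c0 - fcalc ?f ?c0) \<le> 1/400"
    by (rule norm_sub_fcalc_cut) simp
  have "\<forall>\<^sub>F k in sequentially. dist (w k * p * star (w k)) (fcalc ?f ?c0) < 1/400"
    using w(2) by (rule tendstoD) simp
  then obtain k where "dist (w k * p * star (w k)) (fcalc ?f ?c0) < 1/400"
    by (auto simp: eventually_sequentially)
  then have wk: "norm (fcalc ?f ?c0 - w k * p * star (w k)) < 1/400"
    by (simp add: dist_norm norm_minus_commute)
  define D where "D = x - w k * p * star (w k)"
  have "D = (x * f0 * x + (?c0 - fcalc ?f ?c0)) + (fcalc ?f ?c0 - w k * p * star (w k))"
    by (simp add: D_def xx)
  then have "norm D \<le> norm (x * f0 * x) + norm (?c0 - fcalc ?f ?c0) + norm (fcalc ?f ?c0 - w k * p * star (w k))"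
    by (metis norm_triangle_mono norm_triangle_ineq order_refl)
  \<comment> \<open>The compression of \<open>f0\<close> contributes 83/400, the cut-down and the
    approximation 1/400 each.\<close>
  then have D: "norm D < 1/2"
    using xfx cut wk by simp
  \<comment> \<open>In matrix terms \<open>(\<alpha>, \<beta>)\<close> is the first column of the
    compression of \<open>w k\<close>, so \<open>w k * p * star (w k)\<close> compresses to a matrix
    of rank one. It cannot be within 1/2 of the identity: both diagonal entries would exceed 1/2 in
    modulus while the off-diagonal one is smaller than 1/2, although its square is their product in
    modulus.\<close>
  obtain \<alpha> where \<alpha>: "p * w k * p = of_complex \<alpha> * p"
    using minimal_projectionD(5)[OF p w(1)[rule_format]] by blast
  obtain \<beta> where \<beta>: "p * (star v * w k) * p = of_complex \<beta> * p"
    using minimal_projectionD(5)[OF p mult_mem[OF star_mem[OF v(1)] w(1)[rule_format]]] by blast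
  have sc: "star (of_complex z * p) = of_complex (cnj z) * p" for z
    by (simp add: star_mult star_of_complex sp of_complex_commute[of "cnj z" p])
  have prod: "of_complex y * p * (of_complex z * p) = of_complex (y * z) * p" for y z
  proof -
    have "of_complex y * p * (of_complex z * p) = of_complex y * (p * of_complex z) * p"
      by (simp only: mult.assoc)
    also have "p * of_complex z = of_complex z * p" by (rule of_complex_commute[symmetric])
    finally show ?thesis by (simp only: of_complex_mult mult.assoc sp)
  qed
  have one: "p = of_complex 1 * p"
    using of_complex_of_real[of 1, where 'a = 'a] by simp
  have "p * D * p = p - (p * w k * p) * star (p * w k * p)"
    by (simp add: D_def x_def star_mult sp left_diff_distrib right_diff_distrib distrib_left distrib_right
        mult.assoc cancel ppx)
  also have "\<dots> = of_complex (1 - \<alpha> * cnj \<alpha>) * p"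
    unfolding \<alpha> sc prod of_complex_diff left_diff_distrib one[symmetric] ..
  finally have "cmod (1 - \<alpha> * cnj \<alpha>) = norm (p * D * p)"
    by (simp only: norm_of_complex_mult[OF p])
  also have "\<dots> \<le> norm D"
    using np_le order_trans by metis
  finally have "cmod (1 - \<alpha> * cnj \<alpha>) < 1/2" using D by linarith
  then have \<alpha>2: "1/2 < (cmod \<alpha>)\<^sup>2"
    using norm_triangle_ineq[of "1 - \<alpha> * cnj \<alpha>" "\<alpha> * cnj \<alpha>"] by (simp add: norm_mult power2_eq_square)
  have "star v * D * v = p - (p * (star v * w k) * p) * star (p * (star v * w k) * p)"
    by (simp add: D_def x_def star_mult sp left_diff_distrib right_diff_distrib distrib_left distrib_right
        mult.assoc cancel ppx v vp)
  also have "\<dots> = of_complex (1 - \<beta> * cnj \<beta>) * p"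
    unfolding \<beta> sc prod of_complex_diff left_diff_distrib one[symmetric] ..
  finally have "cmod (1 - \<beta> * cnj \<beta>) = norm (star v * D * v)"
    by (simp only: norm_of_complex_mult[OF p])
  also have "\<dots> \<le> norm (star v * D) * norm v"
    by (rule norm_mult_ineq)
  also have "\<dots> \<le> norm D"
    using nv_le(3)[of D] nv by simp
  finally have "cmod (1 - \<beta> * cnj \<beta>) < 1/2" using D by linarith
  then have \<beta>2: "1/2 < (cmod \<beta>)\<^sup>2"
    using norm_triangle_ineq[of "1 - \<beta> * cnj \<beta>" "\<beta> * cnj \<beta>"] by (simp add: norm_mult power2_eq_square)
  have "p * D * v = - ((p * w k * p) * star (p * (star v * w k) * p))"
    by (simp add: D_def x_def star_mult sp left_diff_distrib right_diff_distrib distrib_left distrib_right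
        mult.assoc cancel ppx v vp)
  also have "\<dots> = - (of_complex (\<alpha> * cnj \<beta>) * p)"
    unfolding \<alpha> \<beta> sc prod ..
  finally have "cmod (\<alpha> * cnj \<beta>) = norm (p * D * v)"
    by (simp only: norm_of_complex_mult[OF p] norm_minus_cancel)
  also have "\<dots> \<le> norm (p * D) * norm v"
    by (rule norm_mult_ineq)
  also have "\<dots> \<le> norm D"
    using np_le(1)[of D] nv by simp
  finally have ab: "cmod \<alpha> * cmod \<beta> < 1/2" using D by (simp add: norm_mult)
  have "(cmod \<alpha> * cmod \<beta>)\<^sup>2 < (1/2)\<^sup>2"
    using ab by (intro power_strict_mono) auto
  moreover have "(1/2) * (1/2) < (cmod \<alpha>)\<^sup>2 * (cmod \<beta>)\<^sup>2"
    using \<alpha>2 \<beta>2 by (intro mult_strict_mono) auto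
  ultimately show False
    unfolding power_mult_distrib power2_eq_square[of "1/2"] by linarith
qed

end

section \<open>Complex matrices and order zero maps\<close>

lemma complex_cstar_simps:
  "carrier complex_cstar = UNIV" "x \<otimes>\<^bsub>complex_cstar\<^esub> y = x * y" "x \<oplus>\<^bsub>complex_cstar\<^esub> y = x + y"
  "\<zero>\<^bsub>complex_cstar\<^esub> = 0" "\<one>\<^bsub>complex_cstar\<^esub> = 1" "c \<odot>\<^bsub>complex_cstar\<^esub> x = c * x"
  "adj complex_cstar = cnj" "cnorm complex_cstar = cmod"
  by (simp_all add: complex_cstar_def)

lemma complex_cring: "cring complex_cstar"
proof (intro cringI abelian_groupI comm_monoidI)
  show "\<exists>y\<in>carrier complex_cstar. y \<oplus>\<^bsub>complex_cstar\<^esub> x = \<zero>\<^bsub>complex_cstar\<^esub>" for x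
    by (rule bexI[of _ "- x"]) (simp_all add: complex_cstar_simps)
qed (simp_all add: complex_cstar_simps algebra_simps)

lemma complex_cstar_minus: "x \<ominus>\<^bsub>complex_cstar\<^esub> y = x - y"
proof -
  interpret C: cring complex_cstar by (rule complex_cring)
  have "\<ominus>\<^bsub>complex_cstar\<^esub> y = - y"
    by (rule C.minus_equality) (simp_all add: complex_cstar_simps)
  then show ?thesis by (simp add: a_minus_def complex_cstar_simps)
qed

lemma complex_cstar_algebra: "cstar_algebra complex_cstar"
proof (intro cstar_algebra.intro cstar_algebra_axioms.intro)
  interpret C: cring complex_cstar by (rule complex_cring)
  show "Module.module complex_cstar complex_cstar"
    by (rule moduleI[OF complex_cring C.is_abelian_group]) (simp_all add: complex_cstar_simps algebra_simps)
  fix s :: "nat \<Rightarrow> complex"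
  assume "\<And>e. e > 0 \<Longrightarrow> \<exists>N. \<forall>i\<ge>N. \<forall>j\<ge>N. cnorm complex_cstar (s i \<ominus>\<^bsub>complex_cstar\<^esub> s j) < e"
  then have "Cauchy s"
    by (intro CauchyI) (simp add: complex_cstar_simps complex_cstar_minus)
  then obtain x where "s \<longlonglongrightarrow> x"
    using Cauchy_convergent convergent_def by blast
  then show "\<exists>x\<in>carrier complex_cstar. converges_to complex_cstar s x"
    unfolding converges_to_def complex_cstar_simps complex_cstar_minus
    by (intro bexI[of _ x] tendsto_norm_zero LIM_zero) auto
qed (simp_all add: complex_cstar_simps algebra_simps norm_mult norm_triangle_ineq power2_eq_square)

lemma complex_finsum: "finite I \<Longrightarrow> (\<Oplus>\<^bsub>complex_cstar\<^esub>i\<in>I. f i) = sum f I"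
proof (induction I rule: finite_induct)
  interpret C: cring complex_cstar by (rule complex_cring)
  {
    case empty
    show ?case by (simp add: complex_cstar_simps)
  next
    case (insert i I)
    then show ?case
      by (subst C.finsum_insert) (simp_all add: complex_cstar_simps)
  }
qed

context cstar_algebra
begin

text \<open>Complete positivity for matrices of size 1, with the element placed in the only
  entry.\<close>

lemma positive_of_completely_positive:
  fixes B :: "'b cstar"
  assumes B: "cstar_algebra B" and cp: "completely_positive B A \<phi>" and y: "positive B y"
  shows "positive A (\<phi> y)"
proof -
  interpret B: cstar_algebra B by fact
  obtain b where b: "b \<in> carrier B" "y = adj B b \<otimes>\<^bsub>B\<^esub> b"
    using y by (auto simp: positive_def)
  define b' where "b' = (\<lambda>(i::nat) (j::nat). if i = 0 \<and> j = 0 then b else \<zero>\<^bsub>B\<^esub>)"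
  have b': "b' \<in> carrier (matrix_algebra 1 B)"
    by (rule B.mat_carrierI) (auto simp: b'_def b)
  define a where "a = adj (matrix_algebra 1 B) b' \<otimes>\<^bsub>matrix_algebra 1 B\<^esub> b'"
  have aM: "a \<in> carrier (matrix_algebra 1 B)"
    unfolding a_def by (rule B.mat_mult_closed[OF B.mat_adj_closed[OF b'] b'])
  then have "positive (matrix_algebra 1 B) a"
    using b' by (auto simp: positive_def a_def)
  then have "positive (matrix_algebra 1 A) (\<lambda>i j. \<phi> (a i j))"
    using cp unfolding completely_positive_def by blast
  then obtain c where c: "c \<in> carrier (matrix_algebra 1 A)"
    "(\<lambda>i j. \<phi> (a i j)) = adj (matrix_algebra 1 A) c \<otimes>\<^bsub>matrix_algebra 1 A\<^esub> c"
    by (auto simp: positive_def)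
  have entry: "(adj (matrix_algebra 1 B) b' \<otimes>\<^bsub>matrix_algebra 1 B\<^esub> b') 0 0 = adj B b \<otimes>\<^bsub>B\<^esub> b"
    using b by (simp add: matrix_algebra_simps b'_def lessThan_Suc B.mult_closed B.adj_closed)
  have "a 0 0 = y"
    unfolding a_def entry b ..
  moreover have "\<phi> (a 0 0) = adj A (c 0 0) \<otimes> c 0 0"
    using fun_cong[OF fun_cong[OF c(2), of 0], of 0] mat_entry[OF c(1), of 0 0]
    by (simp add: matrix_algebra_simps lessThan_Suc mult_closed adj_closed)
  ultimately have "\<phi> y = adj A (c 0 0) \<otimes> c 0 0" by simp
  then show ?thesis
    using mat_entry[OF c(1), of 0 0] unfolding positive_def
    by (auto simp: mult_closed adj_closed)
qed

lemma projection_facts: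
  assumes y: "y \<in> carrier A" "adj A y = y" "y \<otimes> y = y"
  shows "positive A y" "cnorm A y \<le> 1"
proof -
  show "positive A y"
    using y unfolding positive_def by (intro conjI bexI[of _ y]) auto
  have "cnorm A y * cnorm A y = cnorm A y"
    using cnorm_adj_mult[OF y(1)] y by (simp add: power2_eq_square)
  then show "cnorm A y \<le> 1"
    by auto
qed

lemma positive_closed: "positive A a \<Longrightarrow> a \<in> carrier A"
  by (simp add: positive_def)

lemma star_embed_positive: "positive A a \<Longrightarrow> star (embed A a) = embed A a"
  by (simp add: positive_iff positive_elem_star)

lemma cstar_subalgebra_embed_simple:
  assumes "simple_cstar_algebra A"
  shows "simple_cstar_subalgebra (embed A ` carrier A)"
proof -
  interpret S: cstar_subalgebra "embed A ` carrier A" by (rule cstar_subalgebra_embed)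
  show ?thesis
  proof
    obtain x where "x \<in> carrier A" "x \<noteq> \<zero>"
      using assms unfolding simple_cstar_algebra_def by (metis insertI1 singletonD subset_singletonD subsetI zero_closed insert_iff empty_iff set_eq_iff)
    then show "embed A ` carrier A \<noteq> {0}"
      by (auto simp: embed_eq_0_iff dest!: equalityD1)
  next
    fix T
    assume T: "T \<subseteq> embed A ` carrier A" "closed T" "0 \<in> T" "\<And>x y. x \<in> T \<Longrightarrow> y \<in> T \<Longrightarrow> x + y \<in> T"
      "\<And>c x. x \<in> T \<Longrightarrow> of_complex c * x \<in> T"
      "\<And>a x. a \<in> embed A ` carrier A \<Longrightarrow> x \<in> T \<Longrightarrow> a * x \<in> T"
      "\<And>a x. a \<in> embed A ` carrier A \<Longrightarrow> x \<in> T \<Longrightarrow> x * a \<in> T"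
    define I where "I = {x \<in> carrier A. embed A x \<in> T}"
    have TI: "T = embed A ` I"
      using T(1) by (auto simp: I_def)
    have "closed_ideal A I"
      unfolding closed_ideal_def
    proof (intro conjI ballI allI impI)
      show "submodule I complex_cstar A"
      proof (rule submoduleI)
        fix c x assume x: "x \<in> I"
        show "c \<odot> x \<in> I" using x T(5) by (simp add: I_def embed_smult)
        show "\<ominus> x \<in> I"
          using x T(5)[of "embed A x" "-1"] by (simp add: I_def embed_smult flip: smult_minus_1)
        fix y assume "y \<in> I"
        then show "x \<oplus> y \<in> I" using x T(4) by (simp add: I_def embed_add)
      qed (auto simp: I_def embed_zero T(3))
      show "a \<otimes> x \<in> I" "x \<otimes> a \<in> I" if "a \<in> carrier A" "x \<in> I" for a x
        using that T(6,7) by (simp_all add: I_def mult_closed embed_mult)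
      fix s x assume x: "x \<in> carrier A" and s: "(\<forall>k. s k \<in> I) \<and> converges_to A s x"
      have sA: "s k \<in> carrier A" and sT: "embed A (s k) \<in> T" for k
        using s by (simp_all add: I_def)
      have lim: "(\<lambda>k. embed A (s k)) \<longlonglongrightarrow> embed A x"
        using s unfolding converges_to_iff[OF sA x] by (rule conjunct2)
      have "embed A x \<in> T"
        by (rule closed_sequentially[OF T(2) sT lim])
      then show "x \<in> I" using x by (simp add: I_def)
    qed
    then have "I = {\<zero>} \<or> I = carrier A"
      using assms by (simp add: simple_cstar_algebra_def)
    then show "T = {0} \<or> T = embed A ` carrier A"
      unfolding TI by (auto simp: embed_zero)
  qed
qed

end

section \<open>Rank one projections in the 2 by 2 matrices\<close>

definition mat22 :: "complex \<Rightarrow> complex \<Rightarrow> complex \<Rightarrow> complex \<Rightarrow> nat \<Rightarrow> nat \<Rightarrow> complex" where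
  "mat22 a b c d i j = (if i = 0 \<and> j = 0 then a else if i = 0 \<and> j = 1 then b
     else if i = 1 \<and> j = 0 then c else if i = 1 \<and> j = 1 then d else 0)"

abbreviation "CM2 \<equiv> matrix_algebra 2 complex_cstar"

lemma mat22_closed: "mat22 a b c d \<in> carrier CM2"
  by (auto simp: matrix_algebra_simps complex_cstar_simps mat22_def)

lemma mat22_simps:
  "mat22 a b c d \<otimes>\<^bsub>CM2\<^esub> mat22 a' b' c' d' = mat22 (a * a' + b * c') (a * b' + b * d') (c * a' + d * c') (c * b' + d * d')"
  "mat22 a b c d \<oplus>\<^bsub>CM2\<^esub> mat22 a' b' c' d' = mat22 (a + a') (b + b') (c + c') (d + d')"
  "z \<odot>\<^bsub>CM2\<^esub> mat22 a b c d = mat22 (z * a) (z * b) (z * c) (z * d)"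
  "adj CM2 (mat22 a b c d) = mat22 (cnj a) (cnj c) (cnj b) (cnj d)"
  "\<one>\<^bsub>CM2\<^esub> = mat22 1 0 0 1" "\<zero>\<^bsub>CM2\<^esub> = mat22 0 0 0 0"
  by (auto simp: matrix_algebra_simps complex_cstar_simps complex_finsum mat22_def numeral_2_eq_2
      lessThan_Suc fun_eq_iff)

text \<open>The projection (1 + c Z + s X) / 2 of the Bloch picture, for the Pauli matrices Z and X
  and a real unit vector (c, s). The opposite vector gives the complementary projection.\<close>

definition rotated_projection :: "real \<Rightarrow> real \<Rightarrow> nat \<Rightarrow> nat \<Rightarrow> complex" where
  "rotated_projection c s = mat22 (complex_of_real ((1 + c) / 2)) (complex_of_real (s / 2))
     (complex_of_real (s / 2)) (complex_of_real ((1 - c) / 2))"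

lemma rotated_projection:
  assumes "c\<^sup>2 + s\<^sup>2 = 1"
  shows "rotated_projection c s \<in> carrier CM2" "adj CM2 (rotated_projection c s) = rotated_projection c s"
    "rotated_projection c s \<otimes>\<^bsub>CM2\<^esub> rotated_projection c s = rotated_projection c s"
    "rotated_projection c s \<otimes>\<^bsub>CM2\<^esub> rotated_projection (- c) (- s) = \<zero>\<^bsub>CM2\<^esub>"
proof -
  show "rotated_projection c s \<in> carrier CM2" "adj CM2 (rotated_projection c s) = rotated_projection c s"
    by (simp_all add: rotated_projection_def mat22_closed mat22_simps)
  have s2: "s * s = 1 - c * c" using assms by (simp add: power2_eq_square)
  have e: "(1 + c) / 2 * ((1 + c) / 2) + s / 2 * (s / 2) = (1 + c) / 2"
    "(1 + c) / 2 * (s / 2) + s / 2 * ((1 - c) / 2) = s / 2"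
    "s / 2 * ((1 + c) / 2) + (1 - c) / 2 * (s / 2) = s / 2"
    "s / 2 * (s / 2) + (1 - c) / 2 * ((1 - c) / 2) = (1 - c) / 2"
    "(1 + c) / 2 * ((1 + - c) / 2) + s / 2 * (- s / 2) = 0"
    "(1 + c) / 2 * (- s / 2) + s / 2 * ((1 - - c) / 2) = 0"
    "s / 2 * ((1 + - c) / 2) + (1 - c) / 2 * (- s / 2) = 0"
    "s / 2 * (- s / 2) + (1 - c) / 2 * ((1 - - c) / 2) = 0"
    by (simp_all add: field_simps s2)
  show "rotated_projection c s \<otimes>\<^bsub>CM2\<^esub> rotated_projection c s = rotated_projection c s"
    "rotated_projection c s \<otimes>\<^bsub>CM2\<^esub> rotated_projection (- c) (- s) = \<zero>\<^bsub>CM2\<^esub>"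
    unfolding rotated_projection_def mat22_simps of_real_mult[symmetric] of_real_add[symmetric] e
    by simp_all
qed

lemma rotated_projection_eq:
  "rotated_projection c s = complex_of_real (1/2) \<odot>\<^bsub>CM2\<^esub>
    ((\<one>\<^bsub>CM2\<^esub> \<oplus>\<^bsub>CM2\<^esub> complex_of_real c \<odot>\<^bsub>CM2\<^esub> mat22 1 0 0 (-1)) \<oplus>\<^bsub>CM2\<^esub> complex_of_real s \<odot>\<^bsub>CM2\<^esub> mat22 0 1 1 0)"
  by (simp add: rotated_projection_def mat22_simps)

section \<open>Exclusion of minimal projections\<close>

context cstar_algebra
begin

lemma embed_scalar_star_isomorphic:
  assumes p: "embed A ` carrier A = range (\<lambda>c. of_complex c * p)" "star p = p" "p * p = p" "p \<noteq> 0"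
  shows "star_isomorphic A complex_cstar"
proof -
  have "\<forall>x. \<exists>c. x \<in> carrier A \<longrightarrow> embed A x = of_complex c * p"
    using p(1) by blast
  from choice[OF this] obtain f where f: "\<And>x. x \<in> carrier A \<Longrightarrow> embed A x = of_complex (f x) * p"
    by blast
  have eqI: "f x = c" if "x \<in> carrier A" "embed A x = of_complex c * p" for x c
    using f[OF that(1)] that(2) of_complex_inject p(4) by metis
  have comm: "p * of_complex c = of_complex c * p" for c
    by (rule of_complex_commute[symmetric])
  have mult: "of_complex b * p * (of_complex c * p) = of_complex (b * c) * p" for b c
  proof -
    have "of_complex b * p * (of_complex c * p) = of_complex b * (p * of_complex c) * p"
      by (simp only: mult.assoc)
    then show ?thesis by (simp only: comm of_complex_mult mult.assoc p(3))
  qed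
  show ?thesis
    unfolding star_isomorphic_def linear_map_def
  proof (intro exI[of _ f] conjI ballI allI)
    show "f \<in> carrier A \<rightarrow> carrier complex_cstar" by (simp add: complex_cstar_simps)
    show "f (x \<oplus> y) = f x \<oplus>\<^bsub>complex_cstar\<^esub> f y" if "x \<in> carrier A" "y \<in> carrier A" for x y
      using that by (intro eqI) (simp_all add: embed_add f[OF that(1)] f[OF that(2)] complex_cstar_simps of_complex_add distrib_right)
    show "f (c \<odot> x) = c \<odot>\<^bsub>complex_cstar\<^esub> f x" if "x \<in> carrier A" for c x
      using that by (intro eqI) (simp_all add: embed_smult f[OF that] complex_cstar_simps of_complex_mult mult.assoc)
    show "f (x \<otimes> y) = f x \<otimes>\<^bsub>complex_cstar\<^esub> f y" if "x \<in> carrier A" "y \<in> carrier A" for x y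
      using that by (intro eqI) (simp_all add: embed_mult f[OF that(1)] f[OF that(2)] complex_cstar_simps mult mult_closed)
    show "f (adj A x) = adj complex_cstar (f x)" if "x \<in> carrier A" for x
      using that by (intro eqI)
        (simp_all add: embed_adj adj_closed f[OF that] complex_cstar_simps star_mult star_of_complex p(2) comm)
    show "bij_betw f (carrier A) (carrier complex_cstar)"
    proof (rule bij_betwI')
      show "(f x = f y) = (x = y)" if "x \<in> carrier A" "y \<in> carrier A" for x y
        using f[OF that(1)] f[OF that(2)] embed_inject[OF that] by metis
      show "f x \<in> carrier complex_cstar" for x by (simp add: complex_cstar_simps)
      fix c :: complex
      have "of_complex c * p \<in> embed A ` carrier A" using p(1) by blast
      then obtain x where "x \<in> carrier A" "embed A x = of_complex c * p" by auto
      then show "\<exists>x\<in>carrier A. c = f x" using eqI by metis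
    qed
  qed
qed

text \<open>The absorption property is applied for matrices of size 2 with the minimal projection in
  the role of \<open>a\<close>. By \<open>minimal_projection_spans\<close> the algebra then consists
  of the multiples of this projection and is isomorphic to the complex numbers, which is
  excluded.\<close>

lemma no_minimal_projection:
  assumes trac: "tracially_Z_absorbing A"
  shows "\<nexists>p. cstar_subalgebra.minimal_projection (embed A ` carrier A) p"
proof
  assume ex: "\<exists>p. cstar_subalgebra.minimal_projection (embed A ` carrier A) p"
  have sim: "simple_cstar_algebra A" and noiso: "\<not> star_isomorphic A complex_cstar"
    using trac by (simp_all add: tracially_Z_absorbing_def)
  interpret S: simple_cstar_subalgebra "embed A ` carrier A"
    by (rule cstar_subalgebra_embed_simple[OF sim])
  obtain p where p: "S.minimal_projection p"
    using ex by blast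
  interpret CM: cstar_algebra CM2
    by (rule cstar_algebra.matrix_cstar_algebra[OF complex_cstar_algebra])
  obtain p0 where p0: "p0 \<in> carrier A" "p = embed A p0"
    using S.minimal_projectionD(1)[OF p] by auto
  have "positive_elem p"
    using positive_elem_square[OF S.minimal_projectionD(3)[OF p]] by (simp only: S.minimal_projectionD(4)[OF p])
  then have p0pos: "positive A p0" using p0 by (simp add: positive_iff)
  have p0nz: "p0 \<noteq> \<zero>" using S.minimal_projectionD(2)[OF p] p0 by (auto simp: embed_zero)
  have "embed A ` carrier A = range (\<lambda>c. of_complex c * p)"
  proof (rule S.minimal_projection_spans[OF p])
    fix x F assume x: "x \<in> embed A ` carrier A" "positive_elem x" and F: "finite F" "F \<subseteq> embed A ` carrier A"
    obtain x0 where x0: "x0 \<in> carrier A" "x = embed A x0" using x by blast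
    have x0pos: "positive A x0" using x x0 by (simp add: positive_iff)
    obtain F0 where F0: "F0 \<subseteq> carrier A" "finite F0" "F = embed A ` F0"
      using finite_subset_image[OF F] by blast
    obtain \<phi> where cpc: "cpc_order_zero CM2 A \<phi>"
      and sub: "cuntz_subeq A (cut_down A (x0 \<otimes> x0 \<ominus> x0 \<otimes> \<phi> \<one>\<^bsub>CM2\<^esub> \<otimes> x0) (1/400)) p0"
      and comm: "\<And>z b. z \<in> carrier CM2 \<Longrightarrow> cnorm CM2 z \<le> 1 \<Longrightarrow> b \<in> F0 \<Longrightarrow>
        cnorm A (\<phi> z \<otimes> b \<ominus> b \<otimes> \<phi> z) < 1/400"
    proof -
      have "\<exists>\<phi>. let M = matrix_algebra 2 complex_cstar in
           cpc_order_zero M A \<phi> \<and>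
           cuntz_subeq A (cut_down A (x0 \<otimes>\<^bsub>A\<^esub> x0 \<ominus>\<^bsub>A\<^esub> x0 \<otimes>\<^bsub>A\<^esub> \<phi> \<one>\<^bsub>M\<^esub> \<otimes>\<^bsub>A\<^esub> x0) (1/400)) p0 \<and>
           (\<forall>z\<in>carrier M. cnorm M z \<le> 1 \<longrightarrow>
              (\<forall>b\<in>F0. cnorm A (\<phi> z \<otimes>\<^bsub>A\<^esub> b \<ominus>\<^bsub>A\<^esub> b \<otimes>\<^bsub>A\<^esub> \<phi> z) < 1/400))"
        using trac x0pos p0pos p0nz F0(1,2) unfolding tracially_Z_absorbing_def
        by (elim conjE allE[of _ x0] allE[of _ p0] allE[of _ F0] allE[of _ "1/400"] allE[of _ 2] impE) auto
      then show ?thesis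
        using that unfolding Let_def by blast
    qed
    have cp: "completely_positive CM2 A \<phi>" and lin: "linear_map CM2 A \<phi>"
      and contr: "\<And>z. z \<in> carrier CM2 \<Longrightarrow> cnorm A (\<phi> z) \<le> cnorm CM2 z"
      and oz: "\<And>y z. positive CM2 y \<Longrightarrow> positive CM2 z \<Longrightarrow> y \<otimes>\<^bsub>CM2\<^esub> z = \<zero>\<^bsub>CM2\<^esub> \<Longrightarrow> \<phi> y \<otimes> \<phi> z = \<zero>"
      using cpc by (auto simp: cpc_order_zero_def completely_positive_def)
    have \<phi>c: "\<phi> z \<in> carrier A" if "z \<in> carrier CM2" for z
      using lin that by (auto simp: linear_map_def)
    have \<phi>add: "\<phi> (y \<oplus>\<^bsub>CM2\<^esub> z) = \<phi> y \<oplus> \<phi> z" if "y \<in> carrier CM2" "z \<in> carrier CM2" for y z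
      using lin that by (auto simp: linear_map_def)
    have \<phi>smult: "\<phi> (c \<odot>\<^bsub>CM2\<^esub> z) = c \<odot> \<phi> z" if "z \<in> carrier CM2" for c z
      using lin that by (auto simp: linear_map_def)
    have pos\<phi>: "positive A (\<phi> y)" if "positive CM2 y" for y
      by (rule positive_of_completely_positive[OF CM.cstar_algebra_axioms cp that])
    define e where "e z = embed A (\<phi> z)" for z
    let ?Z = "mat22 1 0 0 (-1)" and ?X = "mat22 0 1 1 0"
    have one: "\<one>\<^bsub>CM2\<^esub> \<in> carrier CM2" by (simp add: mat22_simps mat22_closed)
    have erot: "e (rotated_projection c s) = (1/2) *\<^sub>R (e \<one>\<^bsub>CM2\<^esub> + c *\<^sub>R e ?Z + s *\<^sub>R e ?X)" for c s
      unfolding rotated_projection_eq e_def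
      by (simp only: \<phi>smult \<phi>add one mat22_closed CM.smult_closed' CM.a_closed embed_smult_real embed_add
          smult_closed' a_closed \<phi>c)
    have onep: "positive CM2 \<one>\<^bsub>CM2\<^esub>" "cnorm CM2 \<one>\<^bsub>CM2\<^esub> \<le> 1"
      by (rule CM.projection_facts; simp add: mat22_simps mat22_closed)+
    have rotp: "positive CM2 (rotated_projection c s)" "cnorm CM2 (rotated_projection c s) \<le> 1"
      if "c\<^sup>2 + s\<^sup>2 = 1" for c s
      using CM.projection_facts[OF rotated_projection(1-3)[OF that]] by auto
    have se: "star (e z) = e z" if "positive CM2 z" for z
      unfolding e_def by (rule star_embed_positive[OF pos\<phi>[OF that]])
    have selfadj: "star (e \<one>\<^bsub>CM2\<^esub>) = e \<one>\<^bsub>CM2\<^esub>" "star (e ?Z) = e ?Z" "star (e ?X) = e ?X"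
    proof -
      show s1: "star (e \<one>\<^bsub>CM2\<^esub>) = e \<one>\<^bsub>CM2\<^esub>" by (rule se[OF onep(1)])
      \<comment> \<open>The Pauli matrices are not positive. Self-adjointness of their images is
        read off from the images of projections, which are positive.\<close>
      have "e ?Z = 2 *\<^sub>R e (rotated_projection 1 0) - e \<one>\<^bsub>CM2\<^esub>" unfolding erot by simp
      moreover have "star (e (rotated_projection 1 0)) = e (rotated_projection 1 0)" by (rule se[OF rotp(1)]) simp
      ultimately show "star (e ?Z) = e ?Z" by (simp add: star_diff star_scaleR s1)
      have "e ?X = 2 *\<^sub>R e (rotated_projection 0 1) - e \<one>\<^bsub>CM2\<^esub>" unfolding erot by simp
      moreover have "star (e (rotated_projection 0 1)) = e (rotated_projection 0 1)" by (rule se[OF rotp(1)]) simp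
      ultimately show "star (e ?X) = e ?X" by (simp add: star_diff star_scaleR s1)
    qed
    have ecomm: "norm (e z * b - b * e z) < 1/400" if zb: "z \<in> carrier CM2" "cnorm CM2 z \<le> 1" "b \<in> F" for z b
    proof -
      obtain b0 where b0: "b0 \<in> F0" "b0 \<in> carrier A" "b = embed A b0" using zb(3) F0 by blast
      have "e z * b - b * e z = embed A (\<phi> z \<otimes> b0 \<ominus> b0 \<otimes> \<phi> z)"
        using b0 \<phi>c[OF zb(1)] by (simp add: e_def embed_minus embed_mult mult_closed)
      then show ?thesis
        using comm[OF zb(1,2) b0(1)] b0 \<phi>c[OF zb(1)] by (simp add: norm_embed mult_closed)
    qed
    have enorm: "norm (e z) \<le> 1" if "z \<in> carrier CM2" "cnorm CM2 z \<le> 1" for z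
      unfolding e_def norm_embed[OF \<phi>c[OF that(1)]] using contr[OF that(1)] that(2) by linarith
    have eq2: "e (rotated_projection (- c) (- s)) = (1/2) *\<^sub>R (e \<one>\<^bsub>CM2\<^esub> - c *\<^sub>R e ?Z - s *\<^sub>R e ?X)" for c s
      unfolding erot by simp
    let ?c = "x0 \<otimes> x0 \<ominus> x0 \<otimes> \<phi> \<one>\<^bsub>CM2\<^esub> \<otimes> x0"
    have cc: "?c \<in> carrier A" using x0 \<phi>c[OF one] by (simp add: mult_closed)
    have ec: "embed A ?c = x * x - x * e \<one>\<^bsub>CM2\<^esub> * x"
      using x0 \<phi>c[OF one] by (simp add: embed_minus embed_mult mult_closed e_def)
    have "star (embed A ?c) = embed A ?c"
      unfolding ec by (simp add: star_diff star_mult selfadj positive_elem_star[OF x(2)] mult.assoc)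
    then have "embed A (adj A ?c) = embed A ?c" by (simp only: embed_adj[OF cc])
    then have adjc: "adj A ?c = ?c" using embed_inject[OF adj_closed[OF cc] cc] by blast
    note cut = cut_down_embed[OF cc adjc, of "1/400"]
    have "\<exists>v. (\<forall>k. v k \<in> carrier A) \<and>
        (\<lambda>k. embed A (v k) * embed A p0 * star (embed A (v k))) \<longlonglongrightarrow> embed A (cut_down A ?c (1/400))"
      using sub cuntz_subeq_iff[OF cut(1) p0(1)] by simp
    then obtain v where v: "\<And>k. v k \<in> carrier A"
      "(\<lambda>k. embed A (v k) * p * star (embed A (v k))) \<longlonglongrightarrow> fcalc (\<lambda>t. max (t - 1/400) 0) (x * x - x * e \<one>\<^bsub>CM2\<^esub> * x)"
      using cut(2) by (auto simp: p0 ec)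
    show "\<exists>f0 f1 f2 w. S.order_zero_data p x F f0 f1 f2 w"
      unfolding S.order_zero_data_def
    proof (intro exI conjI allI impI ballI)
      show "e \<one>\<^bsub>CM2\<^esub> \<in> embed A ` carrier A" "e ?Z \<in> embed A ` carrier A" "e ?X \<in> embed A ` carrier A"
        unfolding e_def by (intro imageI \<phi>c one mat22_closed)+
      show "star (e \<one>\<^bsub>CM2\<^esub>) = e \<one>\<^bsub>CM2\<^esub>" "star (e ?Z) = e ?Z" "star (e ?X) = e ?X" by (rule selfadj)+
      show "norm (e \<one>\<^bsub>CM2\<^esub>) \<le> 1" by (rule enorm[OF one onep(2)])
      show "norm (e \<one>\<^bsub>CM2\<^esub> * b - b * e \<one>\<^bsub>CM2\<^esub>) < 1/400" if "b \<in> F" for b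
        by (rule ecomm[OF one onep(2) that])
      show "embed A (v k) \<in> embed A ` carrier A" for k by (rule imageI[OF v(1)])
      show "(\<lambda>k. embed A (v k) * p * star (embed A (v k))) \<longlonglongrightarrow> fcalc (\<lambda>t. max (t - 1/400) 0) (x * x - x * e \<one>\<^bsub>CM2\<^esub> * x)"
        by (rule v(2))
      fix c s :: real assume cs: "c\<^sup>2 + s\<^sup>2 = 1"
      then have cs': "(- c)\<^sup>2 + (- s)\<^sup>2 = 1" by simp
      show "((1/2) *\<^sub>R (e \<one>\<^bsub>CM2\<^esub> + c *\<^sub>R e ?Z + s *\<^sub>R e ?X)) * ((1/2) *\<^sub>R (e \<one>\<^bsub>CM2\<^esub> - c *\<^sub>R e ?Z - s *\<^sub>R e ?X)) = 0"
        unfolding erot[symmetric] eq2[symmetric] unfolding e_def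
        using oz[OF rotp(1)[OF cs] rotp(1)[OF cs'] rotated_projection(4)[OF cs]]
        by (simp add: embed_zero \<phi>c rotated_projection(1)[OF cs] rotated_projection(1)[OF cs'] flip: embed_mult)
      show "norm ((1/2) *\<^sub>R (e \<one>\<^bsub>CM2\<^esub> - c *\<^sub>R e ?Z - s *\<^sub>R e ?X)) \<le> 1"
        unfolding eq2[symmetric] by (rule enorm[OF rotated_projection(1)[OF cs'] rotp(2)[OF cs']])
      show "norm ((1/2) *\<^sub>R (e \<one>\<^bsub>CM2\<^esub> + c *\<^sub>R e ?Z + s *\<^sub>R e ?X) * b - b * ((1/2) *\<^sub>R (e \<one>\<^bsub>CM2\<^esub> + c *\<^sub>R e ?Z + s *\<^sub>R e ?X))) < 1/400"
        if "b \<in> F" for b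
        unfolding erot[symmetric] by (rule ecomm[OF rotated_projection(1)[OF cs] rotp(2)[OF cs] that])
    qed
  qed
  then have "star_isomorphic A complex_cstar"
    by (rule embed_scalar_star_isomorphic) (rule S.minimal_projectionD[OF p])+
  with noiso show False by blast
qed

end

section \<open>Matrix algebras over simple tracially Z-absorbing algebras\<close>

context cstar_algebra
begin

definition single :: "nat \<Rightarrow> nat \<Rightarrow> 'a \<Rightarrow> nat \<Rightarrow> nat \<Rightarrow> 'a" where
  "single k l x i j = (if i = k \<and> j = l then x else \<zero>)"

definition diag :: "nat \<Rightarrow> 'a \<Rightarrow> nat \<Rightarrow> nat \<Rightarrow> 'a" where
  "diag n x i j = (if i = j \<and> i < n then x else \<zero>)"

lemma neg_zero: "\<ominus> \<zero> = \<zero>"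
  using smult_minus_1[of \<zero>] by (simp add: smult_zero)

lemma single_closed: "k < n \<Longrightarrow> l < n \<Longrightarrow> x \<in> carrier A \<Longrightarrow> single k l x \<in> carrier (M n)"
  by (rule mat_carrierI) (auto simp: single_def)

lemma diag_closed: "x \<in> carrier A \<Longrightarrow> diag n x \<in> carrier (M n)"
  by (rule mat_carrierI) (auto simp: diag_def)

lemma sum_eq_term:
  fixes f :: "nat \<Rightarrow> 'b::comm_monoid_add"
  assumes "i < n" "\<And>k. k \<noteq> i \<Longrightarrow> f k = 0"
  shows "(\<Sum>k<n. f k) = f i"
proof -
  have "(\<Sum>k<n. f k) = sum f {i}"
    by (rule sum.mono_neutral_right) (use assms in auto)
  then show ?thesis by simp
qed

lemma embed_mat_mult:
  assumes "a \<in> carrier (M n)" "b \<in> carrier (M n)"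
  shows "embed A ((a \<otimes>\<^bsub>M n\<^esub> b) i j) = (\<Sum>k<n. embed A (a i k) * embed A (b k j))"
  by (simp add: matrix_algebra_simps(2) embed_finsum mult_closed embed_mult mat_entry[OF assms(1)] mat_entry[OF assms(2)])

lemma single_mult_left:
  assumes kl: "k < n" "l < n" and x: "x \<in> carrier A" and a: "a \<in> carrier (M n)"
  shows "single k l x \<otimes>\<^bsub>M n\<^esub> a = (\<lambda>i j. if i = k then x \<otimes> a l j else \<zero>)"
proof (rule mat_eqI[where n = n])
  show "single k l x \<otimes>\<^bsub>M n\<^esub> a \<in> carrier (M n)"
    by (intro mat_mult_closed single_closed kl x a)
  show "(\<lambda>i j. if i = k then x \<otimes> a l j else \<zero>) \<in> carrier (M n)"
    by (rule mat_carrierI) (use kl in \<open>auto simp: mult_closed x mat_entry[OF a] mat_outside[OF a] mult_zero_right\<close>)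
  fix i j
  show "embed A ((single k l x \<otimes>\<^bsub>M n\<^esub> a) i j) = embed A (if i = k then x \<otimes> a l j else \<zero>)"
    unfolding embed_mat_mult[OF single_closed[OF kl x] a]
    by (subst sum_eq_term[OF kl(2)]) (auto simp: single_def embed_zero embed_mult x mat_entry[OF a])
qed

lemma single_mult_right:
  assumes kl: "k < n" "l < n" and x: "x \<in> carrier A" and a: "a \<in> carrier (M n)"
  shows "a \<otimes>\<^bsub>M n\<^esub> single k l x = (\<lambda>i j. if j = l then a i k \<otimes> x else \<zero>)"
proof (rule mat_eqI[where n = n])
  show "a \<otimes>\<^bsub>M n\<^esub> single k l x \<in> carrier (M n)"
    by (intro mat_mult_closed single_closed kl x a)
  show "(\<lambda>i j. if j = l then a i k \<otimes> x else \<zero>) \<in> carrier (M n)"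
    by (rule mat_carrierI) (use kl in \<open>auto simp: mult_closed x mat_entry[OF a] mat_outside[OF a] mult_zero_left\<close>)
  fix i j
  show "embed A ((a \<otimes>\<^bsub>M n\<^esub> single k l x) i j) = embed A (if j = l then a i k \<otimes> x else \<zero>)"
    unfolding embed_mat_mult[OF a single_closed[OF kl x]]
    by (subst sum_eq_term[OF kl(1)]) (auto simp: single_def embed_zero embed_mult x mat_entry[OF a])
qed

lemma single_mult_single:
  assumes "k < n" "l < n" "m < n" "x \<in> carrier A" "y \<in> carrier A"
  shows "single k l x \<otimes>\<^bsub>M n\<^esub> single l m y = single k m (x \<otimes> y)"
  using assms by (subst single_mult_left) (auto simp: single_closed single_def fun_eq_iff mult_zero_right)

lemma single_add: "single k l (x \<oplus> y) = single k l x \<oplus>\<^bsub>M n\<^esub> single k l y"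
  by (auto simp: single_def matrix_algebra_simps fun_eq_iff)

lemma single_smult: "single k l (c \<odot> x) = c \<odot>\<^bsub>M n\<^esub> single k l x"
  by (auto simp: single_def matrix_algebra_simps fun_eq_iff smult_zero)

lemma single_zero: "single k l \<zero> = \<zero>\<^bsub>M n\<^esub>"
  by (auto simp: single_def matrix_algebra_simps fun_eq_iff)

lemma single_adj: "adj (M n) (single k l x) = single l k (adj A x)"
  by (auto simp: single_def matrix_algebra_simps fun_eq_iff adj_zero)

lemma single_eq_zero_iff: "single k l x = \<zero>\<^bsub>M n\<^esub> \<longleftrightarrow> x = \<zero>"
  by (auto simp: single_def matrix_algebra_simps fun_eq_iff)

lemma cnorm_single_le:
  assumes "k < n" "l < n" "x \<in> carrier A"
  shows "cnorm (M n) (single k l x) \<le> cnorm A x"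
proof -
  have "(\<Sum>j<n. cnorm A (single k l x i j)) = (if i = k then cnorm A x else 0)" for i
    by (subst sum_eq_term[OF assms(2)]) (auto simp: single_def cnorm_zero)
  then have "(\<Sum>i<n. \<Sum>j<n. cnorm A (single k l x i j)) = cnorm A x"
    using sum_eq_term[OF assms(1), of "\<lambda>i. if i = k then cnorm A x else 0"] by simp
  then show ?thesis
    using mat_cnorm_le_sum[OF single_closed[OF assms]] by simp
qed

section \<open>Simplicity of the matrix algebra\<close>

lemma nonzero_exists: "simple_cstar_algebra A \<Longrightarrow> \<exists>x\<in>carrier A. x \<noteq> \<zero>"
  unfolding simple_cstar_algebra_def using zero_closed by blast

lemma prime_carrier:
  assumes sim: "simple_cstar_algebra A" and w: "w \<in> carrier A" "w \<noteq> \<zero>" and b: "b \<in> carrier A" "b \<noteq> \<zero>"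
  shows "\<exists>z\<in>carrier A. w \<otimes> z \<otimes> b \<noteq> \<zero>"
proof -
  interpret S: simple_cstar_subalgebra "embed A ` carrier A"
    by (rule cstar_subalgebra_embed_simple[OF sim])
  obtain z where "z \<in> embed A ` carrier A" "embed A w * z * embed A b \<noteq> 0"
    using S.prime[of "embed A w" "embed A b"] w b by (auto simp: embed_eq_0_iff)
  then obtain z0 where "z0 \<in> carrier A" "embed A w * embed A z0 * embed A b \<noteq> 0" by auto
  then show ?thesis
    using w b by (intro bexI[of _ z0]) (auto simp: embed_zero embed_mult mult_closed dest!: arg_cong[where f = "embed A"])
qed

text \<open>For a nonzero closed ideal and a fixed position, the elements of \<open>A\<close> that
  occur in the ideal as the single entry there form a closed ideal of \<open>A\<close>. It is
  nonzero, hence everything, and every matrix is a finite sum of matrices with one nonzero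
  entry.\<close>

lemma simple_matrix_algebra:
  assumes sim: "simple_cstar_algebra A" and n: "n \<ge> 1"
  shows "simple_cstar_algebra (M n)"
proof -
  interpret M: cstar_algebra "M n" by (rule matrix_cstar_algebra)
  obtain x0 where x0: "x0 \<in> carrier A" "x0 \<noteq> \<zero>" using nonzero_exists[OF sim] by blast
  have "single 0 0 x0 \<in> carrier (M n)" "single 0 0 x0 \<noteq> \<zero>\<^bsub>M n\<^esub>"
    using n x0 by (auto simp: single_closed single_eq_zero_iff)
  then have nontriv: "carrier (M n) \<noteq> {\<zero>\<^bsub>M n\<^esub>}" by blast
  have "I = {\<zero>\<^bsub>M n\<^esub>} \<or> I = carrier (M n)" if I: "closed_ideal (M n) I" for I
  proof (rule disjCI)
    assume notfull: "I \<noteq> carrier (M n)"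
    have sub: "submodule I complex_cstar (M n)"
      and ideal: "\<And>a x. a \<in> carrier (M n) \<Longrightarrow> x \<in> I \<Longrightarrow> a \<otimes>\<^bsub>M n\<^esub> x \<in> I"
        "\<And>a x. a \<in> carrier (M n) \<Longrightarrow> x \<in> I \<Longrightarrow> x \<otimes>\<^bsub>M n\<^esub> a \<in> I"
      and lim: "\<And>s x. x \<in> carrier (M n) \<Longrightarrow> (\<And>k. s k \<in> I) \<Longrightarrow> converges_to (M n) s x \<Longrightarrow> x \<in> I"
      using I unfolding closed_ideal_def by blast+
    note subE = M.submoduleE[OF sub]
    have zeroI: "\<zero>\<^bsub>M n\<^esub> \<in> I"
    proof -
      obtain y where "y \<in> I" using subE(2) by blast
      then have "0 \<odot>\<^bsub>M n\<^esub> y \<in> I" "y \<in> carrier (M n)"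
        using subE(1) subE(4)[of 0 y] by (auto simp: complex_cstar_simps)
      then show ?thesis by (simp add: M.smult_0)
    qed
    show "I = {\<zero>\<^bsub>M n\<^esub>}"
    proof (rule ccontr)
      assume "I \<noteq> {\<zero>\<^bsub>M n\<^esub>}"
      then obtain a where a: "a \<in> I" "a \<noteq> \<zero>\<^bsub>M n\<^esub>" using zeroI by blast
      then have aM: "a \<in> carrier (M n)" using subE(1) by blast
      obtain r c where rc: "a r c \<noteq> \<zero>"
        using a(2) by (auto simp: matrix_algebra_simps fun_eq_iff)
      then have rcn: "r < n" "c < n" using mat_outside[OF aM] by blast+
      note ar = mat_entry[OF aM, of r c]
      have full: "single k l x \<in> I" if kl: "k < n" "l < n" and x: "x \<in> carrier A" for k l x
      proof -
        define J where "J = {x \<in> carrier A. single k l x \<in> I}"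
        have "closed_ideal A J"
          unfolding closed_ideal_def
        proof (intro conjI ballI allI impI)
          show "submodule J complex_cstar A"
          proof (rule submoduleI)
            fix b x assume "x \<in> J"
            then show "b \<odot> x \<in> J"
              using subE(4)[of b "single k l x"] by (simp add: J_def single_smult[of k l b x n] complex_cstar_simps)
            show "\<ominus> x \<in> J"
              using \<open>x \<in> J\<close> subE(4)[of "-1" "single k l x"]
              by (simp add: J_def complex_cstar_simps single_smult[of k l "-1" x n, symmetric] smult_minus_1)
            fix y assume "y \<in> J"
            then show "x \<oplus> y \<in> J"
              using \<open>x \<in> J\<close> subE(5) by (simp add: J_def single_add[of k l x y n])
          qed (auto simp: J_def single_zero[of k l n] zeroI)
          show "b \<otimes> x \<in> J" "x \<otimes> b \<in> J" if "b \<in> carrier A" "x \<in> J" for b x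
            using that ideal(1)[OF single_closed[OF kl(1) kl(1)], of b "single k l x"]
              ideal(2)[OF single_closed[OF kl(2) kl(2)], of b "single k l x"]
            by (simp_all add: J_def mult_closed single_mult_single kl)
          fix s x assume x: "x \<in> carrier A" and s: "(\<forall>k. s k \<in> J) \<and> converges_to A s x"
          then have sA: "s m \<in> carrier A" for m by (simp add: J_def)
          have "single k l x \<in> I"
          proof (rule lim)
            show "single k l (s m) \<in> I" for m using s by (simp add: J_def)
            have eq: "single k l (s m) \<ominus>\<^bsub>M n\<^esub> single k l x = single k l (s m \<ominus> x)" for m
              unfolding matrix_minus[OF single_closed[OF kl sA] single_closed[OF kl x]]
              by (auto simp: single_def fun_eq_iff a_minus_def r_neg neg_zero)
            show "converges_to (M n) (\<lambda>m. single k l (s m)) (single k l x)"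
              unfolding converges_to_def eq
            proof (rule Lim_null_comparison)
              show "\<forall>\<^sub>F m in sequentially. norm (cnorm (M n) (single k l (s m \<ominus> x))) \<le> cnorm A (s m \<ominus> x)"
                using cnorm_single_le[OF kl minus_closed[OF sA x]]
                  M.cnorm_nonneg[OF single_closed[OF kl minus_closed[OF sA x]]]
                by (intro always_eventually) simp
              show "(\<lambda>m. cnorm A (s m \<ominus> x)) \<longlonglongrightarrow> 0" using s by (simp add: converges_to_def)
            qed
          qed (rule single_closed[OF kl x])
          then show "x \<in> J" using x by (simp add: J_def)
        qed
        then have J: "J = {\<zero>} \<or> J = carrier A"
          using sim by (simp add: simple_cstar_algebra_def)
        obtain z where z: "z \<in> carrier A" "a r c \<otimes> z \<otimes> a r c \<noteq> \<zero>"
          using prime_carrier[OF sim ar rc ar rc] by blast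
        obtain y where y: "y \<in> carrier A" "(a r c \<otimes> z \<otimes> a r c) \<otimes> y \<otimes> a r c \<noteq> \<zero>"
          using prime_carrier[OF sim _ z(2) ar rc] z(1) ar by (auto simp: mult_closed)
        let ?b = "a r c \<otimes> z" and ?c = "y \<otimes> a r c"
        have bc: "?b \<in> carrier A" "?c \<in> carrier A" using z y ar by (simp_all add: mult_closed)
        have "single k r ?b \<otimes>\<^bsub>M n\<^esub> a \<otimes>\<^bsub>M n\<^esub> single c l ?c \<in> I"
          by (intro ideal a single_closed kl rcn bc)
        moreover have "single k r ?b \<otimes>\<^bsub>M n\<^esub> a \<otimes>\<^bsub>M n\<^esub> single c l ?c = single k l (?b \<otimes> a r c \<otimes> ?c)"
          by (subst single_mult_right[OF rcn(2) kl(2) bc(2) mat_mult_closed[OF single_closed[OF kl(1) rcn(1) bc(1)] aM]],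
              subst single_mult_left[OF kl(1) rcn(1) bc(1) aM])
            (auto simp: single_def fun_eq_iff mult_zero_left bc)
        moreover have "?b \<otimes> a r c \<otimes> ?c \<noteq> \<zero>"
          using y z ar by (simp add: mult_assoc mult_closed)
        moreover have "?b \<otimes> a r c \<otimes> ?c \<in> carrier A" using bc ar by (simp add: mult_closed)
        ultimately have "J \<noteq> {\<zero>}" by (auto simp: J_def)
        with J x show ?thesis by (auto simp: J_def)
      qed
      have "x \<in> I" if x: "x \<in> carrier (M n)" for x
      proof -
        define R where "R P = (\<lambda>i j. if (i, j) \<in> P then x i j else \<zero>)" for P
        have "R P \<in> I" if "finite P" "P \<subseteq> {..<n} \<times> {..<n}" for P
          using that
        proof (induction P rule: finite_induct)
          case empty
          have "R {} = \<zero>\<^bsub>M n\<^esub>" by (simp add: R_def matrix_algebra_simps)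
          then show ?case using zeroI by simp
        next
          case (insert p P)
          obtain k l where p: "p = (k, l)" by fastforce
          have "R (insert p P) = R P \<oplus>\<^bsub>M n\<^esub> single k l (x k l)"
            using insert(2) by (auto simp: R_def single_def matrix_algebra_simps fun_eq_iff p mat_entry[OF x])
          then show ?case
            using insert p full[of k l "x k l"] mat_entry[OF x] subE(5) by auto
        qed
        then have "R ({..<n} \<times> {..<n}) \<in> I" by simp
        moreover have "R ({..<n} \<times> {..<n}) = x"
          using mat_outside[OF x] by (auto simp: R_def fun_eq_iff)
        ultimately show ?thesis by simp
      qed
      then show False using notfull subE(1) by blast
    qed
  qed
  then show ?thesis
    unfolding simple_cstar_algebra_def using matrix_cstar_algebra nontriv by blast
qed

text \<open>Restricted to the corner, the isomorphism is an injective homomorphism from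
  \<open>A\<close> to the complex numbers that respects adjoints. Its image is a nonzero complex
  subspace, hence everything.\<close>

lemma matrix_not_complex:
  assumes sim: "simple_cstar_algebra A" and n: "n \<ge> 1" and iso: "star_isomorphic (M n) complex_cstar"
  shows "star_isomorphic A complex_cstar"
proof -
  obtain f where lin: "linear_map (M n) complex_cstar f" and bij: "bij_betw f (carrier (M n)) (carrier complex_cstar)"
    and mult: "\<And>x y. x \<in> carrier (M n) \<Longrightarrow> y \<in> carrier (M n) \<Longrightarrow> f (x \<otimes>\<^bsub>M n\<^esub> y) = f x * f y"
    and ad: "\<And>x. x \<in> carrier (M n) \<Longrightarrow> f (adj (M n) x) = cnj (f x)"
    using iso unfolding star_isomorphic_def complex_cstar_simps by blast
  have add: "f (x \<oplus>\<^bsub>M n\<^esub> y) = f x + f y" if "x \<in> carrier (M n)" "y \<in> carrier (M n)" for x y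
    using lin that by (simp add: linear_map_def complex_cstar_simps)
  have smult: "f (c \<odot>\<^bsub>M n\<^esub> x) = c * f x" if "x \<in> carrier (M n)" for c x
    using lin that by (simp add: linear_map_def complex_cstar_simps)
  let ?s = "single 0 0"
  have sc: "?s x \<in> carrier (M n)" if "x \<in> carrier A" for x
    using n that by (simp add: single_closed)
  define g where "g x = f (?s x)" for x
  have gadd: "g (x \<oplus> y) = g x + g y" if "x \<in> carrier A" "y \<in> carrier A" for x y
    unfolding g_def single_add[of 0 0 x y n] by (rule add[OF sc[OF that(1)] sc[OF that(2)]])
  have gsmult: "g (c \<odot> x) = c * g x" if "x \<in> carrier A" for c x
    unfolding g_def single_smult[of 0 0 c x n] by (rule smult[OF sc[OF that]])
  have inj: "g x = g y \<longleftrightarrow> x = y" if "x \<in> carrier A" "y \<in> carrier A" for x y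
  proof
    assume "g x = g y"
    then have "?s x = ?s y"
      using bij sc that unfolding g_def bij_betw_def inj_on_def by blast
    then have "?s x 0 0 = ?s y 0 0" by simp
    then show "x = y" by (simp add: single_def)
  qed simp
  obtain x where x: "x \<in> carrier A" "x \<noteq> \<zero>" using nonzero_exists[OF sim] by blast
  have "g \<zero> = 0" using gsmult[of \<zero> 0] by (simp add: smult_0)
  then have gx: "g x \<noteq> 0" using inj[OF x(1) zero_closed] x(2) by simp
  show ?thesis
    unfolding star_isomorphic_def linear_map_def complex_cstar_simps
  proof (intro exI[of _ g] conjI ballI allI)
    show "bij_betw g (carrier A) UNIV"
    proof (rule bij_betwI')
      show "(g x = g y) = (x = y)" if "x \<in> carrier A" "y \<in> carrier A" for x y
        by (rule inj[OF that])
      show "\<exists>y\<in>carrier A. c = g y" for c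
        using gx x by (intro bexI[of _ "(c / g x) \<odot> x"]) (simp_all add: gsmult)
    qed simp
    show "g (x \<otimes> y) = g x * g y" if "x \<in> carrier A" "y \<in> carrier A" for x y
      using mult[OF sc[OF that(1)] sc[OF that(2)]] n that by (simp add: g_def single_mult_single)
    show "g (adj A x) = cnj (g x)" if "x \<in> carrier A" for x
      using ad[OF sc[OF that]] by (simp add: g_def single_adj)
  qed (auto simp: gadd gsmult)
qed

section \<open>Constant diagonal matrices\<close>

lemma diag_mult:
  assumes "x \<in> carrier A" "y \<in> carrier A"
  shows "diag n x \<otimes>\<^bsub>M n\<^esub> diag n y = diag n (x \<otimes> y)"
proof (rule mat_eqI[where n = n])
  fix i j
  show "embed A ((diag n x \<otimes>\<^bsub>M n\<^esub> diag n y) i j) = embed A (diag n (x \<otimes> y) i j)"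
  proof (cases "i < n")
    case True
    then show ?thesis
      unfolding embed_mat_mult[OF diag_closed[OF assms(1)] diag_closed[OF assms(2)]]
      by (subst sum_eq_term[OF True]) (auto simp: diag_def embed_zero embed_mult assms)
  next
    case False
    then show ?thesis
      unfolding embed_mat_mult[OF diag_closed[OF assms(1)] diag_closed[OF assms(2)]]
      by (simp add: diag_def embed_zero)
  qed
qed (intro mat_mult_closed diag_closed mult_closed assms)+

lemma diag_entry_mult_left:
  assumes "y \<in> carrier A" "a \<in> carrier (M n)"
  shows "diag n y \<otimes>\<^bsub>M n\<^esub> a = (\<lambda>i j. y \<otimes> a i j)"
proof (rule mat_eqI[where n = n])
  show "(\<lambda>i j. y \<otimes> a i j) \<in> carrier (M n)"
    by (rule mat_carrierI) (auto simp: mult_closed assms(1) mat_entry[OF assms(2)] mat_outside[OF assms(2)] mult_zero_right)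
  fix i j
  show "embed A ((diag n y \<otimes>\<^bsub>M n\<^esub> a) i j) = embed A (y \<otimes> a i j)"
  proof (cases "i < n")
    case True
    then show ?thesis
      unfolding embed_mat_mult[OF diag_closed[OF assms(1)] assms(2)]
      by (subst sum_eq_term[OF True]) (auto simp: diag_def embed_zero embed_mult assms(1) mat_entry[OF assms(2)])
  next
    case False
    then show ?thesis
      unfolding embed_mat_mult[OF diag_closed[OF assms(1)] assms(2)]
      by (simp add: diag_def embed_zero mat_outside[OF assms(2)] assms(1) mult_zero_right)
  qed
qed (intro mat_mult_closed diag_closed assms)

lemma diag_entry_mult_right:
  assumes "y \<in> carrier A" "a \<in> carrier (M n)"
  shows "a \<otimes>\<^bsub>M n\<^esub> diag n y = (\<lambda>i j. a i j \<otimes> y)"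
proof (rule mat_eqI[where n = n])
  show "(\<lambda>i j. a i j \<otimes> y) \<in> carrier (M n)"
    by (rule mat_carrierI) (auto simp: mult_closed assms(1) mat_entry[OF assms(2)] mat_outside[OF assms(2)] mult_zero_left)
  fix i j
  show "embed A ((a \<otimes>\<^bsub>M n\<^esub> diag n y) i j) = embed A (a i j \<otimes> y)"
  proof (cases "j < n")
    case True
    then show ?thesis
      unfolding embed_mat_mult[OF assms(2) diag_closed[OF assms(1)]]
      by (subst sum_eq_term[OF True]) (auto simp: diag_def embed_zero embed_mult assms(1) mat_entry[OF assms(2)])
  next
    case False
    then show ?thesis
      unfolding embed_mat_mult[OF assms(2) diag_closed[OF assms(1)]]
      by (simp add: diag_def embed_zero mat_outside[OF assms(2)] assms(1) mult_zero_left)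
  qed
qed (intro mat_mult_closed diag_closed assms)

lemma diag_add: "diag n (x \<oplus> y) = diag n x \<oplus>\<^bsub>M n\<^esub> diag n y"
  by (auto simp: diag_def matrix_algebra_simps fun_eq_iff)

lemma diag_smult: "diag n (c \<odot> x) = c \<odot>\<^bsub>M n\<^esub> diag n x"
  by (auto simp: diag_def matrix_algebra_simps fun_eq_iff smult_zero)

lemma diag_zero: "diag n \<zero> = \<zero>\<^bsub>M n\<^esub>"
  by (auto simp: diag_def matrix_algebra_simps fun_eq_iff)

lemma diag_adj: "diag n (adj A x) = adj (M n) (diag n x)"
  by (auto simp: diag_def matrix_algebra_simps fun_eq_iff adj_zero)

lemma diag_minus: "x \<in> carrier A \<Longrightarrow> y \<in> carrier A \<Longrightarrow> diag n (x \<ominus> y) = diag n x \<ominus>\<^bsub>M n\<^esub> diag n y"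
  by (subst matrix_minus) (auto simp: diag_closed diag_def fun_eq_iff a_minus_def r_neg neg_zero)

text \<open>Outside the \<open>n\<close> by \<open>n\<close> block \<open>diag n x\<close> is zero,
  unlike the matrix of \<open>mat_norm_diag_le\<close>; only the block acts on columns of length
  \<open>n\<close>.\<close>

lemma cnorm_diag_le:
  assumes "x \<in> carrier A"
  shows "cnorm (M n) (diag n x) \<le> cnorm A x"
proof -
  interpret S: cstar_subalgebra "embed A ` carrier A" by (rule cstar_subalgebra_embed)
  have "S.mat_norm n (emb (diag n x)) = S.mat_norm n (\<lambda>i j. if i = j then embed A x else 0)"
  proof -
    have "mat_vec n (emb (diag n x)) y i = mat_vec n (\<lambda>i j. if i = j then embed A x else 0) y i"
      if "i < n" for y i
      unfolding mat_vec_def using that by (intro sum.cong) (auto simp: diag_def embed_zero)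
    then have "norm_col n (mat_vec n (emb (diag n x)) y) = norm_col n (mat_vec n (\<lambda>i j. if i = j then embed A x else 0) y)" for y
      by (rule norm_col_cong)
    then show ?thesis by (simp add: S.mat_norm_def)
  qed
  then show ?thesis
    using S.mat_norm_diag_le[of n "embed A x"]
    by (simp add: cnorm_matrix[OF diag_closed[OF assms]] norm_embed[OF assms])
qed

lemma matrix_finsum_entry:
  assumes "finite I" "\<And>k. k \<in> I \<Longrightarrow> f k \<in> carrier (M n)"
  shows "(\<Oplus>\<^bsub>M n\<^esub>k\<in>I. f k) = (\<lambda>i j. \<Oplus>k\<in>I. f k i j)"
  using assms
proof (induction I rule: finite_induct)
  interpret M: cstar_algebra "M n" by (rule matrix_cstar_algebra)
  {
    case empty
    show ?case by (simp add: matrix_algebra_simps)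
  next
    case (insert k I)
    then have "(\<lambda>x. f x i j) \<in> I \<rightarrow> carrier A" "f k i j \<in> carrier A" for i j
      using insert.prems by (auto intro!: mat_entry[where n = n])
    with insert show ?case
      by (subst M.finsum_insert) (auto simp: matrix_algebra_simps(4) fun_eq_iff)
  }
qed

lemma diag_finsum:
  assumes "finite I" "\<And>k. k \<in> I \<Longrightarrow> f k \<in> carrier A"
  shows "diag n (\<Oplus>k\<in>I. f k) = (\<Oplus>\<^bsub>M n\<^esub>k\<in>I. diag n (f k))"
proof -
  have "(\<Oplus>\<^bsub>M n\<^esub>k\<in>I. diag n (f k)) = (\<lambda>i j. \<Oplus>k\<in>I. diag n (f k) i j)"
    by (rule matrix_finsum_entry) (use assms in \<open>auto simp: diag_closed\<close>)
  moreover have "diag n (\<Oplus>k\<in>I. f k) i j = (\<Oplus>k\<in>I. diag n (f k) i j)" for i j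
  proof (cases "i = j \<and> i < n")
    case True
    then show ?thesis by (simp add: diag_def)
  next
    case False
    then show ?thesis by (simp only: diag_def if_False finsum_zero)
  qed
  ultimately show ?thesis by (simp add: fun_eq_iff)
qed

text \<open>The diagonal map is a contractive homomorphism respecting adjoints. Applied to the
  entries of a factor \<open>b\<close> it turns a factorization over \<open>A\<close> of the matrix
  of images into one over the matrix algebra, which preserves complete positivity; the other
  properties are immediate.\<close>

lemma cpc_order_zero_diag:
  fixes B :: "'b cstar"
  assumes cpc: "cpc_order_zero B A \<phi>"
  shows "cpc_order_zero B (M n) (\<lambda>z. diag n (\<phi> z))"
proof -
  interpret M: cstar_algebra "M n" by (rule matrix_cstar_algebra)
  have lin: "linear_map B A \<phi>" and cp: "\<And>k a. k \<ge> 1 \<Longrightarrow> positive (matrix_algebra k B) a \<Longrightarrow>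
      positive (matrix_algebra k A) (\<lambda>i j. \<phi> (a i j))"
    and contr: "\<And>z. z \<in> carrier B \<Longrightarrow> cnorm A (\<phi> z) \<le> cnorm B z"
    and oz: "\<And>y z. positive B y \<Longrightarrow> positive B z \<Longrightarrow> y \<otimes>\<^bsub>B\<^esub> z = \<zero>\<^bsub>B\<^esub> \<Longrightarrow> \<phi> y \<otimes> \<phi> z = \<zero>"
    using cpc unfolding cpc_order_zero_def completely_positive_def by blast+
  have \<phi>c: "\<phi> z \<in> carrier A" if "z \<in> carrier B" for z
    using lin that by (auto simp: linear_map_def)
  show ?thesis
    unfolding cpc_order_zero_def completely_positive_def
  proof (intro conjI ballI allI impI)
    show "linear_map B (M n) (\<lambda>z. diag n (\<phi> z))"
      using lin by (auto simp: linear_map_def \<phi>c diag_closed diag_add diag_smult)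
    show "cnorm (M n) (diag n (\<phi> z)) \<le> cnorm B z" if "z \<in> carrier B" for z
      using cnorm_diag_le[OF \<phi>c[OF that]] contr[OF that] by (rule order_trans)
    show "diag n (\<phi> y) \<otimes>\<^bsub>M n\<^esub> diag n (\<phi> z) = \<zero>\<^bsub>M n\<^esub>"
      if "positive B y \<and> positive B z \<and> y \<otimes>\<^bsub>B\<^esub> z = \<zero>\<^bsub>B\<^esub>" for y z
      using that oz[of y z] \<phi>c by (simp add: diag_mult diag_zero positive_def)
    fix k a assume k: "1 \<le> (k::nat)" and a: "positive (matrix_algebra k B) a"
    obtain b where b: "b \<in> carrier (matrix_algebra k A)"
      "(\<lambda>i j. \<phi> (a i j)) = adj (matrix_algebra k A) b \<otimes>\<^bsub>matrix_algebra k A\<^esub> b"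
      using cp[OF k a] by (auto simp: positive_def)
    define b' where "b' i j = diag n (b i j)" for i j
    have b': "b' \<in> carrier (matrix_algebra k (M n))"
      by (rule M.mat_carrierI) (auto simp: b'_def diag_closed mat_entry[OF b(1)] mat_outside[OF b(1)] diag_zero)
    have "diag n (\<phi> (a i j)) = (adj (matrix_algebra k (M n)) b' \<otimes>\<^bsub>matrix_algebra k (M n)\<^esub> b') i j" for i j
    proof -
      have "\<phi> (a i j) = (\<Oplus>l\<in>{..<k}. adj A (b l i) \<otimes> b l j)"
        using fun_cong[OF fun_cong[OF b(2), of i], of j] by (simp add: matrix_algebra_simps)
      then have "diag n (\<phi> (a i j)) = (\<Oplus>\<^bsub>M n\<^esub>l\<in>{..<k}. diag n (adj A (b l i) \<otimes> b l j))"
        by (simp add: diag_finsum mult_closed adj_closed mat_entry[OF b(1)])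
      also have "\<dots> = (\<Oplus>\<^bsub>M n\<^esub>l\<in>{..<k}. adj (M n) (b' l i) \<otimes>\<^bsub>M n\<^esub> b' l j)"
        by (simp add: b'_def diag_mult[symmetric] adj_closed mat_entry[OF b(1)] diag_adj)
      finally show ?thesis
        by (simp only: matrix_algebra_simps(2,6)[of k "M n"])
    qed
    then have eq: "(\<lambda>i j. diag n (\<phi> (a i j))) = adj (matrix_algebra k (M n)) b' \<otimes>\<^bsub>matrix_algebra k (M n)\<^esub> b'"
      by (simp only:)
    show "positive (matrix_algebra k (M n)) (\<lambda>i j. diag n (\<phi> (a i j)))"
      unfolding positive_def eq
      by (intro conjI bexI[of _ b'] refl b' M.mat_mult_closed M.mat_adj_closed)
  qed
qed

end

text \<open>With \<open>D = X - Y * X\<close>, inserting \<open>Y\<close> next to \<open>X\<close>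
  changes each of \<open>X * X\<close> and \<open>X * P * X\<close> by two terms that contain
  \<open>D\<close> or its adjoint. The remaining factors are \<open>X\<close> and contractions, so
  each of the four terms is at most \<open>\<delta> * norm X\<close>.\<close>

lemma norm_compression_diff_le:
  fixes X Y P :: "'a::cstar_unital"
  assumes sa: "star X = X" "star Y = Y" and Y: "norm Y \<le> 1" and P: "norm P \<le> 1"
    and \<delta>: "norm (X - Y * X) \<le> \<delta>"
  shows "norm (X * X - X * P * X - X * (Y * Y - Y * P * Y) * X) \<le> 4 * (\<delta> * norm X)"
proof -
  define D where "D = X - Y * X"
  have sD: "star D = X - X * Y"
    by (simp add: D_def star_diff star_mult sa)
  have nD: "norm D \<le> \<delta>" "norm (star D) \<le> \<delta>" using \<delta> by (simp_all add: D_def)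
  have contr: "norm (Q * u) \<le> norm u" if "norm Q \<le> 1" for Q u :: 'a
    using norm_mult_ineq[of Q u] mult_right_mono[OF that norm_ge_zero[of u]] by simp
  have 1: "norm (star D * u) \<le> \<delta> * norm X" if "norm u \<le> norm X" for u
    using norm_mult_ineq[of "star D" u] mult_mono[OF nD(2) that] order_trans[OF norm_ge_zero nD(1)] by simp
  have 2: "norm (X * u) \<le> \<delta> * norm X" if "norm u \<le> \<delta>" for u
    using norm_mult_ineq[of X u] mult_left_mono[OF that norm_ge_zero[of X]] by (simp add: mult.commute)
  have "X * X - X * P * X - X * (Y * Y - Y * P * Y) * X
      = (star D * X + X * (Y * D)) - (star D * (P * X) + X * (Y * (P * D)))"
    unfolding sD unfolding D_def by (simp add: left_diff_distrib right_diff_distrib mult.assoc)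
  also have "norm \<dots> \<le> (\<delta> * norm X + \<delta> * norm X) + (\<delta> * norm X + \<delta> * norm X)"
    by (intro norm_triangle_le_diff add_mono norm_triangle_le 1 2 contr Y P order_refl
        order_trans[OF contr[OF Y] nD(1)] order_trans[OF contr[OF Y] order_trans[OF contr[OF P] nD(1)]])
  finally show ?thesis by simp
qed

section \<open>The absorption property of the matrix algebra\<close>

context cstar_algebra
begin

text \<open>The columns \<open>w j = h * u j\<close> of \<open>orthogonal_equivalent_columns\<close>
  for a nonzero diagonal entry \<open>h\<close> do the work. With \<open>d\<close> a root of
  \<open>h\<close> and \<open>star (u j) * d\<close> in row \<open>j\<close> of column
  \<open>i\<close> of \<open>z\<close>, the entry of \<open>z a z*\<close> at \<open>(j, l)\<close>
  is \<open>star (u j) * d * h * d * u l = star (w j) * w l\<close>, which is diagonal with constant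
  entry.\<close>

lemma diag_below_positive:
  assumes trac: "tracially_Z_absorbing A" and n: "n \<ge> 1" and a: "positive (M n) a" "a \<noteq> \<zero>\<^bsub>M n\<^esub>"
  obtains a0 z where "positive A a0" "a0 \<noteq> \<zero>" "z \<in> carrier (M n)"
    "diag n a0 = z \<otimes>\<^bsub>M n\<^esub> a \<otimes>\<^bsub>M n\<^esub> adj (M n) z"
proof -
  interpret M: cstar_algebra "M n" by (rule matrix_cstar_algebra)
  interpret S: simple_cstar_subalgebra "embed A ` carrier A"
    by (rule cstar_subalgebra_embed_simple) (use trac in \<open>simp add: tracially_Z_absorbing_def\<close>)
  obtain \<beta> where \<beta>: "\<beta> \<in> carrier (M n)" "a = adj (M n) \<beta> \<otimes>\<^bsub>M n\<^esub> \<beta>"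
    using a(1) by (auto simp: positive_def)
  have aM: "a \<in> carrier (M n)" by (rule M.positive_closed[OF a(1)])
  have dg: "embed A (a i i) = inner_col n (\<lambda>k. embed A (\<beta> k i)) (\<lambda>k. embed A (\<beta> k i))" for i
    unfolding \<beta>(2) embed_mat_mult[OF mat_adj_closed[OF \<beta>(1)] \<beta>(1)]
    by (simp add: inner_col_def matrix_algebra_simps(6) embed_adj mat_entry[OF \<beta>(1)])
  \<comment> \<open>The diagonal entries are the inner squares of the columns of \<beta>, so all of
    them vanish only if \<beta> does.\<close>
  have "\<exists>i<n. a i i \<noteq> \<zero>"
  proof (rule ccontr)
    assume "\<not> (\<exists>i<n. a i i \<noteq> \<zero>)"
    then have z: "a i i = \<zero>" if "i < n" for i using that by blast
    have "\<beta> k i = \<zero>" for k i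
    proof (cases "k < n \<and> i < n")
      case True
      then have "norm_col n (\<lambda>k. embed A (\<beta> k i)) = 0"
        using z[of i] dg[of i] by (simp add: norm_col_def embed_zero)
      then have "embed A (\<beta> k i) = 0"
        using norm_entry_le_norm_col[of k n "\<lambda>k. embed A (\<beta> k i)"] True by simp
      then show ?thesis by (simp add: embed_eq_0_iff mat_entry[OF \<beta>(1)])
    qed (rule mat_outside[OF \<beta>(1)])
    then have "\<beta> = \<zero>\<^bsub>M n\<^esub>" by (simp add: matrix_algebra_simps fun_eq_iff)
    then have "a = \<zero>\<^bsub>M n\<^esub>"
      unfolding \<beta>(2) by (simp add: M.mult_zero_right mat_adj_closed mat_zero_closed)
    with a(2) show False by blast
  qed
  then obtain i where i: "i < n" "a i i \<noteq> \<zero>" by blast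
  note hc = mat_entry[OF aM, of i i]
  define h where "h = embed A (a i i)"
  have h: "positive_elem h" "h \<in> embed A ` carrier A" "h \<noteq> 0"
  proof -
    show "positive_elem h" unfolding h_def dg by (rule positive_inner_col)
    show "h \<in> embed A ` carrier A" unfolding h_def by (rule imageI[OF hc])
    show "h \<noteq> 0" using i(2) by (simp add: h_def embed_eq_0_iff[OF hc])
  qed
  have sh: "star h = h" by (rule positive_elem_star[OF h(1)])
  \<comment> \<open>Indices up to and including \<open>n - 1\<close> give the \<open>n\<close>
    columns needed for the rows of \<open>z\<close>.\<close>
  obtain w b0 where b0: "b0 \<in> embed A ` carrier A" "b0 \<noteq> 0"
    and wu: "\<forall>j\<le>n - 1. \<exists>u\<in>embed A ` carrier A. w j = h * u"
    and ww: "\<forall>j\<le>n - 1. \<forall>l\<le>n - 1. star (w j) * w l = (if j = l then b0 else 0)"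
    using S.orthogonal_equivalent_columns[OF no_minimal_projection[OF trac] h(2,1,3), of "n - 1"] by blast
  have "\<forall>j. \<exists>u. j < n \<longrightarrow> u \<in> carrier A \<and> w j = h * embed A u"
  proof
    fix j
    show "\<exists>u. j < n \<longrightarrow> u \<in> carrier A \<and> w j = h * embed A u"
    proof (cases "j < n")
      case True
      then have "j \<le> n - 1" by simp
      then show ?thesis using wu by blast
    qed simp
  qed
  from choice[OF this] obtain u where u: "\<And>j. j < n \<Longrightarrow> u j \<in> carrier A" "\<And>j. j < n \<Longrightarrow> w j = h * embed A (u j)"
    by blast
  obtain d where d: "d \<in> carrier A" "star (embed A d) = embed A d" "embed A d * embed A d = h"
    using S.positive_sqrt_mem[OF h(1,2)] by blast
  obtain a0 where a0: "a0 \<in> carrier A" "embed A a0 = b0" using b0 by auto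
  have "star (w 0) * w 0 = b0" using ww by simp
  then have a0p: "positive A a0" "a0 \<noteq> \<zero>"
    using a0 b0 positive_elem_star_mult[of "w 0"] by (auto simp: positive_iff embed_zero)
  define z where "z = (\<lambda>j r. if j < n \<and> r = i then adj A (u j) \<otimes> d else \<zero>)"
  have zM: "z \<in> carrier (M n)"
    by (rule mat_carrierI) (use i in \<open>auto simp: z_def mult_closed adj_closed u d\<close>)
  have zi: "embed A (z j i) = star (embed A (u j)) * embed A d" if "j < n" for j
    using that by (simp add: z_def embed_mult embed_adj adj_closed u d)
  have z0: "embed A (z j r) = 0" if "r \<noteq> i" for j r
    using that by (simp add: z_def embed_zero)
  have out: "z j i = \<zero>" if "\<not> j < n" for j using that by (simp add: z_def)
  have "embed A ((z \<otimes>\<^bsub>M n\<^esub> a \<otimes>\<^bsub>M n\<^esub> adj (M n) z) j l) = embed A (diag n a0 j l)" for j l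
  proof -
    have "embed A ((z \<otimes>\<^bsub>M n\<^esub> a \<otimes>\<^bsub>M n\<^esub> adj (M n) z) j l)
        = (\<Sum>r<n. embed A ((z \<otimes>\<^bsub>M n\<^esub> a) j r) * star (embed A (z l r)))"
      unfolding embed_mat_mult[OF mat_mult_closed[OF zM aM] mat_adj_closed[OF zM]]
      by (simp add: matrix_algebra_simps(6) embed_adj mat_entry[OF zM])
    also have "\<dots> = embed A ((z \<otimes>\<^bsub>M n\<^esub> a) j i) * star (embed A (z l i))"
      by (rule sum_eq_term[OF i(1)]) (simp add: z0)
    also have "embed A ((z \<otimes>\<^bsub>M n\<^esub> a) j i) = embed A (z j i) * embed A (a i i)"
      unfolding embed_mat_mult[OF zM aM] by (rule sum_eq_term[OF i(1)]) (simp add: z0)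
    finally have e: "embed A ((z \<otimes>\<^bsub>M n\<^esub> a \<otimes>\<^bsub>M n\<^esub> adj (M n) z) j l) = embed A (z j i) * h * star (embed A (z l i))"
      by (simp only: h_def)
    show ?thesis
    proof (cases "j < n \<and> l < n")
      case True
      have "embed A (z j i) * h * star (embed A (z l i))
          = star (embed A (u j)) * (embed A d * h * embed A d) * embed A (u l)"
        using True by (simp add: zi star_mult d(2) mult.assoc)
      also have "embed A d * h * embed A d = h * h"
        by (simp only: d(3)[symmetric] mult.assoc)
      also have "star (embed A (u j)) * (h * h) * embed A (u l) = star (w j) * w l"
        using True by (simp add: u(2) star_mult sh mult.assoc)
      also have "\<dots> = (if j = l then b0 else 0)"
      proof -
        have "j \<le> n - 1" "l \<le> n - 1" using True by auto
        then show ?thesis using ww by blast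
      qed
      finally show ?thesis
        unfolding e using True by (simp add: diag_def a0 embed_zero)
    next
      case False
      then show ?thesis
        unfolding e using out by (auto simp: diag_def embed_zero)
    qed
  qed
  then have "diag n a0 = z \<otimes>\<^bsub>M n\<^esub> a \<otimes>\<^bsub>M n\<^esub> adj (M n) z"
    by (intro mat_eqI[where n = n] diag_closed a0 mat_mult_closed mat_adj_closed zM aM) simp
  with a0p zM show ?thesis using that by blast
qed

lemma cnorm_diag_commutator_le:
  assumes y: "y \<in> carrier A" and b: "b \<in> carrier (M n)"
    and e: "\<And>i j. i < n \<Longrightarrow> j < n \<Longrightarrow> cnorm A (y \<otimes> b i j \<ominus> b i j \<otimes> y) \<le> e"
  shows "cnorm (M n) (diag n y \<otimes>\<^bsub>M n\<^esub> b \<ominus>\<^bsub>M n\<^esub> b \<otimes>\<^bsub>M n\<^esub> diag n y) \<le> real n * real n * e"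
proof -
  interpret M: cstar_algebra "M n" by (rule matrix_cstar_algebra)
  let ?c = "diag n y \<otimes>\<^bsub>M n\<^esub> b \<ominus>\<^bsub>M n\<^esub> b \<otimes>\<^bsub>M n\<^esub> diag n y"
  have cl: "diag n y \<otimes>\<^bsub>M n\<^esub> b \<in> carrier (M n)" "b \<otimes>\<^bsub>M n\<^esub> diag n y \<in> carrier (M n)"
    by (intro mat_mult_closed diag_closed y b)+
  have "?c i j = y \<otimes> b i j \<ominus> b i j \<otimes> y" for i j
    unfolding matrix_minus[OF cl] unfolding diag_entry_mult_left[OF y b] diag_entry_mult_right[OF y b] ..
  then have "cnorm (M n) ?c \<le> (\<Sum>i<n. \<Sum>j<n. cnorm A (y \<otimes> b i j \<ominus> b i j \<otimes> y))"
    using mat_cnorm_le_sum[OF M.minus_closed[OF cl]] by simp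
  also have "\<dots> \<le> (\<Sum>i<n. \<Sum>j<n. e)"
    by (intro sum_mono e) auto
  finally show ?thesis by (simp add: mult.assoc)
qed

text \<open>One approximate unit for all entries of \<open>x\<close>; the tolerance
  \<open>\<delta> / (real n * real n)\<close> for each entry adds up to \<delta> for the
  matrix.\<close>

lemma diag_approximate_unit:
  assumes x: "x \<in> carrier (M n)" and \<delta>: "0 < \<delta>" and n: "n \<ge> 1"
  obtains y where "positive A y" "cnorm A y \<le> 1" "cnorm (M n) (x \<ominus>\<^bsub>M n\<^esub> diag n y \<otimes>\<^bsub>M n\<^esub> x) \<le> \<delta>"
proof -
  interpret M: cstar_algebra "M n" by (rule matrix_cstar_algebra)
  interpret S: cstar_subalgebra "embed A ` carrier A" by (rule cstar_subalgebra_embed)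
  let ?G = "(\<lambda>(i, j). embed A (x i j)) ` ({..<n} \<times> {..<n})"
  let ?d = "\<delta> / (real n * real n)"
  have "finite ?G" "?G \<subseteq> embed A ` carrier A" "0 < ?d"
    using mat_entry[OF x] \<delta> n by auto
  then obtain y' where y': "y' \<in> embed A ` carrier A" "positive_elem y'" "norm y' \<le> 1"
    "\<And>g. g \<in> ?G \<Longrightarrow> norm (g - y' * g) \<le> ?d"
    using S.approximate_unit[of ?G ?d] by blast
  then obtain y where y: "y \<in> carrier A" "y' = embed A y" by blast
  have cl: "diag n y \<otimes>\<^bsub>M n\<^esub> x \<in> carrier (M n)"
    by (intro mat_mult_closed diag_closed y x)
  have "cnorm A (x i j \<ominus> y \<otimes> x i j) \<le> ?d" if "i < n" "j < n" for i j
  proof -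
    have "cnorm A (x i j \<ominus> y \<otimes> x i j) = norm (embed A (x i j) - y' * embed A (x i j))"
      using mat_entry[OF x, of i j] y by (simp add: embed_minus embed_mult mult_closed flip: norm_embed)
    also have "\<dots> \<le> ?d" by (rule y'(4)) (use that in force)
    finally show ?thesis .
  qed
  then have "(\<Sum>i<n. \<Sum>j<n. cnorm A (x i j \<ominus> y \<otimes> x i j)) \<le> (\<Sum>i<n. \<Sum>j<n. ?d)"
    by (intro sum_mono) auto
  also have "\<dots> = \<delta>" using n by simp
  finally have sum: "(\<Sum>i<n. \<Sum>j<n. cnorm A (x i j \<ominus> y \<otimes> x i j)) \<le> \<delta>" .
  have "(x \<ominus>\<^bsub>M n\<^esub> diag n y \<otimes>\<^bsub>M n\<^esub> x) i j = x i j \<ominus> y \<otimes> x i j" for i j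
    unfolding matrix_minus[OF x cl] unfolding diag_entry_mult_left[OF y(1) x] ..
  then have "cnorm (M n) (x \<ominus>\<^bsub>M n\<^esub> diag n y \<otimes>\<^bsub>M n\<^esub> x) \<le> \<delta>"
    using order_trans[OF mat_cnorm_le_sum[OF M.minus_closed[OF x cl]]] sum by simp
  then show ?thesis
    using that[of y] y y' by (simp add: positive_iff norm_embed)
qed

theorem matrix_tracially_Z_absorbing:
  assumes trac: "tracially_Z_absorbing A" and n: "n \<ge> 1"
  shows "tracially_Z_absorbing (M n)"
proof -
  interpret M: cstar_algebra "M n" by (rule matrix_cstar_algebra)
  interpret SM: cstar_subalgebra "embed (M n) ` carrier (M n)" by (rule M.cstar_subalgebra_embed)
  have sim: "simple_cstar_algebra A" and noiso: "\<not> star_isomorphic A complex_cstar"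
    using trac by (simp_all add: tracially_Z_absorbing_def)
  let ?K = "embed (M n)"
  have main: "\<exists>\<psi>. cpc_order_zero (matrix_algebra m complex_cstar) (M n) \<psi> \<and>
      cuntz_subeq (M n) (cut_down (M n) (x \<otimes>\<^bsub>M n\<^esub> x \<ominus>\<^bsub>M n\<^esub> x \<otimes>\<^bsub>M n\<^esub> \<psi> \<one>\<^bsub>matrix_algebra m complex_cstar\<^esub> \<otimes>\<^bsub>M n\<^esub> x) \<epsilon>) a \<and>
      (\<forall>z\<in>carrier (matrix_algebra m complex_cstar). cnorm (matrix_algebra m complex_cstar) z \<le> 1 \<longrightarrow>
        (\<forall>b\<in>F. cnorm (M n) (\<psi> z \<otimes>\<^bsub>M n\<^esub> b \<ominus>\<^bsub>M n\<^esub> b \<otimes>\<^bsub>M n\<^esub> \<psi> z) < \<epsilon>))"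
    if x: "positive (M n) x" and a: "positive (M n) a" "a \<noteq> \<zero>\<^bsub>M n\<^esub>"
      and F: "finite F" "F \<subseteq> carrier (M n)" and \<epsilon>: "(\<epsilon>::real) > 0" and m: "m \<ge> 1" for x a F \<epsilon> m
  proof -
    let ?C = "matrix_algebra m complex_cstar"
    interpret C: cstar_algebra ?C
      by (rule cstar_algebra.matrix_cstar_algebra[OF complex_cstar_algebra])
    note xM = M.positive_closed[OF x] and aM = M.positive_closed[OF a(1)]
    define X where "X = ?K x"
    have sX: "star X = X" unfolding X_def by (rule M.star_embed_positive[OF x])
    define B where "B = norm X + 1"
    have B: "B \<ge> 1" "norm X \<le> B" by (simp_all add: B_def)
    obtain a0 z where a0: "positive A a0" "a0 \<noteq> \<zero>" and z: "z \<in> carrier (M n)"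
      and diag_a0: "diag n a0 = z \<otimes>\<^bsub>M n\<^esub> a \<otimes>\<^bsub>M n\<^esub> adj (M n) z"
      using diag_below_positive[OF trac n a] by blast
    have a0c: "a0 \<in> carrier A" by (rule positive_closed[OF a0(1)])
    \<comment> \<open>By \<open>norm_compression_diff_le\<close> the insertion of \<open>y\<close>
      costs at most \<open>4 * \<delta> * norm X\<close>, hence at most
      \<open>\<epsilon> / 4\<close>.\<close>
    define \<delta> where "\<delta> = \<epsilon> / (16 * B)"
    have \<delta>: "0 < \<delta>" using \<epsilon> B by (simp add: \<delta>_def)
    obtain y where y: "positive A y" "cnorm A y \<le> 1" and yx: "cnorm (M n) (x \<ominus>\<^bsub>M n\<^esub> diag n y \<otimes>\<^bsub>M n\<^esub> x) \<le> \<delta>"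
      using diag_approximate_unit[OF xM \<delta> n] by blast
    have yc: "y \<in> carrier A" by (rule positive_closed[OF y(1)])
    \<comment> \<open>The first bound makes an error of \<open>2 * e\<close>, multiplied by
      \<open>X\<close> on both sides, cost at most \<open>\<epsilon> / 8\<close>. The second keeps
      the sum of all entrywise commutators at most \<open>\<epsilon> / 2\<close>.\<close>
    define e where "e = min (\<epsilon> / (16 * (B * B))) (\<epsilon> / (2 * (real n * real n)))"
    have e: "0 < e" "e \<le> \<epsilon> / (16 * (B * B))" "e \<le> \<epsilon> / (2 * (real n * real n))"
      using \<epsilon> B n by (auto simp: e_def)
    define F' where "F' = (\<Union>b\<in>F. (\<lambda>(i, j). b i j) ` ({..<n} \<times> {..<n}))"
    have F': "finite F'" "F' \<subseteq> carrier A"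
      using F mat_entry by (auto simp: F'_def)
    obtain \<phi> where cpc: "cpc_order_zero ?C A \<phi>"
      and sub: "cuntz_subeq A (cut_down A (y \<otimes> y \<ominus> y \<otimes> \<phi> \<one>\<^bsub>?C\<^esub> \<otimes> y) e) a0"
      and comm: "\<And>z b. z \<in> carrier ?C \<Longrightarrow> cnorm ?C z \<le> 1 \<Longrightarrow> b \<in> F' \<Longrightarrow> cnorm A (\<phi> z \<otimes> b \<ominus> b \<otimes> \<phi> z) < e"
    proof -
      have "\<exists>\<phi>. let M = ?C in
           cpc_order_zero M A \<phi> \<and>
           cuntz_subeq A (cut_down A (y \<otimes>\<^bsub>A\<^esub> y \<ominus>\<^bsub>A\<^esub> y \<otimes>\<^bsub>A\<^esub> \<phi> \<one>\<^bsub>M\<^esub> \<otimes>\<^bsub>A\<^esub> y) e) a0 \<and>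
           (\<forall>z\<in>carrier M. cnorm M z \<le> 1 \<longrightarrow>
              (\<forall>b\<in>F'. cnorm A (\<phi> z \<otimes>\<^bsub>A\<^esub> b \<ominus>\<^bsub>A\<^esub> b \<otimes>\<^bsub>A\<^esub> \<phi> z) < e))"
        using trac y(1) a0 F' e(1) m unfolding tracially_Z_absorbing_def
        by (elim conjE allE[of _ y] allE[of _ a0] allE[of _ F'] allE[of _ e] allE[of _ m] impE) auto
      then show ?thesis
        using that unfolding Let_def by blast
    qed
    have cp: "completely_positive ?C A \<phi>" and lin: "linear_map ?C A \<phi>"
      and contr: "\<And>z. z \<in> carrier ?C \<Longrightarrow> cnorm A (\<phi> z) \<le> cnorm ?C z"
      using cpc by (auto simp: cpc_order_zero_def completely_positive_def)
    have \<phi>c: "\<phi> z \<in> carrier A" if "z \<in> carrier ?C" for z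
      using lin that by (auto simp: linear_map_def)
    have one: "\<one>\<^bsub>?C\<^esub> \<in> carrier ?C" "positive ?C \<one>\<^bsub>?C\<^esub>" "cnorm ?C \<one>\<^bsub>?C\<^esub> \<le> 1"
    proof -
      show c: "\<one>\<^bsub>?C\<^esub> \<in> carrier ?C"
        by (auto simp: matrix_algebra_simps complex_cstar_simps)
      have ad: "adj ?C \<one>\<^bsub>?C\<^esub> = \<one>\<^bsub>?C\<^esub>"
        by (auto simp: matrix_algebra_simps complex_cstar_simps fun_eq_iff)
      have mu: "\<one>\<^bsub>?C\<^esub> \<otimes>\<^bsub>?C\<^esub> \<one>\<^bsub>?C\<^esub> = \<one>\<^bsub>?C\<^esub>"
      proof (intro ext)
        fix i j
        show "(\<one>\<^bsub>?C\<^esub> \<otimes>\<^bsub>?C\<^esub> \<one>\<^bsub>?C\<^esub>) i j = \<one>\<^bsub>?C\<^esub> i j"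
        proof (cases "i < m")
          case True
          then show ?thesis
            by (simp only: matrix_algebra_simps complex_cstar_simps complex_finsum finite_lessThan)
              (subst sum_eq_term[OF True], auto)
        qed (simp add: matrix_algebra_simps complex_cstar_simps complex_finsum)
      qed
      show "positive ?C \<one>\<^bsub>?C\<^esub>" "cnorm ?C \<one>\<^bsub>?C\<^esub> \<le> 1"
        using C.projection_facts[OF c ad mu] by auto
    qed
    define f where "f = \<phi> \<one>\<^bsub>?C\<^esub>"
    have fc: "f \<in> carrier A" unfolding f_def by (rule \<phi>c[OF one(1)])
    have fp: "positive A f"
      unfolding f_def by (rule positive_of_completely_positive[OF C.cstar_algebra_axioms cp one(2)])
    have fn: "cnorm A f \<le> 1" unfolding f_def using contr[OF one(1)] one(3) by linarith
    define k where "k = y \<otimes> y \<ominus> y \<otimes> f \<otimes> y"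
    have kc: "k \<in> carrier A" unfolding k_def by (simp add: mult_closed yc fc)
    note sy = star_embed_positive[OF y(1)] and sf = star_embed_positive[OF fp]
    have ek: "embed A k = embed A y * embed A y - embed A y * embed A f * embed A y"
      by (simp add: k_def embed_minus embed_mult mult_closed yc fc)
    have "positive_elem (star (embed A y) * (of_real 1 - embed A f) * embed A y)"
      by (intro positive_elem_conj positive_elem_norm_diff sf) (simp add: norm_embed fc fn)
    then have kp: "positive_elem (embed A k)"
      by (simp add: sy ek left_diff_distrib right_diff_distrib)
    then have "positive A k" using kc by (simp add: positive_iff)
    then have "embed A (adj A k) = embed A k"
      using star_embed_positive by (simp add: embed_adj kc)
    then have adk: "adj A k = k" using embed_inject[OF adj_closed[OF kc] kc] by blast
    note cutk = cut_down_embed[OF kc adk less_imp_le[OF e(1)]]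
    have cut_near: "norm (embed A k - embed A (cut_down A k e)) \<le> e"
      unfolding cutk(2) by (rule norm_sub_fcalc_cut[OF kp less_imp_le[OF e(1)]])
    obtain vs where vs: "\<And>l. vs l \<in> carrier A"
      "(\<lambda>l. embed A (vs l) * embed A a0 * star (embed A (vs l))) \<longlonglongrightarrow> embed A (cut_down A k e)"
      using sub cuntz_subeq_iff[OF cutk(1) a0c] unfolding f_def[symmetric] k_def[symmetric] by blast
    have "\<forall>\<^sub>F l in sequentially. dist (embed A (vs l) * embed A a0 * star (embed A (vs l))) (embed A (cut_down A k e)) < e"
      using vs(2) e(1) by (rule tendstoD)
    then obtain l where l: "dist (embed A (vs l) * embed A a0 * star (embed A (vs l))) (embed A (cut_down A k e)) < e"
      by (auto simp: eventually_sequentially)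
    \<comment> \<open>A single member of the sequence suffices: an approximation within
      \<open>2 * e\<close> is enough, because the final cut-down by \<epsilon> absorbs the
      error.\<close>
    define v where "v = vs l"
    have vc: "v \<in> carrier A" by (simp add: v_def vs)
    have "norm (embed A k - embed A v * embed A a0 * star (embed A v)) \<le> e + e"
      using norm_triangle_mono[OF cut_near, of "embed A (cut_down A k e) - embed A v * embed A a0 * star (embed A v)" e] l
      by (simp add: v_def dist_norm norm_minus_commute)
    then have kva: "cnorm A (k \<ominus> v \<otimes> a0 \<otimes> adj A v) \<le> e + e"
      by (simp add: embed_minus embed_mult embed_adj mult_closed adj_closed kc vc a0c flip: norm_embed)
    define Y where "Y = ?K (diag n y)"
    define P where "P = ?K (diag n f)"
    define V where "V = ?K (diag n v)"
    define \<zeta> where "\<zeta> = ?K z"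
    define \<alpha> where "\<alpha> = ?K a"
    note Mc = diag_closed[of _ n]
    have sY: "star Y = Y"
    proof -
      have "embed A (adj A y) = embed A y" by (simp add: embed_adj yc sy)
      then have "adj A y = y" using embed_inject[OF adj_closed[OF yc] yc] by blast
      then show ?thesis using M.embed_adj[OF Mc[OF yc]] by (simp add: Y_def flip: diag_adj)
    qed
    have sP: "star P = P"
    proof -
      have "embed A (adj A f) = embed A f" by (simp add: embed_adj fc sf)
      then have "adj A f = f" using embed_inject[OF adj_closed[OF fc] fc] by blast
      then show ?thesis using M.embed_adj[OF Mc[OF fc]] by (simp add: P_def flip: diag_adj)
    qed
    have nY: "norm Y \<le> 1" "norm P \<le> 1"
      using cnorm_diag_le[OF yc, of n] y(2) cnorm_diag_le[OF fc, of n] fn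
      by (simp_all add: Y_def P_def M.norm_embed Mc yc fc)
    have nXY: "norm (X - Y * X) \<le> \<delta>"
      using yx by (simp add: X_def Y_def M.embed_minus M.embed_mult Mc yc xM mat_mult_closed flip: M.norm_embed)
    have Kk: "?K (diag n k) = Y * Y - Y * P * Y"
      unfolding k_def Y_def P_def
      by (simp add: diag_minus mult_closed yc fc M.embed_minus M.embed_mult Mc mat_mult_closed flip: diag_mult)
    have Ka0: "?K (diag n a0) = \<zeta> * \<alpha> * star \<zeta>"
      unfolding diag_a0 \<zeta>_def \<alpha>_def by (simp add: M.embed_mult M.embed_adj z aM mat_mult_closed mat_adj_closed)
    have near: "norm (Y * Y - Y * P * Y - V * (\<zeta> * \<alpha> * star \<zeta>) * star V) \<le> e + e"
    proof -
      have "Y * Y - Y * P * Y - V * (\<zeta> * \<alpha> * star \<zeta>) * star V = ?K (diag n (k \<ominus> v \<otimes> a0 \<otimes> adj A v))"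
        by (simp add: diag_minus mult_closed adj_closed kc vc a0c M.embed_minus M.embed_mult Mc mat_mult_closed
            Kk Ka0 V_def diag_adj M.embed_adj mat_adj_closed flip: diag_mult)
      then show ?thesis
        using cnorm_diag_le[of "k \<ominus> v \<otimes> a0 \<otimes> adj A v" n] kva
        by (simp add: M.norm_embed Mc mult_closed adj_closed kc vc a0c)
    qed
    \<comment> \<open>The element \<open>b\<close> below is exactly of the form
      \<open>W * \<alpha> * star W\<close>, so it is Cuntz below \<open>a\<close>. Since it is
      closer than \<epsilon> to the element to be cut down, \<open>cut_down_cuntz_below\<close>
      compares the cut-down with \<open>b\<close>, and \<open>W\<close> is absorbed into the
      multipliers.\<close>
    define W where "W = X * V * \<zeta>"
    define b where "b = W * \<alpha> * star W"
    let ?c = "x \<otimes>\<^bsub>M n\<^esub> x \<ominus>\<^bsub>M n\<^esub> x \<otimes>\<^bsub>M n\<^esub> diag n f \<otimes>\<^bsub>M n\<^esub> x"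
    have cc: "?c \<in> carrier (M n)"
      by (intro M.minus_closed mat_mult_closed xM Mc fc)
    have Kc: "?K ?c = X * X - X * P * X"
      by (simp add: X_def P_def M.embed_minus M.embed_mult Mc fc xM mat_mult_closed)
    have sKc: "star (?K ?c) = ?K ?c"
      unfolding Kc by (simp add: star_diff star_mult sX sP mult.assoc)
    then have "?K (adj (M n) ?c) = ?K ?c" by (simp only: M.embed_adj[OF cc])
    then have adc: "adj (M n) ?c = ?c" using M.embed_inject[OF mat_adj_closed[OF cc] cc] by blast
    note cutc = M.cut_down_embed[OF cc adc less_imp_le[OF \<epsilon>]]
    have "norm (?K ?c - b) < \<epsilon>"
    proof -
      have eq: "?K ?c - b = (X * X - X * P * X - X * (Y * Y - Y * P * Y) * X)
          + X * (Y * Y - Y * P * Y - V * (\<zeta> * \<alpha> * star \<zeta>) * star V) * X"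
        by (simp add: Kc b_def W_def star_mult sX left_diff_distrib right_diff_distrib mult.assoc)
      have "norm (X * X - X * P * X - X * (Y * Y - Y * P * Y) * X) \<le> 4 * (\<delta> * norm X)"
        by (rule norm_compression_diff_le[OF sX sY nY nXY])
      moreover have "norm (X * (Y * Y - Y * P * Y - V * (\<zeta> * \<alpha> * star \<zeta>) * star V) * X) \<le> B * (e + e) * B"
        by (rule order_trans[OF norm_mult_ineq] mult_mono order_trans[OF norm_mult_ineq] near B(2)
            mult_nonneg_nonneg norm_ge_zero | use B e in simp)+
      moreover have "4 * (\<delta> * norm X) \<le> \<epsilon> / 4"
      proof -
        have "\<delta> * norm X \<le> \<delta> * B" using B \<delta> by simp
        also have "\<dots> = \<epsilon> / 16" using B by (simp add: \<delta>_def)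
        finally show ?thesis by simp
      qed
      moreover have "B * (e + e) * B \<le> \<epsilon> / 4"
      proof -
        have "e * (B * B) \<le> \<epsilon> / (16 * (B * B)) * (B * B)" using e(2) B by (intro mult_right_mono) auto
        also have "\<dots> = \<epsilon> / 16" using B by simp
        finally show ?thesis using \<epsilon> by (simp add: algebra_simps)
      qed
      ultimately show ?thesis
        unfolding eq using \<epsilon> norm_triangle_ineq[of "X * X - X * P * X - X * (Y * Y - Y * P * Y) * X"
            "X * (Y * Y - Y * P * Y - V * (\<zeta> * \<alpha> * star \<zeta>) * star V) * X"] by linarith
    qed
    moreover have WS: "W \<in> ?K ` carrier (M n)"
      unfolding W_def X_def V_def \<zeta>_def by (intro SM.mult_mem imageI xM Mc vc z)
    moreover have bS: "b \<in> ?K ` carrier (M n)"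
      unfolding b_def \<alpha>_def by (intro SM.mult_mem SM.star_mem WS imageI aM)
    moreover have bp: "positive_elem b"
      using positive_elem_conj[of \<alpha> "star W"] a(1) by (simp add: b_def \<alpha>_def M.positive_iff)
    ultimately obtain q where q: "\<And>l. q l \<in> ?K ` carrier (M n)"
      "(\<lambda>l. q l * b * star (q l)) \<longlonglongrightarrow> fcalc (\<lambda>t. max (t - \<epsilon>) 0) (?K ?c)"
      using SM.cut_down_cuntz_below[OF imageI[OF cc] sKc bS bp] by blast
    have "\<forall>l. \<exists>p. p \<in> carrier (M n) \<and> q l * W = ?K p"
      using SM.mult_mem[OF q(1) WS] by blast
    from choice[OF this] obtain p where p: "\<And>l. p l \<in> carrier (M n)" "\<And>l. q l * W = ?K (p l)" by blast
    have "q l * b * star (q l) = ?K (p l) * ?K a * star (?K (p l))" for l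
      unfolding p(2)[symmetric] b_def \<alpha>_def star_mult by (simp only: mult.assoc)
    then have "(\<lambda>l. ?K (p l) * ?K a * star (?K (p l))) \<longlonglongrightarrow> ?K (cut_down (M n) ?c \<epsilon>)"
      using q(2) by (simp only: cutc(2))
    then have cs: "cuntz_subeq (M n) (cut_down (M n) ?c \<epsilon>) a"
      using p(1) M.cuntz_subeq_iff[OF cutc(1) aM] by blast
    show ?thesis
    proof (intro exI[of _ "\<lambda>z. diag n (\<phi> z)"] conjI ballI impI)
      show "cpc_order_zero ?C (M n) (\<lambda>z. diag n (\<phi> z))" by (rule cpc_order_zero_diag[OF cpc])
      show "cuntz_subeq (M n) (cut_down (M n) (x \<otimes>\<^bsub>M n\<^esub> x \<ominus>\<^bsub>M n\<^esub> x \<otimes>\<^bsub>M n\<^esub> diag n (\<phi> \<one>\<^bsub>?C\<^esub>) \<otimes>\<^bsub>M n\<^esub> x) \<epsilon>) a"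
        using cs by (simp only: f_def)
      fix z b assume zb: "z \<in> carrier ?C" "cnorm ?C z \<le> 1" "b \<in> F"
      have bM: "b \<in> carrier (M n)" using zb F by blast
      have "cnorm (M n) (diag n (\<phi> z) \<otimes>\<^bsub>M n\<^esub> b \<ominus>\<^bsub>M n\<^esub> b \<otimes>\<^bsub>M n\<^esub> diag n (\<phi> z)) \<le> real n * real n * e"
      proof (rule cnorm_diag_commutator_le[OF \<phi>c[OF zb(1)] bM])
        fix i j assume "i < n" "j < n"
        then have "b i j \<in> F'" using zb(3) by (force simp: F'_def)
        then show "cnorm A (\<phi> z \<otimes> b i j \<ominus> b i j \<otimes> \<phi> z) \<le> e"
          using comm[OF zb(1,2)] by (simp add: less_imp_le)
      qed
      also have "\<dots> \<le> real n * real n * (\<epsilon> / (2 * (real n * real n)))"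
        by (intro mult_left_mono e) auto
      also have "\<dots> < \<epsilon>" using \<epsilon> n by simp
      finally show "cnorm (M n) (diag n (\<phi> z) \<otimes>\<^bsub>M n\<^esub> b \<ominus>\<^bsub>M n\<^esub> b \<otimes>\<^bsub>M n\<^esub> diag n (\<phi> z)) < \<epsilon>" .
    qed
  qed
  show ?thesis
    unfolding tracially_Z_absorbing_def Let_def
    using simple_matrix_algebra[OF sim n] matrix_not_complex[OF sim n] noiso main by blast
qed

end

theorem proposition4p5:
  fixes A :: "'a cstar" and n :: nat
  assumes "simple_cstar_algebra A"
    and "tracially_Z_absorbing A"
    and "n \<ge> 1"
  shows "tracially_Z_absorbing (matrix_algebra n A)"
  using cstar_algebra.matrix_tracially_Z_absorbing assms
  unfolding simple_cstar_algebra_def by blast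

end
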